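(* Let $\Gamma$ be an abstract tropical curve and let $d$ be the largest degree of a vertex of $\Gamma$. Then $\Gamma$ has an embedding (a smooth embedding) in $\mathbb{R}^n$ for every integer $n \geq \max\{3, d-1\}$. Moreover, if $d \leq 3$, then $\Gamma$ has an immersion in $\mathbb{R}^2$.
   Context: An abstract tropical curve is a finite connected graph (loops and multiple edges allowed) in which each edge is assigned a length in $(0,\infty]$; an edge of infinite length must have a vertex of degree $1$ (an "infinite vertex") as one of its endpoints. The degree of a vertex is the number of edge-ends at it. A subdivision replaces an edge by two consecutive edges whose lengths sum to the original length (if the original edge is infinite, the new edge incident to the infinite vertex is infinite); a reverse subdivision is the inverse operation. An elementary tropical modification adds an infinite edge at a finite vertex; a tropical modification is any finite sequence of elementary tropical modifications, subdivisions and reverse subdivisions. For $2 \le d \le n+1$, the standard smooth model of valence $d$ in $\mathbb{R}^n$ is the union of the rays generated by $e_1,\dots,e_{d-1}$ and $-e_1-\dots-e_{d-1}$. A smooth tropical curve in $\mathbb{R}^n$ is a finite union of segments and rays such that a neighborhood of every point coincides with a neighborhood of the origin in some standard smooth model, after a translation and a change of coordinates in $GL_n(\mathbb{Z})$. The nodal local model in $\mathbb{R}^2$ is a union of two distinct lines through the origin with rational slopes; a nodal tropical curve in $\mathbb{R}^2$ is a finite union of segments and rays which near every point equals, up to translation and $GL_2(\mathbb{Z})$, either a standard smooth model or the nodal local model. Every segment is parallel to a primitive integer vector $v$; a segment with endpoints $p_1,p_2$ and $p_1-p_2=\alpha v$, $\alpha>0$, is given length $\alpha$. A smooth tropical curve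 thus yields an abstract tropical curve (edges = segments and rays with these lengths, with an infinite vertex added at the end of each ray); for a nodal curve one first resolves each node, replacing the node by two vertices, one incident to the two half-edges of each of the two lines. An embedding of $\Gamma$ in $\mathbb{R}^n$ (resp. an immersion of $\Gamma$ in $\mathbb{R}^2$) is a smooth tropical curve in $\mathbb{R}^n$ (resp. a nodal tropical curve in $\mathbb{R}^2$) whose associated abstract tropical curve is isometric to a tropical modification of $\Gamma$. *)

theory Defs
  imports "HOL-Analysis.Analysis" "HOL-Library.Multiset"
begin

section \<open>Abstract tropical curves\<close>

text \<open>
  An undirected multigraph with edge lengths. The two ends of an edge form a multiset of
  size two, so a loop at \<open>v\<close> has ends \<open>{#v, v#}\<close>. The functions \<open>ends\<close> and \<open>len\<close> are only
  meaningful on \<open>edges\<close>.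

  The infinite vertices are part of the data. They are determined by the lengths except
  when the graph is a single infinite edge joining two vertices of degree one, which may be
  a ray (one infinite vertex) or a line (two infinite vertices).
\<close>

record ('v, 'e) metric_graph =
  verts :: "'v set"
  edges :: "'e set"
  ends :: "'e \<Rightarrow> 'v multiset"
  len :: "'e \<Rightarrow> ereal"
  inf_verts :: "'v set"

definition vertex_degree :: "('v, 'e) metric_graph \<Rightarrow> 'v \<Rightarrow> nat" where
  "vertex_degree G v = (\<Sum>e\<in>edges G. count (ends G e) v)"

definition connected_graph :: "('v, 'e) metric_graph \<Rightarrow> bool" where
  "connected_graph G \<longleftrightarrow> verts G \<noteq> {} \<and>
     (\<forall>u\<in>verts G. \<forall>v\<in>verts G. (u, v) \<in> {(x, y). \<exists>e\<in>edges G. ends G e = {#x, y#}}\<^sup>*)"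

definition abstract_tropical_curve :: "('v, 'e) metric_graph \<Rightarrow> bool" where
  "abstract_tropical_curve G \<longleftrightarrow>
     finite (verts G) \<and> finite (edges G) \<and>
     (\<forall>e\<in>edges G. size (ends G e) = 2 \<and> set_mset (ends G e) \<subseteq> verts G) \<and>
     connected_graph G \<and>
     (\<forall>e\<in>edges G. 0 < len G e) \<and>
     inf_verts G \<subseteq> verts G \<and>
     (\<forall>v\<in>inf_verts G. vertex_degree G v = 1) \<and>
     (\<forall>e\<in>edges G. len G e = \<infinity> \<longleftrightarrow> (\<exists>v\<in>inf_verts G. v \<in># ends G e))"

text \<open>
  Isometry is a length-preserving graph isomorphism. Since tropical modifications may
  subdivide and merge edges, this gives the same notion of ``isometric to a tropical
  modification of \<open>G\<close>'' as an isometry of the underlying metric spaces.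
\<close>

definition isometric :: "('v, 'e) metric_graph \<Rightarrow> ('w, 'f) metric_graph \<Rightarrow> bool" where
  "isometric G H \<longleftrightarrow>
     (\<exists>\<phi> \<psi>. bij_betw \<phi> (verts G) (verts H) \<and> bij_betw \<psi> (edges G) (edges H) \<and>
        \<phi> ` inf_verts G = inf_verts H \<and>
        (\<forall>e\<in>edges G. ends H (\<psi> e) = image_mset \<phi> (ends G e) \<and> len H (\<psi> e) = len G e))"

text \<open>
  The edge \<open>e\<close> with ends \<open>a\<close>, \<open>b\<close> is replaced by \<open>e1\<close> from \<open>a\<close> to \<open>m\<close> and \<open>e2\<close> from \<open>m\<close> to \<open>b\<close>,
  where \<open>m\<close> is a new finite vertex. Requiring \<open>G\<close> to be a tropical curve matters for reverse
  subdivisions: it forces \<open>m\<close> to have degree two in \<open>H\<close>.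
\<close>

definition subdivision :: "('v, 'e) metric_graph \<Rightarrow> ('v, 'e) metric_graph \<Rightarrow> bool" where
  "subdivision G H \<longleftrightarrow>
     abstract_tropical_curve G \<and>
     (\<exists>e a b m e1 e2.
        e \<in> edges G \<and> ends G e = {#a, b#} \<and>
        m \<notin> verts G \<and> e1 \<notin> edges G \<and> e2 \<notin> edges G \<and> e1 \<noteq> e2 \<and>
        verts H = insert m (verts G) \<and>
        inf_verts H = inf_verts G \<and>
        edges H = (edges G - {e}) \<union> {e1, e2} \<and>
        ends H e1 = {#a, m#} \<and> ends H e2 = {#m, b#} \<and>
        0 < len H e1 \<and> 0 < len H e2 \<and> len H e1 + len H e2 = len G e \<and>
        (len H e1 = \<infinity> \<longleftrightarrow> a \<in> inf_verts G) \<and> (len H e2 = \<infinity> \<longleftrightarrow> b \<in> inf_verts G) \<and>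
        (\<forall>x\<in>edges G - {e}. ends H x = ends G x \<and> len H x = len G x))"

definition elementary_modification :: "('v, 'e) metric_graph \<Rightarrow> ('v, 'e) metric_graph \<Rightarrow> bool" where
  "elementary_modification G H \<longleftrightarrow>
     abstract_tropical_curve G \<and>
     (\<exists>v w e.
        v \<in> verts G - inf_verts G \<and> w \<notin> verts G \<and> e \<notin> edges G \<and>
        verts H = insert w (verts G) \<and>
        inf_verts H = insert w (inf_verts G) \<and>
        edges H = insert e (edges G) \<and>
        ends H e = {#v, w#} \<and> len H e = \<infinity> \<and>
        (\<forall>x\<in>edges G. ends H x = ends G x \<and> len H x = len G x))"

inductive tropical_modification :: "('v, 'e) metric_graph \<Rightarrow> ('v, 'e) metric_graph \<Rightarrow> bool" where
  refl: "tropical_modification G G"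
| modify: "tropical_modification G H \<Longrightarrow> elementary_modification H K \<Longrightarrow> tropical_modification G K"
| subdivide: "tropical_modification G H \<Longrightarrow> subdivision H K \<Longrightarrow> tropical_modification G K"
| unsubdivide: "tropical_modification G H \<Longrightarrow> subdivision K H \<Longrightarrow> tropical_modification G K"

text \<open>
  The steps are carried out on copies labelled by natural numbers, so that new vertices and
  edges are always available.
\<close>

definition isometric_to_modification :: "('w, 'f) metric_graph \<Rightarrow> ('v, 'e) metric_graph \<Rightarrow> bool" where
  "isometric_to_modification H G \<longleftrightarrow>
     (\<exists>G' H' :: (nat, nat) metric_graph.
        isometric G G' \<and> tropical_modification G' H' \<and> isometric H' H)"

section \<open>Local models\<close>

definition real_vec :: "int ^ 'n \<Rightarrow> real ^ 'n" where
  "real_vec v = (\<chi> i. real_of_int (v $ i))"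

definition real_mat :: "int ^ 'n ^ 'm \<Rightarrow> real ^ 'n ^ 'm" where
  "real_mat A = (\<chi> i j. real_of_int (A $ i $ j))"

definition primitive_vec :: "int ^ 'n \<Rightarrow> bool" where
  "primitive_vec v \<longleftrightarrow> Gcd (range (\<lambda>i. v $ i)) = 1"

definition ray :: "real ^ 'n \<Rightarrow> real ^ 'n \<Rightarrow> (real ^ 'n) set" where
  "ray p v = {p + t *\<^sub>R v | t. 0 \<le> t}"

text \<open>
  The index type \<open>'n\<close> carries no order, so the \<open>d - 1\<close> basis vectors are those indexed by any
  set \<open>I\<close> of \<open>d - 1\<close> coordinates. The choice of \<open>I\<close> is immaterial up to a permutation of
  the coordinates.
\<close>

definition standard_smooth_model :: "nat \<Rightarrow> (real ^ 'n) set \<Rightarrow> bool" where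
  "standard_smooth_model d M \<longleftrightarrow>
     2 \<le> d \<and> d \<le> CARD('n) + 1 \<and>
     (\<exists>I :: 'n set. card I = d - 1 \<and>
        M = (\<Union>i\<in>I. ray 0 (axis i 1)) \<union> ray 0 (- (\<Sum>i\<in>I. axis i 1)))"

definition nodal_model :: "(real ^ 2) set \<Rightarrow> bool" where
  "nodal_model M \<longleftrightarrow>
     (\<exists>u v :: int ^ 2. u \<noteq> 0 \<and> v \<noteq> 0 \<and> span {real_vec u} \<noteq> span {real_vec v} \<and>
        M = span {real_vec u} \<union> span {real_vec v})"

text \<open>
  Near \<open>x\<close>, the set \<open>C\<close> agrees with \<open>M\<close> near the origin up to \<open>GL\<^sub>n(\<int>)\<close> and translation.
  Note that \<open>invertible A\<close> is invertibility over the integers.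
\<close>

definition locally_like :: "(real ^ 'n) set \<Rightarrow> real ^ 'n \<Rightarrow> (real ^ 'n) set \<Rightarrow> bool" where
  "locally_like C x M \<longleftrightarrow>
     (\<exists>(A :: int ^ 'n ^ 'n) U. invertible A \<and> open U \<and> x \<in> U \<and>
        C \<inter> U = (\<lambda>y. x + real_mat A *v y) ` M \<inter> U)"

definition smooth_point :: "(real ^ 'n) set \<Rightarrow> real ^ 'n \<Rightarrow> bool" where
  "smooth_point C x \<longleftrightarrow> (\<exists>d M. standard_smooth_model d M \<and> locally_like C x M)"

definition node :: "(real ^ 2) set \<Rightarrow> real ^ 2 \<Rightarrow> bool" where
  "node C x \<longleftrightarrow> (\<exists>M. nodal_model M \<and> locally_like C x M)"

section \<open>Smooth and nodal tropical curves\<close>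

datatype 'n piece = Segment "real ^ 'n" "real ^ 'n" | Ray "real ^ 'n" "real ^ 'n"

fun carrier :: "'n::finite piece \<Rightarrow> (real ^ 'n) set" where
  "carrier (Segment p q) = closed_segment p q"
| "carrier (Ray p v) = ray p v"

fun nondegenerate :: "'n::finite piece \<Rightarrow> bool" where
  "nondegenerate (Segment p q) \<longleftrightarrow> p \<noteq> q"
| "nondegenerate (Ray p v) \<longleftrightarrow> v \<noteq> 0"

fun endpoints :: "'n::finite piece \<Rightarrow> (real ^ 'n) set" where
  "endpoints (Segment p q) = {p, q}"
| "endpoints (Ray p v) = {p}"

fun is_ray :: "'n::finite piece \<Rightarrow> bool" where
  "is_ray (Segment p q) \<longleftrightarrow> False"
| "is_ray (Ray p v) \<longleftrightarrow> True"

definition union_of_pieces :: "(real ^ 'n) set \<Rightarrow> bool" where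
  "union_of_pieces C \<longleftrightarrow>
     (\<exists>D. finite D \<and> (\<forall>a\<in>D. nondegenerate a) \<and> C = (\<Union>a\<in>D. carrier a))"

definition smooth_tropical_curve :: "(real ^ 'n) set \<Rightarrow> bool" where
  "smooth_tropical_curve C \<longleftrightarrow> union_of_pieces C \<and> (\<forall>x\<in>C. smooth_point C x)"

definition nodal_tropical_curve :: "(real ^ 2) set \<Rightarrow> bool" where
  "nodal_tropical_curve C \<longleftrightarrow> union_of_pieces C \<and> (\<forall>x\<in>C. smooth_point C x \<or> node C x)"

text \<open>
  A presentation of \<open>C\<close> as a graph: distinct pieces meet only in common endpoints.
\<close>

definition decomposition :: "(real ^ 'n) set \<Rightarrow> 'n piece set \<Rightarrow> bool" where
  "decomposition C D \<longleftrightarrow>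
     finite D \<and> (\<forall>a\<in>D. nondegenerate a) \<and> C = (\<Union>a\<in>D. carrier a) \<and>
     (\<forall>a\<in>D. \<forall>b\<in>D. a \<noteq> b \<longrightarrow> carrier a \<inter> carrier b \<subseteq> endpoints a \<inter> endpoints b)"

definition lattice_length :: "real ^ 'n \<Rightarrow> real ^ 'n \<Rightarrow> real" where
  "lattice_length p q = (THE \<alpha>. 0 < \<alpha> \<and> (\<exists>v. primitive_vec v \<and> p - q = \<alpha> *\<^sub>R real_vec v))"

text \<open>
  The vertices of the associated abstract tropical curve: ordinary points, the two vertices
  \<open>Branch p L\<close> that replace a node \<open>p\<close> (one for each of the two lines \<open>L\<close> through \<open>p\<close>), and the
  vertex at the infinite end of a ray.
\<close>

datatype 'n curve_vertex =
  Point "real ^ 'n" | Branch "real ^ 'n" "(real ^ 'n) set" | At_Infinity "'n piece"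

definition vertex_at :: "(real ^ 'n) set \<Rightarrow> 'n piece \<Rightarrow> real ^ 'n \<Rightarrow> 'n curve_vertex" where
  "vertex_at N a p = (if p \<in> N then Branch p (affine hull (carrier a)) else Point p)"

fun piece_ends :: "(real ^ 'n::finite) set \<Rightarrow> 'n piece \<Rightarrow> 'n curve_vertex multiset" where
  "piece_ends N (Segment p q) = {#vertex_at N (Segment p q) p, vertex_at N (Segment p q) q#}"
| "piece_ends N (Ray p v) = {#vertex_at N (Ray p v) p, At_Infinity (Ray p v)#}"

fun piece_length :: "'n::finite piece \<Rightarrow> ereal" where
  "piece_length (Segment p q) = ereal (lattice_length p q)"
| "piece_length (Ray p v) = \<infinity>"

text \<open>
  The abstract tropical curve of a decomposition \<open>D\<close>, with the points of \<open>N\<close> resolved as nodes.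
  In a decomposition of a nodal curve every node is an endpoint of the four pieces at it.
\<close>

definition associated_curve ::
    "(real ^ 'n) set \<Rightarrow> 'n piece set \<Rightarrow> ('n curve_vertex, 'n piece) metric_graph" where
  "associated_curve N D =
     \<lparr> verts = (\<Union>a\<in>D. set_mset (piece_ends N a)),
       edges = D,
       ends = piece_ends N,
       len = piece_length,
       inf_verts = At_Infinity ` {a \<in> D. is_ray a} \<rparr>"

text \<open>
  Two decompositions of the same curve have a common refinement, so the associated curve is
  well defined up to tropical modification and the choice of \<open>D\<close> below does not matter.
\<close>

definition is_embedding :: "('v, 'e) metric_graph \<Rightarrow> (real ^ 'n) set \<Rightarrow> bool" where
  "is_embedding G C \<longleftrightarrow>
     smooth_tropical_curve C \<and>
     (\<exists>D. decomposition C D \<and> isometric_to_modification (associated_curve {} D) G)"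

definition is_immersion :: "('v, 'e) metric_graph \<Rightarrow> (real ^ 2) set \<Rightarrow> bool" where
  "is_immersion G C \<longleftrightarrow>
     nodal_tropical_curve C \<and>
     (\<exists>D. decomposition C D \<and>
        isometric_to_modification (associated_curve {x \<in> C. node C x} D) G)"

end

(*
  Place every finite vertex of the graph at a point of R^n, the points being multiples of one
  vector with rationally independent entries, and let all n + 1 rays of the standard model
  emanate from each of them. An edge incident to a vertex claims one of its rays, an infinite
  edge is its ray, and the unclaimed rays are tropical modifications. A finite edge is realised
  by replacing the two claimed rays by a path: its edge directions run several times
  cyclically through the rays of the standard model, and at every bend an additional ray keeps the curve
  trivalent and unimodular. If the vertices are close together compared with the edge lengths,
  the lengths of the steps of the path can be chosen positive with the prescribed sum. The
  admissible lengths form an open subset of an affine space, and every unwanted incidence is an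
  affine condition that is not identically satisfied, so a generic choice avoids all of them:
  for n >= 3 the curve is embedded, and for n = 2 distinct pieces only cross in simple nodes. In
  the latter case the pieces are finally subdivided at the nodes, which subdivides the abstract curve.
*)

theory Submission
  imports Defs
begin

section \<open>Tropical modifications up to isometry\<close>

text \<open>Two obstacles shape the construction. First, displacement and total length of a path are
  prescribed, so an affine condition on its step lengths may turn out to be constant. Each condition
  is therefore written with coefficients \<mu> l . u l, where \<mu> is piecewise constant along the
  path. The n + 1 rays sum to zero, so one cycle of steps can absorb any displacement together with
  any length; if \<mu> is constant on such a cycle, a change of one other step can be compensated
  there, and it alters the functional. Concurrency of three lines breaks \<mu> at up to three bends,
  hence four disjoint cycles. Second, the first and the last step stay on lines that exist before
  the path does; in dimension at least three the directions next to them are tilted by a generic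
  integer multiple instead. All incidence conditions speak of whole lines, which do not change when
  a ray is shortened to a segment; so general position is an invariant under adding one edge after
  the other. The vertices are multiples of one vector because a coincidence among the initial stars
  then becomes an integral relation between its entries.\<close>

lemma isometric_trans:
  assumes "isometric G H" "isometric H K"
  shows "isometric G K"
proof -
  obtain \<phi> \<psi> where 1: "bij_betw \<phi> (verts G) (verts H)" "bij_betw \<psi> (edges G) (edges H)"
    "\<phi> ` inf_verts G = inf_verts H"
    "\<forall>e\<in>edges G. ends H (\<psi> e) = image_mset \<phi> (ends G e) \<and> len H (\<psi> e) = len G e"
    using assms(1) unfolding isometric_def by blast
  obtain \<phi>' \<psi>' where 2: "bij_betw \<phi>' (verts H) (verts K)" "bij_betw \<psi>' (edges H) (edges K)"
    "\<phi>' ` inf_verts H = inf_verts K"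
    "\<forall>e\<in>edges H. ends K (\<psi>' e) = image_mset \<phi>' (ends H e) \<and> len K (\<psi>' e) = len H e"
    using assms(2) unfolding isometric_def by blast
  have e: "\<psi> e \<in> edges H" if "e \<in> edges G" for e
    using 1(2) that by (auto simp: bij_betw_def)
  have "bij_betw (\<phi>' \<circ> \<phi>) (verts G) (verts K)" "bij_betw (\<psi>' \<circ> \<psi>) (edges G) (edges K)"
    by (fact bij_betw_trans[OF 1(1) 2(1)], fact bij_betw_trans[OF 1(2) 2(2)])
  moreover have "(\<phi>' \<circ> \<phi>) ` inf_verts G = inf_verts K"
    using 1(3) 2(3) by (metis image_comp)
  ultimately show ?thesis
    unfolding isometric_def using 1(4) 2(4) e
    by (intro exI[of _ "\<phi>' \<circ> \<phi>"] exI[of _ "\<psi>' \<circ> \<psi>"]) (simp add: multiset.map_comp)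
qed

lemma abstract_tropical_curveD:
  assumes "abstract_tropical_curve G"
  shows "finite (verts G)" "finite (edges G)"
    "\<And>e. e \<in> edges G \<Longrightarrow> size (ends G e) = 2"
    "\<And>e. e \<in> edges G \<Longrightarrow> set_mset (ends G e) \<subseteq> verts G"
    "connected_graph G" "\<And>e. e \<in> edges G \<Longrightarrow> 0 < len G e"
    "inf_verts G \<subseteq> verts G" "\<And>v. v \<in> inf_verts G \<Longrightarrow> vertex_degree G v = 1"
    "\<And>e. e \<in> edges G \<Longrightarrow> len G e = \<infinity> \<longleftrightarrow> (\<exists>v\<in>inf_verts G. v \<in># ends G e)"
  using assms unfolding abstract_tropical_curve_def by auto

text \<open>\<open>isometric_to_modification\<close> uses one isometry into the numbered world and
  one out of it. Inverting an isometry requires the ends of edges to be vertices, so both directions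
  are built here together; finiteness supplies the injections.\<close>

lemma nat_copy:
  assumes "abstract_tropical_curve G"
  obtains G' :: "(nat, nat) metric_graph" where "isometric G G'" "isometric G' G"
proof -
  note G = abstract_tropical_curveD[OF assms]
  obtain \<phi> :: "_ \<Rightarrow> nat" where \<phi>: "inj_on \<phi> (verts G)"
    using finite_imp_inj_to_nat_seg[OF G(1)] by blast
  obtain \<psi> :: "_ \<Rightarrow> nat" where \<psi>: "inj_on \<psi> (edges G)"
    using finite_imp_inj_to_nat_seg[OF G(2)] by blast
  define \<phi>' where "\<phi>' = the_inv_into (verts G) \<phi>"
  define \<psi>' where "\<psi>' = the_inv_into (edges G) \<psi>"
  define G' where "G' = \<lparr> verts = \<phi> ` verts G, edges = \<psi> ` edges G,
      ends = (\<lambda>f. image_mset \<phi> (ends G (\<psi>' f))), len = (\<lambda>f. len G (\<psi>' f)),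
      inf_verts = \<phi> ` inf_verts G \<rparr>"
  have \<phi>'[simp]: "\<phi>' (\<phi> v) = v" if "v \<in> verts G" for v
    unfolding \<phi>'_def using \<phi> that by (rule the_inv_into_f_f)
  have \<psi>'[simp]: "\<psi>' (\<psi> e) = e" if "e \<in> edges G" for e
    unfolding \<psi>'_def using \<psi> that by (rule the_inv_into_f_f)
  have im: "image_mset \<phi>' (image_mset \<phi> (ends G e)) = ends G e" if "e \<in> edges G" for e
  proof -
    have "image_mset (\<phi>' \<circ> \<phi>) (ends G e) = image_mset id (ends G e)"
      by (rule image_mset_cong) (use G(4)[OF that] in auto)
    then show ?thesis by (simp add: multiset.map_comp)
  qed
  have "isometric G G'"
    unfolding isometric_def
    by (rule exI[of _ \<phi>], rule exI[of _ \<psi>]) (auto simp: G'_def \<phi> \<psi> bij_betw_def)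
  moreover have "isometric G' G"
    unfolding isometric_def
  proof (rule exI[of _ \<phi>'], rule exI[of _ \<psi>'], intro conjI)
    show "bij_betw \<phi>' (verts G') (verts G)"
      using \<phi> by (simp add: G'_def \<phi>'_def bij_betw_the_inv_into inj_on_imp_bij_betw)
    show "bij_betw \<psi>' (edges G') (edges G)"
      using \<psi> by (simp add: G'_def \<psi>'_def bij_betw_the_inv_into inj_on_imp_bij_betw)
    show "\<phi>' ` inf_verts G' = inf_verts G"
    proof -
      have "\<phi>' ` \<phi> ` inf_verts G = id ` inf_verts G"
        unfolding image_image by (rule image_cong) (use G(7) in auto)
      then show ?thesis by (simp add: G'_def)
    qed
    show "\<forall>e\<in>edges G'. ends G (\<psi>' e) = image_mset \<phi>' (ends G' e) \<and> len G (\<psi>' e) = len G' e"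
      by (auto simp: G'_def im)
  qed
  ultimately show thesis by (rule that)
qed

lemma isometric_to_modification_refl:
  assumes "abstract_tropical_curve G"
  shows "isometric_to_modification G G"
proof -
  obtain G' :: "(nat, nat) metric_graph" where "isometric G G'" "isometric G' G"
    using nat_copy[OF assms] .
  with tropical_modification.refl[of G'] show ?thesis
    unfolding isometric_to_modification_def by (intro exI conjI)
qed

lemma isometric_to_modification_isometric:
  assumes "isometric_to_modification H G" "isometric H K"
  shows "isometric_to_modification K G"
proof -
  obtain G' H' :: "(nat, nat) metric_graph" where
    *: "isometric G G'" "tropical_modification G' H'" "isometric H' H"
    using assms(1) unfolding isometric_to_modification_def by (elim exE conjE) (rule that)
  from *(1,2) isometric_trans[OF *(3) assms(2)] show ?thesis
    unfolding isometric_to_modification_def by (intro exI conjI)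
qed

section \<open>Stability of abstract tropical curves under isometry and modification\<close>

lemma count_image_mset_inj_on:
  assumes "inj_on \<phi> A" "set_mset M \<subseteq> A" "v \<in> A"
  shows "count (image_mset \<phi> M) (\<phi> v) = count M v"
  using assms(2) by (induction M) (auto simp: inj_on_eq_iff[OF assms(1)] assms(3))

abbreviation adjacency :: "('v, 'e) metric_graph \<Rightarrow> ('v \<times> 'v) set" where
  "adjacency G \<equiv> {(x, y). \<exists>e\<in>edges G. ends G e = {#x, y#}}"

lemma adjacency_sym: "(x, y) \<in> adjacency G \<Longrightarrow> (y, x) \<in> adjacency G"
  by (auto simp: add_mset_commute)

text \<open>Injectivity on vertices preserves degrees: the multiplicity of a vertex in the ends of
  an edge is unchanged, so loops still count twice and infinite vertices keep degree one.\<close>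

lemma abstract_tropical_curve_isometric:
  assumes "abstract_tropical_curve G" "isometric G H"
  shows "abstract_tropical_curve H"
proof -
  note G = abstract_tropical_curveD[OF assms(1)]
  obtain \<phi> \<psi> where I: "bij_betw \<phi> (verts G) (verts H)" "bij_betw \<psi> (edges G) (edges H)"
    "\<phi> ` inf_verts G = inf_verts H"
    "\<And>e. e \<in> edges G \<Longrightarrow> ends H (\<psi> e) = image_mset \<phi> (ends G e)"
    "\<And>e. e \<in> edges G \<Longrightarrow> len H (\<psi> e) = len G e"
    using assms(2) unfolding isometric_def by blast
  have V: "verts H = \<phi> ` verts G" and E: "edges H = \<psi> ` edges G"
    and inj: "inj_on \<phi> (verts G)" "inj_on \<psi> (edges G)"
    using I(1,2) by (auto simp: bij_betw_def)
  have deg: "vertex_degree H (\<phi> v) = vertex_degree G v" if "v \<in> verts G" for v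
    unfolding vertex_degree_def E
    by (subst sum.reindex[OF inj(2)], rule sum.cong)
      (auto simp: I(4) count_image_mset_inj_on[OF inj(1) G(4) that])
  have conn: "connected_graph H"
    unfolding connected_graph_def
  proof (intro conjI ballI)
    show "verts H \<noteq> {}" using G(5) V by (auto simp: connected_graph_def)
    fix x y assume "x \<in> verts H" "y \<in> verts H"
    then obtain a b where ab: "a \<in> verts G" "b \<in> verts G" "x = \<phi> a" "y = \<phi> b"
      using V by auto
    then have "(a, b) \<in> (adjacency G)\<^sup>*"
      using G(5) by (simp add: connected_graph_def)
    then have "(\<phi> a, \<phi> b) \<in> (adjacency H)\<^sup>*"
    proof (induction rule: rtrancl_induct)
      case (step c d)
      then obtain e where "e \<in> edges G" "ends G e = {#c, d#}" by auto
      then have "\<psi> e \<in> edges H" "ends H (\<psi> e) = {#\<phi> c, \<phi> d#}" using I(4) E by auto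
      then have "(\<phi> c, \<phi> d) \<in> adjacency H" by auto
      with step.IH show ?case by (rule rtrancl_into_rtrancl)
    qed simp
    then show "(x, y) \<in> (adjacency H)\<^sup>*" using ab by simp
  qed
  have inf: "len H f = \<infinity> \<longleftrightarrow> (\<exists>v\<in>inf_verts H. v \<in># ends H f)" if f: "f \<in> edges H" for f
  proof -
    obtain e where e: "e \<in> edges G" "f = \<psi> e" using f E by auto
    have "(\<exists>v\<in>inf_verts H. v \<in># ends H f) \<longleftrightarrow> (\<exists>v\<in>inf_verts G. v \<in># ends G e)"
    proof
      assume "\<exists>v\<in>inf_verts H. v \<in># ends H f"
      then obtain v w where v: "v \<in> inf_verts G" "w \<in># ends G e" "\<phi> v = \<phi> w"
        using I(3)[symmetric] I(4)[OF e(1)] e(2) by auto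
      then have "v = w" using inj(1) G(4)[OF e(1)] G(7) by (meson inj_on_def subsetD)
      then show "\<exists>v\<in>inf_verts G. v \<in># ends G e" using v by auto
    next
      assume "\<exists>v\<in>inf_verts G. v \<in># ends G e"
      then show "\<exists>v\<in>inf_verts H. v \<in># ends H f"
        using I(3) I(4)[OF e(1)] e(2) by auto
    qed
    then show ?thesis using G(9)[OF e(1)] I(5)[OF e(1)] e(2) by simp
  qed
  show ?thesis
    unfolding abstract_tropical_curve_def
  proof (intro conjI ballI)
    show "finite (verts H)" "finite (edges H)" using G(1,2) V E by auto
    show "connected_graph H" by (rule conn)
    show "inf_verts H \<subseteq> verts H" using G(7) V I(3)[symmetric] by auto
    show "vertex_degree H v = 1" if v: "v \<in> inf_verts H" for v
    proof -
      obtain w where "w \<in> inf_verts G" "v = \<phi> w" using v I(3) by blast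
      then show ?thesis using deg[of w] G(7,8) by auto
    qed
    fix f assume f: "f \<in> edges H"
    show "len H f = \<infinity> \<longleftrightarrow> (\<exists>v\<in>inf_verts H. v \<in># ends H f)" by (rule inf[OF f])
    obtain e where e: "e \<in> edges G" "f = \<psi> e" using f E by auto
    show "size (ends H f) = 2" "set_mset (ends H f) \<subseteq> verts H" "0 < len H f"
      using G(3,4,6)[OF e(1)] I(4,5)[OF e(1)] e(2) V by auto
  qed
qed

lemma pair_mset_eq: "{#x, y#} = {#a, b#} \<Longrightarrow> x = a \<and> y = b \<or> x = b \<and> y = a"
  by (auto simp: add_eq_conv_diff split: if_splits)

text \<open>Apart from \<open>m\<close> the two halves have exactly the ends \<open>a\<close> and
  \<open>b\<close> of \<open>e\<close>, also when \<open>a = b\<close>, so old degrees are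
  unchanged. A passage along \<open>e\<close> becomes a detour through \<open>m\<close>, which keeps
  the graph connected.\<close>

lemma subdivision_curve:
  assumes "subdivision G H"
  shows "abstract_tropical_curve H"
proof -
  obtain e a b m e1 e2 where
    G0: "abstract_tropical_curve G" and
    S: "e \<in> edges G" "ends G e = {#a, b#}"
        "m \<notin> verts G" "e1 \<notin> edges G" "e2 \<notin> edges G" "e1 \<noteq> e2"
        "verts H = insert m (verts G)"
        "inf_verts H = inf_verts G"
        "edges H = (edges G - {e}) \<union> {e1, e2}"
        "ends H e1 = {#a, m#}" "ends H e2 = {#m, b#}"
        "0 < len H e1" "0 < len H e2" "len H e1 + len H e2 = len G e"
        "len H e1 = \<infinity> \<longleftrightarrow> a \<in> inf_verts G" "len H e2 = \<infinity> \<longleftrightarrow> b \<in> inf_verts G"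
        "\<forall>x\<in>edges G - {e}. ends H x = ends G x \<and> len H x = len G x"
    using assms unfolding subdivision_def by (elim conjE exE) (rule that)
  note G = abstract_tropical_curveD[OF G0]
  have ab: "a \<in> verts G" "b \<in> verts G" using G(4)[OF S(1)] S(2) by auto
  have mi: "m \<notin> inf_verts G" using S(3) G(7) by auto
  have deg: "vertex_degree H v = vertex_degree G v" if "v \<noteq> m" for v
  proof -
    have "vertex_degree H v = (\<Sum>x\<in>edges G - {e}. count (ends H x) v) + (\<Sum>x\<in>{e1,e2}. count (ends H x) v)"
      unfolding vertex_degree_def S(9) using S(4,5) G(2) by (subst sum.union_disjoint) auto
    also have "(\<Sum>x\<in>{e1,e2}. count (ends H x) v) = count (ends G e) v"
      using S(6) that by (simp add: S(2,10,11))
    also have "(\<Sum>x\<in>edges G - {e}. count (ends H x) v) = (\<Sum>x\<in>edges G - {e}. count (ends G x) v)"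
      by (rule sum.cong) (auto simp: S(17))
    also have "\<dots> + count (ends G e) v = vertex_degree G v"
      unfolding vertex_degree_def using S(1) G(2) by (simp add: sum.remove add.commute)
    finally show ?thesis .
  qed
  have am: "(a, m) \<in> adjacency H" and mb: "(m, b) \<in> adjacency H" using S by auto
  have ma: "(m, a) \<in> adjacency H" and bm: "(b, m) \<in> adjacency H"
    by (fact adjacency_sym[OF am], fact adjacency_sym[OF mb])
  have sub: "adjacency G \<subseteq> (adjacency H)\<^sup>*"
  proof clarify
    fix x y f assume f: "f \<in> edges G" "ends G f = {#x, y#}"
    show "(x, y) \<in> (adjacency H)\<^sup>*"
    proof (cases "f = e")
      case True
      then have "x = a \<and> y = b \<or> x = b \<and> y = a" using f(2) S(2) pair_mset_eq by metis
      then show ?thesis using am mb ma bm by (meson converse_rtrancl_into_rtrancl r_into_rtrancl)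
    next
      case False
      then have "(x, y) \<in> adjacency H" using f S(9,17) by (auto intro!: bexI[of _ f])
      then show ?thesis by blast
    qed
  qed
  have 1: "(x, y) \<in> (adjacency H)\<^sup>*" if "x \<in> verts G" "y \<in> verts G" for x y
  proof -
    have "(x, y) \<in> (adjacency G)\<^sup>*" using that G(5) by (simp add: connected_graph_def)
    then show ?thesis using rtrancl_subset_rtrancl[OF sub] by blast
  qed
  have conn: "connected_graph H"
    unfolding connected_graph_def
  proof (intro conjI ballI)
    show "verts H \<noteq> {}" using S by auto
    have 2: "(m, y) \<in> (adjacency H)\<^sup>*" "(y, m) \<in> (adjacency H)\<^sup>*" if "y \<in> verts H" for y
      using that 1[OF ab(1), of y] 1[OF _ ab(1), of y] ma am S(7)
      by (auto intro: converse_rtrancl_into_rtrancl rtrancl_into_rtrancl)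
    fix x y assume "x \<in> verts H" "y \<in> verts H"
    then show "(x, y) \<in> (adjacency H)\<^sup>*" using 2 by (meson rtrancl_trans)
  qed
  show ?thesis
    unfolding abstract_tropical_curve_def
  proof (intro conjI ballI)
    show "finite (verts H)" "finite (edges H)" using S G by auto
    show "connected_graph H" by (rule conn)
    show "inf_verts H \<subseteq> verts H" using S G by auto
    show "vertex_degree H v = 1" if "v \<in> inf_verts H" for v
      using that deg[of v] mi S(8) G(8) by auto
    fix f assume "f \<in> edges H"
    then consider "f \<in> edges G - {e}" | "f = e1" | "f = e2" using S(9) by auto
    then have "size (ends H f) = 2 \<and> set_mset (ends H f) \<subseteq> verts H \<and> 0 < len H f \<and>
      (len H f = \<infinity> \<longleftrightarrow> (\<exists>v\<in>inf_verts H. v \<in># ends H f))"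
    proof cases
      case 1
      then show ?thesis using G(3,4,6,9)[of f] S(7,8,17) by auto
    next
      case 2
      then show ?thesis using S(7,8,10,12,15) ab mi by auto
    next
      case 3
      then show ?thesis using S(7,8,11,13,16) ab mi by auto
    qed
    then show "size (ends H f) = 2" "set_mset (ends H f) \<subseteq> verts H" "0 < len H f"
      "len H f = \<infinity> \<longleftrightarrow> (\<exists>v\<in>inf_verts H. v \<in># ends H f)"
      by blast+
  qed
qed

text \<open>The new end \<open>w\<close> has degree zero before and hence degree one afterwards;
  since the edge is attached at a finite vertex, the old infinite vertices keep degree one.\<close>

lemma elementary_modification_curve:
  assumes "elementary_modification G H"
  shows "abstract_tropical_curve H"
proof -
  obtain v w e where
    G0: "abstract_tropical_curve G" and
    S: "v \<in> verts G" "v \<notin> inf_verts G" "w \<notin> verts G" "e \<notin> edges G"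
        "verts H = insert w (verts G)"
        "inf_verts H = insert w (inf_verts G)"
        "edges H = insert e (edges G)"
        "ends H e = {#v, w#}" "len H e = \<infinity>"
        "\<forall>x\<in>edges G. ends H x = ends G x \<and> len H x = len G x"
    using assms unfolding elementary_modification_def by auto
  note G = abstract_tropical_curveD[OF G0]
  have deg: "vertex_degree H x = count {#v, w#} x + vertex_degree G x" for x
    unfolding vertex_degree_def S(7) using S(4,8,10) G(2) by simp
  have w0: "vertex_degree G w = 0"
    unfolding vertex_degree_def
  proof (rule sum.neutral, rule ballI)
    show "count (ends G x) w = 0" if "x \<in> edges G" for x
      using G(4)[OF that] S(3) by (meson count_eq_zero_iff subsetD)
  qed
  have vw: "(v, w) \<in> adjacency H" using S by auto
  then have wv: "(w, v) \<in> adjacency H" by (rule adjacency_sym)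
  have sub: "adjacency G \<subseteq> adjacency H" using S(7,10) by auto
  have 1: "(x, y) \<in> (adjacency H)\<^sup>*" if "x \<in> verts G" "y \<in> verts G" for x y
  proof -
    have "(x, y) \<in> (adjacency G)\<^sup>*" using that G(5) by (simp add: connected_graph_def)
    then show ?thesis using rtrancl_mono[OF sub] by blast
  qed
  have conn: "connected_graph H"
    unfolding connected_graph_def
  proof (intro conjI ballI)
    show "verts H \<noteq> {}" using S by auto
    have 2: "(v, y) \<in> (adjacency H)\<^sup>*" "(y, v) \<in> (adjacency H)\<^sup>*" if "y \<in> verts H" for y
      using that 1[OF S(1), of y] 1[OF _ S(1), of y] vw wv S(5) by auto
    fix x y assume "x \<in> verts H" "y \<in> verts H"
    then show "(x, y) \<in> (adjacency H)\<^sup>*" using 2 by (meson rtrancl_trans)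
  qed
  have vw': "v \<noteq> w" using S by auto
  show ?thesis
    unfolding abstract_tropical_curve_def
  proof (intro conjI ballI)
    show "finite (verts H)" "finite (edges H)" using S G by auto
    show "connected_graph H" by (rule conn)
    show "inf_verts H \<subseteq> verts H" using S G by auto
    show "vertex_degree H x = 1" if "x \<in> inf_verts H" for x
      using that deg[of x] w0 S(2,3,6) G(7,8) vw' by auto
    fix f assume "f \<in> edges H"
    then consider "f \<in> edges G" | "f = e" using S(7) by auto
    then have "size (ends H f) = 2 \<and> set_mset (ends H f) \<subseteq> verts H \<and> 0 < len H f \<and>
      (len H f = \<infinity> \<longleftrightarrow> (\<exists>v\<in>inf_verts H. v \<in># ends H f))"
    proof cases
      case 1
      then have "w \<notin># ends G f" using G(4)[of f] S(3) by auto
      then show ?thesis using 1 G(3,4,6,9)[of f] S(5,6,10) by auto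
    next
      case 2
      then show ?thesis using S(1,5,6,8,9) by auto
    qed
    then show "size (ends H f) = 2" "set_mset (ends H f) \<subseteq> verts H" "0 < len H f"
      "len H f = \<infinity> \<longleftrightarrow> (\<exists>v\<in>inf_verts H. v \<in># ends H f)"
      by blast+
  qed
qed

lemma tropical_modification_curve:
  assumes "tropical_modification G H" "abstract_tropical_curve G"
  shows "abstract_tropical_curve H"
  using assms
proof (induction rule: tropical_modification.induct)
  \<comment> \<open>A reverse subdivision leads back to the source of \<open>subdivision\<close>,
    which that definition requires to be a curve.\<close>
  case (unsubdivide G H K)
  then show ?case by (simp add: subdivision_def)
qed (simp_all add: subdivision_curve elementary_modification_curve)

lemma isometric_to_modification_curve:
  assumes "isometric_to_modification H G" "abstract_tropical_curve G"
  shows "abstract_tropical_curve H"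
proof -
  obtain G' H' :: "(nat, nat) metric_graph" where
    *: "isometric G G'" "tropical_modification G' H'" "isometric H' H"
    using assms(1) unfolding isometric_to_modification_def by (elim exE conjE) (rule that)
  have "abstract_tropical_curve G'"
    by (rule abstract_tropical_curve_isometric[OF assms(2) *(1)])
  then have "abstract_tropical_curve H'"
    by (rule tropical_modification_curve[OF *(2)])
  then show ?thesis
    by (rule abstract_tropical_curve_isometric[OF _ *(3)])
qed

section \<open>Subdivisions and modifications of curves with arbitrary labels\<close>

lemma image_mset_eq_pair:
  assumes "image_mset f M = {#a, b#}"
  obtains x y where "M = {#x, y#}" "f x = a" "f y = b"
proof -
  obtain x N where x: "M = add_mset x N" "f x = a" "image_mset f N = {#b#}"
    using msed_map_invR[OF assms] by auto
  obtain y N' where y: "N = add_mset y N'" "f y = b" "image_mset f N' = {#}"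
    using msed_map_invR[OF x(3)] by auto
  show thesis using that[of x y] x y by simp
qed

text \<open>The step is carried out on the numbered copy \<open>H'\<close>, where fresh labels
  exist, and the result is relabelled to \<open>K\<close>. In contrast to
  \<open>subdivision\<close>, one of \<open>e1\<close>, \<open>e2\<close> may be \<open>e\<close>
  itself: while a path is laid, the rest of the edge keeps its name.\<close>

lemma isometric_to_modification_subdivide:
  assumes itm: "isometric_to_modification H G" and G0: "abstract_tropical_curve G"
    and e: "e \<in> edges H" "ends H e = {#a, b#}"
    and new: "m \<notin> verts H" "e1 \<notin> edges H - {e}" "e2 \<notin> edges H - {e}" "e1 \<noteq> e2"
    and K: "verts K = insert m (verts H)" "inf_verts K = inf_verts H"
        "edges K = (edges H - {e}) \<union> {e1, e2}"
        "ends K e1 = {#a, m#}" "ends K e2 = {#m, b#}"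
        "0 < len K e1" "0 < len K e2" "len K e1 + len K e2 = len H e"
        "len K e1 = \<infinity> \<longleftrightarrow> a \<in> inf_verts H" "len K e2 = \<infinity> \<longleftrightarrow> b \<in> inf_verts H"
        "\<And>x. x \<in> edges H - {e} \<Longrightarrow> ends K x = ends H x"
        "\<And>x. x \<in> edges H - {e} \<Longrightarrow> len K x = len H x"
  shows "isometric_to_modification K G"
proof -
  obtain G' H' :: "(nat, nat) metric_graph" where
    GH: "isometric G G'" "tropical_modification G' H'" "isometric H' H"
    using itm unfolding isometric_to_modification_def by (elim exE conjE) (rule that)
  have H'0: "abstract_tropical_curve H'"
    by (rule tropical_modification_curve[OF GH(2) abstract_tropical_curve_isometric[OF G0 GH(1)]])
  note H' = abstract_tropical_curveD[OF H'0]
  obtain \<phi> \<psi> where I: "bij_betw \<phi> (verts H') (verts H)" "bij_betw \<psi> (edges H') (edges H)"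
    "\<phi> ` inf_verts H' = inf_verts H"
    "\<And>e. e \<in> edges H' \<Longrightarrow> ends H (\<psi> e) = image_mset \<phi> (ends H' e)"
    "\<And>e. e \<in> edges H' \<Longrightarrow> len H (\<psi> e) = len H' e"
    using GH(3) unfolding isometric_def by blast
  obtain e' where e': "e' \<in> edges H'" "\<psi> e' = e" using e(1) I(2) by (metis bij_betw_def imageE)
  obtain a' b' where ab': "ends H' e' = {#a', b'#}" "\<phi> a' = a" "\<phi> b' = b"
    using image_mset_eq_pair e(2) I(4)[OF e'(1)] e'(2) by metis
  obtain m' where m': "m' \<notin> verts H'" using ex_new_if_finite[OF infinite_UNIV_nat H'(1)] by blast
  obtain e1' where e1': "e1' \<notin> edges H'" using ex_new_if_finite[OF infinite_UNIV_nat H'(2)] by blast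
  obtain e2' where e2': "e2' \<notin> insert e1' (edges H')"
    using ex_new_if_finite[OF infinite_UNIV_nat] H'(2) by (metis finite.insertI)
  define K' where "K' = \<lparr> verts = insert m' (verts H'), edges = (edges H' - {e'}) \<union> {e1', e2'},
     ends = (ends H')(e1' := {#a', m'#}, e2' := {#m', b'#}),
     len = (len H')(e1' := len K e1, e2' := len K e2), inf_verts = inf_verts H' \<rparr>"
  have abv: "a' \<in> verts H'" "b' \<in> verts H'" using H'(4)[OF e'(1)] ab' by auto
  \<comment> \<open>The clauses about infinite halves mention \<open>a\<close> and \<open>b\<close>,
    so being an infinite vertex has to be pulled back along \<phi>.\<close>
  have infiff: "\<phi> v \<in> inf_verts H \<longleftrightarrow> v \<in> inf_verts H'" if "v \<in> verts H'" for v
    using I(1,3) that H'(7) by (auto simp: bij_betw_def inj_on_def)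
  have "subdivision H' K'"
    unfolding subdivision_def
    apply (intro conjI H'0)
    apply (rule exI[of _ e'], rule exI[of _ a'], rule exI[of _ b'], rule exI[of _ m'],
        rule exI[of _ e1'], rule exI[of _ e2'])
    using e' ab' m' e1' e2' K(6-10) I(5)[OF e'(1)] infiff[OF abv(1)] infiff[OF abv(2)]
    by (auto simp: K'_def)
  then have "tropical_modification G' K'" using GH(2) tropical_modification.subdivide by blast
  moreover have "isometric K' K"
    unfolding isometric_def
  proof (rule exI[of _ "\<phi>(m' := m)"], rule exI[of _ "\<psi>(e1' := e1, e2' := e2)"], intro conjI ballI)
    show "bij_betw (\<phi>(m' := m)) (verts K') (verts K)"
    proof -
      have "bij_betw (\<phi>(m' := m)) (verts H') (verts H)"
        using I(1) m' by (subst bij_betw_cong[of _ _ \<phi>]) auto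
      from notIn_Un_bij_betw[OF m' _ this] new(1)
      show ?thesis by (simp add: K'_def K(1))
    qed
    have "bij_betw \<psi> (edges H' - {e'}) (edges H - {e})"
      using I(2) e' inj_on_image_set_diff[of \<psi> "edges H'" "edges H'" "{e'}"]
      by (auto simp: bij_betw_def intro: inj_on_subset)
    then have "bij_betw (\<psi>(e1' := e1, e2' := e2)) (edges H' - {e'}) (edges H - {e})"
      using e1' e2' by (subst bij_betw_cong[of _ _ \<psi>]) auto
    moreover have "bij_betw (\<psi>(e1' := e1, e2' := e2)) {e1', e2'} {e1, e2}"
      using e2' new(4) by (auto simp: bij_betw_def)
    ultimately show "bij_betw (\<psi>(e1' := e1, e2' := e2)) (edges K') (edges K)"
      using new(2,3) by (auto simp: K'_def K(3) simp del: Un_insert_right intro!: bij_betw_combine)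
    show "(\<phi>(m' := m)) ` inf_verts K' = inf_verts K"
    proof -
      have "(\<phi>(m' := m)) ` inf_verts H' = \<phi> ` inf_verts H'"
        by (rule image_cong) (use m' H'(7) in auto)
      then show ?thesis using I(3) K(2) by (simp add: K'_def)
    qed
    fix f assume "f \<in> edges K'"
    then consider "f \<in> edges H' - {e'}" | "f = e1'" | "f = e2'" by (auto simp: K'_def)
    then show "ends K ((\<psi>(e1' := e1, e2' := e2)) f) = image_mset (\<phi>(m' := m)) (ends K' f)"
    proof cases
      case 1
      then have "\<psi> f \<in> edges H - {e}" using I(2) e' by (auto simp: bij_betw_def inj_on_def)
      moreover have "image_mset (\<phi>(m' := m)) (ends H' f) = image_mset \<phi> (ends H' f)"
        by (rule image_mset_cong) (use 1 m' H'(4)[of f] in auto)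
      ultimately show ?thesis using 1 e1' e2' I(4) K(11) by (auto simp: K'_def)
    qed (use e2' abv m' ab' K(4,5) in \<open>auto simp: K'_def\<close>)
    show "len K ((\<psi>(e1' := e1, e2' := e2)) f) = len K' f"
    proof -
      consider "f \<in> edges H' - {e'}" | "f = e1'" | "f = e2'"
        using \<open>f \<in> edges K'\<close> by (auto simp: K'_def)
      then show ?thesis
      proof cases
        case 1
        then have "\<psi> f \<in> edges H - {e}" using I(2) e' by (auto simp: bij_betw_def inj_on_def)
        then show ?thesis using 1 e1' e2' I(5) K(12) by (auto simp: K'_def)
      qed (use e2' in \<open>auto simp: K'_def\<close>)
    qed
  qed
  ultimately show ?thesis
    using GH(1) unfolding isometric_to_modification_def by (intro exI conjI)
qed

text \<open>As for subdivisions, the new infinite edge is created on the numbered copy and then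
  transported to the given labels.\<close>

lemma isometric_to_modification_modify:
  assumes itm: "isometric_to_modification H G" and G0: "abstract_tropical_curve G"
    and v: "v \<in> verts H" "v \<notin> inf_verts H" and new: "w \<notin> verts H" "e \<notin> edges H"
    and K: "verts K = insert w (verts H)" "inf_verts K = insert w (inf_verts H)"
        "edges K = insert e (edges H)" "ends K e = {#v, w#}" "len K e = \<infinity>"
        "\<And>x. x \<in> edges H \<Longrightarrow> ends K x = ends H x"
        "\<And>x. x \<in> edges H \<Longrightarrow> len K x = len H x"
  shows "isometric_to_modification K G"
proof -
  obtain G' H' :: "(nat, nat) metric_graph" where
    GH: "isometric G G'" "tropical_modification G' H'" "isometric H' H"
    using itm unfolding isometric_to_modification_def by (elim exE conjE) (rule that)
  have H'0: "abstract_tropical_curve H'"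
    by (rule tropical_modification_curve[OF GH(2) abstract_tropical_curve_isometric[OF G0 GH(1)]])
  note H' = abstract_tropical_curveD[OF H'0]
  obtain \<phi> \<psi> where I: "bij_betw \<phi> (verts H') (verts H)" "bij_betw \<psi> (edges H') (edges H)"
    "\<phi> ` inf_verts H' = inf_verts H"
    "\<And>e. e \<in> edges H' \<Longrightarrow> ends H (\<psi> e) = image_mset \<phi> (ends H' e)"
    "\<And>e. e \<in> edges H' \<Longrightarrow> len H (\<psi> e) = len H' e"
    using GH(3) unfolding isometric_def by blast
  obtain v' where v': "v' \<in> verts H'" "\<phi> v' = v" using v(1) I(1) by (metis bij_betw_def imageE)
  then have v'i: "v' \<notin> inf_verts H'" using v(2) I(3) by auto
  obtain w' where w': "w' \<notin> verts H'" using ex_new_if_finite[OF infinite_UNIV_nat H'(1)] by blast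
  obtain e' where e': "e' \<notin> edges H'" using ex_new_if_finite[OF infinite_UNIV_nat H'(2)] by blast
  define K' where "K' = \<lparr> verts = insert w' (verts H'), edges = insert e' (edges H'),
     ends = (ends H')(e' := {#v', w'#}),
     len = (len H')(e' := \<infinity>), inf_verts = insert w' (inf_verts H') \<rparr>"
  have "elementary_modification H' K'"
    unfolding elementary_modification_def
    apply (intro conjI H'0)
    apply (rule exI[of _ v'], rule exI[of _ w'], rule exI[of _ e'])
    using v' v'i w' e' by (auto simp: K'_def)
  then have "tropical_modification G' K'" using GH(2) tropical_modification.modify by blast
  moreover have "isometric K' K"
    unfolding isometric_def
  proof (rule exI[of _ "\<phi>(w' := w)"], rule exI[of _ "\<psi>(e' := e)"], intro conjI ballI)
    have "bij_betw (\<phi>(w' := w)) (verts H') (verts H)"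
      using I(1) w' by (subst bij_betw_cong[of _ _ \<phi>]) auto
    from notIn_Un_bij_betw[OF w' _ this] new(1)
    show "bij_betw (\<phi>(w' := w)) (verts K') (verts K)" by (simp add: K'_def K(1))
    have "bij_betw (\<psi>(e' := e)) (edges H') (edges H)"
      using I(2) e' by (subst bij_betw_cong[of _ _ \<psi>]) auto
    from notIn_Un_bij_betw[OF e' _ this] new(2)
    show "bij_betw (\<psi>(e' := e)) (edges K') (edges K)" by (simp add: K'_def K(3))
    show "(\<phi>(w' := w)) ` inf_verts K' = inf_verts K"
    proof -
      have "(\<phi>(w' := w)) ` inf_verts H' = \<phi> ` inf_verts H'"
        by (rule image_cong) (use w' H'(7) in auto)
      then have "(\<phi>(w' := w)) ` inf_verts H' = inf_verts H" using I(3) by metis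
      then show ?thesis unfolding K(2) by (metis K'_def fun_upd_same image_insert metric_graph.select_convs(5))
    qed
    fix f assume f: "f \<in> edges K'"
    show "ends K ((\<psi>(e' := e)) f) = image_mset (\<phi>(w' := w)) (ends K' f)"
    proof (cases "f = e'")
      case False
      then have fH: "f \<in> edges H'" using f by (simp add: K'_def)
      then have "\<psi> f \<in> edges H" using I(2) by (auto simp: bij_betw_def)
      moreover have "image_mset (\<phi>(w' := w)) (ends H' f) = image_mset \<phi> (ends H' f)"
        by (rule image_mset_cong) (use fH w' H'(4)[of f] in auto)
      ultimately show ?thesis using fH False I(4) K(6) by (auto simp: K'_def)
    qed (use v' w' K(4) in \<open>auto simp: K'_def\<close>)
    show "len K ((\<psi>(e' := e)) f) = len K' f"
    proof (cases "f = e'")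
      case False
      then have fH: "f \<in> edges H'" using f by (simp add: K'_def)
      then have "\<psi> f \<in> edges H" using I(2) by (auto simp: bij_betw_def)
      then show ?thesis using fH False I(5) K(7) by (auto simp: K'_def)
    qed (use K(5) in \<open>auto simp: K'_def\<close>)
  qed
  ultimately show ?thesis
    using GH(1) unfolding isometric_to_modification_def by (intro exI conjI)
qed

text \<open>The edges in \<open>D\<close> are already realised by pieces, those in \<open>U\<close> still have to be.\<close>

definition partial_curve ::
  "'n::finite piece set \<Rightarrow> (real ^ 'n) set \<Rightarrow> 'e set \<Rightarrow> ('e \<Rightarrow> real ^ 'n) \<Rightarrow> ('e \<Rightarrow> real ^ 'n) \<Rightarrow> ('e \<Rightarrow> real)
    \<Rightarrow> ('n curve_vertex, 'n piece + 'e) metric_graph" where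
  "partial_curve D V U P Q l =
     \<lparr> verts = Point ` V \<union> At_Infinity ` {a \<in> D. is_ray a},
       edges = Inl ` D \<union> Inr ` U,
       ends = case_sum (piece_ends {}) (\<lambda>e. {#Point (P e), Point (Q e)#}),
       len = case_sum piece_length (\<lambda>e. ereal (l e)),
       inf_verts = At_Infinity ` {a \<in> D. is_ray a} \<rparr>"

lemma partial_curve_simps[simp]:
  "verts (partial_curve D V U P Q l) = Point ` V \<union> At_Infinity ` {a \<in> D. is_ray a}"
  "edges (partial_curve D V U P Q l) = Inl ` D \<union> Inr ` U"
  "ends (partial_curve D V U P Q l) = case_sum (piece_ends {}) (\<lambda>e. {#Point (P e), Point (Q e)#})"
  "len (partial_curve D V U P Q l) = case_sum piece_length (\<lambda>e. ereal (l e))"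
  "inf_verts (partial_curve D V U P Q l) = At_Infinity ` {a \<in> D. is_ray a}"
  by (simp_all add: partial_curve_def)

text \<open>The rest of the edge keeps the label \<open>Inr e\<close>, with starting point and
  length updated. So a whole path can be laid by iterating this step.\<close>

lemma partial_curve_subdivide:
  assumes M: "isometric_to_modification (partial_curve D V U P Q l) \<Gamma>"
    and \<Gamma>: "abstract_tropical_curve \<Gamma>"
    and e: "e \<in> U" and x: "x \<notin> V" and new: "Segment (P e) x \<notin> D"
    and t: "piece_length (Segment (P e) x) = ereal t" "0 < t" "t < l e"
  shows "isometric_to_modification
    (partial_curve (insert (Segment (P e) x) D) (insert x V) U (P(e := x)) Q (l(e := l e - t))) \<Gamma>"
proof (rule isometric_to_modification_subdivide[OF M \<Gamma>, where e = "Inr e" and a = "Point (P e)"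
      and b = "Point (Q e)" and m = "Point x" and ?e1.0 = "Inl (Segment (P e) x)" and ?e2.0 = "Inr e"])
  show "len (partial_curve (insert (Segment (P e) x) D) (insert x V) U (P(e := x)) Q (l(e := l e - t))) (Inl (Segment (P e) x)) +
    len (partial_curve (insert (Segment (P e) x) D) (insert x V) U (P(e := x)) Q (l(e := l e - t))) (Inr e) =
    len (partial_curve D V U P Q l) (Inr e)"
    unfolding partial_curve_simps sum.case t(1) by simp
  show "0 < len (partial_curve (insert (Segment (P e) x) D) (insert x V) U (P(e := x)) Q (l(e := l e - t))) (Inl (Segment (P e) x))"
    unfolding partial_curve_simps sum.case t(1) using t by simp
  show "(len (partial_curve (insert (Segment (P e) x) D) (insert x V) U (P(e := x)) Q (l(e := l e - t))) (Inl (Segment (P e) x)) = \<infinity>) =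
    (Point (P e) \<in> inf_verts (partial_curve D V U P Q l))"
    unfolding partial_curve_simps sum.case t(1) by auto
qed (use e x new t in \<open>auto simp: vertex_at_def split: if_splits\<close>)

text \<open>Realising the last stretch of an edge is a mere change of label, so an isometry is
  enough. The primed functions are unconstrained at \<open>e\<close>, which discards the values that
  laying the path has left there.\<close>

lemma partial_curve_close:
  assumes M: "isometric_to_modification (partial_curve D V U P Q l) \<Gamma>"
    and e: "e \<in> U" and new: "Segment (P e) (Q e) \<notin> D"
    and t: "piece_length (Segment (P e) (Q e)) = ereal (l e)"
    and eq: "\<And>f. f \<in> U - {e} \<Longrightarrow> P' f = P f \<and> Q' f = Q f \<and> l' f = l f"
  shows "isometric_to_modification
    (partial_curve (insert (Segment (P e) (Q e)) D) V (U - {e}) P' Q' l') \<Gamma>"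
proof (rule isometric_to_modification_isometric[OF M])
  let ?s = "Segment (P e) (Q e)"
  let ?\<psi> = "(id :: _ \<Rightarrow> _)(Inr e := Inl ?s)"
  have rays: "{a \<in> insert ?s D. is_ray a} = {a \<in> D. is_ray a}" by auto
  have "bij_betw ?\<psi> (Inl ` D \<union> Inr ` (U - {e}) \<union> {Inr e}) (Inl ` D \<union> Inr ` (U - {e}) \<union> {Inl ?s})"
  proof (rule bij_betw_combine)
    show "bij_betw ?\<psi> (Inl ` D \<union> Inr ` (U - {e})) (Inl ` D \<union> Inr ` (U - {e}))"
      by (subst bij_betw_cong[of _ _ id]) auto
    show "bij_betw ?\<psi> {Inr e} {Inl ?s}" by (simp add: bij_betw_def)
    show "(Inl ` D \<union> Inr ` (U - {e})) \<inter> {Inl ?s} = {}" using new by auto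
  qed
  moreover have "Inl ` D \<union> Inr ` (U - {e}) \<union> {Inr e} = Inl ` D \<union> Inr ` U"
    using e by auto
  moreover have "Inl ` D \<union> Inr ` (U - {e}) \<union> {Inl ?s} = Inl ` insert ?s D \<union> Inr ` (U - {e})"
    by auto
  ultimately have bij: "bij_betw ?\<psi> (Inl ` D \<union> Inr ` U) (Inl ` insert ?s D \<union> Inr ` (U - {e}))"
    by simp
  show "isometric (partial_curve D V U P Q l) (partial_curve (insert ?s D) V (U - {e}) P' Q' l')"
    unfolding isometric_def
  proof (rule exI[of _ id], rule exI[of _ ?\<psi>], intro conjI ballI)
    show "bij_betw ?\<psi> (edges (partial_curve D V U P Q l))
      (edges (partial_curve (insert ?s D) V (U - {e}) P' Q' l'))"
      unfolding partial_curve_simps by (rule bij)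
    show "bij_betw id (verts (partial_curve D V U P Q l))
      (verts (partial_curve (insert ?s D) V (U - {e}) P' Q' l'))"
      unfolding partial_curve_simps rays by simp
    show "id ` inf_verts (partial_curve D V U P Q l) =
      inf_verts (partial_curve (insert ?s D) V (U - {e}) P' Q' l')"
      unfolding partial_curve_simps rays by simp
    fix f assume f: "f \<in> edges (partial_curve D V U P Q l)"
    show "len (partial_curve (insert ?s D) V (U - {e}) P' Q' l') (?\<psi> f) = len (partial_curve D V U P Q l) f"
      using f eq t by (cases "f = Inr e") (auto simp del: piece_length.simps split: if_splits, metis)
    show "ends (partial_curve (insert ?s D) V (U - {e}) P' Q' l') (?\<psi> f) =
        image_mset id (ends (partial_curve D V U P Q l) f)"
      using f eq by (cases "f = Inr e") (auto simp: vertex_at_def, metis+)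
  qed
qed

lemma partial_curve_add_ray:
  assumes M: "isometric_to_modification (partial_curve D V U P Q l) \<Gamma>"
    and \<Gamma>: "abstract_tropical_curve \<Gamma>"
    and p: "p \<in> V" and new: "Ray p v \<notin> D"
  shows "isometric_to_modification (partial_curve (insert (Ray p v) D) V U P Q l) \<Gamma>"
  by (rule isometric_to_modification_modify[OF M \<Gamma>, where v = "Point p"
      and w = "At_Infinity (Ray p v)" and e = "Inl (Ray p v)"])
    (use p new in \<open>auto simp: vertex_at_def\<close>)

lemma partial_curve_add_rays:
  assumes \<Gamma>: "abstract_tropical_curve \<Gamma>" and "finite S"
    and M: "isometric_to_modification (partial_curve D V U P Q l) \<Gamma>"
    and S: "\<And>a. a \<in> S \<Longrightarrow> \<exists>p v. a = Ray p v \<and> p \<in> V"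
  shows "isometric_to_modification (partial_curve (D \<union> S) V U P Q l) \<Gamma>"
  using \<open>finite S\<close> S
proof (induction S)
  case (insert a S)
  then have IH: "isometric_to_modification (partial_curve (D \<union> S) V U P Q l) \<Gamma>" by blast
  obtain p v where a: "a = Ray p v" "p \<in> V" using insert.prems by blast
  show ?case
  proof (cases "a \<in> D")
    case True
    then have "D \<union> insert a S = D \<union> S" by auto
    then show ?thesis using IH by simp
  next
    case False
    then have "Ray p v \<notin> D \<union> S" using insert.hyps(2) a(1) by auto
    from partial_curve_add_ray[OF IH \<Gamma> a(2) this] show ?thesis using a(1) by simp
  qed
qed (use M in simp)

text \<open>Inner vertices come from subdivisions, the last stretch from a relabelling, the rays in
  \<open>S\<close> from elementary modifications. Injectivity is asked of the inner vertices only,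
  since a loop has \<open>X 0 = X k\<close>.\<close>

lemma partial_curve_lay_path:
  assumes M: "isometric_to_modification (partial_curve D V U P Q l) \<Gamma>"
    and \<Gamma>: "abstract_tropical_curve \<Gamma>"
    and e: "e \<in> U" and V: "P e \<in> V" "Q e \<in> V" and D: "(\<Union>a\<in>D. endpoints a) \<subseteq> V"
    and k: "2 \<le> k" and X: "X 0 = P e" "X k = Q e" "inj_on X {1..<k}" "X ` {1..<k} \<inter> V = {}"
    and al: "\<And>i. i < k \<Longrightarrow> piece_length (Segment (X i) (X (Suc i))) = ereal (al i)"
      "\<And>i. i < k \<Longrightarrow> 0 < al i" "(\<Sum>i<k. al i) = l e"
    and S: "finite S" "\<And>a. a \<in> S \<Longrightarrow> \<exists>p v. a = Ray p v \<and> p \<in> X ` {1..<k}"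
  shows "isometric_to_modification (partial_curve (D \<union> (\<lambda>i. Segment (X i) (X (Suc i))) ` {..<k} \<union> S)
     (V \<union> X ` {1..<k}) (U - {e}) P Q l) \<Gamma>"
proof -
  let ?s = "\<lambda>i. Segment (X i) (X (Suc i))"
  have inV: "X i \<in> V \<longleftrightarrow> i = 0 \<or> i = k" if "i \<le> k" for i
  proof (cases "i = 0 \<or> i = k")
    case True
    then show ?thesis using X(1,2) V by auto
  next
    case False
    then have "X i \<in> X ` {1..<k}" using that by (intro imageI) auto
    then show ?thesis using X(4) False by auto
  qed
  have Xeq: "X i = X j \<longleftrightarrow> i = j" if "i \<le> k" "1 \<le> j" "j < k" for i j
  proof (cases "1 \<le> i \<and> i < k")
    case True
    then show ?thesis using X(3) that by (auto simp: inj_on_def)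
  next
    case False
    then have "i = 0 \<or> i = k" using that by auto
    then show ?thesis using inV[OF that(1)] inV[of j] that by auto
  qed
  \<comment> \<open>As \<open>k\<close> is at least two, each step has an inner vertex as an end,
    and inner vertices lie outside \<open>V\<close>.\<close>
  have sD: "?s i \<notin> D" if "i < k" for i
  proof
    assume "?s i \<in> D"
    then have "X i \<in> V" "X (Suc i) \<in> V" using D by fastforce+
    then show False using inV[of i] inV[of "Suc i"] that k by auto
  qed
  have snew: "?s i \<notin> D \<union> ?s ` {..<i}" if "i < k" for i
  proof -
    have "?s i \<noteq> ?s j" if "j < i" for j
      using Xeq[of j i] \<open>i < k\<close> that by auto
    then show ?thesis using sD[OF that] by auto
  qed
  \<comment> \<open>After \<open>j\<close> steps the rest of \<open>e\<close> runs from
    \<open>X j\<close> to \<open>Q e\<close> with the remaining length. The induction stops before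
    the last step because a subdivision must leave a remainder of positive length.\<close>
  have "isometric_to_modification (partial_curve (D \<union> ?s ` {..<j}) (V \<union> X ` {1..<Suc j}) U
     (P(e := X j)) Q (l(e := (\<Sum>i=j..<k. al i)))) \<Gamma>" if "j < k" for j
    using that
  proof (induction j)
    case 0
    then show ?case using M X(1) al(3) by (simp add: atLeast0LessThan)
  next
    case (Suc j)
    let ?P = "P(e := X j)" and ?l = "l(e := (\<Sum>i=j..<k. al i))"
    have IH: "isometric_to_modification (partial_curve (D \<union> ?s ` {..<j}) (V \<union> X ` {1..<Suc j}) U ?P Q ?l) \<Gamma>"
      by (rule Suc.IH) (use Suc.prems in simp)
    have sum: "(\<Sum>i=j..<k. al i) = al j + (\<Sum>i=Suc j..<k. al i)"
      using Suc.prems by (simp add: sum.atLeast_Suc_lessThan)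
    have pos: "0 < (\<Sum>i=Suc j..<k. al i)"
      using Suc.prems al(2) by (intro sum_pos) auto
    have Xn: "X (Suc j) \<notin> V \<union> X ` {1..<Suc j}"
    proof -
      have "X (Suc j) \<noteq> X i" if "i < Suc j" for i
        using Xeq[of i "Suc j"] that Suc.prems by auto
      then have "X (Suc j) \<notin> X ` {1..<Suc j}" by (metis atLeastLessThan_iff imageE)
      then show ?thesis using inV[of "Suc j"] Suc.prems by auto
    qed
    have "Segment (?P e) (X (Suc j)) \<notin> D \<union> ?s ` {..<j}" using snew[of j] Suc.prems by simp
    moreover have "piece_length (Segment (?P e) (X (Suc j))) = ereal (al j)" using al(1)[of j] Suc.prems by simp
    moreover have "al j < ?l e" using pos sum by simp
    ultimately have "isometric_to_modification
      (partial_curve (insert (Segment (?P e) (X (Suc j))) (D \<union> ?s ` {..<j})) (insert (X (Suc j)) (V \<union> X ` {1..<Suc j})) U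
         (?P(e := X (Suc j))) Q (?l(e := ?l e - al j))) \<Gamma>"
      using partial_curve_subdivide[OF IH \<Gamma> e Xn] al(2)[of j] Suc.prems by simp
    moreover have "insert (Segment (?P e) (X (Suc j))) (D \<union> ?s ` {..<j}) = D \<union> ?s ` {..<Suc j}"
      by (auto simp: lessThan_Suc)
    moreover have "insert (X (Suc j)) (V \<union> X ` {1..<Suc j}) = V \<union> X ` {1..<Suc (Suc j)}"
      by (auto simp: atLeastLessThanSuc)
    moreover have "?P(e := X (Suc j)) = P(e := X (Suc j))" by simp
    moreover have "?l(e := ?l e - al j) = l(e := (\<Sum>i=Suc j..<k. al i))" using sum by simp
    ultimately show ?case by (simp only:)
  qed
  from this[of "k - 1"] k have M1: "isometric_to_modification (partial_curve (D \<union> ?s ` {..<k-1}) (V \<union> X ` {1..<k}) U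
     (P(e := X (k-1))) Q (l(e := (\<Sum>i=k-1..<k. al i)))) \<Gamma>"
    by simp
  have k1: "(\<Sum>i=k-1..<k. al i) = al (k - 1)" using k by (cases k) auto
  have "isometric_to_modification
    (partial_curve (insert (Segment ((P(e := X (k-1))) e) (Q e)) (D \<union> ?s ` {..<k-1})) (V \<union> X ` {1..<k}) (U - {e}) P Q l) \<Gamma>"
    by (rule partial_curve_close[OF M1 e])
      (use snew[of "k-1"] k X(2) al(1)[of "k-1"] k1 in \<open>auto simp del: piece_length.simps\<close>)
  moreover have "insert (Segment ((P(e := X (k-1))) e) (Q e)) (D \<union> ?s ` {..<k-1}) = D \<union> ?s ` {..<k}"
    using k X(2) by (cases k) (auto simp: lessThan_Suc)
  ultimately have "isometric_to_modification
    (partial_curve (D \<union> ?s ` {..<k}) (V \<union> X ` {1..<k}) (U - {e}) P Q l) \<Gamma>" by simp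
  from partial_curve_add_rays[OF \<Gamma> S(1) this] S(2) show ?thesis by blast
qed

section \<open>Lattice bases and unimodular directions\<close>

lemma real_vec_simps[simp]:
  "real_vec (a + b) = real_vec a + real_vec b" "real_vec (a - b) = real_vec a - real_vec b"
  "real_vec (- a) = - real_vec a" "real_vec 0 = 0"
  "real_vec (c *s a) = real_of_int c *\<^sub>R real_vec a" "real_vec (axis i 1) = axis i 1"
  by (simp_all add: real_vec_def vec_eq_iff axis_def)

lemma real_vec_sum: "real_vec (sum f A) = (\<Sum>i\<in>A. real_vec (f i))"
  by (induction A rule: infinite_finite_induct) auto

text \<open>Only spanning is demanded; for n vectors in an n-dimensional lattice independence
  follows, as the two-sided inverse of \<open>basis_matrix\<close> shows.\<close>

definition lattice_basis :: "('n::finite \<Rightarrow> int ^ 'n) \<Rightarrow> bool" where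
  "lattice_basis F \<longleftrightarrow> (\<forall>v. \<exists>c. v = (\<Sum>j\<in>UNIV. c j *s F j))"

definition basis_matrix :: "('n::finite \<Rightarrow> int ^ 'n) \<Rightarrow> int ^ 'n ^ 'n" where
  "basis_matrix F = (\<chi> i j. F j $ i)"

lemma real_mat_mult: "real_mat (A ** B) = real_mat A ** real_mat B"
  by (simp add: real_mat_def matrix_matrix_mult_def vec_eq_iff)

lemma real_mat_one: "real_mat (mat 1) = mat 1"
  by (simp add: real_mat_def mat_def vec_eq_iff)

lemma real_mat_inj: "real_mat A = real_mat B \<Longrightarrow> A = B"
  by (simp add: real_mat_def vec_eq_iff)

text \<open>Expanding the unit vectors gives a right inverse over the integers. Over the reals a
  one-sided inverse of a square matrix is two-sided, and the passage to real matrices is injective,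
  so this integral matrix is also a left inverse.\<close>

lemma basis_matrix_invertible:
  fixes F :: "'n::finite \<Rightarrow> int ^ 'n"
  assumes "lattice_basis F"
  obtains B where "basis_matrix F ** B = mat 1" "B ** basis_matrix F = mat 1"
proof -
  have "\<forall>i. \<exists>c. axis i 1 = (\<Sum>j\<in>UNIV. c j *s F j)"
    using assms by (auto simp: lattice_basis_def)
  then obtain c where c: "\<And>i. axis i 1 = (\<Sum>j\<in>UNIV. c i j *s F j)" by metis
  define B :: "int ^ 'n ^ 'n" where "B = (\<chi> j i. c i j)"
  have "(basis_matrix F ** B) $ k $ i = mat 1 $ k $ i" for k i
  proof -
    have "(\<Sum>j\<in>UNIV. F j $ k * c i j) = (\<Sum>j\<in>UNIV. c i j *s F j) $ k"
      by (simp add: sum_component mult.commute)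
    also have "\<dots> = axis i 1 $ k" using c by simp
    finally show ?thesis
      by (simp add: basis_matrix_def B_def matrix_matrix_mult_def mat_def axis_def)
  qed
  then have 1: "basis_matrix F ** B = mat 1" by (simp add: vec_eq_iff)
  then have "real_mat (basis_matrix F) ** real_mat B = mat 1"
    using real_mat_mult real_mat_one by metis
  then have "real_mat B ** real_mat (basis_matrix F) = mat 1"
    by (simp add: matrix_left_right_inverse)
  then have "B ** basis_matrix F = mat 1"
    by (intro real_mat_inj) (simp add: real_mat_mult real_mat_one)
  with 1 show thesis by (rule that)
qed

lemma lattice_basis_axis: "lattice_basis (\<lambda>j. axis j 1)"
  unfolding lattice_basis_def
proof
  fix v :: "int ^ 'n"
  show "\<exists>c. v = (\<Sum>j\<in>UNIV. c j *s axis j 1)"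
    by (rule exI[of _ "($) v"]) (simp add: vec_eq_iff axis_def if_distrib cong: if_cong)
qed

lemma lattice_basis_neg_sum:
  fixes r :: "'n::finite"
  shows "lattice_basis ((\<lambda>j. axis j 1)(r := - (\<Sum>j\<in>UNIV. axis j 1)))"
  unfolding lattice_basis_def
proof
  fix v :: "int ^ 'n"
  let ?F = "(\<lambda>j. axis j 1 :: int ^ 'n)(r := - (\<Sum>j\<in>UNIV. axis j 1))"
  \<comment> \<open>The new vector enters with coefficient \<open>- v $ r\<close> and contributes
    \<open>v $ r\<close> to every coordinate, which the other coefficients take off again.\<close>
  let ?c = "\<lambda>j. if j = r then - v $ r else v $ j - v $ r"
  have "(\<Sum>j\<in>UNIV. ?c j * ?F j $ i) = v $ i" for i
  proof -
    have "(\<Sum>j\<in>UNIV. ?c j * ?F j $ i) = ?c r * ?F r $ i + (\<Sum>j\<in>UNIV - {r}. ?c j * ?F j $ i)"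
      by (rule sum.remove) auto
    also have "(\<Sum>j\<in>UNIV - {r}. ?c j * ?F j $ i) = (\<Sum>j\<in>UNIV - {r}. if i = j then v $ i - v $ r else 0)"
      by (rule sum.cong) (auto simp: axis_def)
    also have "\<dots> = (if i = r then 0 else v $ i - v $ r)"
      by (simp add: sum.delta)
    also have "?c r * ?F r $ i = v $ r"
      by (simp add: sum_component axis_def)
    finally show ?thesis by auto
  qed
  then show "\<exists>c. v = (\<Sum>j\<in>UNIV. c j *s ?F j)"
    by (intro exI[of _ ?c]) (simp only: vec_eq_iff sum_component vector_smult_component, simp)
qed

lemma lattice_basis_uminus:
  assumes "lattice_basis F" shows "lattice_basis (F(a := - F a))"
  unfolding lattice_basis_def
proof
  fix v
  obtain c where c: "v = (\<Sum>j\<in>UNIV. c j *s F j)" using assms by (auto simp: lattice_basis_def)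
  have "v = (\<Sum>j\<in>UNIV. (c(a := - c a)) j *s (F(a := - F a)) j)"
    unfolding c by (rule sum.cong) (auto simp: vec_eq_iff)
  then show "\<exists>c. v = (\<Sum>j\<in>UNIV. c j *s (F(a := - F a)) j)" by blast
qed

text \<open>A shear: the coefficient of \<open>F a\<close> absorbs the multiple that is added to
  \<open>F b\<close>.\<close>

lemma lattice_basis_add:
  assumes "lattice_basis F" "a \<noteq> b" shows "lattice_basis (F(b := F b + y *s F a))"
  unfolding lattice_basis_def
proof
  fix v
  obtain c where c: "v = (\<Sum>j\<in>UNIV. c j *s F j)" using assms by (auto simp: lattice_basis_def)
  let ?c = "c(a := c a - y * c b)" and ?F = "F(b := F b + y *s F a)"
  have rem: "sum f UNIV = f a + (f b + sum f (UNIV - {a} - {b}))" for f :: "'a \<Rightarrow> int ^ 'a"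
    using assms(2) sum.remove[of UNIV a f] sum.remove[of "UNIV - {a}" b f] by auto
  have "(\<Sum>j\<in>UNIV. ?c j *s ?F j) = ?c a *s ?F a + (?c b *s ?F b + (\<Sum>j\<in>UNIV-{a}-{b}. ?c j *s ?F j))"
    by (rule rem)
  also have "(\<Sum>j\<in>UNIV-{a}-{b}. ?c j *s ?F j) = (\<Sum>j\<in>UNIV-{a}-{b}. c j *s F j)"
    by (rule sum.cong) auto
  also have "?c a *s ?F a + (?c b *s ?F b + (\<Sum>j\<in>UNIV-{a}-{b}. c j *s F j))
     = c a *s F a + (c b *s F b + (\<Sum>j\<in>UNIV-{a}-{b}. c j *s F j))"
    using assms(2) by (simp add: vec_eq_iff algebra_simps)
  also have "\<dots> = v"
    unfolding c by (rule rem[symmetric])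
  finally show "\<exists>c. v = (\<Sum>j\<in>UNIV. c j *s ?F j)" by metis
qed

text \<open>The rows of the inverse matrix form the dual basis. They are integral functionals
  reading off coordinates, with which many independence and uniqueness arguments test.\<close>

lemma lattice_basis_dual:
  assumes "lattice_basis F"
  obtains \<beta> :: "'n::finite \<Rightarrow> int ^ 'n" where
    "\<And>j k. (\<Sum>i\<in>UNIV. \<beta> j $ i * F k $ i) = (if j = k then 1 else 0)"
    "\<And>j k. real_vec (\<beta> j) \<bullet> real_vec (F k) = (if j = k then 1 else 0)"
proof -
  obtain B where B: "B ** basis_matrix F = mat 1" using basis_matrix_invertible[OF assms] by metis
  have *: "(\<Sum>i\<in>UNIV. B $ j $ i * F k $ i) = (if j = k then 1 else 0)" for j k
    using arg_cong[OF B, of "\<lambda>M. M $ j $ k"]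
    by (simp add: basis_matrix_def matrix_matrix_mult_def mat_def)
  have "real_vec (B $ j) \<bullet> real_vec (F k) = real_of_int (\<Sum>i\<in>UNIV. B $ j $ i * F k $ i)" for j k
    by (simp add: real_vec_def inner_vec_def)
  with * show thesis by (intro that[of "\<lambda>j. B $ j"]) auto
qed

text \<open>The gcd of the coordinates divides every value of an integral functional, and the dual
  vector takes the value one.\<close>

lemma lattice_basis_primitive:
  assumes "lattice_basis F" shows "primitive_vec (F j)"
proof -
  obtain \<beta> where \<beta>: "\<And>j k. (\<Sum>i\<in>UNIV. \<beta> j $ i * F k $ i) = (if j = k then 1 else 0)"
    using lattice_basis_dual[OF assms] by metis
  have "Gcd (range (\<lambda>i. F j $ i)) dvd (\<Sum>i\<in>UNIV. \<beta> j $ i * F j $ i)"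
    by (intro dvd_sum dvd_mult Gcd_dvd) auto
  then have "Gcd (range (\<lambda>i. F j $ i)) dvd 1" using \<beta>[of j j] by simp
  then show ?thesis by (simp add: primitive_vec_def)
qed

text \<open>The description operator needs uniqueness. If \<open>p - q\<close> is also
  \<open>s\<close> times a primitive \<open>v\<close>, pairing with the dual vector gives
  \<open>t = s * a\<close> with a positive integer \<open>a\<close>; then \<open>v\<close> is
  \<open>a\<close> times \<open>F j\<close>, so \<open>a\<close> divides all its coordinates and
  equals one.\<close>

lemma lattice_length_eq:
  assumes F: "lattice_basis F" and t: "0 < t" and pq: "p - q = t *\<^sub>R real_vec (F j)"
  shows "lattice_length p q = t"
  unfolding lattice_length_def
proof (rule the_equality)
  show "0 < t \<and> (\<exists>v. primitive_vec v \<and> p - q = t *\<^sub>R real_vec v)"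
    using lattice_basis_primitive[OF F] t pq by blast
  fix s assume "0 < s \<and> (\<exists>v. primitive_vec v \<and> p - q = s *\<^sub>R real_vec v)"
  then obtain v where v: "0 < s" "primitive_vec v" "p - q = s *\<^sub>R real_vec v" by blast
  obtain \<beta> where \<beta>: "\<And>j k. real_vec (\<beta> j) \<bullet> real_vec (F k) = (if j = k then 1 else 0)"
    using lattice_basis_dual[OF F] by metis
  define a where "a = (\<Sum>i\<in>UNIV. \<beta> j $ i * v $ i)"
  have ra: "real_of_int a = real_vec (\<beta> j) \<bullet> real_vec v"
    by (simp add: a_def real_vec_def inner_vec_def)
  have "s * real_of_int a = real_vec (\<beta> j) \<bullet> (s *\<^sub>R real_vec v)" using ra by simp
  also have "\<dots> = real_vec (\<beta> j) \<bullet> (t *\<^sub>R real_vec (F j))" using v(3) pq by simp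
  also have "\<dots> = t" using \<beta>[of j j] by simp
  finally have sa: "s * real_of_int a = t" .
  then have "0 < a" using v(1) t by (metis of_int_0_less_iff zero_less_mult_pos)
  have "s *\<^sub>R real_vec v = s *\<^sub>R (real_of_int a *\<^sub>R real_vec (F j))"
    using v(3) pq sa by simp
  then have "real_vec v = real_of_int a *\<^sub>R real_vec (F j)" using v(1) by (metis less_irrefl scaleR_left_imp_eq)
  then have "real_of_int (v $ i) = real_of_int (a * F j $ i)" for i
    by (simp add: real_vec_def vec_eq_iff)
  then have "v $ i = a * F j $ i" for i by (metis of_int_eq_iff)
  then have "a dvd Gcd (range (\<lambda>i. v $ i))" by (intro Gcd_greatest) auto
  then have "a = 1" using v(2) \<open>0 < a\<close> by (simp add: primitive_vec_def)
  then show "s = t" using sa by simp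
qed

section \<open>Families that extend to a lattice basis\<close>

definition unimodular_pair :: "int ^ 'n::finite \<Rightarrow> int ^ 'n \<Rightarrow> bool" where
  "unimodular_pair a b \<longleftrightarrow> (\<exists>F i j. lattice_basis F \<and> i \<noteq> j \<and> F i = a \<and> F j = b)"

definition unimodular_triple :: "int ^ 'n::finite \<Rightarrow> int ^ 'n \<Rightarrow> int ^ 'n \<Rightarrow> bool" where
  "unimodular_triple a b c \<longleftrightarrow>
     (\<exists>F i j k. lattice_basis F \<and> i \<noteq> j \<and> i \<noteq> k \<and> j \<noteq> k \<and> F i = a \<and> F j = b \<and> F k = c)"

lemma unimodular_pair_sym: "unimodular_pair a b \<Longrightarrow> unimodular_pair b a"
  unfolding unimodular_pair_def by metis

lemma unimodular_pair_uminus: "unimodular_pair a b \<Longrightarrow> unimodular_pair (- a) b"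
  unfolding unimodular_pair_def using lattice_basis_uminus by (metis fun_upd_apply)

lemma unimodular_pair_add: "unimodular_pair a b \<Longrightarrow> unimodular_pair a (b + y *s a)"
  unfolding unimodular_pair_def using lattice_basis_add by (metis fun_upd_apply)

lemma unimodular_triple_perm:
  "unimodular_triple a b c \<Longrightarrow> unimodular_triple b a c"
  "unimodular_triple a b c \<Longrightarrow> unimodular_triple a c b"
  unfolding unimodular_triple_def by metis+

lemma unimodular_triple_uminus: "unimodular_triple a b c \<Longrightarrow> unimodular_triple (- a) b c"
  unfolding unimodular_triple_def using lattice_basis_uminus by (metis fun_upd_apply)

lemma unimodular_triple_add: "unimodular_triple a b c \<Longrightarrow> unimodular_triple a (b + y *s c) c"
  unfolding unimodular_triple_def using lattice_basis_add by (metis fun_upd_apply)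

lemma unimodular_triple_pair: "unimodular_triple a b c \<Longrightarrow> unimodular_pair a b"
  unfolding unimodular_triple_def unimodular_pair_def by metis

text \<open>The dual vector of \<open>b\<close> vanishes on \<open>a\<close> and takes the value one
  on \<open>b\<close>.\<close>

lemma unimodular_pair_not_span:
  assumes "unimodular_pair a b" shows "real_vec b \<notin> span {real_vec a}"
proof -
  obtain F i j where F: "lattice_basis F" "i \<noteq> j" "F i = a" "F j = b"
    using assms unfolding unimodular_pair_def by auto
  obtain \<beta> where \<beta>: "\<And>j k. real_vec (\<beta> j) \<bullet> real_vec (F k) = (if j = k then 1 else 0)"
    using lattice_basis_dual[OF F(1)] by metis
  have "real_vec (\<beta> j) \<bullet> real_vec a = 0" "real_vec (\<beta> j) \<bullet> real_vec b = 1"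
    using \<beta>[of j i] \<beta>[of j j] F by auto
  then show ?thesis by (auto simp: span_singleton)
qed

lemma unimodular_triple_not_span:
  assumes "unimodular_triple a b c" shows "real_vec c \<notin> span {real_vec a, real_vec b}"
proof -
  obtain F i j k where F: "lattice_basis F" "i \<noteq> k" "j \<noteq> k" "F i = a" "F j = b" "F k = c"
    using assms unfolding unimodular_triple_def by auto
  obtain \<beta> where \<beta>: "\<And>j k. real_vec (\<beta> j) \<bullet> real_vec (F k) = (if j = k then 1 else 0)"
    using lattice_basis_dual[OF F(1)] by metis
  have 0: "real_vec (\<beta> k) \<bullet> real_vec a = 0" "real_vec (\<beta> k) \<bullet> real_vec b = 0" "real_vec (\<beta> k) \<bullet> real_vec c = 1"
    using \<beta>[of k i] \<beta>[of k j] \<beta>[of k k] F by auto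
  have "span {real_vec a, real_vec b} \<subseteq> {x. real_vec (\<beta> k) \<bullet> x = 0}"
    by (rule span_minimal) (use 0 in \<open>auto simp: subspace_hyperplane\<close>)
  then show ?thesis using 0(3) by auto
qed

section \<open>The rays of the standard model as a cyclic sequence\<close>

definition axis_enum :: "nat \<Rightarrow> 'n::finite" where
  "axis_enum = (SOME h. bij_betw h {..<CARD('n)} UNIV)"

lemma axis_enum_bij: "bij_betw (axis_enum :: nat \<Rightarrow> 'n::finite) {..<CARD('n)} UNIV"
proof -
  have "\<exists>h :: nat \<Rightarrow> 'n. bij_betw h {..<CARD('n)} UNIV"
    using ex_bij_betw_nat_finite[of "UNIV :: 'n set"] by (simp add: atLeast0LessThan)
  then show ?thesis unfolding axis_enum_def by (rule someI_ex)
qed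

text \<open>Ray number \<open>m\<close> of the standard model of full valence, read modulo n + 1;
  the residue n is the diagonal ray. The rays sum to zero and any n of them form a lattice
  basis.\<close>

definition star_dir :: "nat \<Rightarrow> int ^ 'n::finite" where
  "star_dir m = (if m mod Suc CARD('n) < CARD('n) then axis (axis_enum (m mod Suc CARD('n))) 1
     else - (\<Sum>i\<in>UNIV. axis i 1))"

lemma star_dir_mod: "star_dir (m mod Suc CARD('n)) = (star_dir m :: int ^ 'n::finite)"
  by (simp add: star_dir_def)

text \<open>Without the diagonal ray the unit vectors remain; without a unit vector the basis of
  \<open>lattice_basis_neg_sum\<close> remains.\<close>

lemma star_dir_basis:
  assumes "r \<le> CARD('n)"
  obtains F :: "'n::finite \<Rightarrow> int ^ 'n" and \<pi> where "lattice_basis F" "inj_on \<pi> ({..CARD('n)} - {r})"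
    "\<And>i. i \<in> {..CARD('n)} - {r} \<Longrightarrow> F (\<pi> i) = star_dir i"
proof -
  let ?n = "CARD('n)"
  have inj: "inj_on (axis_enum :: nat \<Rightarrow> 'n) {..<?n}" using axis_enum_bij by (auto simp: bij_betw_def)
  show thesis
  proof (cases "r = ?n")
    case True
    have "{..?n} - {r} = {..<?n}" using True by auto
    then show ?thesis
      using inj lattice_basis_axis by (intro that[of "\<lambda>j. axis j 1" axis_enum]) (auto simp: star_dir_def)
  next
    case False
    \<comment> \<open>The diagonal ray takes the coordinate freed by ray \<open>r\<close>.\<close>
    let ?\<pi> = "axis_enum(?n := axis_enum r) :: nat \<Rightarrow> 'n"
    let ?F = "(\<lambda>j. axis j 1 :: int ^ 'n)(axis_enum r := - (\<Sum>j\<in>UNIV. axis j 1))"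
    have ne: "axis_enum i \<noteq> (axis_enum r :: 'n)" if "i < ?n" "i \<noteq> r" for i
      using inj that False assms by (auto simp: inj_on_def)
    show ?thesis
    proof (rule that[of ?F ?\<pi>])
      show "lattice_basis ?F" by (rule lattice_basis_neg_sum)
      show "inj_on ?\<pi> ({..?n} - {r})"
      proof (rule inj_onI)
        fix x y assume "x \<in> {..?n} - {r}" "y \<in> {..?n} - {r}" "?\<pi> x = ?\<pi> y"
        then show "x = y"
          using ne[of x] ne[of y] inj by (auto simp: inj_on_def split: if_splits)
      qed
      show "?F (?\<pi> i) = star_dir i" if "i \<in> {..?n} - {r}" for i
        using that ne[of i] by (auto simp: star_dir_def)
    qed
  qed
qed

text \<open>There are at least three rays, so one can be left out such that the remaining n, a
  basis, still contain both given ones. Triples need a fourth ray, hence dimension three.\<close>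

lemma star_dir_pair:
  assumes "i mod Suc CARD('n) \<noteq> j mod Suc CARD('n)" "2 \<le> CARD('n)"
  shows "unimodular_pair (star_dir i :: int ^ 'n::finite) (star_dir j)"
proof -
  let ?m = "Suc CARD('n)"
  have "card {i mod ?m, j mod ?m} < card {..CARD('n)}"
    using assms(2) by (simp add: card_insert_if)
  then have "\<not> {..CARD('n)} \<subseteq> {i mod ?m, j mod ?m}" using card_mono[of "{i mod ?m, j mod ?m}" "{..CARD('n)}"] by auto
  then obtain r where r: "r \<le> CARD('n)" "r \<noteq> i mod ?m" "r \<noteq> j mod ?m" by auto
  obtain F :: "'n \<Rightarrow> int ^ 'n" and \<pi> where F: "lattice_basis F" "inj_on \<pi> ({..CARD('n)} - {r})"
    "\<And>i. i \<in> {..CARD('n)} - {r} \<Longrightarrow> F (\<pi> i) = star_dir i"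
    using star_dir_basis[OF r(1)] by metis
  have in_i: "i mod ?m \<in> {..CARD('n)} - {r}" "j mod ?m \<in> {..CARD('n)} - {r}"
    using r mod_less_divisor[of ?m i] mod_less_divisor[of ?m j] by (auto simp: less_Suc_eq_le)
  have "\<pi> (i mod ?m) \<noteq> \<pi> (j mod ?m)" using F(2) in_i assms(1) by (auto simp: inj_on_def)
  then show ?thesis unfolding unimodular_pair_def
    using F(1) F(3)[OF in_i(1)] F(3)[OF in_i(2)] by (metis star_dir_mod)
qed

lemma star_dir_triple:
  assumes "i mod Suc CARD('n) \<noteq> j mod Suc CARD('n)" "i mod Suc CARD('n) \<noteq> k mod Suc CARD('n)"
    "j mod Suc CARD('n) \<noteq> k mod Suc CARD('n)" "3 \<le> CARD('n)"
  shows "unimodular_triple (star_dir i :: int ^ 'n::finite) (star_dir j) (star_dir k)"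
proof -
  let ?m = "Suc CARD('n)"
  have "card {i mod ?m, j mod ?m, k mod ?m} < card {..CARD('n)}"
    using assms(4) by (simp add: card_insert_if)
  then have "\<not> {..CARD('n)} \<subseteq> {i mod ?m, j mod ?m, k mod ?m}"
    using card_mono[of "{i mod ?m, j mod ?m, k mod ?m}" "{..CARD('n)}"] by auto
  then obtain r where r: "r \<le> CARD('n)" "r \<noteq> i mod ?m" "r \<noteq> j mod ?m" "r \<noteq> k mod ?m" by auto
  obtain F :: "'n \<Rightarrow> int ^ 'n" and \<pi> where F: "lattice_basis F" "inj_on \<pi> ({..CARD('n)} - {r})"
    "\<And>i. i \<in> {..CARD('n)} - {r} \<Longrightarrow> F (\<pi> i) = star_dir i"
    using star_dir_basis[OF r(1)] by metis
  have in_i: "i mod ?m \<in> {..CARD('n)} - {r}" "j mod ?m \<in> {..CARD('n)} - {r}" "k mod ?m \<in> {..CARD('n)} - {r}"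
    using r mod_less_divisor[of ?m i] mod_less_divisor[of ?m j] mod_less_divisor[of ?m k]
    by (auto simp: less_Suc_eq_le)
  have "\<pi> (i mod ?m) \<noteq> \<pi> (j mod ?m)" "\<pi> (i mod ?m) \<noteq> \<pi> (k mod ?m)" "\<pi> (j mod ?m) \<noteq> \<pi> (k mod ?m)"
    using F(2) in_i assms(1-3) by (auto simp: inj_on_def)
  then show ?thesis unfolding unimodular_triple_def
    using F(1) F(3)[OF in_i(1)] F(3)[OF in_i(2)] F(3)[OF in_i(3)] by (metis star_dir_mod)
qed

text \<open>A window of \<open>m\<close> consecutive indices meets every residue once; shifting it
  by one trades an index for another of the same residue.\<close>

lemma sum_consecutive_mod:
  fixes f :: "nat \<Rightarrow> 'a::comm_monoid_add"
  assumes "0 < m"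
  shows "(\<Sum>l\<in>{s..<s+m}. f (l mod m)) = (\<Sum>i<m. f i)"
proof (induction s)
  case 0
  show ?case by (simp add: atLeast0LessThan)
next
  case (Suc s)
  have "(\<Sum>l\<in>{Suc s..<Suc s+m}. f (l mod m)) = (\<Sum>l\<in>{Suc s..<s+m}. f (l mod m)) + f ((s+m) mod m)"
    using assms by simp
  also have "\<dots> = (\<Sum>l\<in>{s..<s+m}. f (l mod m))"
    using assms sum.atLeast_Suc_lessThan[of s "s+m" "\<lambda>l. f (l mod m)"] by (simp add: add.commute)
  finally show ?case using Suc by simp
qed

text \<open>The coordinates of \<open>x\<close> serve as coefficients of the unit vectors. As the
  rays sum to zero, adding one number to all coefficients leaves the endpoint alone; it is chosen to
  bring the total length to \<sigma>.\<close>

lemma sum_star_dir: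
  fixes \<sigma> :: real and x :: "real ^ 'n::finite"
  defines "\<rho> \<equiv> \<lambda>i. (if i < CARD('n) then x $ axis_enum i else 0) + (\<sigma> - (\<Sum>i\<in>UNIV. x $ i)) / Suc CARD('n)"
  shows "(\<Sum>l\<in>{s..<s + Suc CARD('n)}. \<rho> (l mod Suc CARD('n)) *\<^sub>R real_vec (star_dir l)) = x"
    and "(\<Sum>l\<in>{s..<s + Suc CARD('n)}. \<rho> (l mod Suc CARD('n))) = \<sigma>"
proof -
  let ?n = "CARD('n)" and ?\<tau> = "(\<sigma> - (\<Sum>i\<in>UNIV. x $ i)) / Suc CARD('n)"
  have re: "(\<Sum>i<?n. g (axis_enum i)) = (\<Sum>j\<in>UNIV. g j)" for g :: "'n \<Rightarrow> 'b::comm_monoid_add"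
    by (rule sum.reindex_bij_betw[OF axis_enum_bij])
  have "(\<Sum>l\<in>{s..<s + Suc ?n}. \<rho> (l mod Suc ?n) *\<^sub>R real_vec (star_dir l)) =
     (\<Sum>i<Suc ?n. \<rho> i *\<^sub>R real_vec (star_dir i :: int ^ 'n))"
    using sum_consecutive_mod[of "Suc ?n" "\<lambda>i. \<rho> i *\<^sub>R real_vec (star_dir i :: int ^ 'n)" s]
    by (simp add: star_dir_mod)
  also have "\<dots> = (\<Sum>i<?n. (x $ axis_enum i + ?\<tau>) *\<^sub>R axis (axis_enum i) 1) - ?\<tau> *\<^sub>R (\<Sum>j\<in>UNIV. axis j 1)"
    by (simp add: \<rho>_def star_dir_def real_vec_sum)
  also have "(\<Sum>i<?n. (x $ axis_enum i + ?\<tau>) *\<^sub>R axis (axis_enum i) 1) =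
      (\<Sum>j\<in>UNIV. (x $ j + ?\<tau>) *\<^sub>R (axis j 1 :: real ^ 'n))"
    by (rule re)
  also have "\<dots> - ?\<tau> *\<^sub>R (\<Sum>j\<in>UNIV. axis j 1) = (\<Sum>j\<in>UNIV. x $ j *\<^sub>R axis j 1)"
    by (simp add: scaleR_left_distrib sum.distrib scaleR_sum_right)
  also have "\<dots> = x"
    using basis_expansion[of x] by (simp add: scalar_mult_eq_scaleR)
  finally show "(\<Sum>l\<in>{s..<s + Suc ?n}. \<rho> (l mod Suc ?n) *\<^sub>R real_vec (star_dir l)) = x" .
  have "(\<Sum>l\<in>{s..<s + Suc ?n}. \<rho> (l mod Suc ?n)) = (\<Sum>i<Suc ?n. \<rho> i)"
    by (rule sum_consecutive_mod) simp
  also have "\<dots> = (\<Sum>i<?n. x $ axis_enum i) + Suc ?n * ?\<tau>"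
    by (simp add: \<rho>_def sum.distrib algebra_simps)
  also have "\<dots> = \<sigma>" unfolding re by simp
  finally show "(\<Sum>l\<in>{s..<s + Suc ?n}. \<rho> (l mod Suc ?n)) = \<sigma>" .
qed

text \<open>Origin of the constant 2n + 1: if every coordinate of \<open>x\<close> is below \<sigma>
  / (2n + 1) in absolute value, the common shift is at least (\<sigma> - n \<sigma> / (2n + 1)) / (n
  + 1), which is again \<sigma> / (2n + 1) and outweighs every negative coordinate.\<close>

lemma star_dir_solve:
  fixes x :: "real ^ 'n::finite"
  shows "\<exists>r. (\<Sum>l\<in>{s..<s + Suc CARD('n)}. r l *\<^sub>R real_vec (star_dir l)) = x \<and>
    (\<Sum>l\<in>{s..<s + Suc CARD('n)}. r l) = \<sigma> \<and>
    ((\<forall>i. real (2 * CARD('n) + 1) * \<bar>x $ i\<bar> < \<sigma>) \<longrightarrow> (\<forall>l. 0 < r l))"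
proof -
  let ?n = "CARD('n)"
  let ?\<rho> = "\<lambda>i. (if i < ?n then x $ axis_enum i else 0) + (\<sigma> - (\<Sum>i\<in>UNIV. x $ i)) / Suc ?n"
  have pos: "0 < ?\<rho> i" if *: "\<And>i. real (2 * ?n + 1) * \<bar>x $ i\<bar> < \<sigma>" for i
  proof -
    define y where "y = (if i < ?n then x $ axis_enum i else 0)"
    have s0: "0 \<le> \<sigma>"
      using *[of undefined] by (smt (verit) mult_nonneg_nonneg of_nat_0_le_iff)
    have b: "\<bar>x $ j\<bar> \<le> \<sigma> / (2 * ?n + 1)" for j
      using *[of j] by (simp add: field_simps)
    have "(\<Sum>j\<in>UNIV. x $ j) \<le> (\<Sum>j\<in>(UNIV :: 'n set). \<sigma> / (2 * ?n + 1))"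
      by (rule sum_mono) (use b abs_le_D1 in blast)
    then have S: "(\<Sum>j\<in>UNIV. x $ j) \<le> ?n * (\<sigma> / (2 * ?n + 1))" by simp
    have pos': "0 < \<sigma>" using *[of undefined] s0
      by (smt (verit) mult_nonneg_nonneg of_nat_0_le_iff abs_ge_zero)
    have "- y < \<sigma> / (2 * ?n + 1)"
    proof (cases "i < ?n")
      case True
      then show ?thesis using *[of "axis_enum i"] unfolding y_def by (simp add: field_simps) (smt (verit) mult_left_mono mult_minus_right of_nat_0_le_iff)
    next
      case False
      then show ?thesis using pos' by (simp add: y_def)
    qed
    then have "- y * Suc ?n < \<sigma> / (2 * ?n + 1) * Suc ?n" by (intro mult_strict_right_mono) auto
    also have "\<dots> = \<sigma> - ?n * (\<sigma> / (2 * ?n + 1))" by (simp add: field_simps)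
    also have "\<dots> \<le> \<sigma> - (\<Sum>j\<in>UNIV. x $ j)" using S by simp
    finally have "0 < (y * Suc ?n + (\<sigma> - (\<Sum>j\<in>UNIV. x $ j))) / Suc ?n" by (simp add: algebra_simps)
    then have "0 < y + (\<sigma> - (\<Sum>j\<in>UNIV. x $ j)) / Suc ?n" by (simp add: add_divide_distrib)
    then show ?thesis by (simp add: y_def)
  qed
  show ?thesis
    by (rule exI[of _ "\<lambda>l. ?\<rho> (l mod Suc ?n)"]) (use sum_star_dir[of x \<sigma> s] pos in auto)
qed

section \<open>Pieces in general position\<close>

fun base :: "'n::finite piece \<Rightarrow> real ^ 'n" where
  "base (Segment p q) = p"
| "base (Ray p v) = p"

fun direction :: "'n::finite piece \<Rightarrow> real ^ 'n" where
  "direction (Segment p q) = q - p"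
| "direction (Ray p v) = v"

text \<open>The direction in which the piece leaves \<open>x\<close>; the value is meaningful only
  when \<open>x\<close> is an endpoint.\<close>

fun outward :: "real ^ 'n \<Rightarrow> 'n::finite piece \<Rightarrow> real ^ 'n" where
  "outward x (Segment p q) = (if x = p then q - p else p - q)"
| "outward x (Ray p v) = v"

text \<open>Incidences are controlled on whole lines: truncating a ray does not change its line, and
  meeting a line is an affine condition.\<close>

definition line :: "'n::finite piece \<Rightarrow> (real ^ 'n) set" where
  "line a = range (\<lambda>s. base a + s *\<^sub>R direction a)"

text \<open>These are the vertices of the configuration, not nodes in the sense of
  \<open>node\<close>; in the plane \<open>not_node_at_node\<close> separates the two
  notions.\<close>

definition nodes_of :: "'n::finite piece set \<Rightarrow> (real ^ 'n) set" where
  "nodes_of D = (\<Union>a\<in>D. endpoints a)"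

definition star_set :: "('n::finite \<Rightarrow> int ^ 'n) \<Rightarrow> 'n set \<Rightarrow> (int ^ 'n) set" where
  "star_set F I = insert (- (\<Sum>i\<in>I. F i)) (F ` I)"

text \<open>The pieces ending at \<open>x\<close> realise all rays of a standard smooth model of valence \<open>card I + 1\<close>,
  and nothing else.\<close>

definition star_at :: "'n::finite piece set \<Rightarrow> real ^ 'n \<Rightarrow> bool" where
  "star_at D x \<longleftrightarrow> (\<exists>F I. lattice_basis F \<and> 2 \<le> card I \<and>
     (\<forall>a\<in>D. x \<in> endpoints a \<longrightarrow> (\<exists>u\<in>star_set F I. \<exists>t>0. outward x a = t *\<^sub>R real_vec u)) \<and>
     (\<forall>u\<in>star_set F I. \<exists>a\<in>D. x \<in> endpoints a \<and> (\<exists>t>0. outward x a = t *\<^sub>R real_vec u)))"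

definition lattice_direction :: "'n::finite piece \<Rightarrow> bool" where
  "lattice_direction a \<longleftrightarrow> (\<exists>F j t. lattice_basis F \<and> 0 < t \<and> direction a = t *\<^sub>R real_vec (F j))"

text \<open>One notion serves both halves of the theorem. Crossings of two lines away from the
  vertices are tolerated in the plane, where they become nodes, and forbidden by the last clause
  from dimension three on. Concurrent triples are excluded because they match no local
  model.\<close>

definition general_position :: "'n::finite piece set \<Rightarrow> bool" where
  "general_position D \<longleftrightarrow>
     finite D \<and> (\<forall>a\<in>D. nondegenerate a \<and> lattice_direction a) \<and> (\<forall>x\<in>nodes_of D. star_at D x) \<and>
     (\<forall>x\<in>nodes_of D. \<forall>a\<in>D. x \<in> line a \<longrightarrow> x \<in> endpoints a) \<and>
     (\<forall>a\<in>D. \<forall>b\<in>D. a \<noteq> b \<longrightarrow> endpoints a \<inter> endpoints b \<noteq> {} \<longrightarrow> direction b \<notin> span {direction a}) \<and>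
     (\<forall>a\<in>D. \<forall>b\<in>D. \<forall>c\<in>D. a \<noteq> b \<longrightarrow> a \<noteq> c \<longrightarrow> b \<noteq> c \<longrightarrow> line a \<inter> line b \<inter> line c \<subseteq> nodes_of D) \<and>
     (3 \<le> CARD('n) \<longrightarrow> (\<forall>a\<in>D. \<forall>b\<in>D. a \<noteq> b \<longrightarrow> line a \<inter> line b \<subseteq> nodes_of D))"

lemma general_positionD:
  fixes D :: "'n::finite piece set"
  assumes "general_position D"
  shows "finite D" "\<And>a. a \<in> D \<Longrightarrow> nondegenerate a" "\<And>a. a \<in> D \<Longrightarrow> lattice_direction a"
    "\<And>x. x \<in> nodes_of D \<Longrightarrow> star_at D x"
    "\<And>x a. x \<in> nodes_of D \<Longrightarrow> a \<in> D \<Longrightarrow> x \<in> line a \<Longrightarrow> x \<in> endpoints a"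
    "\<And>a b x. a \<in> D \<Longrightarrow> b \<in> D \<Longrightarrow> a \<noteq> b \<Longrightarrow> x \<in> endpoints a \<Longrightarrow> x \<in> endpoints b \<Longrightarrow>
       direction b \<notin> span {direction a}"
    "\<And>a b c z. a \<in> D \<Longrightarrow> b \<in> D \<Longrightarrow> c \<in> D \<Longrightarrow> a \<noteq> b \<Longrightarrow> a \<noteq> c \<Longrightarrow> b \<noteq> c \<Longrightarrow>
       z \<in> line a \<Longrightarrow> z \<in> line b \<Longrightarrow> z \<in> line c \<Longrightarrow> z \<in> nodes_of D"
    "\<And>a b z. 3 \<le> CARD('n) \<Longrightarrow> a \<in> D \<Longrightarrow> b \<in> D \<Longrightarrow> a \<noteq> b \<Longrightarrow> z \<in> line a \<Longrightarrow> z \<in> line b \<Longrightarrow> z \<in> nodes_of D"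
proof -
  note * = assms[unfolded general_position_def]
  show "finite D" using * by (elim conjE)
  show "nondegenerate a" "lattice_direction a" if "a \<in> D" for a using * that by (elim conjE, simp)+
  show "star_at D x" if "x \<in> nodes_of D" for x using * that by (elim conjE, simp)
  have 5: "\<forall>x\<in>nodes_of D. \<forall>a\<in>D. x \<in> line a \<longrightarrow> x \<in> endpoints a" using * by (elim conjE)
  have 6: "\<forall>a\<in>D. \<forall>b\<in>D. a \<noteq> b \<longrightarrow> endpoints a \<inter> endpoints b \<noteq> {} \<longrightarrow> direction b \<notin> span {direction a}"
    using * by (elim conjE)
  have 7: "\<forall>a\<in>D. \<forall>b\<in>D. \<forall>c\<in>D. a \<noteq> b \<longrightarrow> a \<noteq> c \<longrightarrow> b \<noteq> c \<longrightarrow> line a \<inter> line b \<inter> line c \<subseteq> nodes_of D"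
    using * by (elim conjE)
  have 8: "3 \<le> CARD('n) \<longrightarrow> (\<forall>a\<in>D. \<forall>b\<in>D. a \<noteq> b \<longrightarrow> line a \<inter> line b \<subseteq> nodes_of D)"
    using * by (elim conjE)
  show "x \<in> endpoints a" if "x \<in> nodes_of D" "a \<in> D" "x \<in> line a" for x a
    using 5 that by simp
  show "direction b \<notin> span {direction a}"
    if "a \<in> D" "b \<in> D" "a \<noteq> b" "x \<in> endpoints a" "x \<in> endpoints b" for a b x
    using bspec[OF bspec[OF 6 that(1)] that(2)] that(3-5) by auto
  show "z \<in> nodes_of D" if "a \<in> D" "b \<in> D" "c \<in> D" "a \<noteq> b" "a \<noteq> c" "b \<noteq> c"
    "z \<in> line a" "z \<in> line b" "z \<in> line c" for a b c z
    using bspec[OF bspec[OF bspec[OF 7 that(1)] that(2)] that(3)] that(4-9) by auto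
  show "z \<in> nodes_of D" if "3 \<le> CARD('n)" "a \<in> D" "b \<in> D" "a \<noteq> b" "z \<in> line a" "z \<in> line b" for a b z
    using bspec[OF bspec[OF mp[OF 8 that(1)] that(2)] that(3)] that(4-6) by auto
qed

lemma direction_nonzero: "nondegenerate a \<Longrightarrow> direction a \<noteq> 0"
  by (cases a) auto

lemma carrier_subset_line: "carrier a \<subseteq> line a"
proof (cases a)
  case (Segment p q)
  then show ?thesis by (auto simp: line_def closed_segment_def algebra_simps intro!: image_eqI)
next
  case (Ray p v)
  then show ?thesis by (auto simp: line_def ray_def)
qed

lemma endpoints_subset_carrier: "endpoints a \<subseteq> carrier a"
proof (cases a)
  case (Ray p v)
  then show ?thesis by (auto simp: ray_def intro!: exI[of _ 0])
qed auto

lemma line_eq: "x \<in> line a \<Longrightarrow> line a = range (\<lambda>s. x + s *\<^sub>R direction a)"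
proof -
  assume "x \<in> line a"
  then obtain t where t: "x = base a + t *\<^sub>R direction a" by (auto simp: line_def)
  show ?thesis
  proof (rule set_eqI)
    fix y
    have "y = base a + s *\<^sub>R direction a \<longleftrightarrow> y = x + (s - t) *\<^sub>R direction a" for s
      by (simp add: t algebra_simps)
    then have "(\<exists>s. y = base a + s *\<^sub>R direction a) \<longleftrightarrow> (\<exists>s. y = x + s *\<^sub>R direction a)"
      by (metis add_diff_cancel_right')
    then show "y \<in> line a \<longleftrightarrow> y \<in> range (\<lambda>s. x + s *\<^sub>R direction a)"
      by (auto simp: line_def image_iff)
  qed
qed

lemma line_span: "x \<in> line a \<Longrightarrow> y \<in> line a \<longleftrightarrow> y - x \<in> span {direction a}"
  by (subst line_eq[of x a]) (auto simp: span_singleton image_iff algebra_simps)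

lemma line_unique:
  assumes "x \<in> line a" "x \<in> line b" "y \<in> line a" "y \<in> line b" "direction b \<notin> span {direction a}"
  shows "x = y"
proof (rule ccontr)
  assume "x \<noteq> y"
  have "y - x \<in> span {direction a}" "y - x \<in> span {direction b}"
    using assms line_span by blast+
  then obtain s t where "y - x = s *\<^sub>R direction a" "y - x = t *\<^sub>R direction b"
    by (auto simp: span_singleton)
  moreover then have "t \<noteq> 0" using \<open>x \<noteq> y\<close> by auto
  ultimately have "direction b = (s / t) *\<^sub>R direction a"
    by (metis (no_types, lifting) divide_inverse_commute real_vector.scale_scale scaleR_left.add vector_fraction_eq_iff)
  then show False using assms(5) by (auto simp: span_singleton)
qed

text \<open>Identifies the second argument of \<open>Branch\<close> with \<open>line\<close>, so
  that both halves of a cut piece receive the same branch vertex.\<close>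

lemma line_affine_hull:
  assumes "nondegenerate a" shows "affine hull (carrier a) = line a"
proof (rule hull_unique)
  show "carrier a \<subseteq> line a" by (rule carrier_subset_line)
  show "affine (line a)"
    unfolding affine_def
  proof (intro ballI allI impI)
    fix x y and u v :: real assume "x \<in> line a" "y \<in> line a" "u + v = 1"
    then obtain s t where "x = base a + s *\<^sub>R direction a" "y = base a + t *\<^sub>R direction a"
      by (auto simp: line_def)
    then have "u *\<^sub>R x + v *\<^sub>R y = (u + v) *\<^sub>R base a + (u * s + v * t) *\<^sub>R direction a"
      by (simp add: algebra_simps)
    then show "u *\<^sub>R x + v *\<^sub>R y \<in> line a" using \<open>u + v = 1\<close> by (auto simp: line_def)
  qed
  fix T assume T: "carrier a \<subseteq> T" "affine T"
  have "base a \<in> carrier a" "base a + direction a \<in> carrier a"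
    by (cases a; force simp: ray_def intro: exI[of _ 0] exI[of _ 1])+
  then have 1: "base a \<in> T" "base a + direction a \<in> T" using T by auto
  show "line a \<subseteq> T"
  proof
    fix y assume "y \<in> line a"
    then obtain s where "y = base a + s *\<^sub>R direction a" by (auto simp: line_def)
    then have "y = (1 - s) *\<^sub>R base a + s *\<^sub>R (base a + direction a)" by (simp add: algebra_simps)
    then show "y \<in> T" using T(2) 1 unfolding affine_def by (metis diff_add_cancel)
  qed
qed

lemma closed_ray: "v \<noteq> 0 \<Longrightarrow> closed (ray p (v :: real ^ 'n))"
proof -
  assume "v \<noteq> 0"
  then have "closed ((\<lambda>t. t *\<^sub>R v) ` {0::real..})"
    by (intro closed_injective_linear_image) (auto simp: inj_on_def intro: linearI algebra_simps)
  then have "closed ((+) p ` ((\<lambda>t. t *\<^sub>R v) ` {0::real..}))" by (rule closed_translation)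
  moreover have "(+) p ` ((\<lambda>t. t *\<^sub>R v) ` {0::real..}) = ray p v" by (auto simp: ray_def)
  ultimately show ?thesis by simp
qed

lemma closed_carrier: "nondegenerate a \<Longrightarrow> closed (carrier a)"
  by (cases a) (auto simp: closed_ray)

lemma ray_scale:
  assumes "0 < t" shows "ray x (t *\<^sub>R w) = ray x w"
proof -
  have "x + s *\<^sub>R w = x + (s / t) *\<^sub>R (t *\<^sub>R w)" "x + s *\<^sub>R (t *\<^sub>R w) = x + (s * t) *\<^sub>R w" for s
    using assms by auto
  then show ?thesis unfolding ray_def using assms
    by (metis (no_types, opaque_lifting) divide_nonneg_pos less_imp_le mult_nonneg_nonneg)
qed

section \<open>Local shape of one piece and of a finite union\<close>

definition germ :: "real ^ 'n \<Rightarrow> 'n::finite piece \<Rightarrow> (real ^ 'n) set" where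
  "germ x a = (if x \<in> endpoints a then ray x (outward x a) else if x \<in> carrier a then line a else {})"

text \<open>The germ is the tangent cone. A suitable radius is the length of a segment at one of its
  ends, the distance to the nearest end at an interior point, and that of a ball missing the closed
  carrier elsewhere. All smaller radii are included so that several pieces can be combined.\<close>

lemma carrier_germ:
  assumes a: "nondegenerate a"
  obtains e where "0 < e" "\<And>d. d \<le> e \<Longrightarrow> carrier a \<inter> ball x d = germ x a \<inter> ball x d"
proof -
  have "\<exists>e>0. \<forall>y. dist x y < e \<longrightarrow> (y \<in> carrier a \<longleftrightarrow> y \<in> germ x a)"
  proof (cases "x \<in> carrier a")
    case False
    then have "open (- carrier a)" "x \<in> - carrier a" using closed_carrier[OF a] by auto
    then obtain e where "e > 0" "ball x e \<subseteq> - carrier a" using open_contains_ball by blast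
    then show ?thesis using False endpoints_subset_carrier[of a] by (auto simp: germ_def intro!: exI[of _ e])
  next
    case True
    show ?thesis
    proof (cases a)
      case (Segment p q)
      then have pq: "p \<noteq> q" using a by simp
      have seg: "y \<in> carrier a \<longleftrightarrow> (\<exists>t. y = p + t *\<^sub>R (q - p) \<and> 0 \<le> t \<and> t \<le> 1)" for y
        using Segment by (auto simp: closed_segment_def algebra_simps)
      obtain s where s: "x = p + s *\<^sub>R (q - p)" "0 \<le> s" "s \<le> 1" using True seg by auto
      have d: "dist x (p + t *\<^sub>R (q - p)) = \<bar>t - s\<bar> * norm (q - p)" for t
      proof -
        have "p + t *\<^sub>R (q - p) - x = (t - s) *\<^sub>R (q - p)" by (simp add: s(1) algebra_simps)
        then show ?thesis by (metis dist_commute dist_norm norm_scaleR)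
      qed
      have n: "0 < norm (q - p)" using pq by simp
      consider "x = p" "s = 0" | "x = q" "s = 1" | "0 < s" "s < 1" "x \<noteq> p" "x \<noteq> q"
      proof -
        have "x = q \<longleftrightarrow> s = 1" "x = p \<longleftrightarrow> s = 0"
        proof -
          have "x - q = (s - 1) *\<^sub>R (q - p)" by (simp add: s(1) algebra_simps)
          then show "x = q \<longleftrightarrow> s = 1" using pq by (metis eq_iff_diff_eq_0 scaleR_eq_0_iff)
          show "x = p \<longleftrightarrow> s = 0" using pq by (simp add: s(1))
        qed
        then show thesis using that s by linarith
      qed
      then show ?thesis
      proof cases
        case 1
        have "y \<in> carrier a \<longleftrightarrow> y \<in> germ x a" if y: "dist x y < norm (q - p)" for y
        proof
          assume "y \<in> germ x a"
          then obtain t where t: "y = p + t *\<^sub>R (q - p)" "0 \<le> t"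
            using 1 Segment by (auto simp: germ_def ray_def)
          then have "t * norm (q - p) < 1 * norm (q - p)" using y d[of t] 1 by simp
          then show "y \<in> carrier a" using t n seg by (metis less_imp_le mult_less_cancel_right_pos)
        qed (use 1 Segment seg[of y] in \<open>auto simp: germ_def ray_def\<close>)
        then show ?thesis using n by blast
      next
        case 2
        \<comment> \<open>From the end \<open>q\<close> the segment is run through backwards, with
          parameter \<open>1 - t\<close>.\<close>
        have q: "q + t *\<^sub>R (p - q) = p + (1 - t) *\<^sub>R (q - p)" for t by (simp add: algebra_simps)
        have g: "germ x a = ray q (p - q)" using 2 Segment pq by (auto simp: germ_def)
        have "y \<in> carrier a \<longleftrightarrow> y \<in> germ x a" if y: "dist x y < norm (q - p)" for y
        proof
          assume "y \<in> germ x a"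
          then obtain t where t: "y = p + (1 - t) *\<^sub>R (q - p)" "0 \<le> t"
            unfolding g ray_def q by auto
          then have "t * norm (q - p) < 1 * norm (q - p)" using y d[of "1 - t"] 2 by simp
          then show "y \<in> carrier a" using t n seg by (metis add_increasing2 diff_add_cancel diff_ge_0_iff_ge less_imp_le mult_less_cancel_right_pos diff_le_self le_add_diff_inverse2 diff_le_eq le_add_same_cancel1)
        next
          assume "y \<in> carrier a"
          then obtain t where "y = p + t *\<^sub>R (q - p)" "0 \<le> t" "t \<le> 1" using seg by auto
          then have "y = q + (1 - t) *\<^sub>R (p - q)" "0 \<le> 1 - t" by (auto simp: algebra_simps)
          then show "y \<in> germ x a" unfolding g ray_def by blast
        qed
        then show ?thesis using n by blast
      next
        case 3
        let ?e = "min s (1 - s) * norm (q - p)"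
        have g: "germ x a = line a" using 3 True Segment by (auto simp: germ_def)
        have "y \<in> carrier a \<longleftrightarrow> y \<in> germ x a" if y: "dist x y < ?e" for y
        proof
          assume "y \<in> germ x a"
          then obtain t where t: "y = p + t *\<^sub>R (q - p)" using g Segment by (auto simp: line_def)
          then have "\<bar>t - s\<bar> < min s (1 - s)" using y d[of t] n by simp
          then show "y \<in> carrier a" using t seg by fastforce
        qed (use g carrier_subset_line in blast)
        moreover have "0 < ?e" using 3 n by simp
        ultimately show ?thesis by blast
      qed
    next
      case (Ray p v)
      then have v: "v \<noteq> 0" using a by simp
      obtain s where s: "x = p + s *\<^sub>R v" "0 \<le> s" using True Ray by (auto simp: ray_def)
      show ?thesis
      proof (cases "s = 0")
        case True
        then show ?thesis using s Ray by (auto simp: germ_def intro!: exI[of _ 1])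
      next
        case False
        then have g: "germ x a = line a" using s v Ray True by (auto simp: germ_def)
        have n: "0 < s * norm v" using False s v by simp
        have "y \<in> carrier a \<longleftrightarrow> y \<in> germ x a" if y: "dist x y < s * norm v" for y
        proof
          assume "y \<in> germ x a"
          then obtain t where t: "y = p + t *\<^sub>R v" using g Ray by (auto simp: line_def)
          then have "dist x y = \<bar>s - t\<bar> * norm v"
            by (simp add: s(1) dist_norm scaleR_left_diff_distrib[symmetric])
          then have "\<bar>s - t\<bar> < s" using y v by simp
          then have "0 \<le> t" by linarith
          then show "y \<in> carrier a" using t Ray by (auto simp: ray_def)
        qed (use g carrier_subset_line in blast)
        then show ?thesis using n by blast
      qed
    qed
  qed
  then obtain e where e: "e > 0" "\<And>y. dist x y < e \<Longrightarrow> y \<in> carrier a \<longleftrightarrow> y \<in> germ x a" by blast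
  show thesis by (rule that[OF e(1)]) (use e(2) in \<open>fastforce\<close>)
qed

lemma union_germ:
  assumes "finite D" "\<And>a. a \<in> D \<Longrightarrow> nondegenerate a"
  obtains e where "0 < e" "(\<Union>a\<in>D. carrier a) \<inter> ball x e = (\<Union>a\<in>D. germ x a) \<inter> ball x e"
proof -
  \<comment> \<open>With all smaller radii in the induction hypothesis, the minimum of two radii
    works.\<close>
  have "\<exists>e>0. \<forall>d\<le>e. (\<Union>a\<in>D. carrier a) \<inter> ball x d = (\<Union>a\<in>D. germ x a) \<inter> ball x d"
    using assms
  proof (induction D)
    case empty
    then show ?case by (auto intro: exI[of _ 1])
  next
    case (insert a D)
    then obtain e where e: "e > 0" "\<And>d. d \<le> e \<Longrightarrow> (\<Union>a\<in>D. carrier a) \<inter> ball x d = (\<Union>a\<in>D. germ x a) \<inter> ball x d"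
      by (metis insertI2)
    obtain e' where e': "0 < e'" "\<And>d. d \<le> e' \<Longrightarrow> carrier a \<inter> ball x d = germ x a \<inter> ball x d"
      using carrier_germ[of a x] insert.prems by blast
    show ?case
      by (rule exI[of _ "min e e'"]) (use e e' in \<open>auto simp: Int_Un_distrib2\<close>)
  qed
  then obtain e where "e > 0" "\<forall>d\<le>e. (\<Union>a\<in>D. carrier a) \<inter> ball x d = (\<Union>a\<in>D. germ x a) \<inter> ball x d"
    by (elim exE conjE)
  then show thesis by (intro that[of e]) simp_all
qed

section \<open>Local structure of a union of pieces\<close>

lemma real_mat_axis: "real_mat (basis_matrix F) *v axis j 1 = real_vec (F j)"
  by (simp add: matrix_vector_mult_def vec_eq_iff real_mat_def basis_matrix_def real_vec_def axis_def
      if_distrib[where f = "\<lambda>x. _ * x"] cong: if_cong)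

lemma image_ray_zero: "(\<lambda>y. x + A *v y) ` ray 0 v = ray x (A *v (v :: real ^ 'n))"
  by (auto simp: ray_def image_iff matrix_vector_mult_scaleR) (metis matrix_vector_mult_scaleR)

text \<open>The matrix with columns \<open>F\<close> carries the standard rays to the star and is
  invertible over the integers because \<open>F\<close> is a basis.\<close>

lemma smooth_point_star:
  fixes F :: "'n::finite \<Rightarrow> int ^ 'n"
  assumes F: "lattice_basis F" and I: "1 \<le> card I" and e: "0 < e"
    and C: "C \<inter> ball x e = (\<Union>u\<in>star_set F I. ray x (real_vec u)) \<inter> ball x e"
  shows "smooth_point C x"
proof -
  let ?A = "basis_matrix F"
  let ?M = "(\<Union>i\<in>I. ray 0 (axis i 1)) \<union> ray 0 (- (\<Sum>i\<in>I. axis i 1)) :: (real ^ 'n) set"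
  have "real_mat ?A *v (- (\<Sum>i\<in>I. axis i 1)) = real_vec (- (\<Sum>i\<in>I. F i))"
    by (simp add: vec.neg vec.sum real_mat_axis real_vec_sum)
  then have im: "(\<lambda>y. x + real_mat ?A *v y) ` ?M = (\<Union>u\<in>star_set F I. ray x (real_vec u))"
    by (simp add: image_Un image_UN image_ray_zero real_mat_axis star_set_def Un_commute)
  have "card I \<le> CARD('n)" by (rule card_mono) auto
  then have "standard_smooth_model (card I + 1) ?M"
    using I unfolding standard_smooth_model_def by (intro conjI exI[of _ I]) auto
  moreover have "invertible ?A"
    using basis_matrix_invertible[OF F] unfolding invertible_def by metis
  then have "locally_like C x ?M"
    unfolding locally_like_def by (intro exI[of _ ?A] exI[of _ "ball x e"]) (use C im e in auto)
  ultimately show ?thesis unfolding smooth_point_def by blast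
qed

text \<open>A line is the model of valence two: the star on a single basis vector consists of that
  vector and its negative.\<close>

lemma smooth_point_line:
  fixes F :: "'n::finite \<Rightarrow> int ^ 'n"
  assumes F: "lattice_basis F" and e: "0 < e"
    and C: "C \<inter> ball x e = range (\<lambda>s. x + s *\<^sub>R real_vec (F j)) \<inter> ball x e"
  shows "smooth_point C x"
proof (rule smooth_point_star[OF F _ e])
  show "1 \<le> card {j}" by simp
  have "ray x (real_vec (F j)) \<union> ray x (- real_vec (F j)) = range (\<lambda>s. x + s *\<^sub>R real_vec (F j))"
  proof (intro subset_antisym subsetI)
    fix y assume "y \<in> ray x (real_vec (F j)) \<union> ray x (- real_vec (F j))"
    then obtain s where "y = x + s *\<^sub>R real_vec (F j) \<or> y = x + (- s) *\<^sub>R real_vec (F j)"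
      by (auto simp: ray_def)
    then show "y \<in> range (\<lambda>s. x + s *\<^sub>R real_vec (F j))" by blast
  next
    fix y assume "y \<in> range (\<lambda>s. x + s *\<^sub>R real_vec (F j))"
    then obtain s where s: "y = x + s *\<^sub>R real_vec (F j)" by blast
    show "y \<in> ray x (real_vec (F j)) \<union> ray x (- real_vec (F j))"
    proof (cases "0 \<le> s")
      case True
      then show ?thesis using s by (auto simp: ray_def)
    next
      case False
      then have "y = x + (- s) *\<^sub>R (- real_vec (F j))" "0 \<le> - s" using s by auto
      then show ?thesis unfolding ray_def by blast
    qed
  qed
  then show "C \<inter> ball x e = (\<Union>u\<in>star_set F {j}. ray x (real_vec u)) \<inter> ball x e"
    unfolding C by (simp add: star_set_def Un_commute)
qed

text \<open>By general position a piece passing through a vertex ends there, so only the star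
  contributes germs; a positive factor in \<open>outward\<close> does not change the ray.\<close>

lemma germs_at_node:
  assumes gp: "general_position D" and x: "x \<in> nodes_of D"
  obtains F I e where "lattice_basis F" "2 \<le> card I" "0 < e"
    "(\<Union>a\<in>D. carrier a) \<inter> ball x e = (\<Union>u\<in>star_set F I. ray x (real_vec u)) \<inter> ball x e"
proof -
  note G = general_positionD[OF gp]
  obtain F I where F: "lattice_basis F" "2 \<le> card I"
     "\<And>a. a \<in> D \<Longrightarrow> x \<in> endpoints a \<Longrightarrow> \<exists>u\<in>star_set F I. \<exists>t>0. outward x a = t *\<^sub>R real_vec u"
     "\<And>u. u \<in> star_set F I \<Longrightarrow> \<exists>a\<in>D. x \<in> endpoints a \<and> (\<exists>t>0. outward x a = t *\<^sub>R real_vec u)"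
    using G(4)[OF x] unfolding star_at_def by auto
  obtain e where e: "0 < e" "(\<Union>a\<in>D. carrier a) \<inter> ball x e = (\<Union>a\<in>D. germ x a) \<inter> ball x e"
    using union_germ[OF G(1,2)] by blast
  have "(\<Union>a\<in>D. germ x a) = (\<Union>u\<in>star_set F I. ray x (real_vec u))"
  proof (intro subset_antisym subsetI)
    fix y assume "y \<in> (\<Union>a\<in>D. germ x a)"
    then obtain a where a: "a \<in> D" "y \<in> germ x a" by blast
    have xe: "x \<in> endpoints a"
    proof (rule ccontr)
      assume n: "x \<notin> endpoints a"
      then have "x \<in> carrier a" using a(2) by (auto simp: germ_def split: if_splits)
      then show False using G(5)[OF x a(1)] carrier_subset_line n by blast
    qed
    obtain u t where u: "u \<in> star_set F I" "0 < t" "outward x a = t *\<^sub>R real_vec u" using F(3)[OF a(1) xe] by blast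
    then have "y \<in> ray x (real_vec u)" using a(2) xe by (simp add: germ_def u(3) ray_scale[OF u(2)])
    then show "y \<in> (\<Union>u\<in>star_set F I. ray x (real_vec u))" using u(1) by blast
  next
    fix y assume "y \<in> (\<Union>u\<in>star_set F I. ray x (real_vec u))"
    then obtain u where u: "u \<in> star_set F I" "y \<in> ray x (real_vec u)" by blast
    obtain a t where a: "a \<in> D" "x \<in> endpoints a" "0 < t" "outward x a = t *\<^sub>R real_vec u" using F(4)[OF u(1)] by blast
    then have "y \<in> germ x a" using u(2) by (simp add: germ_def ray_scale)
    then show "y \<in> (\<Union>a\<in>D. germ x a)" using a(1) by blast
  qed
  with F(1,2) e show thesis by (intro that) auto
qed

lemma smooth_at_node:
  assumes "general_position D" "x \<in> nodes_of D"
  shows "smooth_point (\<Union>a\<in>D. carrier a) x"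
proof -
  obtain F I e where *: "lattice_basis F" "2 \<le> card I" "0 < e"
    "(\<Union>a\<in>D. carrier a) \<inter> ball x e = (\<Union>u\<in>star_set F I. ray x (real_vec u)) \<inter> ball x e"
    using germs_at_node[OF assms] .
  then show ?thesis by (intro smooth_point_star[OF *(1) _ *(3,4)]) auto
qed

lemma line_lattice:
  assumes "lattice_direction a" "x \<in> line a"
  obtains F j where "lattice_basis F" "line a = range (\<lambda>s. x + s *\<^sub>R real_vec (F j))"
    "span {direction a} = span {real_vec (F j)}"
proof -
  obtain F j t where F: "lattice_basis F" "0 < t" "direction a = t *\<^sub>R real_vec (F j)"
    using assms(1) unfolding lattice_direction_def by blast
  have sp: "span {direction a} = span {real_vec (F j)}"
    using span_image_scale[of "{real_vec (F j)}" "\<lambda>_. t"] F(2,3) by simp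
  have "line a = (+) x ` span {direction a}"
    using line_eq[OF assms(2)] by (auto simp: span_singleton)
  also have "\<dots> = range (\<lambda>s. x + s *\<^sub>R real_vec (F j))"
    unfolding sp by (auto simp: span_singleton)
  finally have l: "line a = range (\<lambda>s. x + s *\<^sub>R real_vec (F j))" .
  show thesis by (rule that[OF F(1) l sp])
qed

lemma smooth_at_interior:
  assumes gp: "general_position D" and a: "a \<in> D" "x \<in> carrier a" "x \<notin> nodes_of D"
    and un: "\<And>b. b \<in> D \<Longrightarrow> x \<in> carrier b \<Longrightarrow> b = a"
  shows "smooth_point (\<Union>a\<in>D. carrier a) x"
proof -
  note G = general_positionD[OF gp]
  obtain e where e: "0 < e" "(\<Union>a\<in>D. carrier a) \<inter> ball x e = (\<Union>a\<in>D. germ x a) \<inter> ball x e"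
    using union_germ[OF G(1,2)] by blast
  have ne: "x \<notin> endpoints b" if "b \<in> D" for b using a(3) that by (auto simp: nodes_of_def)
  have "germ x b = (if b = a then line a else {})" if "b \<in> D" for b
  proof (cases "b = a")
    case True
    then show ?thesis using ne[OF that] a(2) by (simp add: germ_def)
  next
    case False
    then have "x \<notin> carrier b" using un that by blast
    then show ?thesis using False ne[OF that] by (simp add: germ_def)
  qed
  then have "(\<Union>a\<in>D. germ x a) = line a" using a(1) by auto
  moreover obtain F j where F: "lattice_basis F" "line a = range (\<lambda>s. x + s *\<^sub>R real_vec (F j))"
    using line_lattice[OF G(3)[OF a(1)] subsetD[OF carrier_subset_line a(2)]] .
  ultimately show ?thesis using smooth_point_line[OF F(1) e(1)] e(2) by simp
qed

text \<open>Exclusion of concurrent triples leaves only the two lines near \<open>x\<close>. The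
  identity matrix suffices because the nodal model allows arbitrary distinct rational lines.\<close>

lemma node_at_crossing:
  fixes D :: "2 piece set"
  assumes gp: "general_position D" and ab: "a \<in> D" "b \<in> D" "a \<noteq> b" "x \<in> carrier a" "x \<in> carrier b"
    and x: "x \<notin> nodes_of D" and ind: "direction b \<notin> span {direction a}"
  shows "node (\<Union>a\<in>D. carrier a) x"
proof -
  note G = general_positionD[OF gp]
  obtain e where e: "0 < e" "(\<Union>a\<in>D. carrier a) \<inter> ball x e = (\<Union>a\<in>D. germ x a) \<inter> ball x e"
    using union_germ[OF G(1,2)] by blast
  have ne: "x \<notin> endpoints c" if "c \<in> D" for c using x that by (auto simp: nodes_of_def)
  have only: "c = a \<or> c = b" if "c \<in> D" "x \<in> carrier c" for c
    using G(7)[OF ab(1,2) that(1), of x] ab that x carrier_subset_line by blast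
  have "germ x c = (if c = a then line a else if c = b then line b else {})" if "c \<in> D" for c
  proof (cases "c = a \<or> c = b")
    case True
    then show ?thesis using ne[OF that] ab by (auto simp: germ_def)
  next
    case False
    then have "x \<notin> carrier c" using only that by blast
    then show ?thesis using False ne[OF that] by (simp add: germ_def)
  qed
  then have U: "(\<Union>a\<in>D. germ x a) = line a \<union> line b" using ab by auto
  have xl: "x \<in> line a" "x \<in> line b" using ab carrier_subset_line by blast+
  obtain F i where F: "lattice_basis F" "line a = range (\<lambda>s. x + s *\<^sub>R real_vec (F i))"
      "span {direction a} = span {real_vec (F i)}"
    using line_lattice[OF G(3)[OF ab(1)] xl(1)] .
  obtain F' j where F': "lattice_basis F'" "line b = range (\<lambda>s. x + s *\<^sub>R real_vec (F' j))"
      "span {direction b} = span {real_vec (F' j)}"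
    using line_lattice[OF G(3)[OF ab(2)] xl(2)] .
  let ?M = "span {real_vec (F i)} \<union> span {real_vec (F' j)}"
  have nz: "F i \<noteq> 0" "F' j \<noteq> 0"
    using F(3) F'(3) direction_nonzero[OF G(2)[OF ab(1)]] direction_nonzero[OF G(2)[OF ab(2)]]
      span_base[of "direction a" "{direction a}"] span_base[of "direction b" "{direction b}"]
    by auto
  have "span {real_vec (F i)} \<noteq> span {real_vec (F' j)}"
    using ind F(3) F'(3) span_base[of "direction b" "{direction b}"] by auto
  then have "nodal_model ?M" unfolding nodal_model_def using nz by blast
  moreover have "(\<lambda>y. x + real_mat (mat 1) *v y) ` ?M = line a \<union> line b"
    unfolding F(2) F'(2) by (auto simp: real_mat_one span_singleton image_iff)
  then have "locally_like (\<Union>a\<in>D. carrier a) x ?M"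
    unfolding locally_like_def
    by (intro exI[of _ "mat 1"] exI[of _ "ball x e"]) (use e U in \<open>auto simp: invertible_def\<close>)
  ultimately show ?thesis unfolding node_def by blast
qed

text \<open>The nodal model is centrally symmetric, a star with at least three rays is not.\<close>

lemma not_node_at_node:
  fixes D :: "2 piece set"
  assumes gp: "general_position D" and x: "x \<in> nodes_of D"
  shows "\<not> node (\<Union>a\<in>D. carrier a) x"
proof
  let ?C = "\<Union>a\<in>D. carrier a"
  assume "node ?C x"
  then obtain u v :: "int ^ 2" and A :: "int ^ 2 ^ 2" and U where
    U: "open U" "x \<in> U" "?C \<inter> U = (\<lambda>y. x + real_mat A *v y) ` (span {real_vec u} \<union> span {real_vec v}) \<inter> U"
    unfolding node_def nodal_model_def locally_like_def by blast
  obtain F I e where F: "lattice_basis F" "2 \<le> card I" and e: "0 < e"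
    "?C \<inter> ball x e = (\<Union>u\<in>star_set F I. ray x (real_vec u)) \<inter> ball x e"
    using germs_at_node[OF gp x] .
  obtain e' where e': "0 < e'" "ball x e' \<subseteq> U" using U open_contains_ball by blast
  \<comment> \<open>The reflection of the \<open>i\<close>-th ray will be tested against the dual
    vectors of both \<open>i\<close> and \<open>k\<close>.\<close>
  have "\<exists>i k. i \<in> I \<and> k \<in> I \<and> i \<noteq> k"
    using F(2) by (metis card_2_iff' obtain_subset_with_card_n subsetD)
  then obtain i k where ik: "i \<in> I" "k \<in> I" "i \<noteq> k" by blast
  obtain \<beta> where \<beta>: "\<And>j k. real_vec (\<beta> j) \<bullet> real_vec (F k) = (if j = k then 1 else 0)"
    using lattice_basis_dual[OF F(1)] by metis
  have fin: "finite I" by simp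
  let ?w = "real_vec (F i)"
  have w0: "?w \<noteq> 0" using \<beta>[of i i] by auto
  \<comment> \<open>The displacement has half the smaller radius as its norm, so
    \<open>x + s w\<close> and \<open>x - s w\<close> lie in both balls.\<close>
  define s where "s = min e e' / (2 * norm ?w)"
  have s: "0 < s" using e(1) e'(1) w0 by (simp add: s_def)
  have "s * norm ?w = min e e' / 2" using w0 by (simp add: s_def)
  then have "s * norm ?w < min e e'" using e(1) e'(1) by linarith
  then have b: "x + s *\<^sub>R ?w \<in> ball x e" "x + s *\<^sub>R ?w \<in> ball x e'"
     "x - s *\<^sub>R ?w \<in> ball x e" "x - s *\<^sub>R ?w \<in> ball x e'"
    using s by (auto simp: dist_norm)
  have "x + s *\<^sub>R ?w \<in> ray x ?w" using s by (auto simp: ray_def)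
  then have "x + s *\<^sub>R ?w \<in> ?C" using e(2) b(1) ik(1) by (auto simp: star_set_def)
  then have "x + s *\<^sub>R ?w \<in> (\<lambda>y. x + real_mat A *v y) ` (span {real_vec u} \<union> span {real_vec v})"
    using U(3) b(2) e'(2) by blast
  then obtain y where y: "s *\<^sub>R ?w = real_mat A *v y" "y \<in> span {real_vec u} \<union> span {real_vec v}" by auto
  then have "x - s *\<^sub>R ?w = x + real_mat A *v (- y)" "- y \<in> span {real_vec u} \<union> span {real_vec v}"
    by (auto simp: vec.neg span_neg)
  then have "x - s *\<^sub>R ?w \<in> (\<lambda>y. x + real_mat A *v y) ` (span {real_vec u} \<union> span {real_vec v})"
    by blast
  then have "x - s *\<^sub>R ?w \<in> ?C" using U(3) b(4) e'(2) by blast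
  then obtain u' where u': "u' \<in> star_set F I" "x - s *\<^sub>R ?w \<in> ray x (real_vec u')"
    using e(2) b(3) by blast
  then obtain t where t: "0 \<le> t" "- s *\<^sub>R ?w = t *\<^sub>R real_vec u'"
    by (auto simp: ray_def)
  \<comment> \<open>The reflected point would lie on a ray with negative \<open>i\<close>-th and
    vanishing \<open>k\<close>-th coordinate. Basis rays have no negative coordinate, and on the
    diagonal ray the \<open>k\<close>-th coordinate is negative as well.\<close>
  have 1: "- s = t * (real_vec (\<beta> i) \<bullet> real_vec u')"
    using arg_cong[OF t(2), of "\<lambda>z. real_vec (\<beta> i) \<bullet> z"] \<beta>[of i i] by simp
  have 2: "0 = t * (real_vec (\<beta> k) \<bullet> real_vec u')"
    using arg_cong[OF t(2), of "\<lambda>z. real_vec (\<beta> k) \<bullet> z"] \<beta>[of k i] ik(3) by simp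
  show False
  proof (cases "u' \<in> F ` I")
    case True
    then have "0 \<le> real_vec (\<beta> i) \<bullet> real_vec u'" using \<beta> by auto
    then show False using 1 t(1) s by (smt (verit) mult_nonneg_nonneg)
  next
    case False
    then have "u' = - (\<Sum>i\<in>I. F i)" using u'(1) by (simp add: star_set_def)
    then have "real_vec (\<beta> k) \<bullet> real_vec u' = - 1"
      using ik(2) fin by (simp add: real_vec_sum inner_sum_right \<beta>)
    then show False using 1 2 s by simp
  qed
qed

section \<open>Avoiding affine conditions on the step lengths\<close>

definition sols :: "nat \<Rightarrow> (nat \<Rightarrow> real ^ 'n) \<Rightarrow> real ^ 'n \<Rightarrow> real \<Rightarrow> (nat \<Rightarrow> real) set" where
  "sols k u x L = {\<alpha>. (\<Sum>l<k. \<alpha> l *\<^sub>R u l) = x \<and> (\<Sum>l<k. \<alpha> l) = L}"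

text \<open>On the affine space \<open>sols k u x L\<close>, the condition \<open>T\<close> implies a nontrivial affine equation.\<close>

definition avoidable :: "nat \<Rightarrow> (nat \<Rightarrow> real ^ 'n) \<Rightarrow> real ^ 'n \<Rightarrow> real \<Rightarrow> ((nat \<Rightarrow> real) \<Rightarrow> bool) \<Rightarrow> bool" where
  "avoidable k u x L T \<longleftrightarrow> (\<exists>g c. (\<forall>\<alpha>\<in>sols k u x L. T \<alpha> \<longrightarrow> (\<Sum>l<k. g l * \<alpha> l) + c = 0) \<and>
     (\<exists>\<alpha>\<in>sols k u x L. (\<Sum>l<k. g l * \<alpha> l) + c \<noteq> (0::real)))"

text \<open>Move a solution that is good for the earlier equations slightly towards one where the
  next functional does not vanish. Positivity and the earlier inequalities are open conditions and
  survive a small move.\<close>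

lemma avoid_affine:
  assumes "finite G" "\<And>g c. (g, c) \<in> G \<Longrightarrow> \<exists>\<alpha>\<in>sols k u x L. (\<Sum>l<k. g l * \<alpha> l) + c \<noteq> (0::real)"
    and "\<alpha>0 \<in> sols k u x L" "\<And>l. l < k \<Longrightarrow> 0 < \<alpha>0 l"
  shows "\<exists>\<alpha>\<in>sols k u x L. (\<forall>l<k. 0 < \<alpha> l) \<and> (\<forall>(g, c)\<in>G. (\<Sum>l<k. g l * \<alpha> l) + c \<noteq> 0)"
  using assms(1,2)
proof (induction G)
  case empty
  then show ?case using assms(3,4) by blast
next
  case (insert h G)
  obtain g c where h: "h = (g, c)" by (cases h)
  let ?f = "\<lambda>(g :: nat \<Rightarrow> real) (c :: real) \<alpha>. (\<Sum>l<k. g l * \<alpha> l) + c"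
  have "\<exists>\<alpha>\<in>sols k u x L. (\<forall>l<k. 0 < \<alpha> l) \<and> (\<forall>(g, c)\<in>G. ?f g c \<alpha> \<noteq> 0)"
    by (rule insert.IH) (rule insert.prems, simp)
  then obtain \<alpha> where \<alpha>: "\<alpha> \<in> sols k u x L" "\<forall>l<k. 0 < \<alpha> l" "\<forall>(g, c)\<in>G. ?f g c \<alpha> \<noteq> 0"
    by blast
  obtain \<beta> where \<beta>: "\<beta> \<in> sols k u x L" "?f g c \<beta> \<noteq> 0" using insert.prems[of g c] h by auto
  show ?case
  proof (cases "?f g c \<alpha> = 0")
    case False
    then show ?thesis using \<alpha> h by auto
  next
    case True
    \<comment> \<open>On this segment every functional is affine in \<open>t\<close>; the one that
      vanishes at \<open>t = 0\<close> is nonzero for all \<open>t > 0\<close>.\<close>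
    define \<gamma> where "\<gamma> t = (\<lambda>l. (1 - t) * \<alpha> l + t * \<beta> l)" for t :: real
    have f: "?f g' c' (\<gamma> t) = (1 - t) * ?f g' c' \<alpha> + t * ?f g' c' \<beta>" for g' c' t
      by (simp add: \<gamma>_def sum.distrib sum_distrib_left algebra_simps sum_subtractf)
    have sol: "\<gamma> t \<in> sols k u x L" for t
    proof -
      have "(\<Sum>l<k. \<gamma> t l *\<^sub>R u l) = (1 - t) *\<^sub>R (\<Sum>l<k. \<alpha> l *\<^sub>R u l) + t *\<^sub>R (\<Sum>l<k. \<beta> l *\<^sub>R u l)"
        by (simp add: \<gamma>_def sum.distrib scaleR_sum_right scaleR_left_distrib)
      moreover have "(\<Sum>l<k. \<gamma> t l) = (1 - t) * (\<Sum>l<k. \<alpha> l) + t * (\<Sum>l<k. \<beta> l)"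
        by (simp add: \<gamma>_def sum.distrib sum_distrib_left)
      ultimately show ?thesis using \<alpha>(1) \<beta>(1) by (simp add: sols_def algebra_simps flip: scaleR_add_left)
    qed
    have pos: "\<forall>\<^sub>F t in at_right 0. \<forall>l\<in>{..<k}. 0 < \<gamma> t l"
    proof (rule eventually_ball_finite, simp, rule ballI)
      fix l assume "l \<in> {..<k}"
      then have "0 < \<alpha> l" using \<alpha>(2) by simp
      moreover have "((\<lambda>t. \<gamma> t l) \<longlongrightarrow> (1 - 0) * \<alpha> l + 0 * \<beta> l) (at_right 0)"
        unfolding \<gamma>_def by (intro tendsto_intros)
      ultimately show "\<forall>\<^sub>F t in at_right 0. 0 < \<gamma> t l"
        using order_tendstoD(1)[of "\<lambda>t. \<gamma> t l" "\<alpha> l" "at_right 0" 0] by simp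
    qed
    have ne: "\<forall>\<^sub>F t in at_right 0. \<forall>p\<in>G. ?f (fst p) (snd p) (\<gamma> t) \<noteq> 0"
    proof (rule eventually_ball_finite[OF insert.hyps(1)], rule ballI)
      fix p assume p: "p \<in> G"
      have "((\<lambda>t. (1 - t) * ?f (fst p) (snd p) \<alpha> + t * ?f (fst p) (snd p) \<beta>) \<longlongrightarrow>
         (1 - 0) * ?f (fst p) (snd p) \<alpha> + 0 * ?f (fst p) (snd p) \<beta>) (at_right 0)"
        by (intro tendsto_intros)
      moreover have "(1 - 0) * ?f (fst p) (snd p) \<alpha> + 0 * ?f (fst p) (snd p) \<beta> \<noteq> 0" using \<alpha>(3) p by auto
      ultimately show "\<forall>\<^sub>F t in at_right 0. ?f (fst p) (snd p) (\<gamma> t) \<noteq> 0"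
        unfolding f by (rule tendsto_imp_eventually_ne)
    qed
    have "\<forall>\<^sub>F t in at_right (0::real). 0 < t" by (rule eventually_at_right_less)
    with pos ne have "\<forall>\<^sub>F t in at_right 0. 0 < t \<and> (\<forall>l\<in>{..<k}. 0 < \<gamma> t l) \<and> (\<forall>p\<in>G. ?f (fst p) (snd p) (\<gamma> t) \<noteq> 0)"
      by eventually_elim simp
    from eventually_happens'[OF trivial_limit_at_right_real this]
    obtain t where t: "0 < t" "\<forall>l\<in>{..<k}. 0 < \<gamma> t l" "\<forall>p\<in>G. ?f (fst p) (snd p) (\<gamma> t) \<noteq> 0"
      by (elim exE conjE)
    have "?f g c (\<gamma> t) \<noteq> 0" unfolding f using True \<beta>(2) t(1) by simp
    then show ?thesis using t sol h by (intro bexI[of _ "\<gamma> t"]) auto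
  qed
qed

lemma avoid_all:
  assumes "finite S" "\<And>T. T \<in> S \<Longrightarrow> avoidable k u x L T"
    and "\<alpha>0 \<in> sols k u x L" "\<And>l. l < k \<Longrightarrow> 0 < \<alpha>0 l"
  obtains \<alpha> where "\<alpha> \<in> sols k u x L" "\<And>l. l < k \<Longrightarrow> 0 < \<alpha> l" "\<And>T. T \<in> S \<Longrightarrow> \<not> T \<alpha>"
proof -
  have "\<forall>T\<in>S. \<exists>gc. (\<forall>\<alpha>\<in>sols k u x L. T \<alpha> \<longrightarrow> (\<Sum>l<k. fst gc l * \<alpha> l) + snd gc = 0) \<and>
     (\<exists>\<alpha>\<in>sols k u x L. (\<Sum>l<k. fst gc l * \<alpha> l) + snd gc \<noteq> (0::real))"
  proof
    fix T assume "T \<in> S"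
    then obtain g c where "(\<forall>\<alpha>\<in>sols k u x L. T \<alpha> \<longrightarrow> (\<Sum>l<k. g l * \<alpha> l) + c = 0) \<and>
       (\<exists>\<alpha>\<in>sols k u x L. (\<Sum>l<k. g l * \<alpha> l) + c \<noteq> (0::real))"
      using assms(2) unfolding avoidable_def by blast
    then show "\<exists>gc. (\<forall>\<alpha>\<in>sols k u x L. T \<alpha> \<longrightarrow> (\<Sum>l<k. fst gc l * \<alpha> l) + snd gc = 0) \<and>
       (\<exists>\<alpha>\<in>sols k u x L. (\<Sum>l<k. fst gc l * \<alpha> l) + snd gc \<noteq> (0::real))"
      by (intro exI[of _ "(g, c)"]) simp
  qed
  from bchoice[OF this] obtain h where h: "\<forall>T\<in>S. (\<forall>\<alpha>\<in>sols k u x L. T \<alpha> \<longrightarrow> (\<Sum>l<k. fst (h T) l * \<alpha> l) + snd (h T) = 0) \<and>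
     (\<exists>\<alpha>\<in>sols k u x L. (\<Sum>l<k. fst (h T) l * \<alpha> l) + snd (h T) \<noteq> (0::real))"
    by (elim exE)
  have "\<exists>\<alpha>\<in>sols k u x L. (\<forall>l<k. 0 < \<alpha> l) \<and> (\<forall>(g, c)\<in>h ` S. (\<Sum>l<k. g l * \<alpha> l) + c \<noteq> 0)"
  proof (rule avoid_affine[OF _ _ assms(3,4)])
    show "finite (h ` S)" using assms(1) by simp
    show "\<exists>\<alpha>\<in>sols k u x L. (\<Sum>l<k. g l * \<alpha> l) + c \<noteq> 0" if gc: "(g, c) \<in> h ` S" for g c
    proof -
      obtain T where T: "T \<in> S" "(g, c) = h T" using gc by blast
      show ?thesis using conjunct2[OF bspec[OF h T(1)]] unfolding T(2)[symmetric] by simp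
    qed
  qed
  then obtain \<alpha> where \<alpha>: "\<alpha> \<in> sols k u x L" "\<forall>l<k. 0 < \<alpha> l" "\<forall>(g, c)\<in>h ` S. (\<Sum>l<k. g l * \<alpha> l) + c \<noteq> 0" by blast
  show thesis
  proof (rule that[OF \<alpha>(1)])
    show "0 < \<alpha> l" if "l < k" for l using \<alpha>(2) that by blast
    show "\<not> T \<alpha>" if T: "T \<in> S" for T
    proof
      assume "T \<alpha>"
      then have "(\<Sum>l<k. fst (h T) l * \<alpha> l) + snd (h T) = 0" using bspec[OF h T] \<alpha>(1) by blast
      then show False using \<alpha>(3) T by (auto simp: case_prod_beta)
    qed
  qed
qed

text \<open>The vectors \<open>u l\<close> with \<open>l\<close> in \<open>B\<close>, each extended
  by an entry one, span a space of one dimension more: displacement and length can be prescribed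
  independently, with coefficients of any sign.\<close>

definition full_block :: "(nat \<Rightarrow> real ^ 'n) \<Rightarrow> nat set \<Rightarrow> bool" where
  "full_block u B \<longleftrightarrow> (\<forall>x \<sigma>. \<exists>r. (\<Sum>l\<in>B. r l *\<^sub>R u l) = x \<and> (\<Sum>l\<in>B. r l) = (\<sigma>::real))"

text \<open>Moving weight from one direction to a full block in which \<open>\<mu>\<close> is constant changes the functional.\<close>

lemma avoidable_region:
  fixes u :: "nat \<Rightarrow> real ^ 'n"
  assumes ne: "sols k u x L \<noteq> {}" and B: "full_block u B" "B \<subseteq> {..<k}"
    and \<mu>0: "\<And>l. l \<in> B \<Longrightarrow> \<mu> l = \<mu>0" and l0: "l0 < k" "(\<mu> l0 - \<mu>0) \<bullet> u l0 \<noteq> 0"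
    and T: "\<And>\<alpha>. \<alpha> \<in> sols k u x L \<Longrightarrow> T \<alpha> \<Longrightarrow> (\<Sum>l<k. \<alpha> l * (\<mu> l \<bullet> u l)) + c = 0"
  shows "avoidable k u x L T"
proof -
  obtain \<alpha> where \<alpha>: "\<alpha> \<in> sols k u x L" using ne by blast
  obtain r where r: "(\<Sum>l\<in>B. r l *\<^sub>R u l) = u l0" "(\<Sum>l\<in>B. r l) = (1::real)"
    using B(1) unfolding full_block_def by blast
  have finB: "finite B" using B(2) finite_subset by blast
  \<comment> \<open>A tangent vector of the solution space: one unit more of step \<open>l0\<close>,
    undone within \<open>B\<close> by coefficients with the same displacement and the same
    total.\<close>
  define \<kappa> where "\<kappa> l = (if l = l0 then 1 else 0) - (if l \<in> B then r l else 0)" for l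
  have split: "(\<Sum>l<k. \<kappa> l *\<^sub>R h l) = h l0 - (\<Sum>l\<in>B. r l *\<^sub>R h l)" for h :: "nat \<Rightarrow> 'b::real_vector"
  proof -
    have "(\<Sum>l<k. \<kappa> l *\<^sub>R h l) = (\<Sum>l<k. (if l = l0 then h l else 0)) - (\<Sum>l<k. (if l \<in> B then r l *\<^sub>R h l else 0))"
      unfolding \<kappa>_def sum_subtractf[symmetric] by (rule sum.cong) (auto simp: scaleR_left_diff_distrib)
    also have "(\<Sum>l<k. (if l = l0 then h l else 0)) = h l0" using l0(1) by simp
    also have "(\<Sum>l<k. (if l \<in> B then r l *\<^sub>R h l else 0)) = (\<Sum>l\<in>B. r l *\<^sub>R h l)"
      using B(2) by (simp add: sum.If_cases Int_absorb1)
    finally show ?thesis .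
  qed
  have 1: "(\<Sum>l<k. \<kappa> l *\<^sub>R u l) = 0" using split[of u] r(1) by simp
  have 2: "(\<Sum>l<k. \<kappa> l) = 0" using split[of "\<lambda>_. 1::real"] r(2) by simp
  have "(\<Sum>l<k. \<kappa> l * (\<mu> l \<bullet> u l)) = \<mu> l0 \<bullet> u l0 - (\<Sum>l\<in>B. r l *\<^sub>R (\<mu> l \<bullet> u l))"
    using split[of "\<lambda>l. \<mu> l \<bullet> u l"] by simp
  also have "(\<Sum>l\<in>B. r l *\<^sub>R (\<mu> l \<bullet> u l)) = \<mu>0 \<bullet> (\<Sum>l\<in>B. r l *\<^sub>R u l)"
    using \<mu>0 by (simp add: inner_sum_right)
  finally have 3: "(\<Sum>l<k. \<kappa> l * (\<mu> l \<bullet> u l)) = (\<mu> l0 - \<mu>0) \<bullet> u l0" using r(1) by (simp add: inner_diff_left)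
  let ?\<beta> = "\<lambda>l. \<alpha> l + \<kappa> l"
  have \<beta>: "?\<beta> \<in> sols k u x L" using \<alpha> 1 2 by (simp add: sols_def scaleR_left_distrib sum.distrib)
  have "(\<Sum>l<k. (\<mu> l \<bullet> u l) * ?\<beta> l) = (\<Sum>l<k. (\<mu> l \<bullet> u l) * \<alpha> l) + (\<mu> l0 - \<mu>0) \<bullet> u l0"
    unfolding 3[symmetric] sum.distrib[symmetric] by (rule sum.cong) (simp_all add: algebra_simps)
  \<comment> \<open>The functional takes different values at the two solutions, so it is nonzero at
    one of them.\<close>
  then have "(\<Sum>l<k. (\<mu> l \<bullet> u l) * ?\<beta> l) + c \<noteq> 0 \<or> (\<Sum>l<k. (\<mu> l \<bullet> u l) * \<alpha> l) + c \<noteq> 0"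
    using l0(2) by linarith
  then have "\<exists>\<gamma>\<in>sols k u x L. (\<Sum>l<k. (\<mu> l \<bullet> u l) * \<gamma> l) + c \<noteq> 0"
    using \<alpha> \<beta> by (elim disjE) (rule bexI, assumption, assumption)+
  moreover have "\<forall>\<alpha>\<in>sols k u x L. T \<alpha> \<longrightarrow> (\<Sum>l<k. (\<mu> l \<bullet> u l) * \<alpha> l) + c = 0"
    using T by (simp add: mult.commute)
  ultimately show ?thesis unfolding avoidable_def by (intro exI[of _ "\<lambda>l. \<mu> l \<bullet> u l"] exI[of _ c]) simp
qed

lemma avoidable_impossible:
  assumes "sols k u x L \<noteq> {}" "\<And>\<alpha>. \<alpha> \<in> sols k u x L \<Longrightarrow> \<not> T \<alpha>"
  shows "avoidable k u x L T"
  unfolding avoidable_def using assms by (intro exI[of _ "\<lambda>_. 0"] exI[of _ 1]) auto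

lemma exists_orthogonal:
  fixes z :: "real ^ 'n"
  assumes "subspace W" "z \<notin> W"
  shows "\<exists>\<nu>. (\<forall>w\<in>W. \<nu> \<bullet> w = 0) \<and> \<nu> \<bullet> z \<noteq> 0"
proof -
  obtain y v where yv: "y \<in> span W" "\<And>w. w \<in> span W \<Longrightarrow> orthogonal v w" "z = y + v"
    using orthogonal_subspace_decomp_exists[of W z] by metis
  have sW: "span W = W" using assms(1) by (simp add: span_eq_iff)
  have "v \<noteq> 0" using yv assms(2) sW by auto
  then have "v \<bullet> z \<noteq> 0" using yv(2)[OF yv(1)] by (simp add: yv(3) inner_add_right orthogonal_def)
  with yv(2) sW show ?thesis by (intro exI[of _ v]) (auto simp: orthogonal_def)
qed

text \<open>
  A path from \<open>p\<close> to \<open>p + x\<close> of total length \<open>L\<close> whose steps have the directions \<open>u\<close>. The four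
  blocks serve \<open>block_choice\<close>: however three bends cut the path into four parts, one
  part contains a full block.
\<close>

locale path =
  fixes u :: "nat \<Rightarrow> int ^ 'n::finite" and k m :: nat and s :: "nat \<Rightarrow> nat"
    and p :: "real ^ 'n" and x :: "real ^ 'n" and L :: real
  assumes k: "4 \<le> k"
    and pair: "\<And>l. Suc l < k \<Longrightarrow> unimodular_pair (u l) (u (Suc l))"
    and triple: "\<And>l. 3 \<le> CARD('n) \<Longrightarrow> Suc (Suc l) < k \<Longrightarrow> unimodular_triple (u l) (u (Suc l)) (u (Suc (Suc l)))"
    and block: "\<And>b. b < 4 \<Longrightarrow> full_block (\<lambda>l. real_vec (u l)) {s b..<s b + m}"
    and blocks: "s 0 + m \<le> s 1" "s 1 + m \<le> s 2" "s 2 + m \<le> s 3" "s 3 + m \<le> k" "0 < m"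
    and ne: "sols k (\<lambda>l. real_vec (u l)) x L \<noteq> {}"
begin

abbreviation "U \<equiv> (\<lambda>l. real_vec (u l))"
abbreviation "avoid T \<equiv> avoidable k U x L T"
abbreviation "A \<equiv> sols k U x L"

definition Q :: "(nat \<Rightarrow> real) \<Rightarrow> nat \<Rightarrow> real ^ 'n" where
  "Q \<alpha> l = p + (\<Sum>i<l. \<alpha> i *\<^sub>R U i)"

lemma Q_diff: "i \<le> j \<Longrightarrow> Q \<alpha> j - Q \<alpha> i = (\<Sum>l\<in>{i..<j}. \<alpha> l *\<^sub>R U l)"
  unfolding Q_def using sum.atLeastLessThan_concat[of 0 i j "\<lambda>l. \<alpha> l *\<^sub>R U l"] by (simp add: atLeast0LessThan algebra_simps)

lemma Q_0[simp]: "Q \<alpha> 0 = p" by (simp add: Q_def)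

lemma Q_k: "\<alpha> \<in> A \<Longrightarrow> Q \<alpha> k = p + x" by (simp add: Q_def sols_def)

text \<open>Pigeonhole: a cut strictly inside a block spoils that block only, so three cuts leave
  one of the four disjoint blocks intact.\<close>

lemma block_choice:
  assumes "x1 \<le> x2" "x2 \<le> x3" "x3 \<le> k"
  obtains B where "full_block U B" "B \<subseteq> {..<k}" "B \<subseteq> {..<x1} \<or> B \<subseteq> {x1..<x2} \<or> B \<subseteq> {x2..<x3} \<or> B \<subseteq> {x3..<k}"
proof -
  have "\<exists>b<4. \<forall>z\<in>{x1,x2,x3}. z \<le> s b \<or> s b + m \<le> z"
  proof (rule ccontr)
    assume "\<not> ?thesis"
    then have *: "\<forall>b<4. \<exists>z\<in>{x1,x2,x3}. s b < z \<and> z < s b + m" by (meson not_le)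
    then obtain f where f: "\<And>b. b < 4 \<Longrightarrow> f b \<in> {x1,x2,x3} \<and> s b < f b \<and> f b < s b + m" by metis
    have "f 0 < f 1" "f 1 < f 2" "f 2 < f 3"
      using f[of 0] f[of 1] f[of 2] f[of 3] blocks by auto
    then have "card {f 0, f 1, f 2, f 3} = 4" by auto
    moreover have "{f 0, f 1, f 2, f 3} \<subseteq> {x1,x2,x3}" using f[of 0] f[of 1] f[of 2] f[of 3] by auto
    then have "card {f 0, f 1, f 2, f 3} \<le> card {x1,x2,x3}" by (intro card_mono) auto
    moreover have "card {x1,x2,x3} \<le> 3" by (simp add: card_insert_if)
    ultimately show False by simp
  qed
  then obtain b where b: "b < 4" "\<And>z. z \<in> {x1,x2,x3} \<Longrightarrow> z \<le> s b \<or> s b + m \<le> z" by blast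
  have bk: "s b + m \<le> k"
  proof -
    have "b = 0 \<or> b = 1 \<or> b = 2 \<or> b = 3" using b(1) by auto
    then show ?thesis using blocks by auto
  qed
  show thesis
  proof (rule that[OF block[OF b(1)]])
    show "{s b..<s b + m} \<subseteq> {..<k}" using bk by auto
    show "{s b..<s b + m} \<subseteq> {..<x1} \<or> {s b..<s b + m} \<subseteq> {x1..<x2} \<or> {s b..<s b + m} \<subseteq> {x2..<x3} \<or> {s b..<s b + m} \<subseteq> {x3..<k}"
      using b(2)[of x1] b(2)[of x2] b(2)[of x3] bk by fastforce
  qed
qed

text \<open>Test with a vector orthogonal to \<open>W\<close>, placed on the steps of the interval
  and zero elsewhere. If the block lies inside the interval, the outer step \<open>l2\<close> makes
  the functional nonconstant, otherwise the inner step \<open>l1\<close> does.\<close>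

lemma avoid_interval:
  assumes W: "subspace W" and ij: "i \<le> j" "j \<le> k"
    and T: "\<And>\<alpha>. \<alpha> \<in> A \<Longrightarrow> T \<alpha> \<Longrightarrow> (\<Sum>l\<in>{i..<j}. \<alpha> l *\<^sub>R U l) + d \<in> W"
    and l1: "l1 \<in> {i..<j}" "U l1 \<notin> W" and l2: "l2 < k" "l2 \<notin> {i..<j}" "U l2 \<notin> W"
  shows "avoid T"
proof -
  \<comment> \<open>Two cuts occur here; the third is taken equal to \<open>j\<close>, which makes
    one part empty.\<close>
  obtain B where B: "full_block U B" "B \<subseteq> {..<k}"
    and B': "B \<subseteq> {..<i} \<or> B \<subseteq> {i..<j} \<or> B \<subseteq> {j..<j} \<or> B \<subseteq> {j..<k}"
    using block_choice[OF ij(1) order_refl ij(2)] .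
  have main: "avoid T" if "l0 < k" "\<And>w. w \<in> W \<Longrightarrow> \<nu> \<bullet> w = 0"
     "((if l0 \<in> {i..<j} then \<nu> else 0) - \<mu>0) \<bullet> U l0 \<noteq> 0"
     "\<And>l. l \<in> B \<Longrightarrow> (if l \<in> {i..<j} then \<nu> else 0) = \<mu>0" for \<nu> \<mu>0 l0
  proof (rule avoidable_region[OF ne B(1,2), where \<mu> = "\<lambda>l. if l \<in> {i..<j} then \<nu> else 0" and c = "\<nu> \<bullet> d"])
    fix \<alpha> assume "\<alpha> \<in> A" "T \<alpha>"
    then have "\<nu> \<bullet> ((\<Sum>l\<in>{i..<j}. \<alpha> l *\<^sub>R U l) + d) = 0" using T that(2) by blast
    moreover have "(\<Sum>l<k. \<alpha> l * ((if l \<in> {i..<j} then \<nu> else 0) \<bullet> U l)) = (\<Sum>l<k. if l \<in> {i..<j} then \<alpha> l * (\<nu> \<bullet> U l) else 0)"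
      by (rule sum.cong) auto
    moreover have "\<dots> = (\<Sum>l\<in>{i..<j}. \<alpha> l * (\<nu> \<bullet> U l))"
      using ij by (subst sum.inter_restrict[symmetric]) (auto intro!: sum.cong)
    ultimately show "(\<Sum>l<k. \<alpha> l * ((if l \<in> {i..<j} then \<nu> else 0) \<bullet> U l)) + \<nu> \<bullet> d = 0"
      by (simp add: inner_add_right inner_sum_right)
  qed (use that in auto)
  show ?thesis
  proof (cases "B \<subseteq> {i..<j}")
    case True
    obtain \<nu> where \<nu>: "\<forall>w\<in>W. \<nu> \<bullet> w = 0" "\<nu> \<bullet> U l2 \<noteq> 0" using exists_orthogonal[OF W l2(3)] by blast
    show ?thesis by (rule main[OF l2(1), of \<nu> \<nu>]) (use True l2 \<nu> in auto)
  next
    case False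
    obtain \<nu> where \<nu>: "\<forall>w\<in>W. \<nu> \<bullet> w = 0" "\<nu> \<bullet> U l1 \<noteq> 0" using exists_orthogonal[OF W l1(2)] by blast
    have "l \<notin> {i..<j}" if "l \<in> B" for l using False B' that by auto
    then show ?thesis by (intro main[of l1 \<nu> 0]) (use l1 ij \<nu> in auto)
  qed
qed

end

section \<open>Linear algebra of lines, planes and concurrency\<close>

lemma span_singleton_sym:
  fixes a b :: "'a::real_vector"
  assumes "b \<in> span {a}" "b \<noteq> 0" shows "a \<in> span {b}"
proof -
  obtain c where c: "b = c *\<^sub>R a" using assms(1) by (auto simp: span_singleton)
  then have "a = (1 / c) *\<^sub>R b" using assms(2) by auto
  then show ?thesis by (auto simp: span_singleton)
qed

lemma span_singleton_mono:
  fixes a b :: "'a::real_vector"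
  assumes "b \<in> span {a}" "v \<in> span {b}" shows "v \<in> span {a}"
  using assms span_minimal[of "{b}" "span {a}"] by auto

lemma span_singleton_uminus: "span {- a} = span {a :: 'a::real_vector}"
proof (intro subset_antisym span_minimal)
  show "{- a} \<subseteq> span {a}" by (simp add: span_neg span_base)
  show "{a} \<subseteq> span {- a}" using span_neg[OF span_base[of "- a" "{- a}"]] by simp
qed simp_all

text \<open>\<open>c\<close> and \<open>d\<close> are independent, and a space spanned by two
  vectors has dimension at most two.\<close>

lemma plane_eq:
  fixes a b c d :: "'a::euclidean_space"
  assumes "c \<in> span {a, b}" "d \<in> span {a, b}" "c \<noteq> 0" "d \<notin> span {c}"
  shows "span {a, b} = span {c, d}"
proof
  have cd: "c \<noteq> d" using assms(4) span_base[of c "{c}"] by auto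
  have ind: "independent {c, d}" using assms(3,4)
    by (simp add: independent_insert insert_commute[of c d] dependent_single)
  have "dim (span {a, b}) \<le> card {a, b}" using dim_le_card'[of "{a,b}"] by simp
  also have "\<dots> \<le> card {c, d}" using cd by (simp add: card_insert_if)
  finally show "span {a, b} \<subseteq> span {c, d}"
    using card_ge_dim_independent[OF _ ind, of "span {a, b}"] assms(1,2) by auto
  show "span {c, d} \<subseteq> span {a, b}" using assms(1,2) by (intro span_minimal) auto
qed

text \<open>With such normals, concurrency of three lines in the directions \<open>w\<close>, \<open>v\<close>, \<open>v'\<close> is one affine condition
  on their base points.\<close>

lemma concurrency_normals:
  fixes w v v' :: "real ^ 'n"
  assumes two: "CARD('n) = 2" and nz: "w \<noteq> 0" "v \<noteq> 0"
    and np: "v \<notin> span {w}" "v' \<notin> span {w}" "v' \<notin> span {v}"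
  obtains N0 N1 N2 where "N0 + N1 + N2 = 0" "N0 \<bullet> w = 0" "N1 \<bullet> v = 0" "N2 \<bullet> v' = 0"
    "\<And>z. N0 \<bullet> z = 0 \<Longrightarrow> z \<in> span {w}" "\<And>z. N1 \<bullet> z = 0 \<Longrightarrow> z \<in> span {v}"
    "\<And>z. N2 \<bullet> z = 0 \<Longrightarrow> z \<in> span {v'}"
proof -
  have np': "w \<notin> span {v}" using span_singleton_sym[of w v] np(1) nz by blast
  have wv: "w \<noteq> v" using np(1) span_base[of w "{w}"] by auto
  have ind: "independent {w, v}" using nz np(1) np'
    by (simp add: independent_insert)
  have "dim (UNIV :: (real ^ 'n) set) \<le> card {w, v}" using two wv by (simp add: card_insert_if)
  then have "UNIV \<subseteq> span {w, v}" using card_ge_dim_independent[OF _ ind, of UNIV] by auto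
  then have rep: "\<exists>a b. z = a *\<^sub>R w + b *\<^sub>R v" for z
    using span_breakdown_eq[of z w "{v}"] span_singleton[of v] by (auto simp: algebra_simps) (metis UNIV_I add.commute diff_add_cancel rangeE subsetD)
  obtain s t where st: "v' = s *\<^sub>R w + t *\<^sub>R v" using rep by blast
  have s: "s \<noteq> 0" using st np(3) by (auto simp: span_scale span_base)
  have t: "t \<noteq> 0" using st np(2) by (auto simp: span_scale span_base)
  obtain M1 where M1: "M1 \<bullet> v = 0" "M1 \<bullet> w \<noteq> 0"
    using exists_orthogonal[OF subspace_span np'] span_base[of v "{v}"] by auto
  obtain M0 where M0: "M0 \<bullet> w = 0" "M0 \<bullet> v \<noteq> 0"
    using exists_orthogonal[OF subspace_span np(1)] span_base[of w "{w}"] by auto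
  \<comment> \<open>With \<open>v' = s w + t v\<close> this is the ratio for which
    \<open>r M0 + M1\<close> is orthogonal to \<open>v'\<close>, so its negative can serve as the
    third normal.\<close>
  define r where "r = - (s * (M1 \<bullet> w)) / (t * (M0 \<bullet> v))"
  have r: "r \<noteq> 0" using s t M0 M1 by (simp add: r_def)
  have rt: "r * (M0 \<bullet> v) * t = - (s * (M1 \<bullet> w))" using M0 t by (simp add: r_def)
  show thesis
  proof (rule that[of "r *\<^sub>R M0" M1 "- (r *\<^sub>R M0 + M1)"])
    show "r *\<^sub>R M0 + M1 + - (r *\<^sub>R M0 + M1) = 0" by simp
    show "r *\<^sub>R M0 \<bullet> w = 0" "M1 \<bullet> v = 0" using M0 M1 by auto
    show "- (r *\<^sub>R M0 + M1) \<bullet> v' = 0"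
      using rt M0 M1 by (simp add: st inner_add_left inner_add_right inner_minus_left) (simp add: algebra_simps)
    fix z
    obtain a b where z: "z = a *\<^sub>R w + b *\<^sub>R v" using rep by blast
    show "z \<in> span {w}" if "r *\<^sub>R M0 \<bullet> z = 0"
      using that r M0 by (auto simp: z inner_add_right span_scale span_base)
    show "z \<in> span {v}" if "M1 \<bullet> z = 0"
      using that M1 by (auto simp: z inner_add_right span_scale span_base)
    show "z \<in> span {v'}" if "- (r *\<^sub>R M0 + M1) \<bullet> z = 0"
    proof -
      have "b * (r * (M0 \<bullet> v)) + a * (M1 \<bullet> w) = 0"
        using that M0 M1 by (simp add: z inner_add_left inner_add_right inner_minus_left algebra_simps)
      then have "(b * (r * (M0 \<bullet> v)) + a * (M1 \<bullet> w)) * t = 0" by simp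
      then have "b * (r * (M0 \<bullet> v) * t) + a * t * (M1 \<bullet> w) = 0" by (simp add: algebra_simps)
      then have "(a * t - b * s) * (M1 \<bullet> w) = 0" unfolding rt by (simp add: algebra_simps)
      then have ab: "a * t = b * s" using M1(2) by simp
      have "a = (b / t) * s" using ab t by (simp add: field_simps)
      then have "z = (b / t) *\<^sub>R v'" using t by (simp add: z st scaleR_add_right)
      then show ?thesis by (simp add: span_scale span_base)
    qed
  qed
qed

section \<open>Joining two rays by a path\<close>

text \<open>
  The rays \<open>Ray p (U 0)\<close> and \<open>Ray q (- U (k - 1))\<close> are to be truncated to the first and last
  step of the path. In dimension at least three the second and the last but one direction have
  to be generic, since the first and the last step stay on lines already present.
\<close>

locale join = path u k m s p x L
  for u :: "nat \<Rightarrow> int ^ 'n::finite" and k m s p x L +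
  fixes D :: "'n piece set" and q :: "real ^ 'n"
  assumes gp: "general_position D"
    and r1: "Ray p (U 0) \<in> D" and r2: "Ray q (- U (k - 1)) \<in> D" and r12: "Ray p (U 0) \<noteq> Ray q (- U (k - 1))"
    and x: "x = q - p"
    and gen1: "\<And>a. 3 \<le> CARD('n) \<Longrightarrow> a \<in> D \<Longrightarrow> a \<noteq> Ray p (U 0) \<Longrightarrow> direction a \<notin> span {U 0} \<Longrightarrow>
      U 1 \<notin> span {U 0, direction a}"
    and gen1': "\<And>a. 3 \<le> CARD('n) \<Longrightarrow> a \<in> D \<Longrightarrow> base a - p \<notin> span {U 0} \<Longrightarrow> direction a \<in> span {U 0} \<Longrightarrow>
      U 1 \<notin> span {U 0, base a - p}"
    and gen2: "\<And>a. 3 \<le> CARD('n) \<Longrightarrow> a \<in> D \<Longrightarrow> a \<noteq> Ray q (- U (k - 1)) \<Longrightarrow> direction a \<notin> span {U (k - 1)} \<Longrightarrow>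
      U (k - 2) \<notin> span {U (k - 1), direction a}"
    and gen2': "\<And>a. 3 \<le> CARD('n) \<Longrightarrow> a \<in> D \<Longrightarrow> base a - q \<notin> span {U (k - 1)} \<Longrightarrow> direction a \<in> span {U (k - 1)} \<Longrightarrow>
      U (k - 2) \<notin> span {U (k - 1), base a - q}"
begin

abbreviation "r1 \<equiv> Ray p (U 0)"
abbreviation "r2 \<equiv> Ray q (- U (k - 1))"

text \<open>
  The new lines: those of the inner steps, spanned by the bends \<open>lo\<close> and \<open>hi = lo + 1\<close>, and those of
  the additional rays at the bends \<open>lo = hi\<close>.
\<close>

definition new :: "nat \<Rightarrow> nat \<Rightarrow> real ^ 'n \<Rightarrow> bool" where
  "new lo hi v \<longleftrightarrow> 1 \<le> lo \<and> (Suc lo < k \<and> hi = Suc lo \<and> v = U lo \<or> lo < k \<and> hi = lo \<and> v = U (lo - 1) - U lo)"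

lemma new_range: "new lo hi v \<Longrightarrow> 1 \<le> lo \<and> lo \<le> hi \<and> hi < k \<and> hi \<le> Suc lo"
  by (auto simp: new_def)

lemma pair': "Suc l < k \<Longrightarrow> U (Suc l) \<notin> span {U l}" "Suc l < k \<Longrightarrow> U l \<notin> span {U (Suc l)}"
  using pair[of l] unimodular_pair_not_span unimodular_pair_sym by blast+

lemma pair_side:
  assumes "Suc l < k"
  shows "U l \<notin> span {U l - U (Suc l)}" "U (Suc l) \<notin> span {U l - U (Suc l)}"
proof -
  have "a \<notin> span {a - b}" if "b \<notin> span {a}" "a \<notin> span {b}" for a b :: "real ^ 'n"
  proof
    assume "a \<in> span {a - b}"
    then obtain c where c: "a = c *\<^sub>R (a - b)" by (auto simp: span_singleton)
    then have "c \<noteq> 0" using that(2) by (metis scale_zero_left span_zero)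
    have "c *\<^sub>R b = (c - 1) *\<^sub>R a" using c by (simp add: algebra_simps)
    then have "b = ((c - 1) / c) *\<^sub>R a" using \<open>c \<noteq> 0\<close>
      by (metis (no_types, lifting) divide_inverse_commute eq_vector_fraction_iff scaleR_scaleR)
    then show False using that(1) by (auto simp: span_singleton)
  qed
  note * = this
  show "U l \<notin> span {U l - U (Suc l)}" using *[of "U (Suc l)" "U l"] pair' assms by blast
  have "span {U (Suc l) - U l} = span {U l - U (Suc l)}"
    using span_singleton_uminus[of "U l - U (Suc l)"] by simp
  then show "U (Suc l) \<notin> span {U l - U (Suc l)}" using *[of "U l" "U (Suc l)"] pair' assms by auto
qed

lemma U_nonzero: "l < k \<Longrightarrow> U l \<noteq> 0"
proof -
  assume "l < k"
  show "U l \<noteq> 0"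
  proof (cases "Suc l < k")
    case True
    then show ?thesis using pair'(2)[OF True] span_zero by metis
  next
    case False
    then have "Suc (l - 1) < k" "Suc (l - 1) = l" using k \<open>l < k\<close> by auto
    then show ?thesis using pair'(1)[of "l - 1"] span_zero by metis
  qed
qed

text \<open>The step arriving at bend \<open>lo\<close> and the one leaving bend \<open>hi\<close>
  are the steps next to the new line that are not parallel to it. They are the witnesses for
  nonconstant functionals below.\<close>

lemma new_indep:
  assumes "new lo hi v"
  shows "U (lo - 1) \<notin> span {v}" "U hi \<notin> span {v}" "v \<noteq> 0"
proof -
  have lo: "Suc (lo - 1) = lo" using assms by (auto simp: new_def)
  have "U (lo - 1) \<notin> span {v} \<and> U hi \<notin> span {v}"
  proof (cases "hi = Suc lo")
    case True
    then have "v = U lo" "Suc lo < k" using assms by (auto simp: new_def)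
    then show ?thesis using pair'(1)[of lo] pair'(2)[of "lo - 1"] lo True by auto
  next
    case False
    then have "v = U (lo - 1) - U lo" "lo < k" "hi = lo" using assms by (auto simp: new_def)
    then show ?thesis using pair_side[of "lo - 1"] lo by auto
  qed
  then show "U (lo - 1) \<notin> span {v}" "U hi \<notin> span {v}" by auto
  show "v \<noteq> 0"
  proof
    assume "v = 0"
    then have "U (lo - 1) = U lo \<or> U lo = 0" using assms by (auto simp: new_def)
    then show False
      using pair'(1)[of "lo - 1"] lo new_range[OF assms] U_nonzero[of lo] span_base[of "U lo" "{U lo}"] by auto
  qed
qed

text \<open>A subspace containing the new direction passes from one step to its neighbour: for an
  inner step trivially, for an additional ray because its direction is the difference of the two
  steps at the bend. Repeated use collects consecutive steps in \<open>W\<close>.\<close>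

lemma new_step:
  assumes "new lo hi v" "subspace W" "v \<in> W"
  shows "U (lo - 1) \<in> W \<Longrightarrow> U lo \<in> W" "U hi \<in> W \<Longrightarrow> U (hi - 1) \<in> W"
proof -
  consider "hi = Suc lo" "v = U lo" | "hi = lo" "v = U (lo - 1) - U lo" using assms(1) by (auto simp: new_def)
  then have "(U (lo - 1) \<in> W \<longrightarrow> U lo \<in> W) \<and> (U hi \<in> W \<longrightarrow> U (hi - 1) \<in> W)"
  proof cases
    case 1
    then show ?thesis using assms(3) by auto
  next
    case 2
    have "U lo = U (lo - 1) - v" "U (hi - 1) = v + U hi" using 2 by auto
    then show ?thesis using assms(2,3) subspace_diff subspace_add by metis
  qed
  then show "U (lo - 1) \<in> W \<Longrightarrow> U lo \<in> W" "U hi \<in> W \<Longrightarrow> U (hi - 1) \<in> W" by auto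
qed

lemma Q_new: "new lo hi v \<Longrightarrow> Q \<alpha> hi - Q \<alpha> lo \<in> span {v}"
proof -
  assume n: "new lo hi v"
  have lh: "lo \<le> hi" using new_range[OF n] by simp
  show ?thesis
  proof (cases "hi = Suc lo")
    case True
    then have "v = U lo" using n by (auto simp: new_def)
    then show ?thesis using Q_diff[OF lh, of \<alpha>] True by (simp add: span_scale span_base)
  next
    case False
    then have "hi = lo" using n by (auto simp: new_def)
    then show ?thesis by (simp add: span_zero)
  qed
qed

lemma triple': "3 \<le> CARD('n) \<Longrightarrow> Suc (Suc l) < k \<Longrightarrow> U (Suc (Suc l)) \<notin> span {U l, U (Suc l)}"
  using triple unimodular_triple_not_span by blast

lemma plane_contains:
  assumes "U l \<in> span {a, b}" "U (Suc l) \<in> span {a, b}" "Suc l < k"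
  shows "span {a, b} = span {U l, U (Suc l)}"
  using plane_eq[OF assms(1,2)] U_nonzero[of l] pair'(1)[of l] assms(3) by auto

lemma no_three:
  assumes "3 \<le> CARD('n)" "U l \<in> span {a, b}" "U (Suc l) \<in> span {a, b}" "U (Suc (Suc l)) \<in> span {a, b}" "Suc (Suc l) < k"
  shows False
  using plane_contains[OF assms(2,3)] assms(4,5) triple'[OF assms(1,5)] by auto

lemma no_two:
  assumes "U l \<in> span {w}" "U (Suc l) \<in> span {w}" "Suc l < k"
  shows False
proof -
  have "w \<in> span {U l}" using span_singleton_sym[OF assms(1)] U_nonzero assms(3) by simp
  then have "U (Suc l) \<in> span {U l}" using span_singleton_mono assms(2) by blast
  then show False using pair'(1)[OF assms(3)] by simp
qed

text \<open>The form in which avoidance is proved from here on: if it failed, \<open>W\<close> would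
  contain all steps of the interval or all other steps.\<close>

lemma avoid_intervalD:
  assumes n: "\<not> avoid T" and W: "subspace W" and ij: "i \<le> j" "j \<le> k"
    and T: "\<And>\<alpha>. \<alpha> \<in> A \<Longrightarrow> T \<alpha> \<Longrightarrow> (Q \<alpha> j - Q \<alpha> i) + d \<in> W"
  shows "(\<forall>l. i \<le> l \<and> l < j \<longrightarrow> U l \<in> W) \<or> (\<forall>l<k. l < i \<or> j \<le> l \<longrightarrow> U l \<in> W)"
proof (rule ccontr)
  assume "\<not> ?thesis"
  then obtain l1 l2 where l: "i \<le> l1" "l1 < j" "U l1 \<notin> W" "l2 < k" "l2 < i \<or> j \<le> l2" "U l2 \<notin> W" by blast
  have "avoid T"
    by (rule avoid_interval[OF W ij, where d = d and ?l1.0 = l1 and ?l2.0 = l2])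
      (use l T in \<open>auto simp: Q_diff[OF ij(1)]\<close>)
  then show False using n by simp
qed

text \<open>A piece through the vertex \<open>p\<close> ends there, and distinct pieces with a
  common endpoint are not parallel.\<close>

lemma r1_unique: "a \<in> D \<Longrightarrow> p \<in> line a \<Longrightarrow> direction a \<in> span {U 0} \<Longrightarrow> a = r1"
proof (rule ccontr)
  assume a: "a \<in> D" "p \<in> line a" "direction a \<in> span {U 0}" "a \<noteq> r1"
  have "p \<in> nodes_of D" using r1 by (force simp: nodes_of_def)
  then have "p \<in> endpoints a" using general_positionD(5)[OF gp] a by blast
  then show False using general_positionD(6)[OF gp r1 a(1), of p] a by auto
qed

lemma r2_unique: "a \<in> D \<Longrightarrow> q \<in> line a \<Longrightarrow> direction a \<in> span {U (k - 1)} \<Longrightarrow> a = r2"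
proof (rule ccontr)
  assume a: "a \<in> D" "q \<in> line a" "direction a \<in> span {U (k - 1)}" "a \<noteq> r2"
  have "q \<in> nodes_of D" using r2 by (force simp: nodes_of_def)
  then have "q \<in> endpoints a" using general_positionD(5)[OF gp] a by blast
  then have "direction a \<notin> span {- U (k - 1)}" using general_positionD(6)[OF gp r2 a(1), of q] a by auto
  then show False using a by (simp add: span_singleton_uminus)
qed

lemma line_base: "z \<in> line a \<longleftrightarrow> z - base a \<in> span {direction a}"
  by (rule line_span) (auto simp: line_def intro!: image_eqI[of _ _ 0])

section \<open>Unwanted incidences as avoidable conditions\<close>

lemma av_point_new:
  assumes n: "new lo hi v"
  shows "avoid (\<lambda>\<alpha>. z - Q \<alpha> lo \<in> span {v})"
proof (rule ccontr)
  assume *: "\<not> ?thesis"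
  note R = new_range[OF n]
  have "(\<forall>l. 0 \<le> l \<and> l < lo \<longrightarrow> U l \<in> span {v}) \<or> (\<forall>l<k. l < 0 \<or> lo \<le> l \<longrightarrow> U l \<in> span {v})"
  proof (rule avoid_intervalD[OF * _ _ _, where d = "p - z"])
    fix \<alpha> assume "z - Q \<alpha> lo \<in> span {v}"
    then have "- (z - Q \<alpha> lo) \<in> span {v}" by (rule span_neg)
    then show "Q \<alpha> lo - Q \<alpha> 0 + (p - z) \<in> span {v}" by simp
  qed (use R in auto)
  then have "U (lo - 1) \<in> span {v} \<or> U hi \<in> span {v}"
    using R by (metis diff_less less_le_trans less_numeral_extra(1) zero_le zero_less_one)
  then show False using new_indep[OF n] by blast
qed

text \<open>For a bend before \<open>lo\<close> the stretch up to \<open>lo\<close> contains step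
  \<open>lo - 1\<close> and omits step \<open>hi\<close>; for a bend after \<open>hi\<close> the
  stretch from \<open>hi\<close> contains step \<open>hi\<close> and omits \<open>lo - 1\<close>. By
  \<open>new_indep\<close> neither step is parallel to \<open>v\<close>.\<close>

lemma av_node_new:
  assumes n: "new lo hi v" and y: "y < lo \<or> hi < y" "y \<le> k"
  shows "avoid (\<lambda>\<alpha>. Q \<alpha> y - Q \<alpha> lo \<in> span {v})"
proof (rule ccontr)
  assume *: "\<not> ?thesis"
  note R = new_range[OF n]
  have "U (lo - 1) \<in> span {v} \<or> U hi \<in> span {v}"
  proof (cases "y < lo")
    case True
    have "(\<forall>l. y \<le> l \<and> l < lo \<longrightarrow> U l \<in> span {v}) \<or> (\<forall>l<k. l < y \<or> lo \<le> l \<longrightarrow> U l \<in> span {v})"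
    proof (rule avoid_intervalD[OF * _ _ _, where d = 0])
      fix \<alpha> assume "Q \<alpha> y - Q \<alpha> lo \<in> span {v}"
      then have "- (Q \<alpha> y - Q \<alpha> lo) \<in> span {v}" by (rule span_neg)
      then show "Q \<alpha> lo - Q \<alpha> y + 0 \<in> span {v}" by simp
    qed (use R True in auto)
    moreover have "y \<le> lo - 1" "lo - 1 < lo" "lo \<le> hi" "hi < k" using R True by auto
    ultimately show ?thesis by blast
  next
    case False
    then have y': "hi < y" using y by simp
    have "(\<forall>l. hi \<le> l \<and> l < y \<longrightarrow> U l \<in> span {v}) \<or> (\<forall>l<k. l < hi \<or> y \<le> l \<longrightarrow> U l \<in> span {v})"
    proof (rule avoid_intervalD[OF * _ _ _, where d = 0])
      fix \<alpha> assume "Q \<alpha> y - Q \<alpha> lo \<in> span {v}"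
      then have "(Q \<alpha> y - Q \<alpha> lo) - (Q \<alpha> hi - Q \<alpha> lo) \<in> span {v}" using Q_new[OF n] by (rule span_diff)
      then show "Q \<alpha> y - Q \<alpha> hi + 0 \<in> span {v}" by simp
    qed (use R y y' in auto)
    moreover have "lo - 1 < hi" "lo - 1 < k" using R by auto
    ultimately show ?thesis using y' by blast
  qed
  then show False using new_indep[OF n] by blast
qed

text \<open>The exceptions are the bends on the two truncated rays. A direction containing all steps
  on one side of the bend forces that side to be a single step parallel to \<open>a\<close>; the
  incidence would then put \<open>p\<close> or \<open>q\<close> on the line of \<open>a\<close>,
  which only \<open>r1\<close> or \<open>r2\<close> allows. So it is impossible there.\<close>

lemma av_node_old:
  assumes a: "a \<in> D" and y: "1 \<le> y" "y < k" and y1: "y = 1 \<Longrightarrow> a \<noteq> r1" and yk: "y = k - 1 \<Longrightarrow> a \<noteq> r2"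
  shows "avoid (\<lambda>\<alpha>. Q \<alpha> y \<in> line a)"
proof (rule ccontr)
  assume *: "\<not> ?thesis"
  let ?w = "direction a"
  have w: "?w \<noteq> 0" using direction_nonzero general_positionD(2)[OF gp a] by blast
  have "(\<forall>l. 0 \<le> l \<and> l < y \<longrightarrow> U l \<in> span {?w}) \<or> (\<forall>l<k. l < 0 \<or> y \<le> l \<longrightarrow> U l \<in> span {?w})"
  proof (rule avoid_intervalD[OF * _ _ _, where d = "p - base a"])
    fix \<alpha> assume "Q \<alpha> y \<in> line a"
    then show "Q \<alpha> y - Q \<alpha> 0 + (p - base a) \<in> span {?w}" by (simp add: line_base)
  qed (use y in auto)
  then consider "\<And>l. l < y \<Longrightarrow> U l \<in> span {?w}" | "\<And>l. l < k \<Longrightarrow> y \<le> l \<Longrightarrow> U l \<in> span {?w}" by auto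
  then show False
  proof cases
    case 1
    have "y = 1"
    proof (rule ccontr)
      assume "y \<noteq> 1"
      then show False using no_two[of 0 ?w] 1[of 0] 1[of 1] y by simp
    qed
    have U0: "U 0 \<in> span {?w}" using 1[of 0] y by simp
    then have w0: "?w \<in> span {U 0}" using span_singleton_sym U_nonzero[of 0] k by simp
    have "avoid (\<lambda>\<alpha>. Q \<alpha> y \<in> line a)"
    proof (rule avoidable_impossible[OF ne])
      fix \<alpha> assume "\<alpha> \<in> A"
      show "Q \<alpha> y \<notin> line a"
      proof
        assume "Q \<alpha> y \<in> line a"
        moreover have "Q \<alpha> y = p + \<alpha> 0 *\<^sub>R U 0" using \<open>y = 1\<close> by (simp add: Q_def)
        ultimately have "(p + \<alpha> 0 *\<^sub>R U 0 - base a) - \<alpha> 0 *\<^sub>R U 0 \<in> span {?w}"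
          by (rule_tac span_diff[OF _ span_scale[OF U0]]) (simp add: line_base)
        then have "p \<in> line a" by (simp add: line_base)
        then show False using r1_unique[OF a _ w0] y1 \<open>y = 1\<close> by blast
      qed
    qed
    then show False using * by simp
  next
    case 2
    have "y = k - 1"
    proof (rule ccontr)
      assume "y \<noteq> k - 1"
      then show False using no_two[of "k - 2" ?w] 2[of "k - 2"] 2[of "k - 1"] y k
        by (simp add: numeral_2_eq_2 Suc_diff_Suc)
    qed
    have U0: "U (k - 1) \<in> span {?w}" using 2[of "k - 1"] y by simp
    then have w0: "?w \<in> span {U (k - 1)}" using span_singleton_sym U_nonzero[of "k - 1"] k by simp
    have "avoid (\<lambda>\<alpha>. Q \<alpha> y \<in> line a)"
    proof (rule avoidable_impossible[OF ne])
      fix \<alpha> assume \<alpha>: "\<alpha> \<in> A"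
      show "Q \<alpha> y \<notin> line a"
      proof
        assume Ql: "Q \<alpha> y \<in> line a"
        have "Q \<alpha> k - Q \<alpha> y = \<alpha> y *\<^sub>R U y" using Q_diff[of y k \<alpha>] \<open>y = k - 1\<close> k by (cases k) auto
        moreover have "Q \<alpha> k = q" using Q_k[OF \<alpha>] x by simp
        ultimately have qe: "q = Q \<alpha> y + \<alpha> y *\<^sub>R U y" by (simp add: algebra_simps)
        have "(Q \<alpha> y - base a) + \<alpha> y *\<^sub>R U y \<in> span {?w}"
          by (rule span_add[OF _ span_scale]) (use U0 Ql \<open>y = k - 1\<close> in \<open>auto simp: line_base\<close>)
        then have "q \<in> line a" by (simp add: line_base qe algebra_simps)
        then show False using r2_unique[OF a _ w0] yk \<open>y = k - 1\<close> by blast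
      qed
    qed
    then show False using * by simp
  qed
qed

lemma Q_span:
  assumes "subspace W" "i \<le> j" "\<And>l. i \<le> l \<Longrightarrow> l < j \<Longrightarrow> U l \<in> W"
  shows "Q \<alpha> j - Q \<alpha> i \<in> W"
  unfolding Q_diff[OF assms(2)] using assms by (intro subspace_sum subspace_scale) auto

text \<open>The lines meet only if the difference of their base points lies in the span
  \<open>W\<close> of the two directions. If that is not a proper condition, \<open>W\<close>
  contains all steps before or after the new line; three consecutive steps are independent, so only
  one step can be on that side, and there the genericity of its neighbour decides.\<close>

lemma av_new_old:
  assumes n3: "3 \<le> CARD('n)" and n: "new lo hi v" and a: "a \<in> D"
    and lo: "lo = 1 \<Longrightarrow> a \<noteq> r1" and hi: "hi = k - 1 \<Longrightarrow> a \<noteq> r2"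
  shows "avoid (\<lambda>\<alpha>. \<exists>z. z \<in> line a \<and> z - Q \<alpha> lo \<in> span {v})" (is "avoid ?T")
proof (rule ccontr)
  assume *: "\<not> ?thesis"
  note R = new_range[OF n]
  let ?w = "direction a" and ?W = "span {direction a, v}"
  have w: "?w \<noteq> 0" using direction_nonzero general_positionD(2)[OF gp a] by blast
  have W: "subspace ?W" "?w \<in> ?W" "v \<in> ?W" by (simp_all add: span_base)
  have sub: "span {?w} \<subseteq> ?W" "span {v} \<subseteq> ?W" by (intro span_mono; auto)+
  have TW: "Q \<alpha> lo - base a \<in> ?W" if T: "?T \<alpha>" for \<alpha>
  proof -
    obtain z where "z \<in> line a" "z - Q \<alpha> lo \<in> span {v}" using T by blast
    then have "z - base a \<in> ?W" "z - Q \<alpha> lo \<in> ?W" using sub by (auto simp: line_base)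
    then have "(z - base a) - (z - Q \<alpha> lo) \<in> ?W" by (rule span_diff)
    then show ?thesis by simp
  qed
  have "(\<forall>l. 0 \<le> l \<and> l < lo \<longrightarrow> U l \<in> ?W) \<or> (\<forall>l<k. l < 0 \<or> lo \<le> l \<longrightarrow> U l \<in> ?W)"
    by (rule avoid_intervalD[OF * W(1), where d = "p - base a"]) (use R TW in auto)
  then consider "\<And>l. l < lo \<Longrightarrow> U l \<in> ?W" | "\<And>l. l < k \<Longrightarrow> lo \<le> l \<Longrightarrow> U l \<in> ?W" by auto
  then show False
  proof cases
    case 1
    then have Ulo: "U lo \<in> ?W" using new_step(1)[OF n W(1,3)] R by simp
    have lo1: "lo = 1"
    proof (rule ccontr)
      assume "lo \<noteq> 1"
      then have "U 2 \<in> ?W" using 1[of 2] Ulo R by (cases "lo = 2") auto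
      then show False using no_three[OF n3, of 0 ?w v] 1[of 0] 1[of 1] \<open>lo \<noteq> 1\<close> R k by (simp add: numeral_2_eq_2)
    qed
    have U01: "U 0 \<in> ?W" "U 1 \<in> ?W" using 1[of 0] Ulo lo1 by auto
    have nz: "U 0 \<noteq> 0" using U_nonzero[of 0] k by simp
    show False
    proof (cases "?w \<in> span {U 0}")
      case False
      have "?W = span {U 0, ?w}" by (rule plane_eq[OF U01(1) W(2) nz False])
      then show False using gen1[OF n3 a _ False] lo lo1 U01(2) by auto
    next
      case True
      \<comment> \<open>For a piece parallel to the first step the second genericity assumption
        takes over: its offset from \<open>p\<close> lies outside \<open>W\<close>, while every
        admissible intersection would put it inside.\<close>
      have p_nl: "base a - p \<notin> span {U 0}"
      proof
        assume "base a - p \<in> span {U 0}"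
        then have "base a - p \<in> span {?w}"
          using span_singleton_mono[OF span_singleton_sym[OF True w]] by blast
        then have "- (base a - p) \<in> span {?w}" by (rule span_neg)
        then have "p \<in> line a" by (simp add: line_base)
        then show False using r1_unique[OF a _ True] lo lo1 by blast
      qed
      have "base a - p \<notin> ?W"
      proof
        assume "base a - p \<in> ?W"
        then have "?W = span {U 0, base a - p}" using plane_eq[OF U01(1) _ nz p_nl] by blast
        then show False using gen1'[OF n3 a p_nl True] U01(2) by auto
      qed
      moreover have "base a - p \<in> ?W" if T: "?T \<alpha>" for \<alpha>
      proof -
        have "(Q \<alpha> lo - Q \<alpha> 0) - (Q \<alpha> lo - base a) \<in> ?W"
          by (rule span_diff[OF Q_span[OF W(1)] TW[OF T]]) (use 1 in auto)
        then show ?thesis by simp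
      qed
      ultimately have "avoid ?T" by (intro avoidable_impossible[OF ne]) blast
      then show False using * by simp
    qed
  next
    case 2
    then have Uhi: "U (hi - 1) \<in> ?W" "U hi \<in> ?W" using new_step(2)[OF n W(1,3)] R by auto
    have hik: "hi = k - 1"
    proof (rule ccontr)
      assume "hi \<noteq> k - 1"
      then have "U (Suc hi) \<in> ?W" "Suc hi < k" using 2[of "Suc hi"] R by auto
      moreover have "Suc (hi - 1) = hi" using R by auto
      ultimately show False using no_three[OF n3, of "hi - 1" ?w v] Uhi by simp
    qed
    have U01: "U (k - 1) \<in> ?W" "U (k - 2) \<in> ?W" using Uhi hik by (auto simp: numeral_2_eq_2)
    have nz: "U (k - 1) \<noteq> 0" using U_nonzero[of "k - 1"] k by simp
    show False
    proof (cases "?w \<in> span {U (k - 1)}")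
      case False
      have "?W = span {U (k - 1), ?w}" by (rule plane_eq[OF U01(1) W(2) nz False])
      then show False using gen2[OF n3 a _ False] hi hik U01(2) by auto
    next
      case True
      have p_nl: "base a - q \<notin> span {U (k - 1)}"
      proof
        assume "base a - q \<in> span {U (k - 1)}"
        then have "base a - q \<in> span {?w}"
          using span_singleton_mono[OF span_singleton_sym[OF True w]] by blast
        then have "- (base a - q) \<in> span {?w}" by (rule span_neg)
        then have "q \<in> line a" by (simp add: line_base)
        then show False using r2_unique[OF a _ True] hi hik by blast
      qed
      have "base a - q \<notin> ?W"
      proof
        assume "base a - q \<in> ?W"
        then have "?W = span {U (k - 1), base a - q}" using plane_eq[OF U01(1) _ nz p_nl] by blast
        then show False using gen2'[OF n3 a p_nl True] U01(2) by auto
      qed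
      moreover have "base a - q \<in> ?W" if T: "?T \<alpha>" "\<alpha> \<in> A" for \<alpha>
      proof -
        have "Q \<alpha> k - Q \<alpha> lo \<in> ?W"
          by (rule Q_span[OF W(1)]) (use 2 R in auto)
        then have "(Q \<alpha> k - Q \<alpha> lo) + (Q \<alpha> lo - base a) \<in> ?W" using TW[OF T(1)] by (rule span_add)
        then have "q - base a \<in> ?W" using Q_k[OF T(2)] x by simp
        then have "- (q - base a) \<in> ?W" by (rule span_neg)
        then show ?thesis by simp
      qed
      ultimately have "avoid ?T" by (intro avoidable_impossible[OF ne]) blast
      then show False using * by simp
    qed
  qed
qed

text \<open>The interval between the two lines, with the help of \<open>new_step\<close>, would give
  three consecutive steps in a plane. The complement would leave one step at each end of the path;
  the plane then also contains the direction of \<open>r2\<close>, and the genericity of the second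
  step with respect to \<open>r2\<close> is violated.\<close>

lemma av_new_new:
  assumes n3: "3 \<le> CARD('n)" and n: "new lo hi v" and n': "new lo' hi' v'" and lt: "hi < lo'"
  shows "avoid (\<lambda>\<alpha>. \<exists>z. z - Q \<alpha> lo \<in> span {v} \<and> z - Q \<alpha> lo' \<in> span {v'})" (is "avoid ?T")
proof (rule ccontr)
  assume *: "\<not> ?thesis"
  note R = new_range[OF n] new_range[OF n']
  let ?W = "span {v, v'}"
  have W: "subspace ?W" "v \<in> ?W" "v' \<in> ?W" by (simp_all add: span_base)
  have sub: "span {v} \<subseteq> ?W" "span {v'} \<subseteq> ?W" by (intro span_mono; auto)+
  have TW: "Q \<alpha> lo' - Q \<alpha> hi \<in> ?W" if T: "?T \<alpha>" for \<alpha>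
  proof -
    obtain z where "z - Q \<alpha> lo \<in> span {v}" "z - Q \<alpha> lo' \<in> span {v'}" using T by blast
    then have "z - Q \<alpha> lo \<in> ?W" "z - Q \<alpha> lo' \<in> ?W" using sub by auto
    then have "(z - Q \<alpha> lo) - (z - Q \<alpha> lo') \<in> ?W" by (rule span_diff)
    moreover have "Q \<alpha> hi - Q \<alpha> lo \<in> ?W" using Q_new[OF n] sub by blast
    ultimately have "((z - Q \<alpha> lo) - (z - Q \<alpha> lo')) - (Q \<alpha> hi - Q \<alpha> lo) \<in> ?W" by (rule span_diff)
    then show ?thesis by (simp add: algebra_simps)
  qed
  have "(\<forall>l. hi \<le> l \<and> l < lo' \<longrightarrow> U l \<in> ?W) \<or> (\<forall>l<k. l < hi \<or> lo' \<le> l \<longrightarrow> U l \<in> ?W)"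
    by (rule avoid_intervalD[OF * W(1), where d = 0]) (use R TW lt in auto)
  then consider "\<And>l. hi \<le> l \<Longrightarrow> l < lo' \<Longrightarrow> U l \<in> ?W" | "\<And>l. l < k \<Longrightarrow> l < hi \<or> lo' \<le> l \<Longrightarrow> U l \<in> ?W" by auto
  then show False
  proof cases
    case 1
    have "U hi \<in> ?W" using 1[of hi] lt by simp
    moreover have "U (hi - 1) \<in> ?W" using new_step(2)[OF n W(1,2)] calculation by simp
    moreover have "U (Suc hi) \<in> ?W"
    proof (cases "Suc hi = lo'")
      case True
      then show ?thesis using new_step(1)[OF n' W(1,3)] 1[of "lo' - 1"] by auto
    next
      case False
      then show ?thesis using 1[of "Suc hi"] lt by simp
    qed
    moreover have "Suc (hi - 1) = hi" "Suc hi < k" using R lt by auto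
    ultimately show False using no_three[OF n3, of "hi - 1" v v'] by simp
  next
    case 2
    have "lo - 1 < k" "lo - 1 < hi" using R by auto
    then have Ulo: "U lo \<in> ?W" using new_step(1)[OF n W(1,2)] 2[of "lo - 1"] by blast
    have lo1: "lo = 1"
    proof (rule ccontr)
      assume "lo \<noteq> 1"
      then have "U 2 \<in> ?W" using 2[of 2] Ulo R by (cases "lo = 2") auto
      then show False using no_three[OF n3, of 0 v v'] 2[of 0] 2[of 1] \<open>lo \<noteq> 1\<close> R k by (simp add: numeral_2_eq_2)
    qed
    have Uhi: "U (hi' - 1) \<in> ?W" "U hi' \<in> ?W" using new_step(2)[OF n' W(1,3)] 2[of hi'] R by auto
    have hik: "hi' = k - 1"
    proof (rule ccontr)
      assume "hi' \<noteq> k - 1"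
      then have "U (Suc hi') \<in> ?W" "Suc hi' < k" using 2[of "Suc hi'"] R by auto
      moreover have "Suc (hi' - 1) = hi'" using R by auto
      ultimately show False using no_three[OF n3, of "hi' - 1" v v'] Uhi by simp
    qed
    have U01: "U 0 \<in> ?W" "U 1 \<in> ?W" "U (k - 1) \<in> ?W" using 2[of 0] R Ulo lo1 Uhi hik by auto
    have nz: "U 0 \<noteq> 0" "U (k - 1) \<noteq> 0" using U_nonzero[of 0] U_nonzero[of "k - 1"] k by auto
    have Tq: "q - p \<in> ?W" if T: "?T \<alpha>" "\<alpha> \<in> A" for \<alpha>
    proof -
      have "Q \<alpha> hi - Q \<alpha> 0 \<in> ?W" "Q \<alpha> k - Q \<alpha> lo' \<in> ?W"
        by (rule Q_span[OF W(1)]; use 2 R in auto)+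
      then have "(Q \<alpha> hi - Q \<alpha> 0) + (Q \<alpha> k - Q \<alpha> lo') + (Q \<alpha> lo' - Q \<alpha> hi) \<in> ?W"
        using TW[OF T(1)] by (intro span_add)
      then show ?thesis using Q_k[OF T(2)] x by simp
    qed
    show False
    proof (cases "direction r2 \<in> span {U 0}")
      case False
      have "direction r2 \<in> ?W" using U01(3) by (simp add: span_neg)
      then have "?W = span {U 0, direction r2}" using plane_eq[OF U01(1) _ nz(1) False] by blast
      then show False using gen1[OF n3 r2 _ False] r12 U01(2) by auto
    next
      case True
      have p_nl: "base r2 - p \<notin> span {U 0}"
      proof
        assume "base r2 - p \<in> span {U 0}"
        then have "base r2 - p \<in> span {direction r2}"
          using span_singleton_mono[OF span_singleton_sym[OF True]] nz by simp
        then have "- (base r2 - p) \<in> span {direction r2}" by (rule span_neg)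
        then have "p \<in> line r2" by (simp add: line_base)
        then show False using r1_unique[OF r2 _ True] r12 by auto
      qed
      have "q - p \<notin> ?W"
      proof
        assume "q - p \<in> ?W"
        then have "?W = span {U 0, base r2 - p}" using plane_eq[OF U01(1) _ nz(1) p_nl] by simp
        then show False using gen1'[OF n3 r2 p_nl True] U01(2) by auto
      qed
      then have "avoid ?T" using Tq by (intro avoidable_impossible[OF ne]) blast
      then show False using * by simp
    qed
  qed
qed

text \<open>The intact block may lie in any of the four parts, so each of the four values of \<mu>
  has to be told apart from \<mu> by some step.\<close>

lemma avoid_triple:
  assumes ij: "i \<le> j" "j \<le> h" "h \<le> k"
    and \<mu>: "\<And>l. \<mu> l = (if l < i then m0 else if l < j then m1 else if l < h then m2 else m3)"
    and T: "\<And>\<alpha>. \<alpha> \<in> A \<Longrightarrow> T \<alpha> \<Longrightarrow> (\<Sum>l<k. \<alpha> l * (\<mu> l \<bullet> U l)) + c = 0"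
    and l: "\<exists>l<k. (\<mu> l - m0) \<bullet> U l \<noteq> 0" "\<exists>l<k. (\<mu> l - m1) \<bullet> U l \<noteq> 0"
      "\<exists>l<k. (\<mu> l - m2) \<bullet> U l \<noteq> 0" "\<exists>l<k. (\<mu> l - m3) \<bullet> U l \<noteq> 0"
  shows "avoid T"
proof -
  obtain B where B: "full_block U B" "B \<subseteq> {..<k}"
    and B': "B \<subseteq> {..<i} \<or> B \<subseteq> {i..<j} \<or> B \<subseteq> {j..<h} \<or> B \<subseteq> {h..<k}"
    using block_choice[OF ij] .
  have main: "avoid T" if ex: "\<exists>l<k. (\<mu> l - \<mu>0) \<bullet> U l \<noteq> 0" and const: "\<And>l. l \<in> B \<Longrightarrow> \<mu> l = \<mu>0" for \<mu>0
  proof -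
    obtain l where "l < k" "(\<mu> l - \<mu>0) \<bullet> U l \<noteq> 0" using ex by blast
    then show ?thesis using T by (intro avoidable_region[OF ne B const])
  qed
  from B' show ?thesis
  proof (elim disjE)
    assume "B \<subseteq> {..<i}" then show ?thesis by (intro main[OF l(1)]) (auto simp: \<mu>)
  next
    assume "B \<subseteq> {i..<j}" then show ?thesis by (intro main[OF l(2)]) (auto simp: \<mu>)
  next
    assume "B \<subseteq> {j..<h}" then show ?thesis using ij by (intro main[OF l(3)]) (auto simp: \<mu>)
  next
    assume "B \<subseteq> {h..<k}" then show ?thesis using ij by (intro main[OF l(4)]) (auto simp: \<mu>)
  qed
qed

lemma inner_Q: "j \<le> k \<Longrightarrow> N \<bullet> Q \<alpha> j = N \<bullet> p + (\<Sum>l<k. \<alpha> l * ((if l < j then N else 0) \<bullet> U l))"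
proof -
  assume j: "j \<le> k"
  have "(\<Sum>l<k. \<alpha> l * ((if l < j then N else 0) \<bullet> U l)) = (\<Sum>l<j. \<alpha> l * ((if l < j then N else 0) \<bullet> U l))"
    by (rule sum.mono_neutral_right) (use j in auto)
  also have "\<dots> = (\<Sum>l<j. \<alpha> l * (N \<bullet> U l))" by (rule sum.cong) auto
  finally show ?thesis by (simp add: Q_def inner_add_right inner_sum_right)
qed

text \<open>Normals with sum zero eliminate the common point \<open>z\<close> and leave
  \<open>N0 . base a + N1 . Q hi + N2 . Q lo' = 0\<close>, an affine condition on the
  lengths.\<close>

lemma av_old_new_new:
  assumes two: "CARD('n) = 2" and a: "a \<in> D" and n: "new lo hi v" and n': "new lo' hi' v'" and lt: "hi < lo'"
  shows "avoid (\<lambda>\<alpha>. \<exists>z. z \<in> line a \<and> z - Q \<alpha> lo \<in> span {v} \<and> z - Q \<alpha> lo' \<in> span {v'} \<and>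
     v \<notin> span {direction a} \<and> v' \<notin> span {direction a} \<and> v' \<notin> span {v})" (is "avoid ?T")
proof (cases "v \<notin> span {direction a} \<and> v' \<notin> span {direction a} \<and> v' \<notin> span {v}")
  case False
  then show ?thesis by (intro avoidable_impossible[OF ne]) blast
next
  case True
  note R = new_range[OF n] new_range[OF n']
  have w: "direction a \<noteq> 0" using direction_nonzero general_positionD(2)[OF gp a] by blast
  obtain N0 N1 N2 where N: "N0 + N1 + N2 = 0" "N0 \<bullet> direction a = 0" "N1 \<bullet> v = 0" "N2 \<bullet> v' = 0"
    "\<And>z. N0 \<bullet> z = 0 \<Longrightarrow> z \<in> span {direction a}" "\<And>z. N1 \<bullet> z = 0 \<Longrightarrow> z \<in> span {v}"
    "\<And>z. N2 \<bullet> z = 0 \<Longrightarrow> z \<in> span {v'}"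
    using concurrency_normals[OF two w new_indep(3)[OF n]] True by metis
  \<comment> \<open>A step before \<open>hi\<close> moves both bends and counts with
    \<open>N1 + N2 = - N0\<close>; one between \<open>hi\<close> and \<open>lo'\<close> moves only
    the second. The third cut repeats \<open>lo'\<close>.\<close>
  let ?\<mu> = "\<lambda>l. if l < hi then - N0 else if l < lo' then N2 else if l < lo' then 0 else 0"
  have N12: "N1 + N2 = - N0" using N(1) by (metis add.assoc eq_neg_iff_add_eq_0 add.commute)
  have orth: "M \<bullet> d = 0" if "M \<bullet> e = 0" "d \<in> span {e}" for M d e :: "real ^ 'n"
    using that by (auto simp: span_singleton)
  show ?thesis
  proof (rule avoid_triple[where \<mu> = ?\<mu> and c = "- (N0 \<bullet> p) + N0 \<bullet> base a" and ?m0.0 = "- N0"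
      and ?m1.0 = N2 and ?m2.0 = 0 and ?m3.0 = 0])
    show "hi \<le> lo'" "lo' \<le> lo'" "lo' \<le> k" using lt R by auto
    fix \<alpha> assume "?T \<alpha>"
    then obtain z where z: "z \<in> line a" "z - Q \<alpha> lo \<in> span {v}" "z - Q \<alpha> lo' \<in> span {v'}" by blast
    have "(z - Q \<alpha> lo) - (Q \<alpha> hi - Q \<alpha> lo) \<in> span {v}" using z(2) Q_new[OF n] by (rule span_diff)
    then have z2: "z - Q \<alpha> hi \<in> span {v}" by simp
    have "N0 \<bullet> (z - base a) = 0" "N1 \<bullet> (z - Q \<alpha> hi) = 0" "N2 \<bullet> (z - Q \<alpha> lo') = 0"
      using orth[OF N(2)] orth[OF N(3) z2] orth[OF N(4) z(3)] z(1) by (auto simp: line_base)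
    then have "(N0 + N1 + N2) \<bullet> z = N0 \<bullet> base a + N1 \<bullet> Q \<alpha> hi + N2 \<bullet> Q \<alpha> lo'"
      by (simp add: inner_diff_right inner_add_left)
    then have 0: "N0 \<bullet> base a + N1 \<bullet> Q \<alpha> hi + N2 \<bullet> Q \<alpha> lo' = 0" using N(1) by simp
    have "(\<Sum>l<k. \<alpha> l * (?\<mu> l \<bullet> U l)) =
       (\<Sum>l<k. \<alpha> l * ((if l < hi then N1 else 0) \<bullet> U l)) + (\<Sum>l<k. \<alpha> l * ((if l < lo' then N2 else 0) \<bullet> U l))"
      unfolding sum.distrib[symmetric] by (rule sum.cong) (use lt in \<open>auto simp: N12[symmetric] inner_add_left algebra_simps\<close>)
    also have "\<dots> = N1 \<bullet> Q \<alpha> hi - N1 \<bullet> p + (N2 \<bullet> Q \<alpha> lo' - N2 \<bullet> p)"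
      using inner_Q[of hi N1 \<alpha>] inner_Q[of lo' N2 \<alpha>] R by simp
    finally show "(\<Sum>l<k. \<alpha> l * (?\<mu> l \<bullet> U l)) + (- (N0 \<bullet> p) + N0 \<bullet> base a) = 0"
      using 0 arg_cong[OF N12, of "\<lambda>y. y \<bullet> p"] by (simp add: inner_add_left)
  next
    \<comment> \<open>The differences of neighbouring values of \<mu> are the normals up to sign,
      and steps next to a new line are not orthogonal to its normal.\<close>
    have "N1 \<bullet> U hi \<noteq> 0" using N(6) new_indep(2)[OF n] by blast
    moreover have "N2 + N0 = - N1" using N(1) by (simp add: eq_neg_iff_add_eq_0 algebra_simps)
    ultimately show "\<exists>l<k. (?\<mu> l - - N0) \<bullet> U l \<noteq> 0"
      using R lt by (intro exI[of _ hi]) (simp add: inner_add_left[symmetric])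
    have "N1 \<bullet> U (lo - 1) \<noteq> 0" using N(6) new_indep(1)[OF n] by blast
    moreover have "- N0 - N2 = N1" using N(1) by (simp add: algebra_simps eq_neg_iff_add_eq_0 minus_equation_iff) (metis add_diff_cancel_left' diff_0 N12 add.commute minus_diff_eq)
    moreover have "lo - 1 < hi" "lo - 1 < k" using R by auto
    ultimately show "\<exists>l<k. (?\<mu> l - N2) \<bullet> U l \<noteq> 0"
      by (intro exI[of _ "lo - 1"]) simp
    have "N2 \<bullet> U (lo' - 1) \<noteq> 0" using N(7) new_indep(1)[OF n'] by blast
    then show "\<exists>l<k. (?\<mu> l - 0) \<bullet> U l \<noteq> 0" "\<exists>l<k. (?\<mu> l - 0) \<bullet> U l \<noteq> 0"
      using R lt by (auto intro!: exI[of _ "lo' - 1"])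
  qed simp
qed

text \<open>Here all three lines move. The coefficient functions are 0, \<open>- N0\<close>,
  \<open>N2\<close>, 0 with three genuine cuts, the case that calls for four blocks.\<close>

lemma av_new_new_new:
  assumes two: "CARD('n) = 2" and n: "new lo hi v" and n': "new lo' hi' v'" and n'': "new lo'' hi'' v''"
    and lt: "hi < lo'" "hi' < lo''"
  shows "avoid (\<lambda>\<alpha>. \<exists>z. z - Q \<alpha> lo \<in> span {v} \<and> z - Q \<alpha> lo' \<in> span {v'} \<and> z - Q \<alpha> lo'' \<in> span {v''} \<and>
     v' \<notin> span {v} \<and> v'' \<notin> span {v} \<and> v'' \<notin> span {v'})" (is "avoid ?T")
proof (cases "v' \<notin> span {v} \<and> v'' \<notin> span {v} \<and> v'' \<notin> span {v'}")
  case False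
  then show ?thesis by (intro avoidable_impossible[OF ne]) blast
next
  case True
  note R = new_range[OF n] new_range[OF n'] new_range[OF n'']
  obtain N0 N1 N2 where N: "N0 + N1 + N2 = 0" "N0 \<bullet> v = 0" "N1 \<bullet> v' = 0" "N2 \<bullet> v'' = 0"
    "\<And>z. N0 \<bullet> z = 0 \<Longrightarrow> z \<in> span {v}" "\<And>z. N1 \<bullet> z = 0 \<Longrightarrow> z \<in> span {v'}"
    "\<And>z. N2 \<bullet> z = 0 \<Longrightarrow> z \<in> span {v''}"
    using concurrency_normals[OF two new_indep(3)[OF n] new_indep(3)[OF n']] True by metis
  let ?\<mu> = "\<lambda>l. if l < hi then 0 else if l < lo' then - N0 else if l < lo'' then N2 else 0"
  have N12: "N1 + N2 = - N0" using N(1) by (metis add.assoc eq_neg_iff_add_eq_0 add.commute)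
  have orth: "M \<bullet> d = 0" if "M \<bullet> e = 0" "d \<in> span {e}" for M d e :: "real ^ 'n"
    using that by (auto simp: span_singleton)
  show ?thesis
  proof (rule avoid_triple[where \<mu> = ?\<mu> and c = 0 and ?m0.0 = 0 and ?m1.0 = "- N0" and ?m2.0 = N2 and ?m3.0 = 0])
    show "hi \<le> lo'" "lo' \<le> lo''" "lo'' \<le> k" using lt R by auto
    fix \<alpha> assume "?T \<alpha>"
    then obtain z where z: "z - Q \<alpha> lo \<in> span {v}" "z - Q \<alpha> lo' \<in> span {v'}" "z - Q \<alpha> lo'' \<in> span {v''}" by blast
    have "(z - Q \<alpha> lo) - (Q \<alpha> hi - Q \<alpha> lo) \<in> span {v}" using z(1) Q_new[OF n] by (rule span_diff)
    then have z1: "z - Q \<alpha> hi \<in> span {v}" by simp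
    have "N0 \<bullet> (z - Q \<alpha> hi) = 0" "N1 \<bullet> (z - Q \<alpha> lo') = 0" "N2 \<bullet> (z - Q \<alpha> lo'') = 0"
      using orth[OF N(2) z1] orth[OF N(3) z(2)] orth[OF N(4) z(3)] by auto
    then have "(N0 + N1 + N2) \<bullet> z = N0 \<bullet> Q \<alpha> hi + N1 \<bullet> Q \<alpha> lo' + N2 \<bullet> Q \<alpha> lo''"
      by (simp add: inner_diff_right inner_add_left)
    then have 0: "N0 \<bullet> Q \<alpha> hi + N1 \<bullet> Q \<alpha> lo' + N2 \<bullet> Q \<alpha> lo'' = 0" using N(1) by simp
    have N012: "N0 \<bullet> y + (N1 \<bullet> y + N2 \<bullet> y) = 0" for y
      using arg_cong[OF N(1), of "\<lambda>M. M \<bullet> y"] by (simp add: inner_add_left)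
    have "(\<Sum>l<k. \<alpha> l * (?\<mu> l \<bullet> U l)) =
       (\<Sum>l<k. \<alpha> l * ((if l < hi then N0 else 0) \<bullet> U l)) + ((\<Sum>l<k. \<alpha> l * ((if l < lo' then N1 else 0) \<bullet> U l))
         + (\<Sum>l<k. \<alpha> l * ((if l < lo'' then N2 else 0) \<bullet> U l)))"
      unfolding sum.distrib[symmetric]
    proof (rule sum.cong)
      fix l
      show "\<alpha> l * (?\<mu> l \<bullet> U l) = \<alpha> l * ((if l < hi then N0 else 0) \<bullet> U l) +
          (\<alpha> l * ((if l < lo' then N1 else 0) \<bullet> U l) + \<alpha> l * ((if l < lo'' then N2 else 0) \<bullet> U l))"
        unfolding distrib_left[symmetric]
        by (rule arg_cong[where f = "\<lambda>t. \<alpha> l * t"]) (use lt R N012[of "U l"] in auto)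
    qed simp
    also have "\<dots> = N0 \<bullet> Q \<alpha> hi - N0 \<bullet> p + ((N1 \<bullet> Q \<alpha> lo' - N1 \<bullet> p) + (N2 \<bullet> Q \<alpha> lo'' - N2 \<bullet> p))"
      using inner_Q[of hi N0 \<alpha>] inner_Q[of lo' N1 \<alpha>] inner_Q[of lo'' N2 \<alpha>] R by simp
    finally show "(\<Sum>l<k. \<alpha> l * (?\<mu> l \<bullet> U l)) + 0 = 0"
      using 0 N012[of p] by simp
  next
    have "N0 \<bullet> U hi \<noteq> 0" using N(5) new_indep(2)[OF n] by blast
    then show "\<exists>l<k. (?\<mu> l - 0) \<bullet> U l \<noteq> 0" "\<exists>l<k. (?\<mu> l - 0) \<bullet> U l \<noteq> 0"
      using R lt by (auto intro!: exI[of _ hi])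
    have "N0 \<bullet> U (lo - 1) \<noteq> 0" using N(5) new_indep(1)[OF n] by blast
    moreover have "lo - 1 < hi" "lo - 1 < k" using R by auto
    ultimately show "\<exists>l<k. (?\<mu> l - - N0) \<bullet> U l \<noteq> 0"
      by (intro exI[of _ "lo - 1"]) simp
    have "N2 \<bullet> U hi'' \<noteq> 0" using N(7) new_indep(2)[OF n''] by blast
    moreover have "\<not> hi'' < hi" "\<not> hi'' < lo'" "\<not> hi'' < lo''" "hi'' < k" using R lt by auto
    ultimately show "\<exists>l<k. (?\<mu> l - N2) \<bullet> U l \<noteq> 0"
      by (intro exI[of _ hi'']) simp
  qed simp
qed

text \<open>Two nonparallel old lines have at most one common point, so this is the avoidance of a
  fixed point.\<close>

lemma av_crossing_new:
  assumes n: "new lo hi v" and np: "direction b \<notin> span {direction a}"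
  shows "avoid (\<lambda>\<alpha>. \<exists>z. z \<in> line a \<and> z \<in> line b \<and> z - Q \<alpha> lo \<in> span {v})"
proof (cases "\<exists>z. z \<in> line a \<and> z \<in> line b")
  case True
  then obtain z where z: "z \<in> line a" "z \<in> line b" by blast
  have "(\<lambda>\<alpha>. \<exists>z. z \<in> line a \<and> z \<in> line b \<and> z - Q \<alpha> lo \<in> span {v}) = (\<lambda>\<alpha>. z - Q \<alpha> lo \<in> span {v})"
    using line_unique[OF _ _ z np] z by (intro ext iffI) blast+
  then show ?thesis using av_point_new[OF n, of z] by simp
next
  case False
  then show ?thesis by (intro avoidable_impossible[OF ne]) blast
qed

end

section \<open>One generic choice of all step lengths\<close>

context join
begin

abbreviation "meets \<alpha> lo v z \<equiv> z - Q \<alpha> lo \<in> span {v}"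

lemma finite_new: "finite {(lo, hi, v). new lo hi v}"
proof -
  have "{(lo, hi, v). new lo hi v} \<subseteq> {..<k} \<times> {..<k} \<times> (U ` {..<k} \<union> (\<lambda>l. U (l - 1) - U l) ` {..<k})"
    by (auto simp: new_def)
  then show ?thesis by (rule finite_subset) auto
qed

lemma finite_nodes: "finite (nodes_of D)"
proof -
  have "finite (endpoints a)" for a :: "'n piece" by (cases a) auto
  then show ?thesis using general_positionD(1)[OF gp] by (auto simp: nodes_of_def)
qed

text \<open>There are finitely many new lines, old pieces and bends, so each kind of condition is
  indexed by a finite set and \<open>avoid_all\<close> handles them together. The conclusions
  reappear in the same order as assumptions of the locale \<open>joined\<close>.\<close>

lemma generic_lengths:
  assumes "\<alpha>0 \<in> A" "\<And>l. l < k \<Longrightarrow> 0 < \<alpha>0 l"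
  obtains \<alpha> where "\<alpha> \<in> A" "\<And>l. l < k \<Longrightarrow> 0 < \<alpha> l"
    "\<And>z lo hi v. z \<in> nodes_of D \<Longrightarrow> new lo hi v \<Longrightarrow> \<not> meets \<alpha> lo v z"
    "\<And>y lo hi v. y \<le> k \<Longrightarrow> new lo hi v \<Longrightarrow> y < lo \<or> hi < y \<Longrightarrow> \<not> meets \<alpha> lo v (Q \<alpha> y)"
    "\<And>y a. 1 \<le> y \<Longrightarrow> y < k \<Longrightarrow> a \<in> D \<Longrightarrow> (y = 1 \<Longrightarrow> a \<noteq> r1) \<Longrightarrow> (y = k - 1 \<Longrightarrow> a \<noteq> r2) \<Longrightarrow> Q \<alpha> y \<notin> line a"
    "\<And>a lo hi v z. 3 \<le> CARD('n) \<Longrightarrow> a \<in> D \<Longrightarrow> new lo hi v \<Longrightarrow> (lo = 1 \<Longrightarrow> a \<noteq> r1) \<Longrightarrow>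
      (hi = k - 1 \<Longrightarrow> a \<noteq> r2) \<Longrightarrow> z \<in> line a \<Longrightarrow> \<not> meets \<alpha> lo v z"
    "\<And>lo hi v lo' hi' v' z. 3 \<le> CARD('n) \<Longrightarrow> new lo hi v \<Longrightarrow> new lo' hi' v' \<Longrightarrow> hi < lo' \<Longrightarrow>
      meets \<alpha> lo v z \<Longrightarrow> \<not> meets \<alpha> lo' v' z"
    "\<And>a b lo hi v z. a \<in> D \<Longrightarrow> b \<in> D \<Longrightarrow> direction b \<notin> span {direction a} \<Longrightarrow> new lo hi v \<Longrightarrow>
      z \<in> line a \<Longrightarrow> z \<in> line b \<Longrightarrow> \<not> meets \<alpha> lo v z"
    "\<And>a lo hi v lo' hi' v' z. CARD('n) = 2 \<Longrightarrow> a \<in> D \<Longrightarrow> new lo hi v \<Longrightarrow> new lo' hi' v' \<Longrightarrow> hi < lo' \<Longrightarrow>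
      v \<notin> span {direction a} \<Longrightarrow> v' \<notin> span {direction a} \<Longrightarrow> v' \<notin> span {v} \<Longrightarrow>
      z \<in> line a \<Longrightarrow> meets \<alpha> lo v z \<Longrightarrow> \<not> meets \<alpha> lo' v' z"
    "\<And>lo hi v lo' hi' v' lo'' hi'' v'' z. CARD('n) = 2 \<Longrightarrow> new lo hi v \<Longrightarrow> new lo' hi' v' \<Longrightarrow> new lo'' hi'' v'' \<Longrightarrow>
      hi < lo' \<Longrightarrow> hi' < lo'' \<Longrightarrow> v' \<notin> span {v} \<Longrightarrow> v'' \<notin> span {v} \<Longrightarrow> v'' \<notin> span {v'} \<Longrightarrow>
      meets \<alpha> lo v z \<Longrightarrow> meets \<alpha> lo' v' z \<Longrightarrow> \<not> meets \<alpha> lo'' v'' z"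
proof -
  let ?N = "{(lo, hi, v). new lo hi v}"
  define E1 where "E1 = (\<lambda>(z, lo, hi :: nat, v) \<alpha>. meets \<alpha> lo v z)"
  define E2 where "E2 = (\<lambda>(y, lo, hi :: nat, v) \<alpha>. meets \<alpha> lo v (Q \<alpha> y))"
  define E3 where "E3 = (\<lambda>(y, a) \<alpha>. Q \<alpha> y \<in> line a)"
  define E4 where "E4 = (\<lambda>(a, lo, hi :: nat, v) \<alpha>. \<exists>z. z \<in> line a \<and> meets \<alpha> lo v z)"
  define E5 where "E5 = (\<lambda>((lo, hi :: nat, v), (lo', hi' :: nat, v')) \<alpha>. \<exists>z. meets \<alpha> lo v z \<and> meets \<alpha> lo' v' z)"
  define E6 where "E6 = (\<lambda>((a, b), (lo, hi :: nat, v)) \<alpha>. \<exists>z. z \<in> line a \<and> z \<in> line b \<and> meets \<alpha> lo v z)"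
  define E7 where "E7 = (\<lambda>(a, (lo, hi :: nat, v), (lo', hi' :: nat, v')) \<alpha>. \<exists>z. z \<in> line a \<and> meets \<alpha> lo v z \<and> meets \<alpha> lo' v' z \<and>
     v \<notin> span {direction a} \<and> v' \<notin> span {direction a} \<and> v' \<notin> span {v})"
  define E8 where "E8 = (\<lambda>((lo, hi :: nat, v), (lo', hi' :: nat, v'), (lo'', hi'' :: nat, v'')) \<alpha>. \<exists>z. meets \<alpha> lo v z \<and> meets \<alpha> lo' v' z \<and>
     meets \<alpha> lo'' v'' z \<and> v' \<notin> span {v} \<and> v'' \<notin> span {v} \<and> v'' \<notin> span {v'})"
  define I1 where "I1 = nodes_of D \<times> ?N"
  define I2 where "I2 = {(y, lo, hi, v). (y, lo, hi, v) \<in> {..k} \<times> ?N \<and> (y < lo \<or> hi < y)}"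
  define I3 where "I3 = {(y, a). (y, a) \<in> {1..<k} \<times> D \<and> (y = 1 \<longrightarrow> a \<noteq> r1) \<and> (y = k - 1 \<longrightarrow> a \<noteq> r2)}"
  define I4 where "I4 = {(a, lo, hi, v). (a, lo, hi, v) \<in> D \<times> ?N \<and> 3 \<le> CARD('n) \<and> (lo = 1 \<longrightarrow> a \<noteq> r1) \<and> (hi = k - 1 \<longrightarrow> a \<noteq> r2)}"
  define I5 where "I5 = {((lo, hi, v), (lo', hi', v')). ((lo, hi, v), (lo', hi', v')) \<in> ?N \<times> ?N \<and> 3 \<le> CARD('n) \<and> hi < lo'}"
  define I6 where "I6 = {((a, b), (lo, hi, v)). ((a, b), (lo, hi, v)) \<in> (D \<times> D) \<times> ?N \<and> direction b \<notin> span {direction a}}"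
  define I7 where "I7 = {(a, (lo, hi, v), (lo', hi', v')). (a, (lo, hi, v), (lo', hi', v')) \<in> D \<times> ?N \<times> ?N \<and> CARD('n) = 2 \<and> hi < lo'}"
  define I8 where "I8 = {((lo, hi, v), (lo', hi', v'), (lo'', hi'', v'')).
     ((lo, hi, v), (lo', hi', v'), (lo'', hi'', v'')) \<in> ?N \<times> ?N \<times> ?N \<and> CARD('n) = 2 \<and> hi < lo' \<and> hi' < lo''}"
  define S where "S = E1 ` I1 \<union> E2 ` I2 \<union> E3 ` I3 \<union> E4 ` I4 \<union> E5 ` I5 \<union> E6 ` I6 \<union> E7 ` I7 \<union> E8 ` I8"
  note fin = finite_new finite_nodes general_positionD(1)[OF gp]
  have fins: "finite I1" "finite I2" "finite I3" "finite I4" "finite I5" "finite I6" "finite I7" "finite I8"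
  proof -
    show "finite I1" unfolding I1_def using fin by simp
    show "finite I2" unfolding I2_def by (rule finite_subset[of _ "{..k} \<times> ?N"]) (use fin in auto)
    show "finite I3" unfolding I3_def by (rule finite_subset[of _ "{1..<k} \<times> D"]) (use fin in auto)
    show "finite I4" unfolding I4_def by (rule finite_subset[of _ "D \<times> ?N"]) (use fin in auto)
    show "finite I5" unfolding I5_def by (rule finite_subset[of _ "?N \<times> ?N"]) (use fin in auto)
    show "finite I6" unfolding I6_def by (rule finite_subset[of _ "(D \<times> D) \<times> ?N"]) (use fin in auto)
    show "finite I7" unfolding I7_def by (rule finite_subset[of _ "D \<times> ?N \<times> ?N"]) (use fin in auto)
    show "finite I8" unfolding I8_def by (rule finite_subset[of _ "?N \<times> ?N \<times> ?N"]) (use fin in auto)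
  qed
  have "finite S" unfolding S_def by (intro finite_UnI finite_imageI fins)
  have "avoid T" if "T \<in> S" for T
    using that unfolding S_def
  proof (elim UnE imageE)
    fix i assume "T = E1 i" "i \<in> I1"
    then show ?thesis using av_point_new by (auto simp: E1_def I1_def)
  next
    fix i assume "T = E2 i" "i \<in> I2"
    then show ?thesis using av_node_new by (auto simp: E2_def I2_def)
  next
    fix i assume "T = E3 i" "i \<in> I3"
    then show ?thesis using av_node_old by (auto simp: E3_def I3_def)
  next
    fix i assume "T = E4 i" "i \<in> I4"
    then show ?thesis using av_new_old by (auto simp: E4_def I4_def)
  next
    fix i assume "T = E5 i" "i \<in> I5"
    then show ?thesis using av_new_new by (auto simp: E5_def I5_def)
  next
    fix i assume "T = E6 i" "i \<in> I6"
    then show ?thesis using av_crossing_new by (auto simp: E6_def I6_def)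
  next
    fix i assume "T = E7 i" "i \<in> I7"
    then show ?thesis using av_old_new_new by (auto simp: E7_def I7_def)
  next
    fix i assume "T = E8 i" "i \<in> I8"
    then show ?thesis using av_new_new_new by (auto simp: E8_def I8_def)
  qed
  from avoid_all[OF \<open>finite S\<close> this assms]
  obtain \<alpha> where \<alpha>: "\<alpha> \<in> A" "\<And>l. l < k \<Longrightarrow> 0 < \<alpha> l" and no: "\<And>T. T \<in> S \<Longrightarrow> \<not> T \<alpha>" by blast
  have no1: "\<not> E1 i \<alpha>" if "i \<in> I1" for i by (rule no) (use that in \<open>simp add: S_def\<close>)
  have no2: "\<not> E2 i \<alpha>" if "i \<in> I2" for i by (rule no) (use that in \<open>simp add: S_def\<close>)
  have no3: "\<not> E3 i \<alpha>" if "i \<in> I3" for i by (rule no) (use that in \<open>simp add: S_def\<close>)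
  have no4: "\<not> E4 i \<alpha>" if "i \<in> I4" for i by (rule no) (use that in \<open>simp add: S_def\<close>)
  have no5: "\<not> E5 i \<alpha>" if "i \<in> I5" for i by (rule no) (use that in \<open>simp add: S_def\<close>)
  have no6: "\<not> E6 i \<alpha>" if "i \<in> I6" for i by (rule no) (use that in \<open>simp add: S_def\<close>)
  have no7: "\<not> E7 i \<alpha>" if "i \<in> I7" for i by (rule no) (use that in \<open>simp add: S_def\<close>)
  have no8: "\<not> E8 i \<alpha>" if "i \<in> I8" for i by (rule no) (use that in \<open>simp add: S_def\<close>)
  show thesis
  proof (rule that[OF \<alpha>])
    show "\<not> meets \<alpha> lo v z" if "z \<in> nodes_of D" "new lo hi v" for z lo hi v
      using no1[of "(z, lo, hi, v)"] that by (auto simp: E1_def I1_def)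
    show "\<not> meets \<alpha> lo v (Q \<alpha> y)" if "y \<le> k" "new lo hi v" "y < lo \<or> hi < y" for y lo hi v
      using no2[of "(y, lo, hi, v)"] that by (auto simp: E2_def I2_def)
    show "Q \<alpha> y \<notin> line a" if "1 \<le> y" "y < k" "a \<in> D" "y = 1 \<Longrightarrow> a \<noteq> r1" "y = k - 1 \<Longrightarrow> a \<noteq> r2" for y a
      using no3[of "(y, a)"] that by (auto simp: E3_def I3_def)
    show "\<not> meets \<alpha> lo v z" if "3 \<le> CARD('n)" "a \<in> D" "new lo hi v" "lo = 1 \<Longrightarrow> a \<noteq> r1"
      "hi = k - 1 \<Longrightarrow> a \<noteq> r2" "z \<in> line a" for a lo hi v z
      using no4[of "(a, lo, hi, v)"] that by (auto simp: E4_def I4_def)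
    show "\<not> meets \<alpha> lo' v' z" if "3 \<le> CARD('n)" "new lo hi v" "new lo' hi' v'" "hi < lo'" "meets \<alpha> lo v z" for lo hi v lo' hi' v' z
      using no5[of "((lo, hi, v), (lo', hi', v'))"] that by (auto simp: E5_def I5_def)
    show "\<not> meets \<alpha> lo v z" if "a \<in> D" "b \<in> D" "direction b \<notin> span {direction a}" "new lo hi v"
      "z \<in> line a" "z \<in> line b" for a b lo hi v z
      using no6[of "((a, b), (lo, hi, v))"] that by (auto simp: E6_def I6_def)
    show "\<not> meets \<alpha> lo' v' z" if "CARD('n) = 2" "a \<in> D" "new lo hi v" "new lo' hi' v'" "hi < lo'"
      "v \<notin> span {direction a}" "v' \<notin> span {direction a}" "v' \<notin> span {v}" "z \<in> line a" "meets \<alpha> lo v z" for a lo hi v lo' hi' v' z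
      using no7[of "(a, (lo, hi, v), (lo', hi', v'))"] that by (auto simp: E7_def I7_def)
    show "\<not> meets \<alpha> lo'' v'' z" if "CARD('n) = 2" "new lo hi v" "new lo' hi' v'" "new lo'' hi'' v''" "hi < lo'" "hi' < lo''"
      "v' \<notin> span {v}" "v'' \<notin> span {v}" "v'' \<notin> span {v'}" "meets \<alpha> lo v z" "meets \<alpha> lo' v' z" for lo hi v lo' hi' v' lo'' hi'' v'' z
      using no8[of "((lo, hi, v), (lo', hi', v'), (lo'', hi'', v''))"] that by (auto simp: E8_def I8_def)
  qed
qed

end

section \<open>The configuration after joining two rays\<close>

locale joined = join u k m s p x L D q
  for u :: "nat \<Rightarrow> int ^ 'n::finite" and k m s p x L D q +
  fixes \<alpha> :: "nat \<Rightarrow> real"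
  assumes two: "2 \<le> CARD('n)"
    and \<alpha>: "\<alpha> \<in> A" and pos: "\<And>l. l < k \<Longrightarrow> 0 < \<alpha> l"
    and node_new: "\<And>z lo hi v. z \<in> nodes_of D \<Longrightarrow> new lo hi v \<Longrightarrow> \<not> meets \<alpha> lo v z"
    and Q_new': "\<And>y lo hi v. y \<le> k \<Longrightarrow> new lo hi v \<Longrightarrow> y < lo \<or> hi < y \<Longrightarrow> \<not> meets \<alpha> lo v (Q \<alpha> y)"
    and Q_old: "\<And>y a. 1 \<le> y \<Longrightarrow> y < k \<Longrightarrow> a \<in> D \<Longrightarrow> (y = 1 \<Longrightarrow> a \<noteq> r1) \<Longrightarrow> (y = k - 1 \<Longrightarrow> a \<noteq> r2) \<Longrightarrow> Q \<alpha> y \<notin> line a"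
    and new_old: "\<And>a lo hi v z. 3 \<le> CARD('n) \<Longrightarrow> a \<in> D \<Longrightarrow> new lo hi v \<Longrightarrow> (lo = 1 \<Longrightarrow> a \<noteq> r1) \<Longrightarrow>
      (hi = k - 1 \<Longrightarrow> a \<noteq> r2) \<Longrightarrow> z \<in> line a \<Longrightarrow> \<not> meets \<alpha> lo v z"
    and new_new: "\<And>lo hi v lo' hi' v' z. 3 \<le> CARD('n) \<Longrightarrow> new lo hi v \<Longrightarrow> new lo' hi' v' \<Longrightarrow> hi < lo' \<Longrightarrow>
      meets \<alpha> lo v z \<Longrightarrow> \<not> meets \<alpha> lo' v' z"
    and old_old_new: "\<And>a b lo hi v z. a \<in> D \<Longrightarrow> b \<in> D \<Longrightarrow> direction b \<notin> span {direction a} \<Longrightarrow> new lo hi v \<Longrightarrow>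
      z \<in> line a \<Longrightarrow> z \<in> line b \<Longrightarrow> \<not> meets \<alpha> lo v z"
    and old_new_new: "\<And>a lo hi v lo' hi' v' z. CARD('n) = 2 \<Longrightarrow> a \<in> D \<Longrightarrow> new lo hi v \<Longrightarrow> new lo' hi' v' \<Longrightarrow> hi < lo' \<Longrightarrow>
      v \<notin> span {direction a} \<Longrightarrow> v' \<notin> span {direction a} \<Longrightarrow> v' \<notin> span {v} \<Longrightarrow>
      z \<in> line a \<Longrightarrow> meets \<alpha> lo v z \<Longrightarrow> \<not> meets \<alpha> lo' v' z"
    and new_new_new: "\<And>lo hi v lo' hi' v' lo'' hi'' v'' z. CARD('n) = 2 \<Longrightarrow> new lo hi v \<Longrightarrow> new lo' hi' v' \<Longrightarrow> new lo'' hi'' v'' \<Longrightarrow>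
      hi < lo' \<Longrightarrow> hi' < lo'' \<Longrightarrow> v' \<notin> span {v} \<Longrightarrow> v'' \<notin> span {v} \<Longrightarrow> v'' \<notin> span {v'} \<Longrightarrow>
      meets \<alpha> lo v z \<Longrightarrow> meets \<alpha> lo' v' z \<Longrightarrow> \<not> meets \<alpha> lo'' v'' z"
begin

abbreviation "X \<equiv> Q \<alpha>"

definition seg :: "nat \<Rightarrow> 'n piece" where "seg l = Segment (X l) (X (Suc l))"

text \<open>Incoming minus outgoing direction: together with the two steps leaving the bend,
  \<open>- U (l - 1)\<close> and \<open>U l\<close>, the ray balances to zero.\<close>

definition side :: "nat \<Rightarrow> 'n piece" where "side l = Ray (X l) (U (l - 1) - U l)"

definition D' :: "'n piece set" where
  "D' = (D - {r1, r2}) \<union> seg ` {..<k} \<union> side ` {1..<k}"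

text \<open>Each piece of \<open>D'\<close> is an old one, possibly shortened on its own line, or a
  piece on a new line; the case analyses below follow this division into \<open>trunc\<close> and
  \<open>fresh\<close>.\<close>

definition trunc :: "'n piece \<Rightarrow> 'n piece" where
  "trunc a = (if a = r1 then seg 0 else if a = r2 then seg (k - 1) else a)"

definition fresh :: "nat \<Rightarrow> nat \<Rightarrow> 'n piece" where
  "fresh lo hi = (if hi = lo then side lo else seg lo)"

lemma D'_cases:
  assumes "a \<in> D'"
  obtains b where "b \<in> D" "a = trunc b" | lo hi v where "new lo hi v" "a = fresh lo hi"
  using assms unfolding D'_def
proof (elim UnE)
  assume a: "a \<in> D - {r1, r2}"
  then show thesis by (intro that(1)[of a]) (auto simp: trunc_def)
next
  assume "a \<in> seg ` {..<k}"
  then obtain l where l: "l < k" "a = seg l" by auto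
  show thesis
  \<comment> \<open>The first and the last step lie on the lines of \<open>r1\<close> and
    \<open>r2\<close> and therefore count as old.\<close>
  proof (cases "l = 0 \<or> l = k - 1")
    case True
    then show thesis using l r1 r2 r12 that(1)[of r1] that(1)[of r2] by (auto simp: trunc_def)
  next
    case False
    then show thesis using l by (intro that(2)[of l "Suc l" "U l"]) (auto simp: new_def fresh_def)
  qed
next
  assume "a \<in> side ` {1..<k}"
  then obtain l where l: "1 \<le> l" "l < k" "a = side l" by auto
  then show thesis by (intro that(2)[of l l "U (l - 1) - U l"]) (auto simp: new_def fresh_def)
qed

lemma trunc_in: "b \<in> D \<Longrightarrow> trunc b \<in> D'"
  using k by (auto simp: trunc_def D'_def)

lemma fresh_in: "new lo hi v \<Longrightarrow> fresh lo hi \<in> D'"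
  by (auto simp: new_def fresh_def D'_def)

lemma X_step: "X (Suc l) - X l = \<alpha> l *\<^sub>R U l"
  using Q_diff[of l "Suc l" \<alpha>] by simp

lemma X_k[simp]: "X k = q" using Q_k[OF \<alpha>] x by simp

lemma side_new: "1 \<le> l \<Longrightarrow> l < k \<Longrightarrow> new l l (U (l - 1) - U l)"
  by (simp add: new_def)

text \<open>No other vertex of the path, its two ends included, lies on the line of the additional
  ray at bend \<open>y\<close>, let alone at the bend itself.\<close>

lemma X_inj: "1 \<le> y \<Longrightarrow> y < k \<Longrightarrow> y' \<le> k \<Longrightarrow> X y' = X y \<longleftrightarrow> y' = y"
proof
  assume y: "1 \<le> y" "y < k" "y' \<le> k" and eq: "X y' = X y"
  show "y' = y"
  proof (rule ccontr)
    assume "y' \<noteq> y"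
    then have "y' < y \<or> y < y'" by auto
    then have "\<not> meets \<alpha> y (U (y - 1) - U y) (X y')" using Q_new'[OF y(3) side_new[OF y(1,2)]] by blast
    then show False using eq by (simp add: span_zero)
  qed
qed simp

lemma X_node: "1 \<le> y \<Longrightarrow> y < k \<Longrightarrow> X y \<notin> nodes_of D"
  using node_new[of "X y" y y] side_new[of y] span_zero by auto

lemma span_scale_eq: "c \<noteq> 0 \<Longrightarrow> span {c *\<^sub>R w} = span {w :: real ^ 'n}"
  using span_image_scale[of "{w}" "\<lambda>_. c"] by simp

lemma seg_direction: "direction (seg l) = \<alpha> l *\<^sub>R U l"
  by (simp add: seg_def X_step)

lemma trunc_direction: "span {direction (trunc a)} = span {direction a}"
proof -
  have "span {direction (seg l)} = span {U l}" if "l < k" for l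
    using span_scale_eq[of "\<alpha> l" "U l"] pos[OF that] by (simp add: seg_direction)
  then show ?thesis using k span_singleton_uminus[of "U (k - 1)"] by (simp add: trunc_def)
qed

lemma line_mem: "y \<in> line a \<Longrightarrow> z \<in> line a \<longleftrightarrow> z - y \<in> span {direction a}"
  by (rule line_span)

text \<open>Lets all line conditions on old pieces carry over to their truncations.\<close>

lemma trunc_line: "line (trunc a) = line a"
proof (rule set_eqI)
  fix z
  have b: "base a \<in> line (trunc a)"
  proof -
    have "q \<in> line (seg (k - 1))"
    proof -
      have "Suc (k - 1) = k" using k by simp
      then have "q \<in> endpoints (seg (k - 1))" by (simp add: seg_def)
      then show ?thesis using endpoints_subset_carrier carrier_subset_line by blast
    qed
    moreover have "p \<in> line (seg 0)"
      using endpoints_subset_carrier[of "seg 0"] carrier_subset_line[of "seg 0"] by (auto simp: seg_def)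
    ultimately show ?thesis by (auto simp: trunc_def line_base span_zero)
  qed
  show "z \<in> line (trunc a) \<longleftrightarrow> z \<in> line a"
    using line_mem[OF b, of z] line_base[of z a] trunc_direction by simp
qed

lemma trunc_endpoints:
  "endpoints (trunc a) = endpoints a \<union> (if a = r1 then {X 1} else {}) \<union> (if a = r2 then {X (k - 1)} else {})"
proof -
  have "Suc (k - 1) = k" using k by simp
  then show ?thesis using r12 by (auto simp: trunc_def seg_def)
qed

lemma fresh_facts:
  assumes n: "new lo hi v"
  shows "span {direction (fresh lo hi)} = span {v}" "z \<in> line (fresh lo hi) \<longleftrightarrow> meets \<alpha> lo v z"
    "endpoints (fresh lo hi) = {X lo, X hi}"
proof -
  consider "hi = Suc lo" "v = U lo" | "hi = lo" "v = U (lo - 1) - U lo" using n by (auto simp: new_def)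
  then show 1: "span {direction (fresh lo hi)} = span {v}"
  proof cases
    case 1
    then show ?thesis using span_scale_eq[of "\<alpha> lo" "U lo"] pos[of lo] new_range[OF n] by (simp add: fresh_def seg_direction)
  next
    case 2
    then show ?thesis by (simp add: fresh_def side_def)
  qed
  have "base (fresh lo hi) = X lo" by (simp add: fresh_def side_def seg_def)
  then show "z \<in> line (fresh lo hi) \<longleftrightarrow> meets \<alpha> lo v z" using line_base[of z "fresh lo hi"] 1 by simp
  show "endpoints (fresh lo hi) = {X lo, X hi}"
    using n by (auto simp: fresh_def side_def seg_def new_def)
qed

lemma nodes_D': "nodes_of D' = nodes_of D \<union> X ` {1..<k}"
proof
  show "nodes_of D' \<subseteq> nodes_of D \<union> X ` {1..<k}"
  proof
    fix z assume "z \<in> nodes_of D'"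
    then obtain a where a: "a \<in> D'" "z \<in> endpoints a" by (auto simp: nodes_of_def)
    from a(1) show "z \<in> nodes_of D \<union> X ` {1..<k}"
    proof (cases rule: D'_cases)
      case (1 b)
      have "z \<in> nodes_of D" if "z \<in> endpoints b" using that 1(1) unfolding nodes_of_def by blast
      then show ?thesis using a(2) k unfolding 1(2) trunc_endpoints by (auto split: if_splits simp del: endpoints.simps)
    next
      case (2 lo hi v)
      then show ?thesis using a(2) new_range[OF 2(1)] fresh_facts(3)[OF 2(1)] by auto
    qed
  qed
  show "nodes_of D \<union> X ` {1..<k} \<subseteq> nodes_of D'"
  proof
    fix z assume "z \<in> nodes_of D \<union> X ` {1..<k}"
    then consider b where "b \<in> D" "z \<in> endpoints b" | y where "1 \<le> y" "y < k" "z = X y" by (auto simp: nodes_of_def)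
    then show "z \<in> nodes_of D'"
    proof cases
      case (1 b)
      then show ?thesis using trunc_in[of b] trunc_endpoints[of b] by (auto simp: nodes_of_def)
    next
      case (2 y)
      then have "side y \<in> D'" "z \<in> endpoints (side y)" by (auto simp: D'_def side_def)
      then show ?thesis unfolding nodes_of_def by blast
    qed
  qed
qed

text \<open>The only incidences of a bend with an old line that were not avoided are those of
  \<open>X 1\<close> with \<open>r1\<close> and \<open>X (k - 1)\<close> with \<open>r2\<close>, and
  there the bend is an endpoint of the truncated piece.\<close>

lemma node_line: "z \<in> nodes_of D' \<Longrightarrow> a \<in> D' \<Longrightarrow> z \<in> line a \<Longrightarrow> z \<in> endpoints a"
proof -
  assume z: "z \<in> nodes_of D'" "z \<in> line a" and a: "a \<in> D'"
  from z(1) consider "z \<in> nodes_of D" | y where "1 \<le> y" "y < k" "z = X y" unfolding nodes_D' by auto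
  note zc = this
  from a show "z \<in> endpoints a"
  proof (cases rule: D'_cases)
    case (1 b)
    then have zl: "z \<in> line b" using z(2) trunc_line by simp
    from zc show ?thesis
    proof cases
      case 1
      then show ?thesis using general_positionD(5)[OF gp _ \<open>b \<in> D\<close> zl] \<open>a = trunc b\<close> by (simp add: trunc_endpoints)
    next
      case (2 y)
      then have "y = 1 \<and> b = r1 \<or> y = k - 1 \<and> b = r2" using Q_old[of y b] zl 1 by blast
      then show ?thesis using 1 2 by (auto simp: trunc_endpoints)
    qed
  next
    case (2 lo hi v)
    then have zl: "meets \<alpha> lo v z" using z(2) fresh_facts(2) by blast
    from zc show ?thesis
    proof cases
      case 1
      then show ?thesis using node_new[OF 1 2(1)] zl by blast
    next
      case (2 y)
      then have "\<not> (y < lo \<or> hi < y)" using Q_new'[of y lo hi v] zl \<open>new lo hi v\<close> by auto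
      then have "y = lo \<or> y = hi" using new_range[OF \<open>new lo hi v\<close>] by auto
      then show ?thesis using 2 fresh_facts(3)[OF \<open>new lo hi v\<close>] \<open>a = fresh lo hi\<close> by auto
    qed
  qed
qed

end

context joined
begin

section \<open>General position of the joined configuration\<close>

lemma fresh_index:
  assumes "new lo hi v" "z \<in> endpoints (fresh lo hi)"
  obtains y where "z = X y" "1 \<le> y" "y < k" "lo \<le> y" "y \<le> hi"
  using assms fresh_facts(3)[OF assms(1)] new_range[OF assms(1)] by (metis insertE le_trans less_le_trans not_less order_refl singletonD)

lemma trunc_endpointsD:
  "z \<in> endpoints (trunc a) \<Longrightarrow> z \<in> endpoints a \<or> a = r1 \<and> z = X 1 \<or> a = r2 \<and> z = X (k - 1)"
  unfolding trunc_endpoints Un_iff by (metis (full_types) empty_iff singletonD)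

text \<open>New lines with a common bend come from two consecutive steps or from a step and an
  additional ray at one of its ends; in both cases the pair condition applies.\<close>

lemma new_new_indep:
  assumes n: "new lo hi v" and n': "new lo' hi' v'" and ne: "(lo, hi) \<noteq> (lo', hi')"
    and y: "lo \<le> y" "y \<le> hi" "lo' \<le> y" "y \<le> hi'"
  shows "v' \<notin> span {v}"
proof -
  have sy: "a \<notin> span {b}" if "b \<notin> span {a}" "a \<noteq> 0" for a b :: "real ^ 'n"
    using that span_singleton_sym by blast
  note nz = new_indep(3)[OF n] new_indep(3)[OF n']
  consider (ss) l where "lo = l" "hi = Suc l" "v = U l" "lo' = Suc l" "hi' = Suc (Suc l)" "v' = U (Suc l)" "Suc (Suc l) < k"
    | (ss') l where "lo' = l" "hi' = Suc l" "v' = U l" "lo = Suc l" "hi = Suc (Suc l)" "v = U (Suc l)" "Suc (Suc l) < k"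
    | (sd) l where "lo = l" "hi = Suc l" "v = U l" "Suc l < k" "lo' = hi'" "v' = U (lo' - 1) - U lo'" "lo' = l \<or> lo' = Suc l" "1 \<le> l"
    | (ds) l where "lo' = l" "hi' = Suc l" "v' = U l" "Suc l < k" "lo = hi" "v = U (lo - 1) - U lo" "lo = l \<or> lo = Suc l" "1 \<le> l"
    using n n' ne y unfolding new_def by (elim conjE disjE) force+
  then show ?thesis
  proof cases
    case ss
    then show ?thesis using pair'(1)[of l] by simp
  next
    case ss'
    then show ?thesis using pair'(2)[of l] by simp
  next
    case sd
    have "v \<notin> span {v'}"
    proof (cases "lo' = l")
      case True
      then show ?thesis using pair_side(2)[of "l - 1"] sd by simp
    next
      case False
      then show ?thesis using pair_side(1)[of l] sd by simp
    qed
    then show ?thesis using sy nz by blast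
  next
    case ds
    show ?thesis
    proof (cases "lo = l")
      case True
      then show ?thesis using pair_side(2)[of "l - 1"] ds by simp
    next
      case False
      then show ?thesis using pair_side(1)[of l] ds by simp
    qed
  qed
qed

lemma span_eq_mem: "span {a} = span {b} \<Longrightarrow> a \<in> span {c} \<longleftrightarrow> b \<in> span {c :: real ^ 'n}"
proof -
  assume e: "span {a} = span {b}"
  have "a \<in> span {b}" "b \<in> span {a}"
    using span_base[of a "{a}"] span_base[of b "{b}"] e by simp_all
  then show ?thesis using span_singleton_mono[of a c b] span_singleton_mono[of b c a] by blast
qed

lemma lattice_direction_D': "a \<in> D' \<Longrightarrow> lattice_direction a"
proof -
  have s: "lattice_direction (seg l)" if "l < k" for l
  proof -
    have "\<exists>F j. lattice_basis F \<and> F j = u l"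
    proof (cases "Suc l < k")
      case True
      then show ?thesis using pair[of l] unfolding unimodular_pair_def by blast
    next
      case False
      then have "Suc (l - 1) < k" "Suc (l - 1) = l" using that k by auto
      then show ?thesis using pair[of "l - 1"] unfolding unimodular_pair_def by metis
    qed
    then obtain F j where "lattice_basis F" "F j = u l" by blast
    then show ?thesis unfolding lattice_direction_def seg_direction
      using pos[OF that] by (intro exI[of _ F] exI[of _ j] exI[of _ "\<alpha> l"]) simp
  qed
  have d: "lattice_direction (side l)" if "1 \<le> l" "l < k" for l
  proof -
    have "Suc (l - 1) = l" using that by simp
    then have "unimodular_pair (u (l - 1)) (u l)" using pair[of "l - 1"] that(2) by (simp only:)
    then have "unimodular_pair (u l) (u (l - 1) + (- 1) *s u l)"
      by (rule unimodular_pair_add[OF unimodular_pair_sym])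
    moreover have "u (l - 1) + (- 1) *s u l = u (l - 1) - u l" by (simp add: vec_eq_iff)
    ultimately obtain F j where "lattice_basis F" "F j = u (l - 1) - u l" unfolding unimodular_pair_def by metis
    then show ?thesis unfolding lattice_direction_def side_def by (intro exI[of _ F] exI[of _ j] exI[of _ 1]) simp
  qed
  assume "a \<in> D'"
  then show ?thesis using s d general_positionD(3)[OF gp] unfolding D'_def by auto
qed

lemma nondegenerate_D': "a \<in> D' \<Longrightarrow> nondegenerate a"
proof -
  have s: "nondegenerate (seg l)" if "l < k" for l
    using X_step[of l] pos[OF that] U_nonzero[OF that] by (auto simp: seg_def)
  have d: "nondegenerate (side l)" if "1 \<le> l" "l < k" for l
    using new_indep(3)[OF side_new[OF that]] by (simp add: side_def)
  assume "a \<in> D'"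
  then show ?thesis using s d general_positionD(2)[OF gp] unfolding D'_def by auto
qed

lemma shared_indep:
  assumes a: "a \<in> D'" and b: "b \<in> D'" and ne: "a \<noteq> b" and z: "z \<in> endpoints a" "z \<in> endpoints b"
  shows "direction b \<notin> span {direction a}"
proof -
  have sy: "d \<notin> span {c}" if "c \<notin> span {d}" "d \<noteq> 0" for c d :: "real ^ 'n"
    using that span_singleton_sym by blast
  \<comment> \<open>A truncated ray and a fresh piece can meet only at a bend, hence at bend 1 or
    bend \<open>k - 1\<close>, where the step next to the new line is the first or the last
    one.\<close>
  have tf: "direction (fresh lo hi) \<notin> span {direction (trunc c)}"
    if c: "c \<in> D" and n: "new lo hi v" and z: "z \<in> endpoints (trunc c)" "z \<in> endpoints (fresh lo hi)" for c lo hi v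
  proof -
    obtain y where y: "z = X y" "1 \<le> y" "y < k" "lo \<le> y" "y \<le> hi" using fresh_index[OF n z(2)] .
    have nD: "z \<notin> endpoints c" using X_node[OF y(2,3)] c y(1) unfolding nodes_of_def by blast
    then have "c = r1 \<and> z = X 1 \<or> c = r2 \<and> z = X (k - 1)"
      using trunc_endpointsD[OF z(1)] by blast
    moreover have "X 1 = X y \<Longrightarrow> 1 = y" using X_inj[OF y(2,3), of 1] k by linarith
    moreover have "X (k - 1) = X y \<Longrightarrow> k - 1 = y" using X_inj[OF y(2,3), of "k - 1"] by linarith
    ultimately have "c = r1 \<and> y = 1 \<or> c = r2 \<and> y = k - 1" using y(1) by metis
    then have "direction c \<notin> span {v}"
    proof (elim disjE conjE)
      assume "c = r1" "y = 1"
      then have "lo = 1" using y new_range[OF n] by auto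
      then show ?thesis using new_indep(1)[OF n] \<open>c = r1\<close> by simp
    next
      assume "c = r2" "y = k - 1"
      then have "hi = k - 1" using y new_range[OF n] by auto
      then have "U (k - 1) \<notin> span {v}" using new_indep(2)[OF n] by simp
      then show ?thesis using \<open>c = r2\<close> span_neg[of "- U (k - 1)" "{v}"] by auto
    qed
    then have "v \<notin> span {direction c}" using sy new_indep(3)[OF n] by blast
    then show ?thesis using span_eq_mem[OF fresh_facts(1)[OF n]] trunc_direction by simp
  qed
  from a show ?thesis
  proof (cases rule: D'_cases)
    case (1 c)
    from b show ?thesis
    proof (cases rule: D'_cases)
      case b: (1 d)
      have cd: "c \<noteq> d" using ne 1 b by auto
      have "z \<in> endpoints c \<and> z \<in> endpoints d"
      \<comment> \<open>The bends \<open>X 1\<close> and \<open>X (k - 1)\<close> are distinct and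
        no old vertices, so two different old pieces share at most old vertices.\<close>
      proof -
        have "1 \<le> k - 1" "k - 1 < k" "1 < k" "1 \<noteq> k - 1" "1 \<le> k" using k by auto
        then have nn: "X 1 \<notin> nodes_of D" "X (k - 1) \<notin> nodes_of D" "X 1 \<noteq> X (k - 1)"
          using X_node[of 1] X_node[of "k - 1"] X_inj[of "k - 1" 1] by blast+
        have zc: "z \<in> endpoints c \<Longrightarrow> z \<in> nodes_of D" and zd: "z \<in> endpoints d \<Longrightarrow> z \<in> nodes_of D"
          using 1(1) b(1) unfolding nodes_of_def by blast+
        have c1: "z \<in> endpoints c \<or> c = r1 \<and> z = X 1 \<or> c = r2 \<and> z = X (k - 1)"
          using trunc_endpointsD z(1) unfolding 1(2) by blast
        have d1: "z \<in> endpoints d \<or> d = r1 \<and> z = X 1 \<or> d = r2 \<and> z = X (k - 1)"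
          using trunc_endpointsD z(2) unfolding b(2) by blast
        show ?thesis
        proof (cases "z \<in> nodes_of D")
          case True
          then have "z \<noteq> X 1" "z \<noteq> X (k - 1)" using nn by blast+
          then show ?thesis using c1 d1 by blast
        next
          case False
          then have "c = r1 \<and> z = X 1 \<or> c = r2 \<and> z = X (k - 1)" "d = r1 \<and> z = X 1 \<or> d = r2 \<and> z = X (k - 1)"
            using c1 d1 zc zd by blast+
          then show ?thesis using nn(3) cd by metis
        qed
      qed
      then have "direction d \<notin> span {direction c}" using general_positionD(6)[OF gp 1(1) b(1) cd] by blast
      then show ?thesis unfolding 1(2) b(2) using span_eq_mem[OF trunc_direction] trunc_direction by simp
    next
      case b: (2 lo hi v)
      then show ?thesis using tf[OF 1(1) b(1)] z 1(2) by simp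
    qed
  next
    case (2 lo hi v)
    from b show ?thesis
    proof (cases rule: D'_cases)
      case b: (1 d)
      then have "direction a \<notin> span {direction b}" using tf[OF b(1) 2(1)] z 2(2) by simp
      then show ?thesis using sy direction_nonzero[OF nondegenerate_D'[OF \<open>b \<in> D'\<close>]] by blast
    next
      case b: (2 lo' hi' v')
      obtain y where y: "z = X y" "1 \<le> y" "y < k" "lo \<le> y" "y \<le> hi" using fresh_index[OF 2(1)] z 2(2) by auto
      obtain y' where y': "z = X y'" "1 \<le> y'" "y' < k" "lo' \<le> y'" "y' \<le> hi'" using fresh_index[OF b(1)] z b(2) by auto
      have "y = y'" using X_inj[of y y'] y y' by auto
      then have "v' \<notin> span {v}" using new_new_indep[OF 2(1) b(1) _ y(4,5)] y' ne 2(2) b(2) by auto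
      then show ?thesis unfolding 2(2) b(2)
        using span_eq_mem[OF fresh_facts(1)[OF b(1)]] fresh_facts(1)[OF 2(1)] by simp
    qed
  qed
qed

lemma shared_node:
  assumes "a \<in> D'" "b \<in> D'" "a \<noteq> b" "y \<in> endpoints a" "y \<in> endpoints b" "z \<in> line a" "z \<in> line b"
  shows "z \<in> nodes_of D'"
proof -
  have y: "y \<in> line a" "y \<in> line b" using assms endpoints_subset_carrier carrier_subset_line by blast+
  have "z = y" by (rule line_unique[OF assms(6,7) y shared_indep[OF assms(1-5)]])
  then show ?thesis using assms by (auto simp: nodes_of_def)
qed

text \<open>Parallel lines with a common point coincide; an endpoint of \<open>b\<close> would lie
  on the line of \<open>a\<close> and be an endpoint of \<open>a\<close> by
  \<open>node_line\<close>.\<close>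

lemma unshared_indep:
  assumes "a \<in> D'" "b \<in> D'" "endpoints a \<inter> endpoints b = {}" "z \<in> line a" "z \<in> line b"
  shows "direction b \<notin> span {direction a}"
proof
  assume "direction b \<in> span {direction a}"
  then have "span {direction b} = span {direction a}"
    using span_singleton_sym[of "direction b" "direction a"] direction_nonzero[OF nondegenerate_D'[OF assms(2)]]
      span_singleton_mono by (metis subsetI subset_antisym)
  then have "line a = line b"
    using line_mem[OF assms(4)] line_mem[OF assms(5)] by blast
  obtain y where y: "y \<in> endpoints b" by (cases b) auto
  then have "y \<in> line a" "y \<in> nodes_of D'"
    using \<open>line a = line b\<close> endpoints_subset_carrier carrier_subset_line assms(2) by (blast, auto simp: nodes_of_def)
  then show False using node_line[OF _ assms(1)] y assms(3) by blast
qed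

text \<open>Why the conditions on pairs of new lines are needed only for separated index ranges:
  overlapping ranges share a bend.\<close>

lemma fresh_overlap:
  assumes "new lo hi v" "new lo' hi' v'" "\<not> hi < lo'" "\<not> hi' < lo"
  shows "\<exists>y. y \<in> endpoints (fresh lo hi) \<and> y \<in> endpoints (fresh lo' hi')"
proof -
  have "lo = lo' \<or> lo = hi' \<or> hi = lo' \<or> hi = hi'"
    using assms new_range[OF assms(1)] new_range[OF assms(2)] by auto
  then show ?thesis using fresh_facts(3)[OF assms(1)] fresh_facts(3)[OF assms(2)] by auto
qed

lemma fresh_exception:
  assumes "c \<in> D" "new lo hi v" "lo = 1 \<and> c = r1 \<or> hi = k - 1 \<and> c = r2"
  shows "\<exists>y. y \<in> endpoints (trunc c) \<and> y \<in> endpoints (fresh lo hi)"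
  using assms(3) fresh_facts(3)[OF assms(2)] by (auto simp: trunc_endpoints)

lemma two_lines:
  assumes n3: "3 \<le> CARD('n)" and a: "a \<in> D'" and b: "b \<in> D'" and ne: "a \<noteq> b" and z: "z \<in> line a" "z \<in> line b"
  shows "z \<in> nodes_of D'"
proof (cases "endpoints a \<inter> endpoints b = {}")
  case False
  then show ?thesis using shared_node[OF a b ne _ _ z] by blast
next
  case dis: True
  have tf: False if "c \<in> D" "new lo hi v" "z \<in> line (trunc c)" "z \<in> line (fresh lo hi)"
     "endpoints (trunc c) \<inter> endpoints (fresh lo hi) = {}" for c lo hi v
  proof -
    have "\<not> (lo = 1 \<and> c = r1 \<or> hi = k - 1 \<and> c = r2)" using fresh_exception that by blast
    then show False using new_old[OF n3 that(1,2)] that(3,4) fresh_facts(2)[OF that(2)] trunc_line by blast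
  qed
  from a show ?thesis
  proof (cases rule: D'_cases)
    case (1 c)
    from b show ?thesis
    proof (cases rule: D'_cases)
      case b: (1 d)
      then have "z \<in> nodes_of D"
        using general_positionD(8)[OF gp n3 1(1) b(1)] ne z unfolding 1(2) b(2) trunc_line by blast
      then show ?thesis by (simp add: nodes_D')
    next
      case b: (2 lo hi v)
      then show ?thesis using tf[OF 1(1) b(1)] z dis 1(2) by simp
    qed
  next
    case (2 lo hi v)
    from b show ?thesis
    proof (cases rule: D'_cases)
      case b: (1 d)
      then show ?thesis using tf[OF b(1) 2(1)] z dis 2(2) by auto
    next
      case b: (2 lo' hi' v')
      have "hi < lo' \<or> hi' < lo" using fresh_overlap[OF 2(1) b(1)] dis 2(2) b(2) by blast
      moreover have "meets \<alpha> lo v z" "meets \<alpha> lo' v' z" using z fresh_facts(2) 2 b by blast+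
      ultimately show ?thesis using new_new[OF n3 2(1) b(1)] new_new[OF n3 b(1) 2(1)] by blast
    qed
  qed
qed

text \<open>In the plane, a concurrency away from the vertices forces the three pieces to have
  pairwise disjoint endpoints. Their directions are then pairwise independent and the index ranges
  of fresh pieces are separated, so one clause of the locale applies for each number of fresh
  pieces.\<close>

lemma three_lines:
  assumes a: "a \<in> D'" "z \<in> line a" and b: "b \<in> D'" "z \<in> line b" and c: "c \<in> D'" "z \<in> line c"
    and ne: "a \<noteq> b" "a \<noteq> c" "b \<noteq> c"
  shows "z \<in> nodes_of D'"
proof (cases "3 \<le> CARD('n)")
  case True
  then show ?thesis using two_lines a b ne by blast
next
  case False
  then have n2: "CARD('n) = 2" using two by simp
  show ?thesis
  proof (rule ccontr)
    assume z: "z \<notin> nodes_of D'"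
    have dis: "endpoints d \<inter> endpoints e = {}" if "d \<in> D'" "e \<in> D'" "d \<noteq> e" "z \<in> line d" "z \<in> line e" for d e
      using shared_node[OF that(1-3) _ _ that(4,5)] z by blast
    have ind: "direction e \<notin> span {direction d}" if "d \<in> D'" "e \<in> D'" "d \<noteq> e" "z \<in> line d" "z \<in> line e" for d e
      using unshared_indep[OF that(1,2) dis[OF that] that(4,5)] .
    have ttf: False if "e \<in> D" "f \<in> D" "trunc e \<noteq> trunc f" "new lo hi v" "z \<in> line (trunc e)" "z \<in> line (trunc f)"
       "z \<in> line (fresh lo hi)" for e f lo hi v
    proof -
      have "direction (trunc f) \<notin> span {direction (trunc e)}" using ind that trunc_in by blast
      then have "direction f \<notin> span {direction e}" using trunc_direction span_eq_mem[OF trunc_direction[of f]] by simp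
      then show False using old_old_new[OF that(1,2) _ that(4), of z] that(5-7) fresh_facts(2)[OF that(4)] trunc_line by blast
    qed
    have ffi: "v' \<notin> span {v} \<and> (hi < lo' \<or> hi' < lo)" if "new lo hi v" "new lo' hi' v'" "fresh lo hi \<noteq> fresh lo' hi'"
       "z \<in> line (fresh lo hi)" "z \<in> line (fresh lo' hi')" for lo hi v lo' hi' v'
    proof
      have "direction (fresh lo' hi') \<notin> span {direction (fresh lo hi)}" using ind that fresh_in by blast
      then show "v' \<notin> span {v}"
        using span_eq_mem[OF fresh_facts(1)[OF that(2)]] fresh_facts(1)[OF that(1)] by simp
      have "endpoints (fresh lo hi) \<inter> endpoints (fresh lo' hi') = {}"
        using dis that fresh_in by blast
      then show "hi < lo' \<or> hi' < lo" using fresh_overlap[OF that(1,2)] by blast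
    qed
    have tff: False if "e \<in> D" "new lo hi v" "new lo' hi' v'" "fresh lo hi \<noteq> fresh lo' hi'"
       "trunc e \<noteq> fresh lo hi" "trunc e \<noteq> fresh lo' hi'"
       "z \<in> line (trunc e)" "z \<in> line (fresh lo hi)" "z \<in> line (fresh lo' hi')" for e lo hi v lo' hi' v'
    proof -
      have "direction (fresh lo hi) \<notin> span {direction (trunc e)}" "direction (fresh lo' hi') \<notin> span {direction (trunc e)}"
        using ind that trunc_in fresh_in by blast+
      then have i1: "v \<notin> span {direction e}" "v' \<notin> span {direction e}"
        using span_eq_mem[OF fresh_facts(1)[OF that(2)]] span_eq_mem[OF fresh_facts(1)[OF that(3)]] trunc_direction by simp_all
      have i2: "v' \<notin> span {v}" "v \<notin> span {v'}" "hi < lo' \<or> hi' < lo"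
        using ffi[OF that(2,3,4,8,9)] ffi[OF that(3,2) that(4)[symmetric] that(9,8)] by auto
      have m: "meets \<alpha> lo v z" "meets \<alpha> lo' v' z" "z \<in> line e"
        using that fresh_facts(2)[OF that(2)] fresh_facts(2)[OF that(3)] trunc_line by auto
      from i2(3) show False
        using old_new_new[OF n2 that(1-3) _ i1 i2(1) m(3,1)] old_new_new[OF n2 that(1) that(3,2) _ i1(2,1) i2(2) m(3,2)] m by blast
    qed
    have fff: False if "new lo hi v" "new lo' hi' v'" "new lo'' hi'' v''"
       "fresh lo hi \<noteq> fresh lo' hi'" "fresh lo hi \<noteq> fresh lo'' hi''" "fresh lo' hi' \<noteq> fresh lo'' hi''"
       "z \<in> line (fresh lo hi)" "z \<in> line (fresh lo' hi')" "z \<in> line (fresh lo'' hi'')" for lo hi v lo' hi' v' lo'' hi'' v''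
    proof -
      have ord: False if "new lo hi v" "new lo' hi' v'" "new lo'' hi'' v''"
       "fresh lo hi \<noteq> fresh lo' hi'" "fresh lo hi \<noteq> fresh lo'' hi''" "fresh lo' hi' \<noteq> fresh lo'' hi''"
       "z \<in> line (fresh lo hi)" "z \<in> line (fresh lo' hi')" "z \<in> line (fresh lo'' hi'')" "hi < lo'" "hi' < lo''"
        for lo hi v lo' hi' v' lo'' hi'' v''
        using new_new_new[OF n2 that(1-3) that(10,11)] ffi[OF that(1,2,4,7,8)] ffi[OF that(1,3,5,7,9)] ffi[OF that(2,3,6,8,9)]
          fresh_facts(2)[OF that(1)] fresh_facts(2)[OF that(2)] fresh_facts(2)[OF that(3)] that(7-9) by blast
      have r: "lo \<le> hi" "lo' \<le> hi'" "lo'' \<le> hi''" using new_range that(1-3) by blast+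
      have "hi < lo' \<or> hi' < lo" "hi < lo'' \<or> hi'' < lo" "hi' < lo'' \<or> hi'' < lo'"
        using ffi[OF that(1,2,4,7,8)] ffi[OF that(1,3,5,7,9)] ffi[OF that(2,3,6,8,9)] by auto
      \<comment> \<open>The clause for three new lines is stated for increasing positions, so the
        six orders are sorted.\<close>
      then consider "hi < lo'" "hi' < lo''" | "hi < lo''" "hi'' < lo'" | "hi' < lo" "hi < lo''"
        | "hi' < lo''" "hi'' < lo" | "hi'' < lo" "hi < lo'" | "hi'' < lo'" "hi' < lo" using r by linarith
      then show False
      proof cases
        case 1 then show ?thesis using ord[OF that(1,2,3)] that by simp
      next
        case 2 then show ?thesis using ord[OF that(1,3,2)] that by metis
      next
        case 3 then show ?thesis using ord[OF that(2,1,3)] that by metis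
      next
        case 4 then show ?thesis using ord[OF that(2,3,1)] that by metis
      next
        case 5 then show ?thesis using ord[OF that(3,1,2)] that by metis
      next
        case 6 then show ?thesis using ord[OF that(3,2,1)] that by metis
      qed
    qed
    from a(1) show False
    proof (cases rule: D'_cases)
      case A: (1 e)
      from b(1) show ?thesis
      proof (cases rule: D'_cases)
        case B: (1 f)
        from c(1) show ?thesis
        proof (cases rule: D'_cases)
          case C: (1 g)
          have "z \<in> nodes_of D"
            using general_positionD(7)[OF gp A(1) B(1) C(1)] ne a(2) b(2) c(2) unfolding A(2) B(2) C(2) trunc_line by blast
          then show ?thesis using z by (simp add: nodes_D')
        next
          case C: (2 lo hi v)
          show ?thesis by (rule ttf[OF A(1) B(1) _ C(1)]) (use A(2) B(2) C(2) a b c ne in auto)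
        qed
      next
        case B: (2 lo hi v)
        from c(1) show ?thesis
        proof (cases rule: D'_cases)
          case C: (1 g)
          show ?thesis by (rule ttf[OF A(1) C(1) _ B(1)]) (use A(2) B(2) C(2) a b c ne in auto)
        next
          case C: (2 lo' hi' v')
          show ?thesis by (rule tff[OF A(1) B(1) C(1)]) (use A(2) B(2) C(2) a b c ne in auto)
        qed
      qed
    next
      case A: (2 lo hi v)
      from b(1) show ?thesis
      proof (cases rule: D'_cases)
        case B: (1 f)
        from c(1) show ?thesis
        proof (cases rule: D'_cases)
          case C: (1 g)
          show ?thesis by (rule ttf[OF B(1) C(1) _ A(1)]) (use A(2) B(2) C(2) a b c ne in auto)
        next
          case C: (2 lo' hi' v')
          show ?thesis by (rule tff[OF B(1) A(1) C(1)]) (use A(2) B(2) C(2) a b c ne in auto)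
        qed
      next
        case B: (2 lo' hi' v')
        from c(1) show ?thesis
        proof (cases rule: D'_cases)
          case C: (1 g)
          show ?thesis by (rule tff[OF C(1) A(1) B(1)]) (use A(2) B(2) C(2) a b c ne in auto)
        next
          case C: (2 lo'' hi'' v'')
          show ?thesis by (rule fff[OF A(1) B(1) C(1)]) (use A(2) B(2) C(2) a b c ne in auto)
        qed
      qed
    qed
  qed
qed

text \<open>At \<open>q\<close> the last step is left backwards, in agreement with
  \<open>r2\<close>, whose direction is minus the last step.\<close>

lemma outward_trunc:
  assumes "z \<in> endpoints b" "b \<in> D"
  shows "\<exists>t>0. outward z (trunc b) = t *\<^sub>R outward z b"
proof -
  have z: "z \<in> nodes_of D" using assms by (auto simp: nodes_of_def)
  have sk: "Suc (k - 1) = k" using k by simp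
  consider "b = r1" | "b = r2" "b \<noteq> r1" | "b \<noteq> r1" "b \<noteq> r2" by blast
  then show ?thesis
  proof cases
    case 1
    then have "z = p" using assms by simp
    then show ?thesis using 1 X_step[of 0] pos[of 0] k by (intro exI[of _ "\<alpha> 0"]) (simp add: trunc_def seg_def)
  next
    case 2
    then have zq: "z = q" using assms by simp
    have "1 \<le> k - 1" "k - 1 < k" using k by auto
    then have "z \<noteq> X (k - 1)" using X_node[of "k - 1"] z by auto
    moreover have "trunc b = Segment (X (k - 1)) q"
      unfolding trunc_def seg_def sk X_k using 2 by (simp only: if_True if_False simp_thms)
    ultimately have "outward z (trunc b) = X (k - 1) - q" using zq by simp
    moreover have "q - X (k - 1) = \<alpha> (k - 1) *\<^sub>R U (k - 1)"
      using X_step[of "k - 1"] unfolding sk X_k .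
    then have "X (k - 1) - q = \<alpha> (k - 1) *\<^sub>R (- U (k - 1))"
      by (metis minus_diff_eq scaleR_minus_right)
    moreover have "outward z b = - U (k - 1)" using 2(1) by simp
    moreover have "0 < \<alpha> (k - 1)" using pos[of "k - 1"] k by simp
    ultimately show ?thesis by metis
  next
    case 3
    then show ?thesis by (intro exI[of _ 1]) (simp add: trunc_def)
  qed
qed

lemma star_old:
  assumes z: "z \<in> nodes_of D" shows "star_at D' z"
proof -
  obtain F I where F: "lattice_basis F" "2 \<le> card I"
     "\<And>a. a \<in> D \<Longrightarrow> z \<in> endpoints a \<Longrightarrow> \<exists>u\<in>star_set F I. \<exists>t>0. outward z a = t *\<^sub>R real_vec u"
     "\<And>u. u \<in> star_set F I \<Longrightarrow> \<exists>a\<in>D. z \<in> endpoints a \<and> (\<exists>t>0. outward z a = t *\<^sub>R real_vec u)"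
    using general_positionD(4)[OF gp z] unfolding star_at_def by auto
  show ?thesis
    unfolding star_at_def
  proof (intro exI[of _ F] exI[of _ I] conjI F(1,2) ballI impI)
    fix a assume a: "a \<in> D'" "z \<in> endpoints a"
    from a(1) show "\<exists>u\<in>star_set F I. \<exists>t>0. outward z a = t *\<^sub>R real_vec u"
    proof (cases rule: D'_cases)
      case (1 b)
      have "1 \<le> k - 1" "k - 1 < k" "1 < k" using k by auto
      then have "X 1 \<noteq> z" "X (k - 1) \<noteq> z" using X_node[of 1] X_node[of "k - 1"] z by auto
      then have zb: "z \<in> endpoints b" using a(2) trunc_endpointsD unfolding 1(2) by blast
      obtain t where t: "0 < t" "outward z a = t *\<^sub>R outward z b" using outward_trunc[OF zb 1(1)] 1(2) by blast
      obtain w t' where w: "w \<in> star_set F I" "0 < t'" "outward z b = t' *\<^sub>R real_vec w" using F(3)[OF 1(1) zb] by blast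
      then show ?thesis using t by (intro bexI[OF _ w(1)] exI[of _ "t * t'"]) simp
    next
      case (2 lo hi v)
      obtain y where "z = X y" "1 \<le> y" "y < k" using fresh_index[OF 2(1)] a(2) 2(2) by metis
      then show ?thesis using X_node z by blast
    qed
  next
    fix w assume "w \<in> star_set F I"
    then obtain b t where b: "b \<in> D" "z \<in> endpoints b" "0 < t" "outward z b = t *\<^sub>R real_vec w" using F(4) by blast
    obtain t' where t': "0 < t'" "outward z (trunc b) = t' *\<^sub>R outward z b" using outward_trunc[OF b(2,1)] by blast
    have "z \<in> endpoints (trunc b)" using b(2) by (simp add: trunc_endpoints)
    then show "\<exists>a\<in>D'. z \<in> endpoints a \<and> (\<exists>t>0. outward z a = t *\<^sub>R real_vec w)"
      using trunc_in[OF b(1)] t' b(3,4) by (intro bexI[of _ "trunc b"] conjI exI[of _ "t' * t"]) auto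
  qed
qed

text \<open>The pieces leave the bend along \<open>- u (y - 1)\<close>, \<open>u y\<close> and minus
  their sum. The first two belong to a lattice basis by the pair condition, so the bend is a smooth
  trivalent point.\<close>

lemma star_new:
  assumes y: "1 \<le> y" "y < k" shows "star_at D' (X y)"
proof -
  have sy: "Suc (y - 1) = y" using y by simp
  have "unimodular_pair (u (y - 1)) (u y)" using pair[of "y - 1"] sy y(2) by (simp only:)
  then have "unimodular_pair (- u (y - 1)) (u y)" by (rule unimodular_pair_uminus)
  then obtain F i j where F: "lattice_basis F" "i \<noteq> j" "F i = - u (y - 1)" "F j = u y"
    unfolding unimodular_pair_def by blast
  have st: "star_set F {i, j} = {u (y - 1) - u y, - u (y - 1), u y}" using F by (auto simp: star_set_def)
  have nX: "X (y - 1) \<noteq> X y" using X_inj[of y "y - 1"] y by auto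
  have o1: "outward (X y) (seg (y - 1)) = \<alpha> (y - 1) *\<^sub>R real_vec (- u (y - 1))"
    using nX X_step[of "y - 1"] sy by (simp add: seg_def) (metis minus_diff_eq)
  have o2: "outward (X y) (seg y) = \<alpha> y *\<^sub>R real_vec (u y)" using X_step[of y] by (simp add: seg_def)
  have o3: "outward (X y) (side y) = 1 *\<^sub>R real_vec (u (y - 1) - u y)" by (simp add: side_def)
  have all: "a = seg (y - 1) \<or> a = seg y \<or> a = side y" if "a \<in> D'" "X y \<in> endpoints a" for a
  proof -
    from that(1) consider "a \<in> D" | l where "l < k" "a = seg l" | l where "1 \<le> l" "l < k" "a = side l"
      unfolding D'_def by auto
    then show ?thesis
    proof cases
      case 1
      then show ?thesis using that(2) X_node[OF y] by (auto simp: nodes_of_def)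
    next
      case (2 l)
      then have "X y = X l \<or> X y = X (Suc l)" using that(2) by (simp add: seg_def)
      then have "l = y \<or> Suc l = y" using X_inj[OF y, of l] X_inj[OF y, of "Suc l"] 2(1) by auto
      then show ?thesis using 2 by auto
    next
      case (3 l)
      then have "X y = X l" using that(2) by (simp add: side_def)
      then show ?thesis using X_inj[OF y, of l] 3 by auto
    qed
  qed
  have p: "0 < \<alpha> (y - 1)" "0 < \<alpha> y" using pos y by auto
  have D3: "seg (y - 1) \<in> D'" "seg y \<in> D'" "side y \<in> D'" using y by (auto simp: D'_def)
  have e3: "X y \<in> endpoints (seg (y - 1))" "X y \<in> endpoints (seg y)" "X y \<in> endpoints (side y)"
    using sy by (auto simp: seg_def side_def)
  show ?thesis
    unfolding star_at_def
  proof (intro exI[of _ F] exI[of _ "{i, j}"] conjI F(1) ballI impI)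
    show "2 \<le> card {i, j}" using F(2) by simp
    fix a assume "a \<in> D'" "X y \<in> endpoints a"
    then consider "a = seg (y - 1)" | "a = seg y" | "a = side y" using all by blast
    then show "\<exists>u\<in>star_set F {i, j}. \<exists>t>0. outward (X y) a = t *\<^sub>R real_vec u"
      unfolding st
    proof cases
      case 1
      show "\<exists>u\<in>{u (y - 1) - u y, - u (y - 1), u y}. \<exists>t>0. outward (X y) a = t *\<^sub>R real_vec u"
        unfolding 1 o1 using p by (intro bexI[of _ "- u (y - 1)"] exI[of _ "\<alpha> (y - 1)"]) auto
    next
      case 2
      show "\<exists>u\<in>{u (y - 1) - u y, - u (y - 1), u y}. \<exists>t>0. outward (X y) a = t *\<^sub>R real_vec u"
        unfolding 2 o2 using p by (intro bexI[of _ "u y"] exI[of _ "\<alpha> y"]) auto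
    next
      case 3
      show "\<exists>u\<in>{u (y - 1) - u y, - u (y - 1), u y}. \<exists>t>0. outward (X y) a = t *\<^sub>R real_vec u"
        unfolding 3 o3 by (intro bexI[of _ "u (y - 1) - u y"] exI[of _ 1]) auto
    qed
  next
    fix w assume "w \<in> star_set F {i, j}"
    then consider "w = - u (y - 1)" | "w = u y" | "w = u (y - 1) - u y" unfolding st by blast
    then show "\<exists>a\<in>D'. X y \<in> endpoints a \<and> (\<exists>t>0. outward (X y) a = t *\<^sub>R real_vec w)"
    proof cases
      case 1
      then show ?thesis using D3(1) e3(1) o1 p(1) by blast
    next
      case 2
      then show ?thesis using D3(2) e3(2) o2 p(2) by blast
    next
      case 3
      then show ?thesis using D3(3) e3(3) o3 zero_less_one by blast
    qed
  qed
qed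

lemma general_position_D': "general_position D'"
  unfolding general_position_def
proof (intro conjI ballI impI subsetI)
  show "finite D'" using general_positionD(1)[OF gp] by (simp add: D'_def)
  show "nondegenerate a" "lattice_direction a" if "a \<in> D'" for a
    using that nondegenerate_D' lattice_direction_D' by blast+
  show "star_at D' z" if "z \<in> nodes_of D'" for z
    using that star_old star_new unfolding nodes_D' by auto
  show "z \<in> endpoints a" if "z \<in> nodes_of D'" "a \<in> D'" "z \<in> line a" for z a
    using node_line that by blast
  show "direction b \<notin> span {direction a}" if "a \<in> D'" "b \<in> D'" "a \<noteq> b" "endpoints a \<inter> endpoints b \<noteq> {}" for a b
    using shared_indep[OF that(1-3)] that(4) by blast
  show "z \<in> nodes_of D'" if "a \<in> D'" "b \<in> D'" "c \<in> D'" "a \<noteq> b" "a \<noteq> c" "b \<noteq> c" "z \<in> line a \<inter> line b \<inter> line c" for a b c z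
    using three_lines[OF that(1) _ that(2) _ that(3) _ that(4-6)] that(7) by blast
  show "z \<in> nodes_of D'" if "3 \<le> CARD('n)" "a \<in> D'" "b \<in> D'" "a \<noteq> b" "z \<in> line a \<inter> line b" for a b z
    using two_lines[OF that(1-4)] that(5) by blast
qed

end

lemma (in join) joined_exists:
  assumes "2 \<le> CARD('n)" "\<alpha>0 \<in> A" "\<And>l. l < k \<Longrightarrow> 0 < \<alpha>0 l"
  shows "\<exists>\<alpha>. joined u k m s p x L D q \<alpha>"
proof (rule generic_lengths[of \<alpha>0], goal_cases)
  case 1
  show ?case by (rule assms(2))
next
  case (2 l)
  then show ?case by (rule assms(3))
next
  case (3 \<alpha>)
  show ?case
    by (rule exI[of _ \<alpha>], unfold_locales) (fact assms(1) 3)+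
qed

section \<open>A cyclic choice of step directions\<close>

text \<open>All steps outside the block receive the same small length and the block solves for the
  rest; the strict bound on displacement and length survives a small enough perturbation.\<close>

lemma positive_solution:
  fixes u :: "nat \<Rightarrow> real ^ 'n::finite"
  assumes B: "B \<subseteq> {..<k}"
    and solve: "\<And>x \<sigma>. (\<And>c. K * \<bar>x $ c\<bar> < \<sigma>) \<Longrightarrow>
      \<exists>r. (\<Sum>l\<in>B. r l *\<^sub>R u l) = x \<and> (\<Sum>l\<in>B. r l) = \<sigma> \<and> (\<forall>l. 0 < r l)"
    and x: "\<And>c. K * \<bar>x $ c\<bar> < L"
  shows "\<exists>\<alpha>\<in>sols k u x L. \<forall>l<k. 0 < \<alpha> l"
proof -
  let ?R = "{..<k} - B"
  define Y where "Y = (\<Sum>l\<in>?R. u l)"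
  have "\<forall>\<^sub>F \<epsilon> in at_right 0. \<forall>c\<in>UNIV. K * \<bar>(x - \<epsilon> *\<^sub>R Y) $ c\<bar> < L - \<epsilon> * real (card ?R)"
  proof (rule eventually_ball_finite, simp, rule ballI)
    fix c :: 'n
    have "((\<lambda>\<epsilon>. (L - \<epsilon> * real (card ?R)) - K * \<bar>x $ c - \<epsilon> * Y $ c\<bar>) \<longlongrightarrow>
       (L - 0 * real (card ?R)) - K * \<bar>x $ c - 0 * Y $ c\<bar>) (at_right 0)"
      by (intro tendsto_intros)
    moreover have "0 < (L - 0 * real (card ?R)) - K * \<bar>x $ c - 0 * Y $ c\<bar>" using x[of c] by simp
    ultimately have "\<forall>\<^sub>F \<epsilon> in at_right 0. 0 < (L - \<epsilon> * real (card ?R)) - K * \<bar>x $ c - \<epsilon> * Y $ c\<bar>"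
      by (rule order_tendstoD(1))
    then show "\<forall>\<^sub>F \<epsilon> in at_right 0. K * \<bar>(x - \<epsilon> *\<^sub>R Y) $ c\<bar> < L - \<epsilon> * real (card ?R)"
      by eventually_elim simp
  qed
  moreover have "\<forall>\<^sub>F \<epsilon> in at_right (0::real). 0 < \<epsilon>" by (rule eventually_at_right_less)
  ultimately have "\<forall>\<^sub>F \<epsilon> in at_right 0. 0 < \<epsilon> \<and> (\<forall>c. K * \<bar>(x - \<epsilon> *\<^sub>R Y) $ c\<bar> < L - \<epsilon> * real (card ?R))"
    by eventually_elim simp
  from eventually_happens'[OF trivial_limit_at_right_real this]
  obtain \<epsilon> where \<epsilon>: "0 < \<epsilon>" "\<And>c. K * \<bar>(x - \<epsilon> *\<^sub>R Y) $ c\<bar> < L - \<epsilon> * real (card ?R)" by blast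
  obtain r where r: "(\<Sum>l\<in>B. r l *\<^sub>R u l) = x - \<epsilon> *\<^sub>R Y" "(\<Sum>l\<in>B. r l) = L - \<epsilon> * real (card ?R)" "\<forall>l. 0 < r l"
    using solve[OF \<epsilon>(2)] by blast
  let ?\<alpha> = "\<lambda>l. if l \<in> B then r l else \<epsilon>"
  have split: "(\<Sum>l<k. h l) = (\<Sum>l\<in>?R. h l) + (\<Sum>l\<in>B. h l)" for h :: "nat \<Rightarrow> 'b::comm_monoid_add"
    using sum.subset_diff[OF B, of h] by simp
  have 1: "(\<Sum>l\<in>?R. ?\<alpha> l *\<^sub>R u l) = \<epsilon> *\<^sub>R Y" unfolding Y_def scaleR_sum_right by (rule sum.cong) auto
  have 2: "(\<Sum>l\<in>B. ?\<alpha> l *\<^sub>R u l) = x - \<epsilon> *\<^sub>R Y" unfolding r(1)[symmetric] by (rule sum.cong) auto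
  have "(\<Sum>l\<in>?R. ?\<alpha> l) = (\<Sum>l\<in>?R. \<epsilon>)" by (rule sum.cong) auto
  then have 3: "(\<Sum>l\<in>?R. ?\<alpha> l) = \<epsilon> * real (card ?R)" by (simp add: mult.commute)
  have 4: "(\<Sum>l\<in>B. ?\<alpha> l) = L - \<epsilon> * real (card ?R)" unfolding r(2)[symmetric] by (rule sum.cong) auto
  have "?\<alpha> \<in> sols k u x L"
    unfolding sols_def mem_Collect_eq split[of "\<lambda>l. ?\<alpha> l *\<^sub>R u l"] split[of ?\<alpha>] 1 2 3 4 by simp
  then show ?thesis using r(3) \<epsilon>(1) by (intro bexI[of _ ?\<alpha>]) auto
qed

text \<open>For each \<open>w\<close> at most one integer is bad: two bad ones would put
  \<open>c\<close> and then \<open>b\<close> into the plane of \<open>a\<close> and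
  \<open>w\<close>, which is then the plane of \<open>a\<close> and \<open>b\<close> and does not
  contain \<open>c\<close>. Adding multiples of \<open>c\<close> keeps the triple
  unimodular.\<close>

lemma choose_multiple:
  fixes a b c :: "int ^ 'n::finite" and E :: "(real ^ 'n) set"
  assumes t: "unimodular_triple a b c" and E: "finite E" "\<And>w. w \<in> E \<Longrightarrow> w \<notin> span {real_vec a}"
  shows "\<exists>y. \<forall>w\<in>E. real_vec (b + y *s c) \<notin> span {real_vec a, w}"
proof -
  have one: "y1 = y2" if w: "w \<in> E" and y: "real_vec (b + y1 *s c) \<in> span {real_vec a, w}" "real_vec (b + y2 *s c) \<in> span {real_vec a, w}"
    for w and y1 y2 :: int
  proof (rule ccontr)
    assume ne: "y1 \<noteq> y2"
    let ?W = "span {real_vec a, w}"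
    have "real_vec (b + y1 *s c) - real_vec (b + y2 *s c) \<in> ?W" using y by (rule span_diff)
    moreover have "real_vec (b + y1 *s c) - real_vec (b + y2 *s c) = (real_of_int y1 - real_of_int y2) *\<^sub>R real_vec c"
      by (simp add: scaleR_left_diff_distrib)
    ultimately have "(1 / (real_of_int y1 - real_of_int y2)) *\<^sub>R (real_of_int y1 - real_of_int y2) *\<^sub>R real_vec c \<in> ?W"
      by (metis span_scale)
    then have c: "real_vec c \<in> ?W" using ne by simp
    have "real_vec (b + y1 *s c) - real_of_int y1 *\<^sub>R real_vec c \<in> ?W" by (rule span_diff[OF y(1) span_scale[OF c]])
    then have b: "real_vec b \<in> ?W" by simp
    have ab: "real_vec b \<notin> span {real_vec a}" using unimodular_pair_not_span unimodular_triple_pair t by blast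
    have "real_vec a \<noteq> 0"
    proof
      assume "real_vec a = 0"
      then have "real_vec a \<in> span {real_vec b}" by (simp add: span_zero)
      then show False using unimodular_pair_not_span[OF unimodular_pair_sym[OF unimodular_triple_pair[OF t]]] by simp
    qed
    then have "?W = span {real_vec a, real_vec b}" using plane_eq[OF _ b _ ab] by (simp add: span_base)
    then show False using c unimodular_triple_not_span[OF t] by simp
  qed
  define bad where "bad w = {y. real_vec (b + y *s c) \<in> span {real_vec a, w}}" for w
  have "finite (bad w)" if "w \<in> E" for w
  proof (cases "bad w = {}")
    case False
    then obtain y where "y \<in> bad w" by blast
    then have "bad w \<subseteq> {y}" using one[OF that] unfolding bad_def by blast
    then show ?thesis by (rule finite_subset) simp
  qed simp
  then have "finite (\<Union>w\<in>E. bad w)" using E(1) by blast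
  then obtain y where "y \<notin> (\<Union>w\<in>E. bad w)" using ex_new_if_finite[OF infinite_UNIV_int] by blast
  then show ?thesis unfolding bad_def by blast
qed

lemma mod_neq:
  assumes "a < b" "b < a + m" shows "a mod m \<noteq> b mod (m::nat)"
proof
  assume "a mod m = b mod m"
  then have "m dvd b - a" using assms(1) by (metis less_imp_le mod_eq_dvd_iff_nat)
  then show False using assms by (auto dest: dvd_imp_le)
qed

text \<open>Around a long cyclic run, each end has two special directions: the claimed ray and a
  tilted neighbour. The tilts are by multiples of the adjacent direction of the run, so consecutive
  pairs and triples stay unimodular.\<close>

lemma join_step:
  fixes D :: "'n::finite piece set"
  assumes two: "2 \<le> CARD('n)" and gp: "general_position D"
    and r1: "Ray p (real_vec (star_dir i)) \<in> D" and r2: "Ray q (real_vec (star_dir j)) \<in> D"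
    and r12: "Ray p (real_vec (star_dir i :: int ^ 'n)) \<noteq> Ray q (real_vec (star_dir j))"
    and L: "\<And>c. real (2 * CARD('n) + 1) * \<bar>(q - p) $ c\<bar> < L"
  obtains k X al S where "2 \<le> k" "X 0 = p" "X k = q" "inj_on X {1..<k}" "X ` {1..<k} \<inter> nodes_of D = {}"
    "\<And>l. l < k \<Longrightarrow> piece_length (Segment (X l) (X (Suc l))) = ereal (al l)" "\<And>l. l < k \<Longrightarrow> 0 < al l"
    "(\<Sum>l<k. al l) = L" "finite S" "\<And>a. a \<in> S \<Longrightarrow> \<exists>z v. a = Ray z v \<and> z \<in> X ` {1..<k}"
    "general_position ((D - {Ray p (real_vec (star_dir i)), Ray q (real_vec (star_dir j))}) \<union>
       (\<lambda>l. Segment (X l) (X (Suc l))) ` {..<k} \<union> S)"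
    "nodes_of ((D - {Ray p (real_vec (star_dir i)), Ray q (real_vec (star_dir j))}) \<union>
       (\<lambda>l. Segment (X l) (X (Suc l))) ` {..<k} \<union> S) = nodes_of D \<union> X ` {1..<k}"
proof -
  let ?N = "CARD('n)"
  define M where "M = Suc ?N"
  note G = general_positionD[OF gp]
  \<comment> \<open>The length is fixed by the residues: position \<open>k - 3\<close> of the run
    has to carry ray \<open>j + n\<close> modulo M. The term \<open>M * (i + 5)\<close> pays for
    subtracting \<open>i\<close> and leaves room for four blocks of length M.\<close>
  define k where "k = j + 3 + M * (i + 5) - i"
  have kM: "i + k = j + 3 + M * (i + 5)"
  proof -
    have "i \<le> M * (i + 5)" by (simp add: M_def)
    then show ?thesis by (simp add: k_def)
  qed
  have k4: "4 * M + 5 \<le> k \<and> 17 \<le> k"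
  proof -
    have "M * (i + 5) = M * i + 5 * M" by (simp add: algebra_simps)
    moreover have "i \<le> M * i" by (simp add: M_def)
    moreover have "3 \<le> M" using two by (simp add: M_def)
    ultimately show ?thesis using kM by linarith
  qed
  then have k4: "4 * M + 5 \<le> k" "17 \<le> k" by auto
  have dm: "star_dir a = (star_dir b :: int ^ 'n)" if "a mod M = b mod M" for a b
    using that star_dir_mod[where 'n = 'n] unfolding M_def by metis
  \<comment> \<open>The vector that together with the first direction spans the plane to be avoided:
    the direction of the piece, or its offset from \<open>p\<close> if it is parallel to the first
    step.\<close>
  define a1 where "a1 w = (if direction w \<in> span {real_vec (star_dir i :: int ^ 'n)} then base w - p else direction w)" for w :: "'n piece"
  define a2 where "a2 w = (if direction w \<in> span {real_vec (star_dir j :: int ^ 'n)} then base w - q else direction w)" for w :: "'n piece"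
  have tri: "unimodular_triple (star_dir a :: int ^ 'n) (star_dir b) (star_dir c)"
    if "3 \<le> ?N" "a mod M \<noteq> b mod M" "a mod M \<noteq> c mod M" "b mod M \<noteq> c mod M" for a b c
    using star_dir_triple[of a b c] that by (simp add: M_def)
  have prs: "unimodular_pair (star_dir a :: int ^ 'n) (star_dir b)" if "a mod M \<noteq> b mod M" for a b
    using star_dir_pair[of a b] that two by (simp add: M_def)
  define E1 where "E1 = {w \<in> a1 ` D. w \<notin> span {real_vec (star_dir i)}}"
  \<comment> \<open>In the plane \<open>y = 0\<close> is fixed, which keeps the second direction a
    ray of the star and its pair with \<open>star_dir i\<close> unimodular.\<close>
  have "\<exists>y. (?N = 2 \<longrightarrow> y = 0) \<and> (3 \<le> ?N \<longrightarrow> (\<forall>w\<in>E1.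
      real_vec (star_dir (i + ?N) + y *s star_dir (i + 1) :: int ^ 'n) \<notin> span {real_vec (star_dir i), w}))"
  proof (cases "3 \<le> ?N")
    case True
    have "unimodular_triple (star_dir i :: int ^ 'n) (star_dir (i + ?N)) (star_dir (i + 1))"
      using True mod_neq[of i "i + ?N" M] mod_neq[of i "i + 1" M] mod_neq[of "i + 1" "i + ?N" M]
      by (intro tri) (auto simp: M_def)
    moreover have "finite E1" using G(1) by (simp add: E1_def)
    moreover have "w \<notin> span {real_vec (star_dir i)}" if "w \<in> E1" for w using that by (simp add: E1_def)
    ultimately have "\<exists>y. \<forall>w\<in>E1. real_vec (star_dir (i + ?N) + y *s star_dir (i + 1) :: int ^ 'n) \<notin> span {real_vec (star_dir i), w}"
      by (rule choose_multiple)
    then show ?thesis using True by fastforce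
  next
    case False
    then show ?thesis by (intro exI[of _ 0]) simp
  qed
  then obtain y where y0: "?N = 2 \<longrightarrow> y = 0"
    and all_y: "3 \<le> ?N \<longrightarrow> (\<forall>w\<in>E1. real_vec (star_dir (i + ?N) + y *s star_dir (i + 1) :: int ^ 'n) \<notin> span {real_vec (star_dir i), w})"
    by (elim exE conjE)
  have y: "real_vec (star_dir (i + ?N) + y *s star_dir (i + 1) :: int ^ 'n) \<notin> span {real_vec (star_dir i), a1 w}"
    if "3 \<le> ?N" "w \<in> D" "a1 w \<notin> span {real_vec (star_dir i)}" for w
  proof -
    have "a1 w \<in> E1" using that unfolding E1_def by blast
    then show ?thesis using all_y that(1) by blast
  qed
  define E2 where "E2 = {w \<in> a2 ` D. w \<notin> span {real_vec (star_dir j)}}"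
  have "\<exists>y'. (?N = 2 \<longrightarrow> y' = 0) \<and> (3 \<le> ?N \<longrightarrow> (\<forall>w\<in>E2.
      real_vec (star_dir (j + 1) + y' *s star_dir (j + ?N) :: int ^ 'n) \<notin> span {real_vec (star_dir j), w}))"
  proof (cases "3 \<le> ?N")
    case True
    have "unimodular_triple (star_dir j :: int ^ 'n) (star_dir (j + 1)) (star_dir (j + ?N))"
      using True mod_neq[of j "j + ?N" M] mod_neq[of j "j + 1" M] mod_neq[of "j + 1" "j + ?N" M]
      by (intro tri) (auto simp: M_def)
    moreover have "finite E2" using G(1) by (simp add: E2_def)
    moreover have "w \<notin> span {real_vec (star_dir j)}" if "w \<in> E2" for w using that by (simp add: E2_def)
    ultimately have "\<exists>y. \<forall>w\<in>E2. real_vec (star_dir (j + 1) + y *s star_dir (j + ?N) :: int ^ 'n) \<notin> span {real_vec (star_dir j), w}"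
      by (rule choose_multiple)
    then show ?thesis using True by fastforce
  next
    case False
    then show ?thesis by (intro exI[of _ 0]) simp
  qed
  then obtain y' where y0': "?N = 2 \<longrightarrow> y' = 0"
    and all_y': "3 \<le> ?N \<longrightarrow> (\<forall>w\<in>E2. real_vec (star_dir (j + 1) + y' *s star_dir (j + ?N) :: int ^ 'n) \<notin> span {real_vec (star_dir j), w})"
    by (elim exE conjE)
  have y': "real_vec (star_dir (j + 1) + y' *s star_dir (j + ?N) :: int ^ 'n) \<notin> span {real_vec (star_dir j), a2 w}"
    if "3 \<le> ?N" "w \<in> D" "a2 w \<notin> span {real_vec (star_dir j)}" for w
  proof -
    have "a2 w \<in> E2" using that unfolding E2_def by blast
    then show ?thesis using all_y' that(1) by blast
  qed
  define g where "g = (star_dir (i + ?N) + y *s star_dir (i + 1) :: int ^ 'n)"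
  define h where "h = (star_dir (j + 1) + y' *s star_dir (j + ?N) :: int ^ 'n)"
  \<comment> \<open>The offset \<open>i + n\<close> is congruent to \<open>i - 1\<close>, so the run
    starts at position 2 with ray \<open>i + 1\<close>. The last step runs into \<open>q\<close>,
    hence the minus sign.\<close>
  define u where "u l = (if l = 0 then star_dir i else if l = 1 then g else if l = k - 2 then h
     else if l = k - 1 then - star_dir j else star_dir (l + (i + ?N)) :: int ^ 'n)" for l
  have u0: "u 0 = star_dir i" and u1: "u 1 = g" by (simp_all add: u_def)
  have um: "u l = star_dir (l + (i + ?N))" if "2 \<le> l" "l \<le> k - 3" for l using that k4 by (auto simp: u_def)
  have uk2: "u (k - 2) = h" and uk1: "u (k - 1) = - star_dir j" using k4 by (auto simp: u_def)
  have shift: "star_dir (a + M) = (star_dir a :: int ^ 'n)" for a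
    by (rule dm) simp
  have u2: "u 2 = star_dir (i + 1)"
  proof -
    have "2 + (i + ?N) = i + 1 + M" by (simp add: M_def)
    moreover have "2 \<le> k - 3" using k4 by simp
    ultimately show ?thesis using um[of 2] shift[of "i + 1"] by (simp only: order_refl)
  qed
  have u3: "u 3 = star_dir (i + 2)"
  proof -
    have "3 + (i + ?N) = i + 2 + M" by (simp add: M_def)
    moreover have "2 \<le> (3::nat)" "3 \<le> k - 3" using k4 by simp_all
    ultimately show ?thesis using um[of 3] shift[of "i + 2"] by (simp only: )
  qed
  have uk3: "u (k - 3) = star_dir (j + ?N)"
  proof -
    have "k - 3 + (i + ?N) = j + ?N + M * (i + 5)" using kM k4 by linarith
    then show ?thesis using um[of "k - 3"] k4 dm[of "k - 3 + (i + ?N)" "j + ?N"] by simp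
  qed
  have uk4: "u (k - 4) = star_dir (j + ?N + ?N)"
  proof -
    have "k - 4 + (i + ?N) + M = j + ?N + ?N + M * (i + 5)" using kM k4 M_def by linarith
    then have "star_dir (k - 4 + (i + ?N)) = (star_dir (j + ?N + ?N + M * (i + 5)) :: int ^ 'n)"
      using shift[of "k - 4 + (i + ?N)"] by (simp only:)
    also have "\<dots> = star_dir (j + ?N + ?N)" by (rule dm) (rule mod_mult_self2)
    finally show ?thesis using um[of "k - 4"] k4 by simp
  qed
  have pair: "unimodular_pair (u l) (u (Suc l))" if l: "Suc l < k" for l
  proof -
    consider "l = 0" | "l = 1" | "2 \<le> l" "Suc l \<le> k - 3" | "l = k - 3" | "l = k - 2"
      using l k4 by linarith
    then show ?thesis
    proof cases
      case 1
      have "unimodular_pair (star_dir i) g"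
      proof (cases "3 \<le> ?N")
        case True
        have "unimodular_triple (star_dir i :: int ^ 'n) (star_dir (i + ?N)) (star_dir (i + 1))"
          using True mod_neq[of i "i + ?N" M] mod_neq[of i "i + 1" M] mod_neq[of "i + 1" "i + ?N" M]
          by (intro tri) (auto simp: M_def)
        then show ?thesis unfolding g_def by (rule unimodular_triple_pair[OF unimodular_triple_add])
      next
        case False
        then have "y = 0" using y0 two by simp
        then have "g = star_dir (i + ?N)" by (simp add: g_def vec_eq_iff)
        then show ?thesis using prs[of i "i + ?N"] mod_neq[of i "i + ?N" M] two by (simp add: M_def)
      qed
      then show ?thesis using 1 u0 u1 by simp
    next
      case 2
      have "unimodular_pair (star_dir (i + 1)) g"
        unfolding g_def using mod_neq[of "i + 1" "i + ?N" M] two by (intro unimodular_pair_add prs) (simp add: M_def)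
      then have "unimodular_pair g (star_dir (i + 1))" by (rule unimodular_pair_sym)
      then show ?thesis using 2 u1 u2 by (simp add: numeral_2_eq_2)
    next
      case 3
      then show ?thesis using um[of l] um[of "Suc l"] prs[of "l + (i + ?N)" "Suc l + (i + ?N)"]
          mod_neq[of "l + (i + ?N)" "Suc l + (i + ?N)" M] two by (simp add: M_def)
    next
      case 4
      have "unimodular_pair (star_dir (j + ?N)) h"
        unfolding h_def using mod_neq[of "j + 1" "j + ?N" M] two
        by (intro unimodular_pair_add prs) (simp add: M_def)
      moreover have "Suc (k - 3) = k - 2" using k4 by simp
      ultimately show ?thesis using 4 uk3 uk2 by simp
    next
      case 5
      have "unimodular_pair (star_dir j) h"
      proof (cases "3 \<le> ?N")
        case True
        have "unimodular_triple (star_dir j :: int ^ 'n) (star_dir (j + 1)) (star_dir (j + ?N))"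
          using True mod_neq[of j "j + ?N" M] mod_neq[of j "j + 1" M] mod_neq[of "j + 1" "j + ?N" M]
          by (intro tri) (auto simp: M_def)
        then show ?thesis unfolding h_def by (rule unimodular_triple_pair[OF unimodular_triple_add])
      next
        case False
        then have "y' = 0" using y0' two by simp
        then have "h = star_dir (j + 1)" by (simp add: h_def vec_eq_iff)
        then show ?thesis using prs[of j "j + 1"] mod_neq[of j "j + 1" M] two by (simp add: M_def)
      qed
      then have "unimodular_pair h (- star_dir j)" by (rule unimodular_pair_sym[OF unimodular_pair_uminus])
      moreover have "Suc (k - 2) = k - 1" using k4 by simp
      ultimately show ?thesis using 5 uk1 uk2 by simp
    qed
  qed
  have triple: "unimodular_triple (u l) (u (Suc l)) (u (Suc (Suc l)))" if n3: "3 \<le> ?N" and l: "Suc (Suc l) < k" for l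
  proof -
    consider "l = 0" | "l = 1" | "2 \<le> l" "Suc (Suc l) \<le> k - 3" | "l = k - 4" | "l = k - 3"
      using l k4 by linarith
    then show ?thesis
    proof cases
      case 1
      have "unimodular_triple (star_dir i :: int ^ 'n) (star_dir (i + ?N)) (star_dir (i + 1))"
        using n3 mod_neq[of i "i + ?N" M] mod_neq[of i "i + 1" M] mod_neq[of "i + 1" "i + ?N" M]
        by (intro tri) (auto simp: M_def)
      then have "unimodular_triple (star_dir i) g (star_dir (i + 1))" unfolding g_def by (rule unimodular_triple_add)
      then show ?thesis using 1 u0 u1 u2 by (simp add: numeral_2_eq_2)
    next
      case 2
      have "unimodular_triple (star_dir (i + 2) :: int ^ 'n) (star_dir (i + ?N)) (star_dir (i + 1))"
        using n3 mod_neq[of "i + 2" "i + ?N" M] mod_neq[of "i + 1" "i + 2" M] mod_neq[of "i + 1" "i + ?N" M]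
        by (intro tri) (auto simp: M_def)
      then have "unimodular_triple (star_dir (i + 2)) g (star_dir (i + 1))" unfolding g_def by (rule unimodular_triple_add)
      then have "unimodular_triple g (star_dir (i + 1)) (star_dir (i + 2))"
        by (rule unimodular_triple_perm(2)[OF unimodular_triple_perm(1)])
      then show ?thesis using 2 u1 u2 u3 by (simp add: numeral_2_eq_2 numeral_3_eq_3)
    next
      case 3
      then show ?thesis using um[of l] um[of "Suc l"] um[of "Suc (Suc l)"] n3
          mod_neq[of "l + (i + ?N)" "Suc l + (i + ?N)" M] mod_neq[of "l + (i + ?N)" "Suc (Suc l) + (i + ?N)" M]
          mod_neq[of "Suc l + (i + ?N)" "Suc (Suc l) + (i + ?N)" M]
          tri[of "l + (i + ?N)" "Suc l + (i + ?N)" "Suc (Suc l) + (i + ?N)"] by (simp add: M_def)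
    next
      case 4
      have "unimodular_triple (star_dir (j + ?N + ?N) :: int ^ 'n) (star_dir (j + 1)) (star_dir (j + ?N))"
      proof (rule tri[OF n3])
        have e: "(j + ?N + ?N) mod M = (j + (?N - 1)) mod M"
        proof -
          have "j + ?N + ?N = (j + (?N - 1)) + M" using two by (simp add: M_def)
          then show ?thesis by (metis mod_add_self2)
        qed
        show "(j + ?N + ?N) mod M \<noteq> (j + 1) mod M"
          unfolding e by (rule not_sym, rule mod_neq) (use n3 in \<open>auto simp: M_def\<close>)
        show "(j + ?N + ?N) mod M \<noteq> (j + ?N) mod M"
          unfolding e by (rule mod_neq) (use n3 in \<open>auto simp: M_def\<close>)
        show "(j + 1) mod M \<noteq> (j + ?N) mod M"
          using mod_neq[of "j + 1" "j + ?N" M] n3 by (simp add: M_def)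
      qed
      then have "unimodular_triple (star_dir (j + ?N + ?N)) h (star_dir (j + ?N))" unfolding h_def by (rule unimodular_triple_add)
      then have "unimodular_triple (star_dir (j + ?N + ?N)) (star_dir (j + ?N)) h" by (rule unimodular_triple_perm(2))
      moreover have "Suc (k - 4) = k - 3" "Suc (k - 3) = k - 2" using k4 by simp_all
      ultimately show ?thesis using 4 uk4 uk3 uk2 by simp
    next
      case 5
      have "unimodular_triple (star_dir j :: int ^ 'n) (star_dir (j + 1)) (star_dir (j + ?N))"
        using n3 mod_neq[of j "j + ?N" M] mod_neq[of j "j + 1" M] mod_neq[of "j + 1" "j + ?N" M]
        by (intro tri) (auto simp: M_def)
      then have "unimodular_triple (star_dir j) h (star_dir (j + ?N))" unfolding h_def by (rule unimodular_triple_add)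
      then have "unimodular_triple (- star_dir j) h (star_dir (j + ?N))" by (rule unimodular_triple_uminus)
      then have "unimodular_triple (star_dir (j + ?N)) h (- star_dir j)"
        by (rule unimodular_triple_perm(1)[OF unimodular_triple_perm(2)[OF unimodular_triple_perm(1)]])
      moreover have "Suc (k - 3) = k - 2" "Suc (k - 2) = k - 1" using k4 by simp_all
      ultimately show ?thesis using 5 uk1 uk2 uk3 by simp
    qed
  qed
  let ?U = "\<lambda>l. real_vec (u l)"
  \<comment> \<open>The blocks follow each other directly after the two special directions; each of
    them is one full cycle of the star.\<close>
  define s where "s b = 2 + b * M" for b
  have solve: "\<exists>r. (\<Sum>l\<in>{s b..<s b + M}. r l *\<^sub>R ?U l) = x \<and> (\<Sum>l\<in>{s b..<s b + M}. r l) = \<sigma> \<and>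
     ((\<forall>c. real (2 * ?N + 1) * \<bar>x $ c\<bar> < \<sigma>) \<longrightarrow> (\<forall>l. 0 < r l))" if b: "b < 4" for b x \<sigma>
  proof -
    from star_dir_solve[of "s b + (i + ?N)" x \<sigma>]
    obtain r where r: "(\<Sum>l\<in>{s b + (i + ?N)..<s b + (i + ?N) + M}. r l *\<^sub>R real_vec (star_dir l)) = x"
      "(\<Sum>l\<in>{s b + (i + ?N)..<s b + (i + ?N) + M}. r l) = \<sigma>"
      "(\<forall>c. real (2 * ?N + 1) * \<bar>x $ c\<bar> < \<sigma>) \<longrightarrow> (\<forall>l. 0 < r l)"
      unfolding M_def[symmetric] by (elim exE conjE)
    have e: "{s b + (i + ?N)..<s b + (i + ?N) + M} = {s b + (i + ?N)..<(s b + M) + (i + ?N)}" by (simp add: add.commute add.left_commute)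
    have "b * M \<le> 3 * M" using b by simp
    then have in_mid: "2 \<le> l \<and> l \<le> k - 3" if "l \<in> {s b..<s b + M}" for l
    proof -
      have "s b \<le> l" "l < s b + M" using that by auto
      then have "2 + b * M \<le> l" "l < 2 + b * M + M" by (simp_all add: s_def)
      then show ?thesis using \<open>b * M \<le> 3 * M\<close> k4 by linarith
    qed
    have "(\<Sum>l\<in>{s b..<s b + M}. r (l + (i + ?N)) *\<^sub>R ?U l) =
        (\<Sum>l\<in>{s b..<s b + M}. r (l + (i + ?N)) *\<^sub>R real_vec (star_dir (l + (i + ?N))))"
      by (rule sum.cong) (use in_mid um in auto)
    also have "\<dots> = x" using r(1) unfolding e sum.shift_bounds_nat_ivl .
    finally have "(\<Sum>l\<in>{s b..<s b + M}. r (l + (i + ?N)) *\<^sub>R ?U l) = x" .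
    moreover have "(\<Sum>l\<in>{s b..<s b + M}. r (l + (i + ?N))) = \<sigma>"
      using r(2) unfolding e sum.shift_bounds_nat_ivl .
    ultimately show ?thesis using r(3) by (intro exI[of _ "\<lambda>l. r (l + (i + ?N))"]) auto
  qed
  have "\<exists>\<alpha>\<in>sols k ?U (q - p) L. \<forall>l<k. 0 < \<alpha> l"
  proof (rule positive_solution[where B = "{s 0..<s 0 + M}" and K = "real (2 * ?N + 1)"])
    show "{s 0..<s 0 + M} \<subseteq> {..<k}" using k4 by (auto simp: s_def)
    show "\<exists>r. (\<Sum>l\<in>{s 0..<s 0 + M}. r l *\<^sub>R ?U l) = x \<and> (\<Sum>l\<in>{s 0..<s 0 + M}. r l) = \<sigma> \<and> (\<forall>l. 0 < r l)"
      if "\<And>c. real (2 * ?N + 1) * \<bar>x $ c\<bar> < \<sigma>" for x \<sigma>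
      using solve[of 0 x \<sigma>] that by auto
    show "real (2 * ?N + 1) * \<bar>(q - p) $ c\<bar> < L" for c by (rule L)
  qed
  then obtain \<alpha>0 where \<alpha>0: "\<alpha>0 \<in> sols k ?U (q - p) L" "\<And>l. l < k \<Longrightarrow> 0 < \<alpha>0 l" by blast
  have rj: "- ?U (k - 1) = real_vec (star_dir j)" unfolding uk1 by simp
  have spj: "span {?U (k - 1)} = span {real_vec (star_dir j)}" unfolding uk1 by (simp add: span_singleton_uminus)
  have spj2: "span {?U (k - 1), w} = span {real_vec (star_dir j), w}" for w
  proof -
    have 1: "?U (k - 1) \<in> span {real_vec (star_dir j), w}" "real_vec (star_dir j) \<in> span {?U (k - 1), w}"
      unfolding rj[symmetric] using span_base[of "?U (k - 1)" "{?U (k - 1), w}"]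
        span_neg[OF span_base[of "- ?U (k - 1)" "{- ?U (k - 1), w}"]] by (auto intro: span_neg)
    show ?thesis
      by (intro subset_antisym span_minimal) (use 1 in \<open>auto intro: span_base\<close>)
  qed
  interpret join u k M s p "q - p" L D q
  proof unfold_locales
    show "4 \<le> k" using k4 by simp
    show "unimodular_pair (u l) (u (Suc l))" if "Suc l < k" for l by (rule pair[OF that])
    show "unimodular_triple (u l) (u (Suc l)) (u (Suc (Suc l)))" if "3 \<le> ?N" "Suc (Suc l) < k" for l
      by (rule triple[OF that])
    show "full_block ?U {s b..<s b + M}" if "b < 4" for b
      unfolding full_block_def using solve[OF that] by blast
    show "s 0 + M \<le> s 1" "s 1 + M \<le> s 2" "s 2 + M \<le> s 3" by (simp_all add: s_def)
    show "s 3 + M \<le> k" using k4 by (simp add: s_def)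
    show "0 < M" by (simp add: M_def)
    show "sols k ?U (q - p) L \<noteq> {}" using \<alpha>0(1) by blast
    show "general_position D" by (rule gp)
    show "Ray p (?U 0) \<in> D" using r1 u0 by simp
    show "Ray q (- ?U (k - 1)) \<in> D" using r2 rj by simp
    show "Ray p (?U 0) \<noteq> Ray q (- ?U (k - 1))" using r12 rj u0 by simp
    show "q - p = q - p" ..
    show "?U 1 \<notin> span {?U 0, direction a}" if "3 \<le> ?N" "a \<in> D" "direction a \<notin> span {?U 0}" for a
      using y[OF that(1,2)] that(3) unfolding u0 u1 g_def a1_def by simp
    show "?U 1 \<notin> span {?U 0, base a - p}" if "3 \<le> ?N" "a \<in> D" "base a - p \<notin> span {?U 0}" "direction a \<in> span {?U 0}" for a
      using y[OF that(1,2)] that(3,4) unfolding u0 u1 g_def a1_def by simp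
    show "?U (k - 2) \<notin> span {?U (k - 1), direction a}" if "3 \<le> ?N" "a \<in> D" "direction a \<notin> span {?U (k - 1)}" for a
      using y'[OF that(1,2)] that(3) unfolding spj2 spj uk2 h_def a2_def by simp
    show "?U (k - 2) \<notin> span {?U (k - 1), base a - q}" if "3 \<le> ?N" "a \<in> D" "base a - q \<notin> span {?U (k - 1)}" "direction a \<in> span {?U (k - 1)}" for a
      using y'[OF that(1,2)] that(3,4) unfolding spj2 spj uk2 h_def a2_def by simp
  qed
  have "\<exists>\<alpha>. joined u k M s p (q - p) L D q \<alpha>"
    by (rule joined_exists[OF two \<alpha>0(1)]) (rule \<alpha>0(2))
  then obtain \<alpha> where "joined u k M s p (q - p) L D q \<alpha>" by blast
  then interpret J: joined u k M s p "q - p" L D q \<alpha> .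
  show thesis
  proof (rule that[of k "J.X" \<alpha> "J.side ` {1..<k}"])
    show "2 \<le> k" using k4 by simp
    show "J.X 0 = p" "J.X k = q" by simp_all
    show "inj_on J.X {1..<k}" using J.X_inj by (auto intro!: inj_onI)
    show "J.X ` {1..<k} \<inter> nodes_of D = {}" using J.X_node by auto
    show "piece_length (Segment (J.X l) (J.X (Suc l))) = ereal (\<alpha> l)" if l: "l < k" for l
    proof -
      obtain F t where F: "lattice_basis F" "F t = u l"
      proof (cases "Suc l < k")
        case True
        then show thesis using pair[of l] that unfolding unimodular_pair_def by blast
      next
        case False
        then have "Suc (l - 1) < k" "Suc (l - 1) = l" using l k4 by auto
        then show thesis using pair[of "l - 1"] that unfolding unimodular_pair_def by metis
      qed
      \<comment> \<open>\<open>lattice_length\<close> looks at \<open>X l - X (Suc l)\<close>, so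
        the basis vector has to be negated.\<close>
      have F': "lattice_basis (F(t := - F t))" by (rule lattice_basis_uminus[OF F(1)])
      have "J.X l - J.X (Suc l) = \<alpha> l *\<^sub>R real_vec ((F(t := - F t)) t)"
        using J.X_step[of l] F(2) by (simp add: algebra_simps)
      from lattice_length_eq[OF F' J.pos[OF l] this] show ?thesis by simp
    qed
    show "0 < \<alpha> l" if "l < k" for l by (rule J.pos[OF that])
    show "(\<Sum>l<k. \<alpha> l) = L" using J.\<alpha> by (simp add: sols_def)
    show "finite (J.side ` {1..<k})" by simp
    show "\<exists>z v. a = Ray z v \<and> z \<in> J.X ` {1..<k}" if "a \<in> J.side ` {1..<k}" for a
      using that by (auto simp: J.side_def)
    have D': "(D - {Ray p (real_vec (star_dir i)), Ray q (real_vec (star_dir j))}) \<union>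
       (\<lambda>l. Segment (J.X l) (J.X (Suc l))) ` {..<k} \<union> J.side ` {1..<k} = J.D'"
      unfolding J.D'_def J.seg_def[abs_def] u0 rj by simp
    show "general_position ((D - {Ray p (real_vec (star_dir i)), Ray q (real_vec (star_dir j))}) \<union>
       (\<lambda>l. Segment (J.X l) (J.X (Suc l))) ` {..<k} \<union> J.side ` {1..<k})"
      unfolding D' by (rule J.general_position_D')
    show "nodes_of ((D - {Ray p (real_vec (star_dir i)), Ray q (real_vec (star_dir j))}) \<union>
       (\<lambda>l. Segment (J.X l) (J.X (Suc l))) ` {..<k} \<union> J.side ` {1..<k}) = nodes_of D \<union> J.X ` {1..<k}"
      unfolding D' by (rule J.nodes_D')
  qed
qed

section \<open>Realising an abstract tropical curve\<close>

abbreviation star_ray :: "real ^ 'n \<Rightarrow> nat \<Rightarrow> 'n::finite piece" where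
  "star_ray p c \<equiv> Ray p (real_vec (star_dir c))"

text \<open>The rays claimed by the other edges must survive joining one edge, which the
  distinctness assumptions ensure. The points \<open>P\<close> and \<open>Q\<close> stay fixed, so
  the distance bounds do not change during the induction.\<close>

lemma join_all:
  fixes P Q :: "'e \<Rightarrow> real ^ 'n::finite" and ci cj :: "'e \<Rightarrow> nat" and l :: "'e \<Rightarrow> real"
  assumes two: "2 \<le> CARD('n)" and \<Gamma>: "abstract_tropical_curve \<Gamma>"
    and "finite U" "general_position D"
    and rays: "\<And>e. e \<in> U \<Longrightarrow> star_ray (P e) (ci e) \<in> D \<and> star_ray (Q e) (cj e) \<in> D"
    and dist1: "\<And>e f. e \<in> U \<Longrightarrow> f \<in> U \<Longrightarrow> star_ray (P e) (ci e) \<noteq> (star_ray (Q f) (cj f) :: 'n piece)"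
    and dist2: "\<And>e f. e \<in> U \<Longrightarrow> f \<in> U \<Longrightarrow> e \<noteq> f \<Longrightarrow> star_ray (P e) (ci e) \<noteq> (star_ray (P f) (ci f) :: 'n piece)"
    and dist3: "\<And>e f. e \<in> U \<Longrightarrow> f \<in> U \<Longrightarrow> e \<noteq> f \<Longrightarrow> star_ray (Q e) (cj e) \<noteq> (star_ray (Q f) (cj f) :: 'n piece)"
    and len: "\<And>e c. e \<in> U \<Longrightarrow> real (2 * CARD('n) + 1) * \<bar>(Q e - P e) $ c\<bar> < l e"
    and M: "isometric_to_modification
       (partial_curve (D - ((\<lambda>e. star_ray (P e) (ci e)) ` U \<union> (\<lambda>e. star_ray (Q e) (cj e)) ` U)) (nodes_of D) U P Q l) \<Gamma>"
  shows "\<exists>D. general_position D \<and> isometric_to_modification (partial_curve D (nodes_of D) {} P Q l) \<Gamma>"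
  using assms(3-)
proof (induction U arbitrary: D rule: finite_induct)
  case empty
  then show ?case by (intro exI[of _ D]) simp
next
  case (insert e U)
  let ?r1 = "\<lambda>e. star_ray (P e) (ci e) :: 'n piece" and ?r2 = "\<lambda>e. star_ray (Q e) (cj e) :: 'n piece"
  have eI: "e \<in> insert e U" by simp
  have r: "?r1 e \<in> D" "?r2 e \<in> D" "?r1 e \<noteq> ?r2 e"
    using insert.prems(2)[OF eI] insert.prems(3)[OF eI eI] by auto
  obtain k X al S where J: "2 \<le> k" "X 0 = P e" "X k = Q e" "inj_on X {1..<k}" "X ` {1..<k} \<inter> nodes_of D = {}"
    "\<And>i. i < k \<Longrightarrow> piece_length (Segment (X i) (X (Suc i))) = ereal (al i)" "\<And>i. i < k \<Longrightarrow> 0 < al i"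
    "(\<Sum>i<k. al i) = l e" "finite S" "\<And>a. a \<in> S \<Longrightarrow> \<exists>z v. a = Ray z v \<and> z \<in> X ` {1..<k}"
    "general_position ((D - {?r1 e, ?r2 e}) \<union> (\<lambda>i. Segment (X i) (X (Suc i))) ` {..<k} \<union> S)"
    "nodes_of ((D - {?r1 e, ?r2 e}) \<union> (\<lambda>i. Segment (X i) (X (Suc i))) ` {..<k} \<union> S) = nodes_of D \<union> X ` {1..<k}"
    by (rule join_step[OF two insert.prems(1) r insert.prems(6)[OF eI]]) blast
  let ?segs = "(\<lambda>i. Segment (X i) (X (Suc i))) ` {..<k}"
  let ?D2 = "(D - {?r1 e, ?r2 e}) \<union> ?segs \<union> S"
  let ?open = "\<lambda>U. ?r1 ` U \<union> ?r2 ` U"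
  have base: "P f \<in> nodes_of D" "Q f \<in> nodes_of D" if "f \<in> insert e U" for f
    using insert.prems(2)[OF that] unfolding nodes_of_def by force+
  have "isometric_to_modification
      (partial_curve ((D - ?open (insert e U)) \<union> ?segs \<union> S) (nodes_of D \<union> X ` {1..<k}) (insert e U - {e}) P Q l) \<Gamma>"
  proof (rule partial_curve_lay_path[OF insert.prems(7) \<Gamma> eI base[OF eI] _ J(1-5)])
    show "(\<Union>a\<in>D - ?open (insert e U). endpoints a) \<subseteq> nodes_of D" by (auto simp: nodes_of_def)
  qed (use J in auto)
  moreover have "(D - ?open (insert e U)) \<union> ?segs \<union> S = ?D2 - ?open U"
  proof -
    \<comment> \<open>Additional rays start at new bends, claimed rays at old vertices, so the two
      kinds are never confused.\<close>
    have "S \<inter> ?open U = {}"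
    proof -
      have "False" if a: "a \<in> S" "f \<in> U" "a = ?r1 f \<or> a = ?r2 f" for a f
      proof -
        obtain z v where "a = Ray z v" "z \<in> X ` {1..<k}" using J(10)[OF a(1)] by blast
        then show False using a(2,3) base[of f] J(5) by auto
      qed
      then show ?thesis by blast
    qed
    moreover have "?segs \<inter> ?open U = {}" by auto
    ultimately show ?thesis by auto
  qed
  moreover have "insert e U - {e} = U" using insert.hyps(2) by auto
  ultimately have M2: "isometric_to_modification (partial_curve (?D2 - ?open U) (nodes_of ?D2) U P Q l) \<Gamma>"
    unfolding J(12) by simp
  have ef: "e \<noteq> f" if "f \<in> U" for f using insert.hyps(2) that by auto
  show ?case
  proof (rule insert.IH[OF J(11) _ _ _ _ _ M2])
    show "?r1 f \<in> ?D2 \<and> ?r2 f \<in> ?D2" if f: "f \<in> U" for f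
    proof -
      have fI: "f \<in> insert e U" using f by simp
      have "?r1 f \<noteq> ?r1 e" "?r1 f \<noteq> ?r2 e" "?r2 f \<noteq> ?r1 e" "?r2 f \<noteq> ?r2 e"
        using insert.prems(4)[OF eI fI ef[OF f]] insert.prems(3)[OF fI eI] insert.prems(3)[OF eI fI]
          insert.prems(5)[OF eI fI ef[OF f]] by metis+
      then show ?thesis using insert.prems(2)[OF fI] by auto
    qed
    show "?r1 f \<noteq> ?r2 g" if "f \<in> U" "g \<in> U" for f g using insert.prems(3)[of f g] that by blast
    show "?r1 f \<noteq> ?r1 g" if "f \<in> U" "g \<in> U" "f \<noteq> g" for f g using insert.prems(4)[of f g] that by blast
    show "?r2 f \<noteq> ?r2 g" if "f \<in> U" "g \<in> U" "f \<noteq> g" for f g using insert.prems(5)[of f g] that by blast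
    show "real (2 * CARD('n) + 1) * \<bar>(Q f - P f) $ c\<bar> < l f" if "f \<in> U" for f c
      using insert.prems(6)[of f c] that by blast
  qed
qed

section \<open>The initial stars around the finite vertices\<close>

lemma exists_rationally_independent:
  "\<exists>\<xi> :: real ^ 'n::finite. \<forall>w :: int ^ 'n. w \<noteq> 0 \<longrightarrow> real_vec w \<bullet> \<xi> \<noteq> 0"
proof (rule ccontr)
  assume "\<not> ?thesis"
  then have "(UNIV :: (real ^ 'n) set) \<subseteq> \<Union> ((\<lambda>w :: int ^ 'n. {x. real_vec w \<bullet> x = 0}) ` {w. w \<noteq> 0})" by auto
  moreover have "negligible (\<Union> ((\<lambda>w :: int ^ 'n. {x. real_vec w \<bullet> x = 0}) ` {w. w \<noteq> 0}))"
  proof (rule negligible_countable_Union)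
    show "countable ((\<lambda>w :: int ^ 'n. {x. real_vec w \<bullet> x = 0}) ` {w. w \<noteq> 0})"
      by (intro countable_image countableI_type)
    fix S assume "S \<in> (\<lambda>w :: int ^ 'n. {x. real_vec w \<bullet> x = 0}) ` {w. w \<noteq> 0}"
    then obtain w :: "int ^ 'n" where "w \<noteq> 0" "S = {x. real_vec w \<bullet> x = 0}" by blast
    moreover then have "real_vec w \<noteq> 0" by (auto simp: real_vec_def vec_eq_iff)
    ultimately show "negligible S" using negligible_hyperplane by blast
  qed
  ultimately show False using negligible_subset non_negligible_UNIV by blast
qed

lemma star_dir_range: "star_dir ` {..CARD('n)} = star_set (\<lambda>j :: 'n::finite. axis j 1) UNIV"
proof -
  have "axis_enum ` {..<CARD('n)} = (UNIV :: 'n set)" using axis_enum_bij by (auto simp: bij_betw_def)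
  then have "(\<lambda>j :: 'n. axis j (1::int)) ` UNIV = (\<lambda>j. axis j 1) ` (axis_enum ` {..<CARD('n)})"
    by (simp only:)
  also have "\<dots> = (\<lambda>c. axis (axis_enum c) 1) ` {..<CARD('n)}" by (simp only: image_image)
  also have "\<dots> = star_dir ` {..<CARD('n)}" by (rule image_cong) (auto simp: star_dir_def)
  finally have "star_set (\<lambda>j :: 'n. axis j 1) UNIV = insert (star_dir CARD('n)) (star_dir ` {..<CARD('n)})"
    by (simp add: star_set_def star_dir_def)
  also have "\<dots> = star_dir ` {..CARD('n)}" by (simp add: lessThan_Suc_atMost[symmetric] lessThan_Suc)
  finally show ?thesis by simp
qed

lemma star_dir_inj: "2 \<le> CARD('n) \<Longrightarrow> inj_on (star_dir :: nat \<Rightarrow> int ^ 'n::finite) {..CARD('n)}"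
proof (rule inj_onI)
  fix a b assume "2 \<le> CARD('n)" "a \<in> {..CARD('n)}" "b \<in> {..CARD('n)}" "star_dir a = (star_dir b :: int ^ 'n)"
  then show "a = b"
    using unimodular_pair_not_span[OF star_dir_pair[where 'n = 'n, of a b]] span_base[of "real_vec (star_dir b :: int ^ 'n)"]
    by (cases "a = b") auto
qed

text \<open>Extend the directions to a lattice basis and take a dual vector at another index; this
  requires one direction in the plane or two in higher dimension.\<close>

lemma exists_annihilator:
  assumes n: "2 \<le> CARD('n)" and ij: "i = j \<or> 3 \<le> CARD('n)" and le: "i \<le> CARD('n)" "j \<le> CARD('n)"
  shows "\<exists>w :: int ^ 'n::finite. w \<noteq> 0 \<and> real_vec w \<bullet> real_vec (star_dir i) = 0 \<and> real_vec w \<bullet> real_vec (star_dir j) = 0"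
proof -
  have "card {i, j} < card {..CARD('n)}" using n by (simp add: card_insert_if)
  then have "\<not> {..CARD('n)} \<subseteq> {i, j}" using card_mono[of "{i, j}" "{..CARD('n)}"] by auto
  then obtain r where r: "r \<le> CARD('n)" "r \<noteq> i" "r \<noteq> j" by auto
  obtain F :: "'n \<Rightarrow> int ^ 'n" and \<pi> where F: "lattice_basis F" "inj_on \<pi> ({..CARD('n)} - {r})"
    "\<And>i. i \<in> {..CARD('n)} - {r} \<Longrightarrow> F (\<pi> i) = star_dir i"
    using star_dir_basis[OF r(1)] by metis
  have "card {\<pi> i, \<pi> j} < card (UNIV :: 'n set)" using n ij by (auto simp: card_insert_if)
  then have "{\<pi> i, \<pi> j} \<noteq> UNIV" by auto
  then obtain t where t: "t \<noteq> \<pi> i" "t \<noteq> \<pi> j" by auto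
  obtain \<beta> where \<beta>: "\<And>j k. real_vec (\<beta> j) \<bullet> real_vec (F k) = (if j = k then 1 else 0)"
    using lattice_basis_dual[OF F(1)] by metis
  have "\<beta> t \<noteq> 0" using \<beta>[of t t] by auto
  moreover have "real_vec (\<beta> t) \<bullet> real_vec (star_dir i) = 0" "real_vec (\<beta> t) \<bullet> real_vec (star_dir j) = 0"
    using \<beta>[of t "\<pi> i"] \<beta>[of t "\<pi> j"] F(3)[of i] F(3)[of j] r le t by auto
  ultimately show ?thesis by blast
qed

text \<open>Positions differ by multiples of \<xi>. Parallel lines of different stars, and any two
  in dimension at least three, can meet only if an integral vector annihilates \<xi>; concurrency in
  the plane leads to an integral relation as well.\<close>

lemma general_position_stars:
  fixes \<xi> :: "real ^ 'n::finite" and W :: "'v set" and m :: "'v \<Rightarrow> nat"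
  assumes two: "2 \<le> CARD('n)" and \<xi>: "\<And>w :: int ^ 'n. w \<noteq> 0 \<Longrightarrow> real_vec w \<bullet> \<xi> \<noteq> 0"
    and W: "finite W" "inj_on m W" and \<epsilon>: "0 < \<epsilon>"
  defines "pos \<equiv> \<lambda>v. (\<epsilon> * real (m v)) *\<^sub>R \<xi>"
  defines "D \<equiv> (\<lambda>(v, c). star_ray (pos v) c) ` (W \<times> {..CARD('n)})"
  shows "general_position D" and "nodes_of D = pos ` W" and "inj_on pos W"
proof -
  let ?D = "(\<lambda>(v, c). star_ray (pos v) c) ` (W \<times> {..CARD('n)})"
  have pos_diff: "v = w" if v: "v \<in> W" "w \<in> W" and ij: "i = j \<or> 3 \<le> CARD('n)" "i \<le> CARD('n)" "j \<le> CARD('n)"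
    and d: "pos v - pos w \<in> span {real_vec (star_dir i), real_vec (star_dir j)}" for v w i j
  proof -
    obtain u :: "int ^ 'n" where u: "u \<noteq> 0" "real_vec u \<bullet> real_vec (star_dir i) = 0" "real_vec u \<bullet> real_vec (star_dir j) = 0"
      using exists_annihilator[OF two ij] by blast
    have "span {real_vec (star_dir i), real_vec (star_dir j)} \<subseteq> {x. real_vec u \<bullet> x = 0}"
      by (rule span_minimal) (use u in \<open>auto simp: subspace_hyperplane\<close>)
    then have "real_vec u \<bullet> (pos v - pos w) = 0" using d by auto
    then have "\<epsilon> * (real (m v) - real (m w)) * (real_vec u \<bullet> \<xi>) = 0"
      by (simp add: pos_def inner_diff_right algebra_simps)
    then have "m v = m w" using \<xi>[OF u(1)] \<epsilon> by simp
    then show ?thesis using W(2) v by (auto simp: inj_on_def)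
  qed
  show inj: "inj_on pos W"
    by (rule inj_onI, rule pos_diff[of _ _ 0 0]) (auto simp: span_zero)
  have nodes: "nodes_of ?D = pos ` W" by (force simp: nodes_of_def)
  then show "nodes_of D = pos ` W" by (simp add: D_def)
  have mem: "\<exists>v c. a = star_ray (pos v) c \<and> v \<in> W \<and> c \<le> CARD('n)" if "a \<in> ?D" for a using that by auto
  have lineD: "z - pos v \<in> span {real_vec (star_dir c)}" if "z \<in> line (star_ray (pos v) c)" for z v c
    using that by (auto simp: line_def span_scale span_base)
  have np: "real_vec (star_dir c' :: int ^ 'n) \<notin> span {real_vec (star_dir c)}"
    if "c \<noteq> c'" "c \<le> CARD('n)" "c' \<le> CARD('n)" for c c'
    using unimodular_pair_not_span[OF star_dir_pair[where 'n = 'n, of c c']] that two by simp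
  have diff_span: "pos v - pos w \<in> span {real_vec (star_dir c), real_vec (star_dir c')}"
    if "z \<in> line (star_ray (pos v) c)" "z \<in> line (star_ray (pos w) c')" for z v w c c'
  proof -
    have sub: "span {real_vec (star_dir c)} \<subseteq> span {real_vec (star_dir c), real_vec (star_dir c' :: int ^ 'n)}"
       "span {real_vec (star_dir c')} \<subseteq> span {real_vec (star_dir c), real_vec (star_dir c' :: int ^ 'n)}"
      by (intro span_mono; auto)+
    have "(z - pos w) - (z - pos v) \<in> span {real_vec (star_dir c), real_vec (star_dir c')}"
      by (rule span_diff[OF subsetD[OF sub(2) lineD[OF that(2)]] subsetD[OF sub(1) lineD[OF that(1)]]])
    then show ?thesis by simp
  qed
  have meet: "z = pos v" if "c \<noteq> c'" "c \<le> CARD('n)" "c' \<le> CARD('n)"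
    "z \<in> line (star_ray (pos v) c)" "z \<in> line (star_ray (pos v) c')" for z v c c'
  proof (rule line_unique[OF that(4,5)])
    show "pos v \<in> line (star_ray (pos v) c)" "pos v \<in> line (star_ray (pos v) c')"
      by (auto simp: line_def intro!: image_eqI[of _ _ 0])
    show "direction (star_ray (pos v) c') \<notin> span {direction (star_ray (pos v) c)}" using np[OF that(1-3)] by simp
  qed
  have B3: "z \<in> nodes_of ?D" if n3: "3 \<le> CARD('n)" and a: "a \<in> ?D" "b \<in> ?D" "a \<noteq> b" "z \<in> line a" "z \<in> line b" for a b z
  proof -
    obtain v c where a': "a = star_ray (pos v) c" "v \<in> W" "c \<le> CARD('n)" using mem[OF a(1)] by blast
    obtain w c' where b': "b = star_ray (pos w) c'" "w \<in> W" "c' \<le> CARD('n)" using mem[OF a(2)] by blast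
    have "v = w" by (rule pos_diff[OF a'(2) b'(2) _ a'(3) b'(3)]) (use n3 diff_span a a' b' in auto)
    then have "z = pos v" using meet[of c c' z v] a a' b' by auto
    then show ?thesis using nodes a'(2) by auto
  qed
  have B2: "z \<in> nodes_of ?D" if n2: "CARD('n) = 2" and abc: "a \<in> ?D" "b \<in> ?D" "d \<in> ?D" "a \<noteq> b" "a \<noteq> d" "b \<noteq> d"
    and z: "z \<in> line a" "z \<in> line b" "z \<in> line d" for a b d z
  proof (rule ccontr)
    assume zn: "z \<notin> nodes_of ?D"
    obtain v c where a': "a = star_ray (pos v) c" "v \<in> W" "c \<le> CARD('n)" using mem[OF abc(1)] by blast
    obtain v' c' where b': "b = star_ray (pos v') c'" "v' \<in> W" "c' \<le> CARD('n)" using mem[OF abc(2)] by blast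
    obtain v'' c'' where d': "d = star_ray (pos v'') c''" "v'' \<in> W" "c'' \<le> CARD('n)" using mem[OF abc(3)] by blast
    have vv: "w1 \<noteq> w2 \<and> k1 \<noteq> k2" if w: "w1 \<in> W" "w2 \<in> W" "k1 \<le> CARD('n)" "k2 \<le> CARD('n)"
      "star_ray (pos w1) k1 \<noteq> (star_ray (pos w2) k2 :: 'n piece)" "z \<in> line (star_ray (pos w1) k1)" "z \<in> line (star_ray (pos w2) k2)"
      for w1 w2 k1 k2
    proof -
      have 1: "w1 \<noteq> w2"
      proof
        assume e: "w1 = w2"
        then have "k1 \<noteq> k2" using w(5) by auto
        then have "z = pos w1" using meet[of k1 k2 z w1] w e by auto
        then show False using zn nodes w(1) by auto
      qed
      have "k1 \<noteq> k2"
      proof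
        assume e: "k1 = k2"
        have "w1 = w2" by (rule pos_diff[OF w(1,2) _ w(3,4)]) (use diff_span[OF w(6,7)] e in auto)
        then show False using 1 by simp
      qed
      with 1 show ?thesis by simp
    qed
    have ne: "v \<noteq> v'" "c \<noteq> c'" "v \<noteq> v''" "c \<noteq> c''" "v' \<noteq> v''" "c' \<noteq> c''"
      using vv[of v v' c c'] vv[of v v'' c c''] vv[of v' v'' c' c''] a' b' d' abc z by auto
    obtain F :: "'n \<Rightarrow> int ^ 'n" and i j where F: "lattice_basis F" "i \<noteq> j" "F i = star_dir c" "F j = star_dir c'"
      using star_dir_pair[where 'n = 'n, of c c'] ne(2) a'(3) b'(3) two unfolding unimodular_pair_def by auto
    obtain \<beta> where \<beta>: "\<And>j k. real_vec (\<beta> j) \<bullet> real_vec (F k) = (if j = k then 1 else 0)"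
      using lattice_basis_dual[OF F(1)] by metis
    have sum0: "real_vec (star_dir c'' :: int ^ 'n) = - real_vec (F i) - real_vec (F j)"
    proof -
      have s: "(\<Sum>t\<le>CARD('n). real_vec (star_dir t :: int ^ 'n)) = 0"
        \<comment> \<open>With displacement zero and total n + 1 all coefficients equal one, so this
          says that the rays sum to zero.\<close>
        using sum_star_dir(1)[of "0 :: real ^ 'n" "real (Suc CARD('n))" 0]
        by (simp add: atLeast0LessThan lessThan_Suc_atMost cong: if_cong)
      have "{..CARD('n)} = {c, c', c''}"
      proof (rule sym, rule card_subset_eq)
        show "{c, c', c''} \<subseteq> {..CARD('n)}" using a' b' d' by auto
        show "card {c, c', c''} = card {..CARD('n)}" using ne n2 by simp
      qed simp
      then have "real_vec (star_dir c :: int ^ 'n) + (real_vec (star_dir c') + real_vec (star_dir c'')) = 0"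
        using s ne by simp
      then show ?thesis unfolding F(3,4) by (simp add: algebra_simps eq_neg_iff_add_eq_0)
    qed
    have bi: "real_vec (\<beta> i) \<bullet> real_vec (F i) = 1" "real_vec (\<beta> i) \<bullet> real_vec (F j) = 0"
      "real_vec (\<beta> j) \<bullet> real_vec (F i) = 0" "real_vec (\<beta> j) \<bullet> real_vec (F j) = 1"
      using \<beta> F(2) by auto
    obtain s1 where z1: "z = pos v + s1 *\<^sub>R real_vec (F i)"
      using z(1) unfolding a'(1) line_def F(3) by auto
    obtain s2 where z2: "z = pos v' + s2 *\<^sub>R real_vec (F j)"
      using z(2) unfolding b'(1) line_def F(4) by auto
    obtain s3 where z3: "z = pos v'' + s3 *\<^sub>R (- real_vec (F i) - real_vec (F j))"
      using z(3) unfolding d'(1) line_def sum0[symmetric] by auto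
    define x y where "x = real_vec (\<beta> i) \<bullet> \<xi>" and "y = real_vec (\<beta> j) \<bullet> \<xi>"
    have e1: "real_vec (\<beta> j) \<bullet> z = \<epsilon> * real (m v) * y"
      unfolding z1 pos_def y_def using bi by (simp add: inner_add_right)
    have e2: "real_vec (\<beta> i) \<bullet> z = \<epsilon> * real (m v') * x"
      unfolding z2 pos_def x_def using bi by (simp add: inner_add_right)
    have "(real_vec (\<beta> i) - real_vec (\<beta> j)) \<bullet> z = \<epsilon> * real (m v'') * (x - y)"
      unfolding z3 pos_def x_def y_def using bi
      by (simp add: inner_add_right inner_diff_left inner_diff_right algebra_simps)
    then have "\<epsilon> * real (m v') * x - \<epsilon> * real (m v) * y = \<epsilon> * real (m v'') * (x - y)"
      using e1 e2 by (simp add: inner_diff_left)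
    then have "\<epsilon> * ((real (m v') - real (m v'')) * x - (real (m v) - real (m v'')) * y) = 0"
      by (simp add: algebra_simps)
    then have 0: "(real (m v') - real (m v'')) * x - (real (m v) - real (m v'')) * y = 0" using \<epsilon> by simp
    \<comment> \<open>Comparing the dual coordinates of the common point on the three lines
      eliminates it and leaves this integral vector orthogonal to \<xi>; its vanishing identifies
      two of the multipliers.\<close>
    let ?w = "(int (m v') - int (m v'')) *s \<beta> i - (int (m v) - int (m v'')) *s \<beta> j"
    have "real_vec ?w \<bullet> \<xi> = 0" using 0 by (simp add: x_def y_def inner_diff_left left_diff_distrib)
    then have "?w = 0" using \<xi> by blast
    then have "real_vec ?w \<bullet> real_vec (F i) = 0" by simp
    moreover have "real_vec ?w \<bullet> real_vec (F i) = real (m v') - real (m v'')"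
      using bi by (simp add: inner_diff_left)
    ultimately have "m v' = m v''" by simp
    then show False using W(2) ne(5) b'(2) d'(2) by (auto simp: inj_on_def)
  qed
  show "general_position D"
    unfolding general_position_def D_def
  proof (intro conjI ballI impI subsetI)
    show "finite ?D" using W(1) by simp
    show "nondegenerate a" if aD: "a \<in> ?D" for a
    proof -
      obtain v c where a: "a = star_ray (pos v) c" "c \<le> CARD('n)" using mem[OF aD] by blast
      define c' where "c' = (if c = 0 then 1 else 0 :: nat)"
      have "c' \<noteq> c" "c' \<le> CARD('n)" using two by (auto simp: c'_def)
      then have "real_vec (star_dir c :: int ^ 'n) \<noteq> 0" using np[of c' c] a(2) span_zero by metis
      then show ?thesis using a(1) by simp
    qed
    show "lattice_direction a" if aD: "a \<in> ?D" for a
    proof -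
      obtain v c where a: "a = star_ray (pos v) c" "c \<le> CARD('n)" using mem[OF aD] by blast
      define c' where "c' = (if c = 0 then 1 else 0 :: nat)"
      have "c mod Suc CARD('n) \<noteq> c' mod Suc CARD('n)" using two a(2) by (auto simp: c'_def)
      then obtain F :: "'n \<Rightarrow> int ^ 'n" and i where "lattice_basis F" "F i = star_dir c"
        using star_dir_pair[where 'n = 'n] two unfolding unimodular_pair_def by metis
      then show ?thesis unfolding lattice_direction_def a(1) by (intro exI[of _ F] exI[of _ i] exI[of _ 1]) simp
    qed
    show "star_at ?D z" if zn: "z \<in> nodes_of ?D" for z
    proof -
      obtain v where v: "v \<in> W" "z = pos v" using zn nodes by auto
      show ?thesis
        unfolding star_at_def
      proof (intro exI[of _ "\<lambda>j. axis j 1"] exI[of _ UNIV] conjI lattice_basis_axis two ballI impI)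
        fix a assume a: "a \<in> ?D" "z \<in> endpoints a"
        obtain w c where a': "a = star_ray (pos w) c" "c \<le> CARD('n)" using mem[OF a(1)] by blast
        then have "star_dir c \<in> star_set (\<lambda>j :: 'n. axis j 1) UNIV" using star_dir_range by blast
        then show "\<exists>u\<in>star_set (\<lambda>j :: 'n. axis j 1) UNIV. \<exists>t>0. outward z a = t *\<^sub>R real_vec u"
          using a' by (intro bexI[of _ "star_dir c"] exI[of _ 1]) auto
      next
        fix u assume "u \<in> star_set (\<lambda>j :: 'n. axis j 1) UNIV"
        then obtain c where c: "c \<le> CARD('n)" "u = star_dir c" using star_dir_range[where 'n = 'n] by blast
        then show "\<exists>a\<in>?D. z \<in> endpoints a \<and> (\<exists>t>0. outward z a = t *\<^sub>R real_vec u)"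
          using v by (intro bexI[of _ "star_ray (pos v) c"] conjI exI[of _ 1]) auto
      qed
    qed
    show "z \<in> endpoints a" if zD: "z \<in> nodes_of ?D" "a \<in> ?D" "z \<in> line a" for z a
    proof -
      obtain w where w: "w \<in> W" "z = pos w" using zD(1) nodes by auto
      obtain v c where a: "a = star_ray (pos v) c" "v \<in> W" "c \<le> CARD('n)" using mem[OF zD(2)] by blast
      have "w = v" by (rule pos_diff[OF w(1) a(2) _ a(3,3)]) (use lineD[of z v c] zD(3) a w in auto)
      then show ?thesis using w a by simp
    qed
    show "direction b \<notin> span {direction a}" if ab: "a \<in> ?D" "b \<in> ?D" "a \<noteq> b" "endpoints a \<inter> endpoints b \<noteq> {}" for a b
    proof -
      obtain v c where a: "a = star_ray (pos v) c" "v \<in> W" "c \<le> CARD('n)" using mem[OF ab(1)] by blast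
      obtain w c' where b: "b = star_ray (pos w) c'" "w \<in> W" "c' \<le> CARD('n)" using mem[OF ab(2)] by blast
      have "c \<noteq> c'" using ab(3,4) a b by auto
      then show ?thesis using np a b by simp
    qed
    show "z \<in> nodes_of ?D" if "a \<in> ?D" "b \<in> ?D" "c \<in> ?D" "a \<noteq> b" "a \<noteq> c" "b \<noteq> c" "z \<in> line a \<inter> line b \<inter> line c" for a b c z
      using B3[OF _ that(1,2,4)] B2[OF _ that(1-6)] that(7) two by (cases "3 \<le> CARD('n)") auto
    show "z \<in> nodes_of ?D" if "3 \<le> CARD('n)" "a \<in> ?D" "b \<in> ?D" "a \<noteq> b" "z \<in> line a \<inter> line b" for a b z
      using B3[OF that(1-4)] that(5) by blast
  qed
qed

lemma real_vec_inj: "real_vec a = real_vec b \<Longrightarrow> a = b"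
  by (simp add: real_vec_def vec_eq_iff)

text \<open>The left-hand sides tend to zero with \<epsilon>, and there are only finitely many
  bounds to satisfy.\<close>

lemma exists_scale:
  fixes \<xi> :: "real ^ 'n::finite"
  assumes "finite U" "\<And>e. e \<in> U \<Longrightarrow> 0 < l e"
  shows "\<exists>\<epsilon>>0. \<forall>e\<in>U. \<forall>c. K * \<bar>((\<epsilon> * x e) *\<^sub>R \<xi> - (\<epsilon> * y e) *\<^sub>R \<xi>) $ c\<bar> < (l e :: real)"
proof -
  have "\<forall>\<^sub>F \<epsilon> in at_right 0. \<forall>e\<in>U. \<forall>c\<in>UNIV. K * \<bar>((\<epsilon> * x e) *\<^sub>R \<xi> - (\<epsilon> * y e) *\<^sub>R \<xi>) $ c\<bar> < l e"
  proof (rule eventually_ball_finite[OF assms(1)], rule ballI, rule eventually_ball_finite, simp, rule ballI)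
    fix e and c :: 'n assume e: "e \<in> U"
    have "((\<lambda>\<epsilon>. K * \<bar>(\<epsilon> * x e) * \<xi> $ c - (\<epsilon> * y e) * \<xi> $ c\<bar>) \<longlongrightarrow>
      K * \<bar>(0 * x e) * \<xi> $ c - (0 * y e) * \<xi> $ c\<bar>) (at_right 0)"
      by (intro tendsto_intros)
    moreover have "K * \<bar>(0 * x e) * \<xi> $ c - (0 * y e) * \<xi> $ c\<bar> < l e" using assms(2)[OF e] by simp
    ultimately have "\<forall>\<^sub>F \<epsilon> in at_right 0. K * \<bar>(\<epsilon> * x e) * \<xi> $ c - (\<epsilon> * y e) * \<xi> $ c\<bar> < l e"
      by (rule order_tendstoD(2))
    then show "\<forall>\<^sub>F \<epsilon> in at_right 0. K * \<bar>((\<epsilon> * x e) *\<^sub>R \<xi> - (\<epsilon> * y e) *\<^sub>R \<xi>) $ c\<bar> < l e"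
      by simp
  qed
  moreover have "\<forall>\<^sub>F \<epsilon> in at_right (0::real). 0 < \<epsilon>" by (rule eventually_at_right_less)
  ultimately have "\<forall>\<^sub>F \<epsilon> in at_right 0. 0 < \<epsilon> \<and> (\<forall>e\<in>U. \<forall>c\<in>UNIV. K * \<bar>((\<epsilon> * x e) *\<^sub>R \<xi> - (\<epsilon> * y e) *\<^sub>R \<xi>) $ c\<bar> < l e)"
    by eventually_elim blast
  from eventually_happens'[OF trivial_limit_at_right_real this] show ?thesis by auto
qed

section \<open>From the abstract graph to stars and paths\<close>

lemma realize:
  fixes G :: "('v, 'e) metric_graph" and t h :: "'e \<Rightarrow> 'v"
  assumes two: "2 \<le> CARD('n::finite)" and \<Gamma>: "abstract_tropical_curve \<Gamma>"
    and M: "isometric_to_modification G \<Gamma>"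
    and ends: "\<And>e. e \<in> edges G \<Longrightarrow> ends G e = {#t e, h e#} \<and> t e \<notin> inf_verts G"
    and deg: "\<And>v. v \<in> verts G \<Longrightarrow> vertex_degree G v \<le> Suc CARD('n)"
  shows "\<exists>(D :: 'n piece set) P Q l. general_position D \<and>
    isometric_to_modification (partial_curve D (nodes_of D) ({} :: 'e set) P Q l) \<Gamma>"
proof -
  note G = abstract_tropical_curveD[OF isometric_to_modification_curve[OF M \<Gamma>]]
  let ?E = "edges G"
  define W where "W = verts G - inf_verts G"
  define U where "U = {e \<in> ?E. len G e \<noteq> \<infinity>}"
  have finW: "finite W" using G(1) by (simp add: W_def)
  have finU: "finite U" using G(2) by (simp add: U_def)
  have thv: "t e \<in> verts G" "h e \<in> verts G" if "e \<in> ?E" for e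
    using G(4)[OF that] ends[OF that] by auto
  have tW: "t e \<in> W" if "e \<in> ?E" for e using thv[OF that] ends[OF that] by (simp add: W_def)
  have inf_iff: "len G e = \<infinity> \<longleftrightarrow> h e \<in> inf_verts G" if "e \<in> ?E" for e
    using G(9)[OF that] ends[OF that] by auto
  have hW: "h e \<in> W" if "e \<in> U" for e using that thv inf_iff by (auto simp: U_def W_def)
  \<comment> \<open>The flags at \<open>v\<close>: a loop contributes two of them, so their number
    is the degree.\<close>
  define fl where "fl v = {(e, b). e \<in> ?E \<and> (if b then h e else t e) = v}" for v
  have fin_fl: "finite (fl v)" for v
    by (rule finite_subset[of _ "?E \<times> UNIV"]) (use G(2) in \<open>auto simp: fl_def\<close>)
  have card_fl: "card (fl v) = vertex_degree G v" for v
  proof -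
    have "fl v = (\<lambda>e. (e, False)) ` {e \<in> ?E. t e = v} \<union> (\<lambda>e. (e, True)) ` {e \<in> ?E. h e = v}"
      by (auto simp: fl_def image_iff split: if_splits)
    then have "card (fl v) = card ((\<lambda>e. (e, False)) ` {e \<in> ?E. t e = v}) + card ((\<lambda>e. (e, True)) ` {e \<in> ?E. h e = v})"
      using G(2) by (simp only:, intro card_Un_disjoint) auto
    also have "\<dots> = card {e \<in> ?E. t e = v} + card {e \<in> ?E. h e = v}"
      by (simp add: card_image inj_on_def)
    also have "\<dots> = (\<Sum>e\<in>?E. (if t e = v then 1 else 0)) + (\<Sum>e\<in>?E. (if h e = v then 1 else 0))"
      using G(2) by (simp add: sum.If_cases Int_def)
    also have "\<dots> = vertex_degree G v"
      unfolding vertex_degree_def sum.distrib[symmetric] by (rule sum.cong) (use ends in auto)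
    finally show ?thesis .
  qed
  \<comment> \<open>The degree bound enters here: the flags at a vertex can claim different rays of
    the star.\<close>
  have "\<exists>g. g ` fl v \<subseteq> {..CARD('n)} \<and> inj_on g (fl v)" if "v \<in> verts G" for v
    by (rule card_le_inj) (use fin_fl card_fl deg[OF that] in auto)
  then have "\<forall>v\<in>verts G. \<exists>g. g ` fl v \<subseteq> {..CARD('n)} \<and> inj_on g (fl v)" by blast
  from bchoice[OF this] obtain g where g: "\<forall>v\<in>verts G. g v ` fl v \<subseteq> {..CARD('n)} \<and> inj_on (g v) (fl v)" by blast
  define ci where "ci e = g (t e) (e, False)" for e
  define cj where "cj e = g (h e) (e, True)" for e
  define l where "l e = real_of_ereal (len G e)" for e
  have lpos: "0 < l e" "ereal (l e) = len G e" if "e \<in> U" for e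
    using that G(6)[of e] unfolding U_def l_def by (cases "len G e"; auto)+
  obtain \<xi> :: "real ^ 'n" where \<xi>: "\<And>w :: int ^ 'n. w \<noteq> 0 \<Longrightarrow> real_vec w \<bullet> \<xi> \<noteq> 0"
    using exists_rationally_independent by blast
  obtain m :: "'v \<Rightarrow> nat" where m: "inj_on m W"
    using finite_imp_inj_to_nat_seg[OF finW] by blast
  obtain \<epsilon> where \<epsilon>: "0 < \<epsilon>" "\<forall>e\<in>U. \<forall>c. real (2 * CARD('n) + 1) * \<bar>((\<epsilon> * real (m (h e))) *\<^sub>R \<xi> - (\<epsilon> * real (m (t e))) *\<^sub>R \<xi>) $ c\<bar> < l e"
    using exists_scale[where K = "real (2 * CARD('n) + 1)" and x = "\<lambda>e. real (m (h e))" and \<xi> = \<xi> and y = "\<lambda>e. real (m (t e))" and l = l and U = U, OF finU lpos(1)] by blast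
  define pos where "pos v = (\<epsilon> * real (m v)) *\<^sub>R \<xi>" for v
  define D where "D = (\<lambda>(v, c). star_ray (pos v) c) ` (W \<times> {..CARD('n)})"
  note gps = general_position_stars[OF two \<xi> finW m \<epsilon>(1), folded pos_def, folded D_def]
  define P where "P e = pos (t e)" for e
  define Q where "Q e = pos (h e)" for e
  let ?r1 = "\<lambda>e. star_ray (P e) (ci e) :: 'n piece" and ?r2 = "\<lambda>e. star_ray (Q e) (cj e) :: 'n piece"
  have flags: "f = f'" if f: "f \<in> fl v" "f' \<in> fl w" "v \<in> W" "w \<in> W" "star_ray (pos v) (g v f) = (star_ray (pos w) (g w f') :: 'n piece)" for f f' v w
  proof -
    have vw: "v = w" using f(3-5) gps(3) by (auto simp: inj_on_def)
    have gv: "g v f \<le> CARD('n)" "g v f' \<le> CARD('n)" "inj_on (g v) (fl v)" using g f vw by (auto simp: W_def)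
    have "star_dir (g v f) = (star_dir (g v f') :: int ^ 'n)" using f(5) vw real_vec_inj by auto
    then have "g v f = g v f'" using star_dir_inj[OF two] gv by (auto simp: inj_on_def)
    then show ?thesis using gv(3) f vw by (auto simp: inj_on_def)
  qed
  have fl1: "(e, False) \<in> fl (t e)" "(e, True) \<in> fl (h e)" if "e \<in> ?E" for e using that by (auto simp: fl_def)
  have UE: "e \<in> ?E" if "e \<in> U" for e using that by (simp add: U_def)
  have r1D: "?r1 e \<in> D" if "e \<in> ?E" for e
  proof -
    have "ci e \<le> CARD('n)" using g thv(1)[OF that] fl1[OF that] unfolding ci_def by blast
    then show ?thesis using tW[OF that] unfolding D_def P_def by auto
  qed
  have r2D: "?r2 e \<in> D" if "e \<in> U" for e
  proof -
    have "cj e \<le> CARD('n)" using g thv(2)[OF UE[OF that]] fl1[OF UE[OF that]] unfolding cj_def by blast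
    then show ?thesis using hW[OF that] unfolding D_def Q_def by auto
  qed
  have d1: "?r1 e \<noteq> ?r2 f" if "e \<in> ?E" "f \<in> U" for e f
    using flags[OF fl1(1)[OF that(1)] fl1(2)[OF UE[OF that(2)]] tW[OF that(1)] hW[OF that(2)]]
    unfolding P_def Q_def ci_def cj_def by auto
  have d2: "?r1 e \<noteq> ?r1 f" if "e \<in> ?E" "f \<in> ?E" "e \<noteq> f" for e f
    using flags[OF fl1(1)[OF that(1)] fl1(1)[OF that(2)] tW[OF that(1)] tW[OF that(2)]] that(3)
    unfolding P_def ci_def by auto
  have d3: "?r2 e \<noteq> ?r2 f" if "e \<in> U" "f \<in> U" "e \<noteq> f" for e f
    using flags[OF fl1(2)[OF UE[OF that(1)]] fl1(2)[OF UE[OF that(2)]] hW[OF that(1)] hW[OF that(2)]] that(3)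
    unfolding Q_def cj_def by auto
  \<comment> \<open>An infinite edge is realised by its claimed ray alone, and its infinite vertex
    becomes the end of that ray.\<close>
  define D0 where "D0 = ?r1 ` (?E - U)"
  have rays0: "{a \<in> D0. is_ray a} = D0" by (auto simp: D0_def)
  \<comment> \<open>Degree one makes the infinite vertices correspond to the infinite edges.\<close>
  have hbij: "bij_betw h (?E - U) (inf_verts G)"
    unfolding bij_betw_def
  proof
    show "inj_on h (?E - U)"
    proof (rule inj_onI, rule ccontr)
      fix e f assume ef: "e \<in> ?E - U" "f \<in> ?E - U" "h e = h f" "e \<noteq> f"
      then have "h e \<in> inf_verts G" using inf_iff by (auto simp: U_def)
      have "{(e, True), (f, True)} \<subseteq> fl (h e)" using ef by (auto simp: fl_def)
      then have "card {(e, True), (f, True)} \<le> card (fl (h e))" by (intro card_mono fin_fl)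
      then show False using card_fl[of "h e"] G(8)[OF \<open>h e \<in> inf_verts G\<close>] ef(4) by simp
    qed
    show "h ` (?E - U) = inf_verts G"
    proof
      show "h ` (?E - U) \<subseteq> inf_verts G" using inf_iff by (auto simp: U_def)
      show "inf_verts G \<subseteq> h ` (?E - U)"
      proof
        fix v assume v: "v \<in> inf_verts G"
        then have "card (fl v) = 1" using card_fl G(8) by simp
        then obtain e b where "(e, b) \<in> fl v" by (metis card_1_singletonE insertI1 surj_pair)
        then have e: "e \<in> ?E" "(if b then h e else t e) = v" by (auto simp: fl_def)
        then have "h e = v" using ends[OF e(1)] v by (auto split: if_splits)
        then show "v \<in> h ` (?E - U)" using e v inf_iff by (auto simp: U_def)
      qed
    qed
  qed
  define eo where "eo = the_inv_into (?E - U) h"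
  have eo: "bij_betw eo (inf_verts G) (?E - U)" "\<And>e. e \<in> ?E - U \<Longrightarrow> eo (h e) = e"
    using bij_betw_the_inv_into[OF hbij] hbij unfolding eo_def by (auto simp: bij_betw_def the_inv_into_f_f)
  have "isometric G (partial_curve D0 (pos ` W) U P Q l)"
    unfolding isometric_def
  proof (rule exI[of _ "\<lambda>v. if v \<in> W then Point (pos v) else At_Infinity (?r1 (eo v))"],
      rule exI[of _ "\<lambda>e. if e \<in> U then Inr e else Inl (?r1 e)"], intro conjI ballI)
    let ?\<phi> = "\<lambda>v. if v \<in> W then Point (pos v) else At_Infinity (?r1 (eo v))"
    let ?\<psi> = "\<lambda>e. if e \<in> U then Inr e else Inl (?r1 e)"
    have b1: "bij_betw ?\<phi> W (Point ` pos ` W)"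
    proof -
      have "bij_betw (Point \<circ> pos) W ((Point \<circ> pos) ` W)"
        using gps(3) by (intro inj_on_imp_bij_betw) (auto simp: inj_on_def)
      then show ?thesis by (subst bij_betw_cong[of _ _ "Point \<circ> pos"]) (auto simp: image_comp)
    qed
    have r1inj: "inj_on ?r1 (?E - U)" using d2 by (auto simp: inj_on_def)
    have b2: "bij_betw ?\<phi> (inf_verts G) (At_Infinity ` D0)"
    proof -
      have "bij_betw (At_Infinity \<circ> ?r1) (?E - U) ((At_Infinity \<circ> ?r1) ` (?E - U))"
        using r1inj by (intro inj_on_imp_bij_betw) (auto simp: inj_on_def)
      then have "bij_betw ((At_Infinity \<circ> ?r1) \<circ> eo) (inf_verts G) ((At_Infinity \<circ> ?r1) ` (?E - U))"
        by (rule bij_betw_trans[OF eo(1)])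
      moreover have "(At_Infinity \<circ> ?r1) ` (?E - U) = At_Infinity ` D0" unfolding D0_def image_comp ..
      ultimately show ?thesis by (subst bij_betw_cong[of _ _ "(At_Infinity \<circ> ?r1) \<circ> eo"]) (auto simp: W_def)
    qed
    have VG: "verts G = W \<union> inf_verts G" using G(7) by (auto simp: W_def)
    show "bij_betw ?\<phi> (verts G) (verts (partial_curve D0 (pos ` W) U P Q l))"
      unfolding partial_curve_simps rays0 VG by (rule bij_betw_combine[OF b1 b2]) auto
    show "?\<phi> ` inf_verts G = inf_verts (partial_curve D0 (pos ` W) U P Q l)"
      unfolding partial_curve_simps rays0 using b2 by (simp add: bij_betw_def)
    have b3: "bij_betw ?\<psi> U (Inr ` U)"
      by (subst bij_betw_cong[of _ _ Inr]) (auto simp: bij_betw_def)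
    have b4: "bij_betw ?\<psi> (?E - U) (Inl ` D0)"
    proof -
      let ?I = "Inl :: 'n piece \<Rightarrow> 'n piece + 'e"
      have "bij_betw (?I \<circ> ?r1) (?E - U) ((?I \<circ> ?r1) ` (?E - U))"
        using r1inj by (intro inj_on_imp_bij_betw) (auto simp: inj_on_def)
      moreover have "(?I \<circ> ?r1) ` (?E - U) = ?I ` D0" unfolding D0_def image_comp ..
      ultimately have "bij_betw (?I \<circ> ?r1) (?E - U) (?I ` D0)" by (simp only:)
      moreover have "bij_betw ?\<psi> (?E - U) (?I ` D0) = bij_betw (?I \<circ> ?r1) (?E - U) (?I ` D0)"
        by (rule bij_betw_cong) simp
      ultimately show ?thesis by blast
    qed
    have EG: "?E = (?E - U) \<union> U" by (auto simp: U_def)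
    show "bij_betw ?\<psi> ?E (edges (partial_curve D0 (pos ` W) U P Q l))"
      unfolding partial_curve_simps by (subst EG, rule bij_betw_combine[OF b4 b3]) auto
    fix e assume e: "e \<in> ?E"
    show "ends (partial_curve D0 (pos ` W) U P Q l) (?\<psi> e) = image_mset ?\<phi> (ends G e)"
    proof (cases "e \<in> U")
      case True
      then show ?thesis using ends[OF e] tW[OF e] hW[OF True] by (simp add: P_def Q_def)
    next
      case False
      then have "h e \<notin> W" using e inf_iff by (auto simp: U_def W_def)
      then show ?thesis using False e ends[OF e] tW[OF e] eo(2)[of e] by (simp add: P_def vertex_at_def)
    qed
    show "len (partial_curve D0 (pos ` W) U P Q l) (?\<psi> e) = len G e"
    proof (cases "e \<in> U")
      case True
      then show ?thesis using lpos(2)[OF True] by simp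
    next
      case False
      then show ?thesis using e by (simp add: U_def)
    qed
  qed
  then have M0: "isometric_to_modification (partial_curve D0 (pos ` W) U P Q l) \<Gamma>"
    by (rule isometric_to_modification_isometric[OF M])
  let ?open = "?r1 ` U \<union> ?r2 ` U"
  have finD: "finite D" using general_positionD(1)[OF gps(1)] .
  \<comment> \<open>Unclaimed rays are added as elementary modifications. Those in
    \<open>?open\<close> stay out, since the paths of the finite edges will replace them.\<close>
  have M1: "isometric_to_modification (partial_curve (D0 \<union> (D - ?open)) (pos ` W) U P Q l) \<Gamma>"
    by (rule partial_curve_add_rays[OF \<Gamma> _ M0]) (use finD in \<open>auto simp: D_def\<close>)
  have "D0 \<subseteq> D - ?open"
  proof
    fix a assume "a \<in> D0"
    then obtain e where e: "e \<in> ?E" "e \<notin> U" "a = ?r1 e" by (auto simp: D0_def)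
    have "?r1 e \<noteq> ?r1 f" "?r1 e \<noteq> ?r2 f" if "f \<in> U" for f
      using d2[OF e(1) UE[OF that]] d1[OF e(1) that] e(2) that by blast+
    then have "?r1 e \<notin> ?r1 ` U" "?r1 e \<notin> ?r2 ` U" by fast+
    then show "a \<in> D - ?open" using r1D[OF e(1)] unfolding e(3) by (simp only: Diff_iff Un_iff simp_thms)
  qed
  then have M2: "isometric_to_modification (partial_curve (D - ?open) (nodes_of D) U P Q l) \<Gamma>"
    using M1 gps(2) by (simp add: Un_absorb1)
  have "\<exists>D :: 'n piece set. general_position D \<and> isometric_to_modification (partial_curve D (nodes_of D) {} P Q l) \<Gamma>"
  proof (rule join_all[OF two \<Gamma> finU gps(1) _ _ _ _ _ M2])
    show "?r1 e \<in> D \<and> ?r2 e \<in> D" if "e \<in> U" for e using r1D[OF UE[OF that]] r2D[OF that] by blast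
    show "?r1 e \<noteq> ?r2 f" if "e \<in> U" "f \<in> U" for e f using d1[OF UE[OF that(1)] that(2)] .
    show "?r1 e \<noteq> ?r1 f" if "e \<in> U" "f \<in> U" "e \<noteq> f" for e f using d2[OF UE[OF that(1)] UE[OF that(2)] that(3)] .
    show "?r2 e \<noteq> ?r2 f" if "e \<in> U" "f \<in> U" "e \<noteq> f" for e f using d3[OF that] .
    show "real (2 * CARD('n) + 1) * \<bar>(Q e - P e) $ c\<bar> < l e" if "e \<in> U" for e c
      using \<epsilon>(2) that unfolding P_def Q_def pos_def by blast
  qed
  then show ?thesis by blast
qed

lemma vertex_degree_isometric:
  assumes "abstract_tropical_curve G" "isometric G H" "w \<in> verts H"
  shows "\<exists>v\<in>verts G. vertex_degree H w = vertex_degree G v"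
proof -
  note G = abstract_tropical_curveD[OF assms(1)]
  obtain \<phi> \<psi> where I: "bij_betw \<phi> (verts G) (verts H)" "bij_betw \<psi> (edges G) (edges H)"
    "\<And>e. e \<in> edges G \<Longrightarrow> ends H (\<psi> e) = image_mset \<phi> (ends G e)"
    using assms(2) unfolding isometric_def by blast
  have E: "edges H = \<psi> ` edges G" and inj: "inj_on \<phi> (verts G)" "inj_on \<psi> (edges G)"
    using I(1,2) by (auto simp: bij_betw_def)
  obtain v where v: "v \<in> verts G" "w = \<phi> v" using I(1) assms(3) by (metis bij_betw_def imageE)
  have "vertex_degree H (\<phi> v) = vertex_degree G v"
    unfolding vertex_degree_def E
    by (subst sum.reindex[OF inj(2)], rule sum.cong)
      (auto simp: I(3) count_image_mset_inj_on[OF inj(1) G(4) v(1)])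
  then show ?thesis using v by blast
qed

lemma mset_size_two:
  assumes "size M = 2" "x \<in># M"
  obtains y where "M = {#x, y#}"
proof -
  obtain N where N: "M = add_mset x N" using assms(2) by (meson multi_member_split)
  then have "size N = 1" using assms(1) by simp
  then obtain y where "N = {#y#}" using size_1_singleton_mset by blast
  then show thesis using that N by blast
qed

text \<open>Subdividing a line (an edge with two infinite ends) creates a finite vertex on it.\<close>

lemma subdivide_lines:
  fixes G :: "(nat, nat) metric_graph"
  assumes \<Gamma>: "abstract_tropical_curve \<Gamma>" and K: "2 \<le> (K::nat)"
  shows "isometric_to_modification G \<Gamma> \<Longrightarrow> (\<And>v. v \<in> verts G \<Longrightarrow> vertex_degree G v \<le> K) \<Longrightarrow>
    \<exists>H :: (nat, nat) metric_graph. isometric_to_modification H \<Gamma> \<and> (\<forall>v\<in>verts H. vertex_degree H v \<le> K) \<and>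
      (\<forall>e\<in>edges H. \<exists>v\<in>#ends H e. v \<notin> inf_verts H)"
proof (induction "card {e \<in> edges G. \<forall>v\<in>#ends G e. v \<in> inf_verts G}" arbitrary: G)
  case 0
  note G = abstract_tropical_curveD[OF isometric_to_modification_curve[OF 0(2) \<Gamma>]]
  have "{e \<in> edges G. \<forall>v\<in>#ends G e. v \<in> inf_verts G} = {}" using 0(1) G(2) by simp
  then show ?case using 0(2,3) by (intro exI[of _ G]) blast
next
  case (Suc n)
  note G = abstract_tropical_curveD[OF isometric_to_modification_curve[OF Suc(3) \<Gamma>]]
  let ?bad = "\<lambda>G :: (nat, nat) metric_graph. {e \<in> edges G. \<forall>v\<in>#ends G e. v \<in> inf_verts G}"
  have "?bad G \<noteq> {}" using Suc(2) by (metis (no_types, lifting) card.empty nat.distinct(1))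
  then obtain e where e: "e \<in> edges G" "\<forall>v\<in>#ends G e. v \<in> inf_verts G" by blast
  have "ends G e \<noteq> {#}" using G(3)[OF e(1)] by auto
  then obtain a where "a \<in># ends G e" by blast
  then obtain b where ab: "ends G e = {#a, b#}" using mset_size_two[OF G(3)[OF e(1)]] by metis
  have abi: "a \<in> inf_verts G" "b \<in> inf_verts G" using e(2) ab by auto
  obtain m where m: "m \<notin> verts G" using ex_new_if_finite[OF infinite_UNIV_nat G(1)] by blast
  obtain f where f: "f \<notin> edges G" using ex_new_if_finite[OF infinite_UNIV_nat G(2)] by blast
  have fe: "f \<noteq> e" using e(1) f by blast
  \<comment> \<open>One half keeps the label \<open>e\<close> and the other is called
    \<open>f\<close>; both halves are infinite, and only their common end \<open>m\<close> is
    finite.\<close>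
  define H where "H = \<lparr> verts = insert m (verts G), edges = insert f (edges G),
     ends = (ends G)(e := {#a, m#}, f := {#m, b#}), len = (len G)(e := \<infinity>, f := \<infinity>), inf_verts = inf_verts G \<rparr>"
  have le: "len G e = \<infinity>" using G(9)[OF e(1)] ab abi by auto
  have mi: "m \<notin> inf_verts G" using m G(7) by blast
  have MH: "isometric_to_modification H \<Gamma>"
    by (rule isometric_to_modification_subdivide[OF Suc(3) \<Gamma> e(1) ab m, where ?e1.0 = e and ?e2.0 = f])
      (use f fe e le abi in \<open>auto simp: H_def\<close>)
  have bad: "?bad H = ?bad G - {e}"
    using mi fe f by (auto simp: H_def split: if_splits)
  have "n = card (?bad H)"
    unfolding bad using Suc(2) e G(2) by (simp add: card_Diff_singleton)
  moreover have "vertex_degree H v \<le> K" if v: "v \<in> verts H" for v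
  proof -
    have "vertex_degree H v = count (ends H f) v + (count (ends H e) v + (\<Sum>x\<in>edges G - {e}. count (ends H x) v))"
    proof -
      have E: "edges H = insert f (insert e (edges G - {e}))" using e(1) by (auto simp: H_def)
      show ?thesis unfolding vertex_degree_def E using f fe G(2) by (subst sum.insert, simp, simp, subst sum.insert) simp_all
    qed
    also have "(\<Sum>x\<in>edges G - {e}. count (ends H x) v) = (\<Sum>x\<in>edges G - {e}. count (ends G x) v)"
      by (rule sum.cong) (use f in \<open>auto simp: H_def\<close>)
    finally have d: "vertex_degree H v = count {#m, b#} v + (count {#a, m#} v + (\<Sum>x\<in>edges G - {e}. count (ends G x) v))"
      using fe by (simp add: H_def)
    show ?thesis
    proof (cases "v = m")
      case True
      have "count (ends G x) m = 0" if "x \<in> edges G" for x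
        using G(4)[OF that] m by (meson count_eq_zero_iff subsetD)
      then have "(\<Sum>x\<in>edges G - {e}. count (ends G x) v) = 0" using True by simp
      \<comment> \<open>The new vertex has degree two, which the bound \<open>K\<close>
        admits.\<close>
      then show ?thesis using d True K m abi G(7) by auto
    next
      case False
      have "vertex_degree G v = count {#a, b#} v + (\<Sum>x\<in>edges G - {e}. count (ends G x) v)"
        unfolding vertex_degree_def using e(1) G(2) ab by (simp add: sum.remove[of _ e])
      then have "vertex_degree H v = vertex_degree G v" using d False by simp
      then show ?thesis using Suc(4)[of v] v False by (simp add: H_def)
    qed
  qed
  ultimately show ?case using Suc(1)[OF _ MH] by blast
qed

lemma exists_general_position:
  fixes \<Gamma> :: "('v, 'e) metric_graph"
  assumes two: "2 \<le> CARD('n::finite)" and \<Gamma>: "abstract_tropical_curve \<Gamma>"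
    and deg: "\<And>v. v \<in> verts \<Gamma> \<Longrightarrow> vertex_degree \<Gamma> v \<le> Suc CARD('n)"
  shows "\<exists>(D :: 'n piece set) P Q l. general_position D \<and>
    isometric_to_modification (partial_curve D (nodes_of D) ({} :: nat set) P Q l) \<Gamma>"
proof -
  obtain G0 :: "(nat, nat) metric_graph" where G0: "isometric \<Gamma> G0"
    using nat_copy[OF \<Gamma>] by metis
  have M0: "isometric_to_modification G0 \<Gamma>"
    by (rule isometric_to_modification_isometric[OF isometric_to_modification_refl[OF \<Gamma>] G0])
  have "vertex_degree G0 v \<le> Suc CARD('n)" if "v \<in> verts G0" for v
    using vertex_degree_isometric[OF \<Gamma> G0 that] deg by auto
  then obtain G :: "(nat, nat) metric_graph" where G: "isometric_to_modification G \<Gamma>"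
     "\<And>v. v \<in> verts G \<Longrightarrow> vertex_degree G v \<le> Suc CARD('n)"
     "\<forall>e\<in>edges G. \<exists>v\<in>#ends G e. v \<notin> inf_verts G"
    using subdivide_lines[OF \<Gamma> _ M0, of "Suc CARD('n)"] two by auto
  note GD = abstract_tropical_curveD[OF isometric_to_modification_curve[OF G(1) \<Gamma>]]
  have "\<forall>e\<in>edges G. \<exists>p. ends G e = {#fst p, snd p#} \<and> fst p \<notin> inf_verts G"
  proof
    fix e assume e: "e \<in> edges G"
    then obtain v where v: "v \<in># ends G e" "v \<notin> inf_verts G" using G(3) by blast
    then obtain w where "ends G e = {#v, w#}" using mset_size_two[OF GD(3)[OF e]] by metis
    then show "\<exists>p. ends G e = {#fst p, snd p#} \<and> fst p \<notin> inf_verts G" using v by (intro exI[of _ "(v, w)"]) simp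
  qed
  from bchoice[OF this] obtain th where th: "\<forall>e\<in>edges G. ends G e = {#fst (th e), snd (th e)#} \<and> fst (th e) \<notin> inf_verts G" by blast
  show ?thesis
    by (rule realize[OF two \<Gamma> G(1), where t = "\<lambda>e. fst (th e)" and h = "\<lambda>e. snd (th e)"]) (use th G(2) in auto)
qed

section \<open>Embeddings\<close>

lemma associated_curve_simps[simp]:
  "verts (associated_curve N D) = (\<Union>a\<in>D. set_mset (piece_ends N a))"
  "edges (associated_curve N D) = D"
  "ends (associated_curve N D) = piece_ends N"
  "len (associated_curve N D) = piece_length"
  "inf_verts (associated_curve N D) = At_Infinity ` {a \<in> D. is_ray a}"
  by (simp_all add: associated_curve_def)

lemma At_Infinity_in_piece_ends: "At_Infinity b \<in># piece_ends N a \<longleftrightarrow> b = a \<and> is_ray a"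
  by (cases a) (auto simp: vertex_at_def)

lemma Branch_in_piece_ends:
  assumes "nondegenerate a" "Branch z L \<in># piece_ends N a"
  shows "z \<in> endpoints a \<and> L = line a"
  using assms line_affine_hull[OF assms(1)] by (cases a) (auto simp: vertex_at_def split: if_splits)

lemma piece_ends_disjoint:
  assumes "endpoints a \<inter> N = {}"
  shows "piece_ends N a = piece_ends {} a"
  using assms by (cases a) (auto simp: vertex_at_def)

lemma set_piece_ends:
  "set_mset (piece_ends {} a) = Point ` endpoints a \<union> At_Infinity ` {b. b = a \<and> is_ray a}"
  by (cases a) (auto simp: vertex_at_def)

text \<open>No piece ends at a point of \<open>N\<close> yet, so no branch vertex occurs and the two
  curves differ only in the labels of edges.\<close>

lemma isometric_associated_curve:
  assumes "N \<inter> nodes_of D = {}"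
  shows "isometric (partial_curve D (nodes_of D) ({} :: 'e set) P Q l) (associated_curve N D)"
  unfolding isometric_def
proof (intro exI[of _ id] exI[of _ projl] conjI ballI)
  have e: "piece_ends N a = piece_ends {} a" if "a \<in> D" for a
    using assms that by (intro piece_ends_disjoint) (auto simp: nodes_of_def)
  show "bij_betw id (verts (partial_curve D (nodes_of D) ({} :: 'e set) P Q l)) (verts (associated_curve N D))"
    by (simp add: e set_piece_ends bij_betw_def nodes_of_def) (auto simp: set_piece_ends)
  show "bij_betw projl (edges (partial_curve D (nodes_of D) ({} :: 'e set) P Q l)) (edges (associated_curve N D))"
    by (auto simp: bij_betw_def inj_on_def image_image)
  show "id ` inf_verts (partial_curve D (nodes_of D) ({} :: 'e set) P Q l) = inf_verts (associated_curve N D)"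
    by simp
  fix x assume "x \<in> edges (partial_curve D (nodes_of D) ({} :: 'e set) P Q l)"
  then obtain a where "x = Inl a" "a \<in> D" by auto
  then show "ends (associated_curve N D) (projl x) = image_mset id (ends (partial_curve D (nodes_of D) ({} :: 'e set) P Q l) x)"
     "len (associated_curve N D) (projl x) = len (partial_curve D (nodes_of D) ({} :: 'e set) P Q l) x"
    using e by simp_all
qed

text \<open>Parallel pieces with a common point lie on one line; the base of \<open>a\<close> would
  be an endpoint of \<open>b\<close>, where parallel pieces are forbidden.\<close>

lemma general_position_crossing:
  assumes gp: "general_position D" and ab: "a \<in> D" "b \<in> D" "a \<noteq> b"
    and w: "w \<in> carrier a" "w \<in> carrier b"
  shows "w \<in> endpoints a \<and> w \<in> endpoints b \<or> w \<notin> nodes_of D \<and> direction b \<notin> span {direction a} \<and> line a \<noteq> line b"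
proof (cases "w \<in> nodes_of D")
  case True
  then show ?thesis using general_positionD(5)[OF gp True] ab w carrier_subset_line by blast
next
  case False
  note G = general_positionD[OF gp]
  have wl: "w \<in> line a" "w \<in> line b" using w carrier_subset_line by blast+
  have "direction b \<notin> span {direction a}"
  proof
    assume d: "direction b \<in> span {direction a}"
    have "direction a \<in> span {direction b}"
      by (rule span_singleton_sym[OF d direction_nonzero[OF G(2)[OF ab(2)]]])
    moreover have ba: "base a \<in> line a" "base a \<in> endpoints a" by (cases a; auto simp: line_def image_iff intro!: exI[of _ 0])+
    ultimately have "base a - w \<in> span {direction b}"
      using line_span[OF wl(1)] span_singleton_mono by blast
    then have "base a \<in> line b" using line_span[OF wl(2)] by blast
    moreover have "base a \<in> nodes_of D" using ba(2) ab(1) by (auto simp: nodes_of_def)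
    ultimately have "base a \<in> endpoints b" using G(5) ab(2) by blast
    then show False using G(6)[OF ab ba(2)] d by blast
  qed
  moreover have "line a \<noteq> line b"
  proof
    assume "line a = line b"
    moreover have "w + direction b \<in> line b" using line_span[OF wl(2), of "w + direction b"] span_base[of "direction b" "{direction b}"] by simp
    ultimately show False using line_span[OF wl(1), of "w + direction b"] \<open>direction b \<notin> _\<close> by simp
  qed
  ultimately show ?thesis using False by blast
qed

lemma exists_embedding:
  assumes n: "3 \<le> CARD('n::finite)" and \<Gamma>: "abstract_tropical_curve \<Gamma>"
    and deg: "\<And>v. v \<in> verts \<Gamma> \<Longrightarrow> vertex_degree \<Gamma> v \<le> Suc CARD('n)"
  shows "\<exists>C :: (real ^ 'n) set. is_embedding \<Gamma> C"
proof -
  have two: "2 \<le> CARD('n)" using n by simp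
  obtain D :: "'n piece set" and P Q l where gp: "general_position D"
    and M: "isometric_to_modification (partial_curve D (nodes_of D) ({} :: nat set) P Q l) \<Gamma>"
    using exists_general_position[OF two \<Gamma> deg] by blast
  note G = general_positionD[OF gp]
  let ?C = "\<Union>a\<in>D. carrier a"
  have meet: "w \<in> endpoints a \<and> w \<in> endpoints b" if ab: "a \<in> D" "b \<in> D" "a \<noteq> b" "w \<in> carrier a" "w \<in> carrier b" for a b w
    using general_position_crossing[OF gp ab] G(8)[OF n ab(1-3)] ab(4,5) carrier_subset_line by blast
  have "decomposition ?C D"
    unfolding decomposition_def using G(1,2) meet by blast
  moreover have "smooth_point ?C x" if x: "x \<in> ?C" for x
  proof (cases "x \<in> nodes_of D")
    case True
    then show ?thesis by (rule smooth_at_node[OF gp])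
  next
    case False
    obtain a where a: "a \<in> D" "x \<in> carrier a" using x by blast
    have "b = a" if "b \<in> D" "x \<in> carrier b" for b
      using meet[OF a(1) that(1) _ a(2) that(2)] False a(1) unfolding nodes_of_def by blast
    then show ?thesis by (rule smooth_at_interior[OF gp a False])
  qed
  moreover have "union_of_pieces ?C"
    unfolding union_of_pieces_def using G(1,2) by blast
  moreover have "isometric_to_modification (associated_curve {} D) \<Gamma>"
    by (rule isometric_to_modification_isometric[OF M isometric_associated_curve]) simp
  ultimately show ?thesis
    unfolding is_embedding_def smooth_tropical_curve_def by blast
qed

section \<open>Resolving nodes and immersions\<close>

lemma line_eqI:
  assumes "base b \<in> line a" "direction b = k *\<^sub>R direction a" "k \<noteq> 0"
  shows "line b = line a"
proof -
  have "range (\<lambda>s. base b + s *\<^sub>R direction a) = range (\<lambda>s. base b + (s * k) *\<^sub>R direction a)" (is "?L = ?R")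
  proof
    show "?L \<subseteq> ?R"
    proof
      fix y assume "y \<in> ?L"
      then obtain s where "y = base b + s *\<^sub>R direction a" by blast
      then have "y = base b + (s / k * k) *\<^sub>R direction a" using assms(3) by simp
      then show "y \<in> ?R" by (rule image_eqI) simp
    qed
  qed auto
  then show ?thesis using line_eq[OF assms(1)] assms(2) by (simp add: line_def)
qed

lemma lattice_length_direction:
  assumes "lattice_basis F" "0 < t" "q - p = t *\<^sub>R real_vec (F j)"
  shows "lattice_length p q = t"
proof (rule lattice_length_eq[OF lattice_basis_uminus[OF assms(1), of j] assms(2), of p q j])
  have "real_vec (- F j) = - real_vec (F j)" by (simp add: real_vec_def vec_eq_iff)
  then show "p - q = t *\<^sub>R real_vec ((F(j := - F j)) j)"
    using assms(3) by (simp add: algebra_simps)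
qed

lemma ray_cut:
  fixes v :: "real ^ 'n::finite"
  assumes "v \<noteq> 0" "0 < s" "z = p + s *\<^sub>R v"
  shows "ray p v = closed_segment p z \<union> ray z v" "closed_segment p z \<inter> ray z v = {z}"
proof -
  show "ray p v = closed_segment p z \<union> ray z v"
  proof (intro subset_antisym subsetI)
    fix x assume "x \<in> ray p v"
    then obtain u where u: "0 \<le> u" "x = p + u *\<^sub>R v" by (auto simp: ray_def)
    show "x \<in> closed_segment p z \<union> ray z v"
    proof (cases "u \<le> s")
      case True
      have "x = (1 - u / s) *\<^sub>R p + (u / s) *\<^sub>R z"
        using u assms(2,3) by (simp add: algebra_simps)
      moreover have "0 \<le> u / s" "u / s \<le> 1" using True u(1) assms(2) by simp_all
      ultimately show ?thesis unfolding closed_segment_def by blast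
    next
      case False
      have "x = z + (u - s) *\<^sub>R v" using u assms(3) by (simp add: algebra_simps)
      then show ?thesis using False unfolding ray_def by force
    qed
  next
    fix x assume "x \<in> closed_segment p z \<union> ray z v"
    then show "x \<in> ray p v"
    proof
      assume "x \<in> closed_segment p z"
      then obtain u where u: "0 \<le> u" "x = (1 - u) *\<^sub>R p + u *\<^sub>R z" by (auto simp: closed_segment_def)
      have "x = p + (u * s) *\<^sub>R v" using u(2) assms(3) by (simp add: algebra_simps)
      moreover have "0 \<le> u * s" using u(1) assms(2) by simp
      ultimately show ?thesis unfolding ray_def by blast
    next
      assume "x \<in> ray z v"
      then obtain u where u: "0 \<le> u" "x = z + u *\<^sub>R v" by (auto simp: ray_def)
      have "x = p + (s + u) *\<^sub>R v" using u(2) assms(3) by (simp add: algebra_simps)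
      moreover have "0 \<le> s + u" using u(1) assms(2) by simp
      ultimately show ?thesis unfolding ray_def by blast
    qed
  qed
  show "closed_segment p z \<inter> ray z v = {z}"
  proof (intro subset_antisym subsetI)
    fix x assume "x \<in> closed_segment p z \<inter> ray z v"
    then have "x \<in> closed_segment p z" "x \<in> ray z v" by blast+
    then obtain u r where u: "0 \<le> u" "u \<le> 1" "x = (1 - u) *\<^sub>R p + u *\<^sub>R z" "0 \<le> r" "x = z + r *\<^sub>R v"
      unfolding closed_segment_def ray_def mem_Collect_eq by (elim exE conjE)
    have "(u * s - s - r) *\<^sub>R v = 0" using u(3,5) assms(3) by (simp add: algebra_simps)
    then have "u * s = s + r" using assms(1) by simp
    moreover have "u * s \<le> 1 * s" using u(2) assms(2) by (intro mult_right_mono) auto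
    ultimately have "r = 0" using u(4) by linarith
    then show "x \<in> {z}" using u(5) by simp
  next
    fix x assume "x \<in> {z}"
    then show "x \<in> closed_segment p z \<inter> ray z v" by (auto simp: ray_def intro!: exI[of _ 0])
  qed
qed

section \<open>Cutting pieces at the nodes\<close>

inductive cut :: "'n::finite piece \<Rightarrow> real ^ 'n \<Rightarrow> 'n piece \<Rightarrow> 'n piece \<Rightarrow> bool" where
  segment: "cut (Segment p q) z (Segment p z) (Segment z q)"
| ray: "cut (Ray p v) z (Segment p z) (Ray z v)"

lemma exists_cut: "\<exists>a1 a2. cut a z a1 a2"
  by (cases a) (auto intro: cut.intros)

lemma cut_properties:
  assumes c: "cut a z a1 a2" and a: "nondegenerate a" "lattice_direction a" "z \<in> carrier a" "z \<notin> endpoints a"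
  shows "carrier a = carrier a1 \<union> carrier a2" "carrier a1 \<inter> carrier a2 = {z}"
    "endpoints a \<subseteq> endpoints a1 \<union> endpoints a2" "z \<in> endpoints a1" "z \<in> endpoints a2"
    "nondegenerate a1" "nondegenerate a2" "lattice_direction a1" "lattice_direction a2"
    "line a1 = line a" "line a2 = line a" "a1 \<noteq> a2"
    "0 < piece_length a1" "0 < piece_length a2" "piece_length a1 + piece_length a2 = piece_length a"
proof -
  obtain F j t where F: "lattice_basis F" "0 < t" "direction a = t *\<^sub>R real_vec (F j)"
    using a(2) unfolding lattice_direction_def by blast
  have ld: "lattice_direction b" if "direction b = k *\<^sub>R direction a" "0 < k" for b k
    unfolding lattice_direction_def by (intro exI[of _ F] exI[of _ j] exI[of _ "k * t"]) (use F that in simp)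
  have zl: "z \<in> line a" using a(3) carrier_subset_line by blast
  have bl: "base a \<in> line a" by (auto simp: line_def image_iff intro!: exI[of _ 0])
  have ll: "lattice_length x y = k * t" if "y - x = k *\<^sub>R direction a" "0 < k" for x y k
    by (rule lattice_length_direction[OF F(1)]) (use F that in auto)
  have *: "carrier a = carrier a1 \<union> carrier a2 \<and> carrier a1 \<inter> carrier a2 = {z} \<and>
    endpoints a \<subseteq> endpoints a1 \<union> endpoints a2 \<and> z \<in> endpoints a1 \<and> z \<in> endpoints a2 \<and>
    nondegenerate a1 \<and> nondegenerate a2 \<and> lattice_direction a1 \<and> lattice_direction a2 \<and>
    line a1 = line a \<and> line a2 = line a \<and> a1 \<noteq> a2 \<and>
    0 < piece_length a1 \<and> 0 < piece_length a2 \<and> piece_length a1 + piece_length a2 = piece_length a"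
    using c
  proof (cases rule: cut.cases)
    case (segment p q)
    have zpq: "z \<in> closed_segment p q" "z \<noteq> p" "z \<noteq> q" "p \<noteq> q" using a segment by auto
    then obtain s where s: "0 \<le> s" "s \<le> 1" "z = (1 - s) *\<^sub>R p + s *\<^sub>R q" by (auto simp: closed_segment_def)
    have s1: "0 < s" "s < 1" using s zpq by (cases "s = 0"; cases "s = 1"; force)+
    have d1: "z - p = s *\<^sub>R direction a" using s(3) segment by (simp add: algebra_simps)
    have d2: "q - z = (1 - s) *\<^sub>R direction a" using s(3) segment by (simp add: algebra_simps)
    have d: "q - p = 1 *\<^sub>R direction a" using segment by simp
    have L: "line a1 = line a"
      by (rule line_eqI[of _ _ s]) (use segment d1 s1 bl in auto)
    have L2: "line a2 = line a"
      by (rule line_eqI[of _ _ "1 - s"]) (use segment d2 s1 zl in auto)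
    have ldd: "lattice_direction a1" by (rule ld[of _ s]) (use segment d1 s1 in auto)
    have ldd2: "lattice_direction a2" by (rule ld[of _ "1 - s"]) (use segment d2 s1 in auto)
    have len: "lattice_length p z = s * t" "lattice_length z q = (1 - s) * t" "lattice_length p q = t"
      using ll[OF d1 s1(1)] ll[OF d2] ll[OF d] s1 by auto
    have "s * t + (1 - s) * t = t" by (simp add: algebra_simps)
    then show ?thesis
      using segment L L2 ldd ldd2 zpq len s1 F(2) Un_closed_segment[OF zpq(1)] Int_closed_segment[of z p q] by auto
  next
    case (ray p v)
    have v: "v \<noteq> 0" "z \<noteq> p" using a ray by auto
    obtain s where s: "0 \<le> s" "z = p + s *\<^sub>R v" using a(3) ray by (auto simp: ray_def)
    have s1: "0 < s" using s v by (cases "s = 0") auto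
    have d1: "z - p = s *\<^sub>R direction a" using s ray by simp
    have L: "line a1 = line a"
      by (rule line_eqI[of _ _ s]) (use ray d1 s1 bl in auto)
    have L2: "line a2 = line a"
      by (rule line_eqI[of _ _ 1]) (use ray zl in auto)
    have ldd: "lattice_direction a1" by (rule ld[of _ s]) (use ray d1 s1 in auto)
    have ldd2: "lattice_direction a2" by (rule ld[of _ 1]) (use ray in auto)
    show ?thesis
      using ray L L2 ldd ldd2 v s1 F(2) ray_cut[OF v(1) s1 s(2)] ll[OF d1 s1] by auto
  qed
  show "carrier a = carrier a1 \<union> carrier a2" "carrier a1 \<inter> carrier a2 = {z}"
    "endpoints a \<subseteq> endpoints a1 \<union> endpoints a2" "z \<in> endpoints a1" "z \<in> endpoints a2"
    "nondegenerate a1" "nondegenerate a2" "lattice_direction a1" "lattice_direction a2"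
    "line a1 = line a" "line a2 = line a" "a1 \<noteq> a2"
    "0 < piece_length a1" "0 < piece_length a2" "piece_length a1 + piece_length a2 = piece_length a"
    using * by - (elim conjE, assumption)+
qed

lemma piece_length_infinite: "piece_length a = \<infinity> \<longleftrightarrow> is_ray a"
  by (cases a) auto

text \<open>Both halves keep the line of \<open>a\<close>, so they meet in the same branch vertex;
  it is fresh because no piece ending at \<open>z\<close> lies on this line. The piece crossing at
  \<open>z\<close> thus gets a different vertex, which is the resolution of the node.\<close>

lemma associated_curve_cut:
  assumes M: "isometric_to_modification (associated_curve N D) \<Gamma>" and \<Gamma>: "abstract_tropical_curve \<Gamma>"
    and nd: "\<And>a. a \<in> D \<Longrightarrow> nondegenerate a"
    and a: "a \<in> D" "lattice_direction a" "z \<in> carrier a" "z \<notin> endpoints a" "z \<in> N"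
    and c: "cut a z a1 a2" and new: "a1 \<notin> D" "a2 \<notin> D"
    and lines: "\<And>b. b \<in> D \<Longrightarrow> z \<in> endpoints b \<Longrightarrow> line b \<noteq> line a"
  shows "isometric_to_modification (associated_curve N ((D - {a}) \<union> {a1, a2})) \<Gamma>"
proof -
  note cp = cut_properties[OF c nd[OF a(1)] a(2-4)]
  let ?H = "associated_curve N D" and ?m = "Branch z (line a)"
  let ?D = "(D - {a}) \<union> {a1, a2}"
  have va: "vertex_at N b x = vertex_at N a x" if "nondegenerate b" "line b = line a" for b x
    using line_affine_hull[OF that(1)] line_affine_hull[OF nd[OF a(1)]] that(2) by (simp add: vertex_at_def)
  have vz: "vertex_at N b z = ?m" if "nondegenerate b" "line b = line a" for b
    using line_affine_hull[OF that(1)] that(2) a(5) by (simp add: vertex_at_def)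
  have m: "?m \<notin> verts ?H"
  proof
    assume "?m \<in> verts ?H"
    then obtain b where b: "b \<in> D" "?m \<in># piece_ends N b" by auto
    then show False using Branch_in_piece_ends[OF nd[OF b(1)] b(2)] lines[OF b(1)] by metis
  qed
  have inf_a: "At_Infinity b \<in> inf_verts ?H \<longleftrightarrow> b \<in> D \<and> is_ray b" for b by auto
  have fin: "vertex_at N b x \<notin> inf_verts ?H" for b x by (auto simp: vertex_at_def)
  show ?thesis using c
  proof (cases rule: cut.cases)
    case (segment p q)
    have e1: "piece_ends N a1 = {#vertex_at N a p, ?m#}"
      using va[OF cp(6,10)] vz[OF cp(6,10)] segment by simp
    have e2: "piece_ends N a2 = {#?m, vertex_at N a q#}"
      using va[OF cp(7,11)] vz[OF cp(7,11)] segment by simp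
    have ea: "piece_ends N a = {#vertex_at N a p, vertex_at N a q#}" using segment by simp
    have r: "\<not> is_ray a" "\<not> is_ray a1" "\<not> is_ray a2" using segment by simp_all
    show ?thesis
    proof (rule isometric_to_modification_subdivide[OF M \<Gamma>, where e = a and m = ?m and ?e1.0 = a1 and ?e2.0 = a2])
      have "verts ?H = (\<Union>b\<in>D - {a}. set_mset (piece_ends N b)) \<union> set_mset (piece_ends N a)" using a(1) by auto
      then show "verts (associated_curve N ?D) = insert ?m (verts ?H)" using e1 e2 ea by auto
      show "inf_verts (associated_curve N ?D) = inf_verts ?H" using r by auto
      show "len (associated_curve N ?D) a1 = \<infinity> \<longleftrightarrow> vertex_at N a p \<in> inf_verts ?H"
        "len (associated_curve N ?D) a2 = \<infinity> \<longleftrightarrow> vertex_at N a q \<in> inf_verts ?H"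
        using fin r by (simp_all add: piece_length_infinite del: associated_curve_simps(5))
    qed (use a m new cp e1 e2 ea in auto)
  next
    case (ray p v)
    have e1: "piece_ends N a1 = {#vertex_at N a p, ?m#}"
      using va[OF cp(6,10)] vz[OF cp(6,10)] ray by simp
    have e2: "piece_ends N a2 = {#?m, At_Infinity a2#}"
      using vz[OF cp(7,11)] ray by simp
    have ea: "piece_ends N a = {#vertex_at N a p, At_Infinity a#}" using ray by simp
    have r: "is_ray a" "\<not> is_ray a1" "is_ray a2" using ray by simp_all
    have aa: "a1 \<noteq> a" "a2 \<noteq> a" using new a(1) by blast+
    \<comment> \<open>A point at infinity is named after its ray, and cutting renames the ray. The
      subdivision is done with the old name, which a subsequent isometry replaces.\<close>
    define K where "K = \<lparr> verts = insert ?m (verts ?H), edges = ?D, ends = (piece_ends N)(a2 := {#?m, At_Infinity a#}),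
      len = piece_length, inf_verts = inf_verts ?H \<rparr>"
    have K: "verts K = insert ?m (verts ?H)" "edges K = ?D" "ends K = (piece_ends N)(a2 := {#?m, At_Infinity a#})"
      "len K = piece_length" "inf_verts K = inf_verts ?H" by (simp_all add: K_def)
    have MK: "isometric_to_modification K \<Gamma>"
    proof (rule isometric_to_modification_subdivide[OF M \<Gamma>, where e = a and m = ?m and ?e1.0 = a1 and ?e2.0 = a2])
      show "len K a1 = \<infinity> \<longleftrightarrow> vertex_at N a p \<in> inf_verts ?H"
        "len K a2 = \<infinity> \<longleftrightarrow> At_Infinity a \<in> inf_verts ?H"
        using fin r a(1) inf_a by (simp_all add: K(4) piece_length_infinite del: associated_curve_simps(5))
    qed (use a m new cp e1 ea in \<open>auto simp: K\<close>)
    let ?\<phi> = "\<lambda>x. if x = At_Infinity a then At_Infinity a2 else x"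
    have nv: "At_Infinity a2 \<notin> verts ?H" using new by (auto simp: At_Infinity_in_piece_ends)
    have vH: "verts ?H = (\<Union>b\<in>D - {a}. set_mset (piece_ends N b)) \<union> {vertex_at N a p, At_Infinity a}"
      using a(1) ea by auto
    have id: "?\<phi> x = x" if "x \<in># piece_ends N b" "b \<noteq> a" for b x
      using that by (auto simp: At_Infinity_in_piece_ends)
    have im: "?\<phi> ` set_mset (piece_ends N b) = set_mset (piece_ends N b)" if "b \<noteq> a" for b
      using id[OF _ that] by (simp cong: image_cong)
    have vp: "vertex_at N a p \<noteq> At_Infinity a" by (simp add: vertex_at_def)
    have "isometric K (associated_curve N ?D)"
      unfolding isometric_def
    proof (intro exI[of _ ?\<phi>] exI[of _ id] conjI ballI)
      have "inj_on ?\<phi> (verts K)"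
        using nv by (intro inj_onI) (auto simp: K(1) simp del: associated_curve_simps split: if_splits)
      moreover have "?\<phi> ` verts K = verts (associated_curve N ?D)"
      proof -
        have "?\<phi> ` verts K = (\<Union>b\<in>D - {a}. ?\<phi> ` set_mset (piece_ends N b)) \<union> {?m, vertex_at N a p, At_Infinity a2}"
          unfolding K(1) vH image_insert image_Un image_UN using vp by auto
        also have "\<dots> = (\<Union>b\<in>D - {a}. set_mset (piece_ends N b)) \<union> {?m, vertex_at N a p, At_Infinity a2}"
          using im by simp
        also have "\<dots> = verts (associated_curve N ?D)"
          using e1 e2 by auto
        finally show ?thesis .
      qed
      ultimately show "bij_betw ?\<phi> (verts K) (verts (associated_curve N ?D))" by (simp add: bij_betw_def)
      show "bij_betw id (edges K) (edges (associated_curve N ?D))" by (simp add: K(2))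
      show "?\<phi> ` inf_verts K = inf_verts (associated_curve N ?D)"
        using r a(1) aa by (auto simp: K(5) image_iff)
      fix b assume b: "b \<in> edges K"
      show "ends (associated_curve N ?D) (id b) = image_mset ?\<phi> (ends K b)"
      proof (cases "b = a2")
        case True
        then show ?thesis using e2 by (simp add: K(3))
      next
        case False
        have "b \<noteq> a" using b aa by (auto simp: K(2))
        then have "image_mset ?\<phi> (piece_ends N b) = image_mset id (piece_ends N b)"
          using id[of _ b] by (intro image_mset_cong) simp
        then show ?thesis using False by (simp add: K(3))
      qed
      show "len (associated_curve N ?D) (id b) = len K b" by (simp add: K(4))
    qed
    then show ?thesis by (rule isometric_to_modification_isometric[OF MK])
  qed
qed

text \<open>
  The invariant under cutting at the crossings in \<open>X\<close>. Collinear pieces share at most endpoints, so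
  the two vertices resolving a node are distinguished by their lines.
\<close>

definition resolvable :: "(real ^ 2) set \<Rightarrow> (real ^ 2) set \<Rightarrow> (real ^ 2) set \<Rightarrow> ('v, 'e) metric_graph \<Rightarrow> 2 piece set \<Rightarrow> bool" where
  "resolvable C N X \<Gamma> D \<longleftrightarrow>
     finite D \<and> (\<forall>a\<in>D. nondegenerate a \<and> lattice_direction a) \<and> (\<Union>a\<in>D. carrier a) = C \<and>
     (\<forall>a\<in>D. \<forall>b\<in>D. \<forall>w\<in>carrier a \<inter> carrier b. a \<noteq> b \<longrightarrow>
        w \<in> endpoints a \<inter> endpoints b \<or> w \<in> X \<and> line a \<noteq> line b) \<and>
     isometric_to_modification (associated_curve N D) \<Gamma>"

text \<open>Crossings at which the piece has not been cut yet; their number over all pieces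
  decreases with every cut.\<close>

definition interior_crossings :: "(real ^ 2) set \<Rightarrow> 2 piece \<Rightarrow> (real ^ 2) set" where
  "interior_crossings X a = X \<inter> (carrier a - endpoints a)"

text \<open>The point \<open>z\<close> becomes an endpoint of both halves, and every other crossing
  inside \<open>a\<close> stays inside at most one half, so the total count drops.\<close>

lemma resolvable_cut:
  assumes D: "resolvable C N X \<Gamma> D" and \<Gamma>: "abstract_tropical_curve \<Gamma>" and X: "X \<subseteq> N" "finite X"
    and a: "a \<in> D" "z \<in> interior_crossings X a"
  shows "\<exists>D'. resolvable C N X \<Gamma> D' \<and>
    (\<Sum>b\<in>D'. card (interior_crossings X b)) < (\<Sum>b\<in>D. card (interior_crossings X b))"
proof -
  have D1: "finite D" "\<And>b. b \<in> D \<Longrightarrow> nondegenerate b" "\<And>b. b \<in> D \<Longrightarrow> lattice_direction b"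
    "(\<Union>a\<in>D. carrier a) = C" "isometric_to_modification (associated_curve N D) \<Gamma>"
    using D unfolding resolvable_def by simp_all
  have D2: "w \<in> endpoints b \<and> w \<in> endpoints c \<or> w \<in> X \<and> line b \<noteq> line c"
    if "b \<in> D" "c \<in> D" "b \<noteq> c" "w \<in> carrier b" "w \<in> carrier c" for b c w
    using D that unfolding resolvable_def by (elim conjE) blast
  have z: "z \<in> X" "z \<in> carrier a" "z \<notin> endpoints a" using a(2) by (auto simp: interior_crossings_def)
  obtain a1 a2 where c: "cut a z a1 a2" using exists_cut by blast
  note cp = cut_properties[OF c D1(2)[OF a(1)] D1(3)[OF a(1)] z(2,3)]
  have lines: "line b \<noteq> line a" if "b \<in> D" "z \<in> endpoints b" for b
    using D2[OF that(1) a(1) _ _ z(2)] that(2) z(3) endpoints_subset_carrier by blast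
  have new: "a1 \<notin> D" "a2 \<notin> D"
  proof -
    show "a1 \<notin> D"
    proof
      assume "a1 \<in> D"
      from lines[OF this cp(4)] cp(10) show False by (rule notE)
    qed
    show "a2 \<notin> D"
    proof
      assume "a2 \<in> D"
      from lines[OF this cp(5)] cp(11) show False by (rule notE)
    qed
  qed
  let ?D = "(D - {a}) \<union> {a1, a2}"
  have meet: "w = z" if "w \<in> carrier a1" "w \<in> carrier a2" for w
  proof -
    have "w \<in> carrier a1 \<inter> carrier a2" using that by (rule IntI)
    then show ?thesis unfolding cp(2) by (rule singletonD)
  qed
  have ends: "w \<in> endpoints a1" if w: "w \<in> endpoints a" "w \<in> carrier a1" for w
    using subsetD[OF cp(3) w(1)]
  proof
    assume "w \<in> endpoints a2"
    from meet[OF w(2) subsetD[OF endpoints_subset_carrier this]] cp(4) show ?thesis by (simp only:)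
  qed
  have ends2: "w \<in> endpoints a2" if w: "w \<in> endpoints a" "w \<in> carrier a2" for w
    using subsetD[OF cp(3) w(1)]
  proof
    assume "w \<in> endpoints a1"
    from meet[OF subsetD[OF endpoints_subset_carrier this] w(2)] cp(5) show ?thesis by (simp only:)
  qed
  \<comment> \<open>An endpoint of \<open>a\<close> remains an endpoint of the half containing it,
    and halves inherit the line of \<open>a\<close>, so the alternatives for \<open>a\<close> pass
    to the halves.\<close>
  have old: "w \<in> endpoints b \<and> w \<in> endpoints f \<or> w \<in> X \<and> line b \<noteq> line f"
    if "b \<in> D - {a}" "f = a1 \<or> f = a2" "w \<in> carrier b" "w \<in> carrier f" for b f w
  proof -
    have w: "w \<in> carrier a" using that(2,4) unfolding cp(1) by auto
    have l: "line f = line a" using that(2) cp(10,11) by (elim disjE) (simp_all only:)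
    have e: "w \<in> endpoints f" if "w \<in> endpoints a"
      using \<open>f = a1 \<or> f = a2\<close> \<open>w \<in> carrier f\<close> ends[OF that] ends2[OF that] by (elim disjE) (simp_all only:)
    have "b \<in> D" "b \<noteq> a" using that(1) by simp_all
    from D2[OF this(1) a(1) this(2) that(3) w] e show ?thesis unfolding l by blast
  qed
  have both: "w \<in> endpoints a1 \<and> w \<in> endpoints a2" if "w \<in> carrier a1" "w \<in> carrier a2" for w
    unfolding meet[OF that] using cp(4,5) by (rule conjI)
  have pairs: "w \<in> endpoints b \<inter> endpoints f \<or> w \<in> X \<and> line b \<noteq> line f"
    if bf: "b \<in> ?D" "f \<in> ?D" "w \<in> carrier b \<inter> carrier f" "b \<noteq> f" for b f w
  proof -
    have w: "w \<in> carrier b" "w \<in> carrier f" using bf(3) by auto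
    consider "b \<in> D - {a}" "f \<in> D - {a}" | "b \<in> D - {a}" "f = a1 \<or> f = a2" | "f \<in> D - {a}" "b = a1 \<or> b = a2"
      | "b = a1" "f = a2" | "b = a2" "f = a1" using bf(1,2,4) by blast
    then show ?thesis
    proof cases
      case 1 then show ?thesis using D2[of b f w] w bf(4) by auto
    next
      case 2 then show ?thesis using old[of b f w] w by auto
    next
      case 3 then show ?thesis using old[of f b w] w by auto
    qed (use both[of w] w in auto)
  qed
  have "(\<Union>b\<in>D. carrier b) = (\<Union>b\<in>D - {a}. carrier b) \<union> carrier a" using a(1) by blast
  then have C: "(\<Union>b\<in>?D. carrier b) = C" using D1(4) cp(1) by auto
  have M: "isometric_to_modification (associated_curve N ?D) \<Gamma>"
    by (rule associated_curve_cut[OF D1(5) \<Gamma> D1(2) a(1) D1(3)[OF a(1)] z(2,3) subsetD[OF X(1) z(1)] c new lines])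
  have nl: "\<forall>b\<in>?D. nondegenerate b \<and> lattice_direction b" using D1(2,3) cp(6-9) by simp
  have p: "\<forall>b\<in>?D. \<forall>f\<in>?D. \<forall>w\<in>carrier b \<inter> carrier f. b \<noteq> f \<longrightarrow>
      w \<in> endpoints b \<inter> endpoints f \<or> w \<in> X \<and> line b \<noteq> line f"
    by (intro ballI impI) (rule pairs)
  have "finite ?D" using D1(1) by simp
  from this nl C p M have R: "resolvable C N X \<Gamma> ?D"
    unfolding resolvable_def by (intro conjI)
  let ?I = "interior_crossings X"
  have fin: "finite (?I b)" for b using X(2) by (simp add: interior_crossings_def)
  have sub: "?I a1 \<union> ?I a2 \<subseteq> ?I a - {z}"
  proof
    fix w assume w: "w \<in> ?I a1 \<union> ?I a2"
    then have "w \<in> X" "w \<in> carrier a" unfolding interior_crossings_def cp(1) by auto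
    moreover have "w \<notin> endpoints a" using w ends[of w] ends2[of w] unfolding interior_crossings_def by auto
    moreover have "w \<noteq> z" using w cp(4,5) unfolding interior_crossings_def by auto
    ultimately show "w \<in> ?I a - {z}" unfolding interior_crossings_def by simp
  qed
  have disj: "?I a1 \<inter> ?I a2 = {}" using both unfolding interior_crossings_def by fastforce
  have "card (?I a1) + card (?I a2) = card (?I a1 \<union> ?I a2)" by (rule card_Un_disjoint[symmetric, OF fin fin disj])
  also have "\<dots> \<le> card (?I a - {z})" by (rule card_mono[OF _ sub]) (simp add: fin)
  also have "\<dots> < card (?I a)" by (rule card_Diff1_less[OF fin a(2)])
  finally have less: "card (?I a1) + card (?I a2) < card (?I a)" .
  have "?D = insert a1 (insert a2 (D - {a}))" by auto
  then have "(\<Sum>b\<in>?D. card (?I b)) = card (?I a1) + (card (?I a2) + (\<Sum>b\<in>D - {a}. card (?I b)))"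
    using new cp(12) D1(1) by simp
  also have "\<dots> < card (?I a) + (\<Sum>b\<in>D - {a}. card (?I b))" using less by simp
  also have "\<dots> = (\<Sum>b\<in>D. card (?I b))" by (rule sum.remove[OF D1(1) a(1), symmetric])
  finally show ?thesis using R by blast
qed

lemma resolvable_decomposition:
  assumes "resolvable C N X \<Gamma> D" and \<Gamma>: "abstract_tropical_curve \<Gamma>" and X: "X \<subseteq> N" "finite X"
  shows "\<exists>D'. decomposition C D' \<and> isometric_to_modification (associated_curve N D') \<Gamma>"
  using assms(1)
proof (induction "\<Sum>b\<in>D. card (interior_crossings X b)" arbitrary: D rule: less_induct)
  case less
  show ?case
  proof (cases "\<exists>a\<in>D. interior_crossings X a \<noteq> {}")
    case True
    then obtain a z where "a \<in> D" "z \<in> interior_crossings X a" by blast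
    from resolvable_cut[OF less.prems \<Gamma> X this] less.hyps show ?thesis by blast
  next
    case False
    have "decomposition C D"
      unfolding decomposition_def
    proof (intro conjI ballI impI subsetI)
      fix a b w assume ab: "a \<in> D" "b \<in> D" "a \<noteq> b" "w \<in> carrier a \<inter> carrier b"
      have "w \<in> endpoints a \<inter> endpoints b \<or> w \<in> X \<and> line a \<noteq> line b"
        using less.prems ab unfolding resolvable_def by (elim conjE) blast
      then show "w \<in> endpoints a \<inter> endpoints b"
        using False ab unfolding interior_crossings_def by blast
    qed (use less.prems in \<open>auto simp: resolvable_def\<close>)
    then show ?thesis using less.prems unfolding resolvable_def by blast
  qed
qed

text \<open>Cuts are made at the crossings \<open>X\<close>, branches are assigned at all nodes
  \<open>N\<close>. Each crossing is a node and no vertex of the configuration is one, so the uncut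
  pieces have no branches and cutting creates exactly those required.\<close>

lemma exists_immersion:
  assumes \<Gamma>: "abstract_tropical_curve \<Gamma>"
    and deg: "\<And>v. v \<in> verts \<Gamma> \<Longrightarrow> vertex_degree \<Gamma> v \<le> 3"
  shows "\<exists>C :: (real ^ 2) set. is_immersion \<Gamma> C"
proof -
  have two: "2 \<le> CARD(2)" by simp
  have "vertex_degree \<Gamma> v \<le> Suc CARD(2)" if "v \<in> verts \<Gamma>" for v using deg[OF that] by simp
  then obtain D :: "2 piece set" and P Q l where gp: "general_position D"
    and M: "isometric_to_modification (partial_curve D (nodes_of D) ({} :: nat set) P Q l) \<Gamma>"
    using exists_general_position[OF two \<Gamma>] by blast
  note G = general_positionD[OF gp]
  define C where "C = (\<Union>a\<in>D. carrier a)"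
  define N where "N = {x \<in> C. node C x}"
  define X where "X = {w. w \<notin> nodes_of D \<and> (\<exists>a\<in>D. \<exists>b\<in>D. a \<noteq> b \<and> w \<in> carrier a \<and> w \<in> carrier b)}"
  have XD: "direction b \<notin> span {direction a}" "line a \<noteq> line b"
    if "a \<in> D" "b \<in> D" "a \<noteq> b" "w \<in> carrier a" "w \<in> carrier b" "w \<notin> nodes_of D" for a b w
  proof -
    have "w \<notin> endpoints a" using that(1,6) by (auto simp: nodes_of_def)
    then show "direction b \<notin> span {direction a}" "line a \<noteq> line b"
      using general_position_crossing[OF gp that(1-5)] by blast+
  qed
  have XN: "X \<subseteq> N"
  proof
    fix w assume "w \<in> X"
    then obtain a b where ab: "w \<notin> nodes_of D" "a \<in> D" "b \<in> D" "a \<noteq> b" "w \<in> carrier a" "w \<in> carrier b"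
      unfolding X_def by blast
    have "node C w"
      unfolding C_def by (rule node_at_crossing[OF gp ab(2-6) ab(1) XD(1)[OF ab(2-6) ab(1)]])
    then show "w \<in> N" using ab unfolding N_def C_def by blast
  qed
  \<comment> \<open>Two pieces that cross outside the vertices lie on independent lines, so each
    pair contributes at most one point.\<close>
  have finX: "finite X"
  proof -
    define S where "S p = {w. fst p \<noteq> snd p \<and> w \<notin> nodes_of D \<and> w \<in> carrier (fst p) \<and> w \<in> carrier (snd p)}" for p
    have "X \<subseteq> (\<Union>p\<in>D \<times> D. S p)"
      unfolding X_def S_def by auto
    moreover have "finite (\<Union>p\<in>D \<times> D. S p)"
    proof (rule finite_UN_I)
      show "finite (D \<times> D)" using G(1) by simp
      fix p assume p: "p \<in> D \<times> D"
      show "finite (S p)"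
      proof (cases "S p = {}")
        case False
        then obtain w where w: "fst p \<noteq> snd p" "w \<notin> nodes_of D" "w \<in> carrier (fst p)" "w \<in> carrier (snd p)"
          unfolding S_def by blast
        have p': "fst p \<in> D" "snd p \<in> D" using p by auto
        have "x = w" if "x \<in> S p" for x
        proof (rule line_unique[OF _ _ _ _ XD(1)[OF p' w(1,3,4,2)]])
          show "x \<in> line (fst p)" "x \<in> line (snd p)" "w \<in> line (fst p)" "w \<in> line (snd p)"
            using that w(3,4) carrier_subset_line by (auto simp: S_def)
        qed
        then have "S p \<subseteq> {w}" by blast
        then show ?thesis by (rule finite_subset) simp
      qed simp
    qed
    ultimately show ?thesis by (rule finite_subset)
  qed
  have Nn: "N \<inter> nodes_of D = {}"
    using not_node_at_node[OF gp] unfolding N_def C_def by blast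
  have "isometric_to_modification (associated_curve N D) \<Gamma>"
    by (rule isometric_to_modification_isometric[OF M isometric_associated_curve[OF Nn]])
  moreover have "w \<in> endpoints a \<inter> endpoints b \<or> w \<in> X \<and> line a \<noteq> line b"
    if "a \<in> D" "b \<in> D" "w \<in> carrier a \<inter> carrier b" "a \<noteq> b" for a b w
    using general_position_crossing[OF gp that(1,2,4), of w] that unfolding X_def by blast
  ultimately have "resolvable C N X \<Gamma> D"
    unfolding resolvable_def using G(1-3) C_def by (intro conjI ballI impI) auto
  then obtain D' where D': "decomposition C D'" "isometric_to_modification (associated_curve N D') \<Gamma>"
    using resolvable_decomposition[OF _ \<Gamma> XN finX] by blast
  have "smooth_point C x \<or> node C x" if x: "x \<in> C" for x
  proof (cases "x \<in> nodes_of D")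
    case True
    then show ?thesis using smooth_at_node[OF gp] unfolding C_def by blast
  next
    case False
    obtain a where a: "a \<in> D" "x \<in> carrier a" using x unfolding C_def by blast
    show ?thesis
    proof (cases "x \<in> X")
      case True
      then show ?thesis using XN unfolding N_def by blast
    next
      case nX: False
      have "b = a" if "b \<in> D" "x \<in> carrier b" for b
        using nX False a that unfolding X_def by blast
      then show ?thesis using smooth_at_interior[OF gp a False] unfolding C_def by blast
    qed
  qed
  moreover have "union_of_pieces C"
    unfolding union_of_pieces_def C_def using G(1,2) by blast
  ultimately show ?thesis
    unfolding is_immersion_def nodal_tropical_curve_def using D' N_def by blast
qed

theorem theorem1p1:
  fixes \<Gamma> :: "('v, 'e) metric_graph" and d :: nat
  assumes "abstract_tropical_curve \<Gamma>"
    and "d = Max (vertex_degree \<Gamma> ` verts \<Gamma>)"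
  shows "(CARD('n::finite) \<ge> max 3 (d - 1) \<longrightarrow> (\<exists>C :: (real ^ 'n) set. is_embedding \<Gamma> C)) \<and>
         (d \<le> 3 \<longrightarrow> (\<exists>C :: (real ^ 2) set. is_immersion \<Gamma> C))"
proof -
  have deg: "vertex_degree \<Gamma> v \<le> d" if "v \<in> verts \<Gamma>" for v
    unfolding assms(2) using abstract_tropical_curveD(1)[OF assms(1)] that by (intro Max_ge) auto
  show ?thesis
  proof (intro conjI impI)
    assume n: "CARD('n) \<ge> max 3 (d - 1)"
    show "\<exists>C :: (real ^ 'n) set. is_embedding \<Gamma> C"
    proof (rule exists_embedding[OF _ assms(1)])
      \<comment> \<open>The difference \<open>d - 1\<close> is truncated at zero; in every case the
        bound gives \<open>d <= n + 1\<close>.\<close>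
      show "vertex_degree \<Gamma> v \<le> Suc CARD('n)" if "v \<in> verts \<Gamma>" for v using deg[OF that] n by linarith
    qed (use n in simp)
  next
    assume "d \<le> 3"
    then show "\<exists>C :: (real ^ 2) set. is_immersion \<Gamma> C"
      using deg order_trans by (intro exists_immersion[OF assms(1)]) blast
  qed
qed

end
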